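(* Let $K\subset\mathbb{R}^3$ be a generic knot. Put $C_K:=2\sup\{C_{s_1}\,|\,s_1\in\mathbb{R}/T\mathbb{Z}\}$. For sufficiently small $\varepsilon>0$, in a small closed tubular neighborhood of $$\Delta_\varepsilon^{cusp}:=\Delta_\varepsilon\setminus\big\{(s_1,\theta_1,s_2,\theta_2)\,|\,\theta_1\in(k\pi/2-\varepsilon^{1/2}C_K,\ k\pi/2+\varepsilon^{1/2}C_K),\ k\in\mathbb{Z}\big\}$$ it holds that $M_{K,\varepsilon}$ has a structure of a locally trivial stratified fibration (over $\Delta_\varepsilon^{cusp}$, via the tubular neighborhood projection $\pi_{\mathcal N}$). The fibers are identified with the union of two cuspidal regions; more precisely, for each $p\in\Delta_\varepsilon^{cusp}$ there is a stratum-preserving homeomorphism identifying the fiber $\pi_{\mathcal N}^{-1}(p)$ with $$\{(x,y)\in\mathbb{R}^2\,|\,y^2\le|x^3|\ \wedge\ x^2+y^2\le1\},$$ which is a diffeomorphism outside of $p$.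
   Context: $K$ is a smooth knot of length $T$ with arc-length parametrization $\gamma$ and nowhere vanishing curvature $\kappa$ (generic: also finitely many special pairs, with the standing conditions that for such a pair with the tangent line at one point $P$ passing through the other point $P'$ the tangent line at $P'$ is not in the osculating plane at $P$, and that no two distinct points have the same tangent line); $n=\ddot\gamma/\|\ddot\gamma\|$, $b=\dot\gamma\times n$, $v(s,\theta)=\cos(\theta)n(s)+\sin(\theta)b(s)$, $\Gamma_\varepsilon(s,\theta)=\gamma(s)+\varepsilon v(s,\theta)$ parametrizes the embedded torus $T_{K,\varepsilon}$. $F_i^{[\varepsilon]}(s_1,\theta_1,s_2,\theta_2)=\langle\Gamma_\varepsilon(s_2,\theta_2)-\Gamma_\varepsilon(s_1,\theta_1),v(s_i,\theta_i)\rangle$, $M_{K,\varepsilon}=\overline{\{F_1^{[\varepsilon]}\ge0,F_2^{[\varepsilon]}\ge0,s_1\ne s_2\}}\subset(\mathbb{R}/T\mathbb{Z}\times S^1)^2$, $\Delta_\varepsilon=M_{K,\varepsilon}\cap\{s_1=s_2\}$ (contained in the full diagonal $\{s_1=s_2,\theta_1=\theta_2\}$, where the Gaussian curvature of $T_{K,\varepsilon}$ is non-positive). The tubular neighborhood and $\pi_{\mathcal N}$ come from the normal bundle of the full diagonal in $(\mathbb{R}/T\mathbb{Z}\times S^1)^2$ with respect to the metric $(\Gamma_\varepsilon\times\Gamma_\varepsilon)^*\langle\cdot,\cdot\rangle$. A locally trivial stratified fibration is one whose local trivializations are stratum-preserving homeomorphisms, smooth on each stratum; $M_{K,\varepsilon}$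 near $\Delta_\varepsilon^{cusp}$ is stratified by $\Delta_\varepsilon^{cusp}$ and the strata determined by which of $F_1^{[\varepsilon]}, F_2^{[\varepsilon]}$ vanish. Constants $C_s$. Let $p=\Gamma_\varepsilon(s,\theta)$ with $\theta\in(-\pi/2,\pi/2)$ (negative Gaussian curvature). The principal directions at $p$ are $w_M=-\dot\gamma(s)$ (principal curvature $\kappa_M=\kappa\cos\theta/(1-\varepsilon\kappa\cos\theta)>0$) and $w_m=\partial_\theta v$ (principal curvature $\kappa_m=-1/\varepsilon<0$). The two planes through $p$ spanned by the normal $v$ together with $w_M$, respectively $w_m$, split a small neighborhood of $p$ in $T_{K,\varepsilon}$ into quadrants $Q_1$ (between $w_M$ and $w_m$), $Q_2$ (between $w_m$ and $-w_M$), $Q_3$ (between $-w_M$ and $-w_m$), $Q_4$ (between $-w_m$ and $w_M$). Let $c_j$ be the curve from $p$ in $Q_j$ given by the intersection of the affine tangent plane at $p$ with the torus. $Q_j$ is called outward-pointing if near $p$ (excluding $p$) $c_j$ is, in the corresponding quadrant of the tangent plane, the graph of a strictly concave function over the axis $\langle w_M\rangle$ (positive values being taken in the direction of the half-axis of $\langle w_m\rangle$ bounding the quadrant); it is called inward-pointing if the same holds with $w_M$ and $w_m$ exchanged. For each $s$, $C_s>0$ is a constant such that for each sufficiently small $\varepsilon>0$: if $\theta\in[\varepsilon^{1/2}C_s,\pi/2-\varepsilon^{1/2}C_s]$, then $Q_1,Q_2$ are outward-pointing and $Q_3,Q_4$ inward-pointing; if $\theta\in[-\pi/2+\varepsilon^{1/2}C_s,-\varepsilon^{1/2}C_s]$,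 then $Q_1,Q_2$ are inward-pointing and $Q_3,Q_4$ outward-pointing. (Such constants exist.) *)

theory Defs
  imports "HOL-Analysis.Analysis"
begin

section \<open>Smooth maps\<close>

primrec times_differentiable_on ::
  "nat \<Rightarrow> ('a::real_normed_vector \<Rightarrow> 'b::real_normed_vector) \<Rightarrow> 'a set \<Rightarrow> bool" where
  "times_differentiable_on 0 f U \<longleftrightarrow> continuous_on U f"
| "times_differentiable_on (Suc k) f U \<longleftrightarrow>
     (\<forall>x\<in>U. f differentiable (at x)) \<and>
     (\<forall>d. times_differentiable_on k (\<lambda>x. frechet_derivative f (at x) d) U)"

definition smooth_on_open :: "('a::euclidean_space \<Rightarrow> 'b::euclidean_space) \<Rightarrow> 'a set \<Rightarrow> bool" where
  "smooth_on_open f U \<longleftrightarrow> open U \<and> (\<forall>k. times_differentiable_on k f U)"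

text \<open>
  On an arbitrary subset of a Euclidean space, smooth means locally extendable to a smooth map on
  an open set of the ambient space. For embedded submanifolds, possibly with boundary and corners,
  this is the intrinsic notion.
\<close>

definition smooth_map_on :: "'a::euclidean_space set \<Rightarrow> ('a \<Rightarrow> 'b::euclidean_space) \<Rightarrow> bool" where
  "smooth_map_on S f \<longleftrightarrow>
     (\<forall>x\<in>S. \<exists>U g. x \<in> U \<and> smooth_on_open g U \<and> (\<forall>y\<in>S \<inter> U. g y = f y))"

definition diffeomorphism_between ::
  "'a::euclidean_space set \<Rightarrow> 'b::euclidean_space set \<Rightarrow> ('a \<Rightarrow> 'b) \<Rightarrow> ('b \<Rightarrow> 'a) \<Rightarrow> bool" where
  "diffeomorphism_between S T f g \<longleftrightarrow>
     homeomorphism S T f g \<and> smooth_map_on S f \<and> smooth_map_on T g"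


section \<open>Knots\<close>

definition velocity :: "(real \<Rightarrow> 'a::real_normed_vector) \<Rightarrow> real \<Rightarrow> 'a" where
  "velocity c t = vector_derivative c (at t)"

definition acceleration :: "(real \<Rightarrow> 'a::real_normed_vector) \<Rightarrow> real \<Rightarrow> 'a" where
  "acceleration c = velocity (velocity c)"

definition tangent_line :: "(real \<Rightarrow> real^3) \<Rightarrow> real \<Rightarrow> (real^3) set" where
  "tangent_line \<gamma> s = range (\<lambda>t. \<gamma> s + t *\<^sub>R velocity \<gamma> s)"

definition osculating_plane :: "(real \<Rightarrow> real^3) \<Rightarrow> real \<Rightarrow> (real^3) set" where
  "osculating_plane \<gamma> s = (\<lambda>w. \<gamma> s + w) ` span {velocity \<gamma> s, acceleration \<gamma> s}"

definition arclength_knot :: "real \<Rightarrow> (real \<Rightarrow> real^3) \<Rightarrow> bool" where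
  "arclength_knot T \<gamma> \<longleftrightarrow>
     T > 0 \<and> smooth_on_open \<gamma> UNIV \<and>
     (\<forall>s s'. \<gamma> s = \<gamma> s' \<longleftrightarrow> (\<exists>k::int. s' = s + of_int k * T)) \<and>
     (\<forall>s. norm (velocity \<gamma> s) = 1)"

definition special_pairs :: "(real \<Rightarrow> real^3) \<Rightarrow> ((real^3) \<times> (real^3)) set" where
  "special_pairs \<gamma> = {(\<gamma> s, \<gamma> s') | s s'. \<gamma> s \<noteq> \<gamma> s' \<and> \<gamma> s' \<in> tangent_line \<gamma> s}"

definition generic_knot :: "real \<Rightarrow> (real \<Rightarrow> real^3) \<Rightarrow> bool" where
  "generic_knot T \<gamma> \<longleftrightarrow>
     arclength_knot T \<gamma> \<and>
     (\<forall>s. acceleration \<gamma> s \<noteq> 0) \<and>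
     finite (special_pairs \<gamma>) \<and>
     (\<forall>s s'. (\<gamma> s, \<gamma> s') \<in> special_pairs \<gamma> \<longrightarrow> \<not> tangent_line \<gamma> s' \<subseteq> osculating_plane \<gamma> s) \<and>
     (\<forall>s s'. \<gamma> s \<noteq> \<gamma> s' \<longrightarrow> tangent_line \<gamma> s \<noteq> tangent_line \<gamma> s')"


section \<open>The torus around a knot\<close>

definition normal_vec :: "(real \<Rightarrow> real^3) \<Rightarrow> real \<Rightarrow> real^3" where
  "normal_vec \<gamma> s = (1 / norm (acceleration \<gamma> s)) *\<^sub>R acceleration \<gamma> s"

definition binormal_vec :: "(real \<Rightarrow> real^3) \<Rightarrow> real \<Rightarrow> real^3" where
  "binormal_vec \<gamma> s = cross3 (velocity \<gamma> s) (normal_vec \<gamma> s)"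

definition tube_normal :: "(real \<Rightarrow> real^3) \<Rightarrow> real \<times> real \<Rightarrow> real^3" where
  "tube_normal \<gamma> = (\<lambda>(s, \<theta>). cos \<theta> *\<^sub>R normal_vec \<gamma> s + sin \<theta> *\<^sub>R binormal_vec \<gamma> s)"

definition tube_map :: "(real \<Rightarrow> real^3) \<Rightarrow> real \<Rightarrow> real \<times> real \<Rightarrow> real^3" where
  "tube_map \<gamma> \<epsilon> = (\<lambda>(s, \<theta>). \<gamma> s + \<epsilon> *\<^sub>R tube_normal \<gamma> (s, \<theta>))"

definition F1 :: "(real \<Rightarrow> real^3) \<Rightarrow> real \<Rightarrow> (real \<times> real) \<times> (real \<times> real) \<Rightarrow> real" where
  "F1 \<gamma> \<epsilon> = (\<lambda>(a, b). (tube_map \<gamma> \<epsilon> b - tube_map \<gamma> \<epsilon> a) \<bullet> tube_normal \<gamma> a)"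

definition F2 :: "(real \<Rightarrow> real^3) \<Rightarrow> real \<Rightarrow> (real \<times> real) \<times> (real \<times> real) \<Rightarrow> real" where
  "F2 \<gamma> \<epsilon> = (\<lambda>(a, b). (tube_map \<gamma> \<epsilon> b - tube_map \<gamma> \<epsilon> a) \<bullet> tube_normal \<gamma> b)"

text \<open>
  The space \<open>(\<real>/T\<int> \<times> S\<^sup>1)\<^sup>2\<close> is realized as a product of four unit circles in the complex plane:
  \<open>torus_pt2 T\<close> is the quotient map from \<open>((s\<^sub>1,\<theta>\<^sub>1),(s\<^sub>2,\<theta>\<^sub>2)) \<in> \<real>\<^sup>4\<close>. The maps
  \<open>tube_map\<close>, \<open>tube_normal\<close>, \<open>F1\<close>, \<open>F2\<close> are given on \<open>\<real>\<^sup>2\<close>, respectively \<open>\<real>\<^sup>4\<close>; by periodicity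
  they descend to the quotient.
\<close>

type_synonym torus2 = "(complex \<times> complex) \<times> (complex \<times> complex)"

definition torus_pt :: "real \<Rightarrow> real \<times> real \<Rightarrow> complex \<times> complex" where
  "torus_pt T = (\<lambda>(s, \<theta>). (cis (2 * pi * s / T), cis \<theta>))"

definition torus_pt2 :: "real \<Rightarrow> (real \<times> real) \<times> (real \<times> real) \<Rightarrow> torus2" where
  "torus_pt2 T = map_prod (torus_pt T) (torus_pt T)"

definition M_set :: "real \<Rightarrow> (real \<Rightarrow> real^3) \<Rightarrow> real \<Rightarrow> torus2 set" where
  "M_set T \<gamma> \<epsilon> = closure {torus_pt2 T ((s1, \<theta>1), (s2, \<theta>2)) | s1 \<theta>1 s2 \<theta>2.
     F1 \<gamma> \<epsilon> ((s1, \<theta>1), (s2, \<theta>2)) \<ge> 0 \<and> F2 \<gamma> \<epsilon> ((s1, \<theta>1), (s2, \<theta>2)) \<ge> 0 \<and>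
     cis (2 * pi * s1 / T) \<noteq> cis (2 * pi * s2 / T)}"

definition Delta_set :: "real \<Rightarrow> (real \<Rightarrow> real^3) \<Rightarrow> real \<Rightarrow> torus2 set" where
  "Delta_set T \<gamma> \<epsilon> = M_set T \<gamma> \<epsilon> \<inter> {torus_pt2 T ((s, \<theta>1), (s, \<theta>2)) | s \<theta>1 \<theta>2. True}"

definition Delta_cusp :: "real \<Rightarrow> (real \<Rightarrow> real^3) \<Rightarrow> real \<Rightarrow> real \<Rightarrow> torus2 set" where
  "Delta_cusp T \<gamma> CK \<epsilon> = Delta_set T \<gamma> \<epsilon> -
     {torus_pt2 T ((s1, \<theta>1), (s2, \<theta>2)) | s1 \<theta>1 s2 \<theta>2.
        \<exists>k::int. \<theta>1 \<in> {of_int k * pi / 2 - sqrt \<epsilon> * CK <..< of_int k * pi / 2 + sqrt \<epsilon> * CK}}"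


section \<open>The tubular neighbourhood of the diagonal\<close>

definition tube_map2 ::
  "(real \<Rightarrow> real^3) \<Rightarrow> real \<Rightarrow> (real \<times> real) \<times> (real \<times> real) \<Rightarrow> (real^3) \<times> (real^3)" where
  "tube_map2 \<gamma> \<epsilon> = map_prod (tube_map \<gamma> \<epsilon>) (tube_map \<gamma> \<epsilon>)"

text \<open>
  Tangent vectors of \<open>(\<real>/T\<int> \<times> S\<^sup>1)\<^sup>2\<close> are represented by their images under the differential of
  \<open>\<Gamma>\<^sub>\<epsilon> \<times> \<Gamma>\<^sub>\<epsilon>\<close>, which turns the pulled-back metric into the Euclidean inner product of
  \<open>\<real>\<^sup>3 \<times> \<real>\<^sup>3\<close>.
\<close>

definition tangent_space2 ::
  "(real \<Rightarrow> real^3) \<Rightarrow> real \<Rightarrow> (real \<times> real) \<times> (real \<times> real) \<Rightarrow> ((real^3) \<times> (real^3)) set" where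
  "tangent_space2 \<gamma> \<epsilon> z = range (frechet_derivative (tube_map2 \<gamma> \<epsilon>) (at z))"

definition diagonal_tangent_space ::
  "(real \<Rightarrow> real^3) \<Rightarrow> real \<Rightarrow> real \<times> real \<Rightarrow> ((real^3) \<times> (real^3)) set" where
  "diagonal_tangent_space \<gamma> \<epsilon> x = range (frechet_derivative (\<lambda>x. tube_map2 \<gamma> \<epsilon> (x, x)) (at x))"

definition diagonal_normal_space ::
  "(real \<Rightarrow> real^3) \<Rightarrow> real \<Rightarrow> real \<times> real \<Rightarrow> ((real^3) \<times> (real^3)) set" where
  "diagonal_normal_space \<gamma> \<epsilon> x =
     {u \<in> tangent_space2 \<gamma> \<epsilon> (x, x). \<forall>w \<in> diagonal_tangent_space \<gamma> \<epsilon> x. u \<bullet> w = 0}"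

text \<open>
  Geodesics of the pulled-back metric, lifted to \<open>\<real>\<^sup>4\<close>: the covariant derivative of the velocity is
  the tangential part of the acceleration in \<open>\<real>\<^sup>3 \<times> \<real>\<^sup>3\<close>.
\<close>

definition geodesic2 ::
  "(real \<Rightarrow> real^3) \<Rightarrow> real \<Rightarrow> (real \<Rightarrow> (real \<times> real) \<times> (real \<times> real)) \<Rightarrow> bool" where
  "geodesic2 \<gamma> \<epsilon> c \<longleftrightarrow> smooth_on_open c UNIV \<and>
     (\<forall>t. \<forall>w \<in> tangent_space2 \<gamma> \<epsilon> (c t). acceleration (\<lambda>t. tube_map2 \<gamma> \<epsilon> (c t)) t \<bullet> w = 0)"

definition exp_map ::
  "real \<Rightarrow> (real \<Rightarrow> real^3) \<Rightarrow> real \<Rightarrow> torus2 \<times> ((real^3) \<times> (real^3)) \<Rightarrow> torus2" where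
  "exp_map T \<gamma> \<epsilon> = (\<lambda>(p, u). THE q. \<exists>c. geodesic2 \<gamma> \<epsilon> c \<and> torus_pt2 T (c 0) = p \<and>
     velocity (\<lambda>t. tube_map2 \<gamma> \<epsilon> (c t)) 0 = u \<and> torus_pt2 T (c 1) = q)"

definition normal_disc_bundle ::
  "real \<Rightarrow> (real \<Rightarrow> real^3) \<Rightarrow> real \<Rightarrow> real \<Rightarrow> (torus2 \<times> ((real^3) \<times> (real^3))) set" where
  "normal_disc_bundle T \<gamma> \<epsilon> r =
     {(torus_pt2 T (x, x), u) | x u. u \<in> diagonal_normal_space \<gamma> \<epsilon> x \<and> norm u \<le> r}"

definition tubular_nbhd :: "real \<Rightarrow> (real \<Rightarrow> real^3) \<Rightarrow> real \<Rightarrow> real \<Rightarrow> torus2 set" where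
  "tubular_nbhd T \<gamma> \<epsilon> r = exp_map T \<gamma> \<epsilon> ` normal_disc_bundle T \<gamma> \<epsilon> r"

definition is_tubular_radius :: "real \<Rightarrow> (real \<Rightarrow> real^3) \<Rightarrow> real \<Rightarrow> real \<Rightarrow> bool" where
  "is_tubular_radius T \<gamma> \<epsilon> r \<longleftrightarrow> r > 0 \<and>
     (\<exists>g. diffeomorphism_between (normal_disc_bundle T \<gamma> \<epsilon> r) (tubular_nbhd T \<gamma> \<epsilon> r)
            (exp_map T \<gamma> \<epsilon>) g)"

definition tubular_proj :: "real \<Rightarrow> (real \<Rightarrow> real^3) \<Rightarrow> real \<Rightarrow> real \<Rightarrow> torus2 \<Rightarrow> torus2" where
  "tubular_proj T \<gamma> \<epsilon> r q =
     fst (inv_into (normal_disc_bundle T \<gamma> \<epsilon> r) (exp_map T \<gamma> \<epsilon>) q)"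

definition M_near_cusp :: "real \<Rightarrow> (real \<Rightarrow> real^3) \<Rightarrow> real \<Rightarrow> real \<Rightarrow> real \<Rightarrow> torus2 set" where
  "M_near_cusp T \<gamma> CK \<epsilon> r =
     {q \<in> M_set T \<gamma> \<epsilon> \<inter> tubular_nbhd T \<gamma> \<epsilon> r. tubular_proj T \<gamma> \<epsilon> r q \<in> Delta_cusp T \<gamma> CK \<epsilon>}"


section \<open>Stratified fibrations and cuspidal regions\<close>

text \<open>
  A stratification is given by the indexed family of its strata, some of which may be empty. The
  typical fibre of a trivialization around \<open>b\<close> is the fibre over \<open>b\<close> with the induced strata.
\<close>

definition locally_trivial_stratified_fibration ::
  "'a::euclidean_space set \<Rightarrow> 'b::euclidean_space set \<Rightarrow> ('a \<Rightarrow> 'b) \<Rightarrow> ('i \<Rightarrow> 'a set) \<Rightarrow> bool" where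
  "locally_trivial_stratified_fibration E B \<pi> S \<longleftrightarrow>
     continuous_on E \<pi> \<and> \<pi> ` E = B \<and>
     (\<Union>i. S i) = E \<and> (\<forall>i j. i \<noteq> j \<longrightarrow> S i \<inter> S j = {}) \<and>
     (\<forall>b\<in>B. \<exists>V \<Phi> \<Psi>. openin (top_of_set B) V \<and> b \<in> V \<and>
        (let EV = {q \<in> E. \<pi> q \<in> V}; fib = {q \<in> E. \<pi> q = b} in
           homeomorphism EV (Sigma V (\<lambda>_. fib)) \<Phi> \<Psi> \<and>
           (\<forall>q\<in>EV. fst (\<Phi> q) = \<pi> q) \<and>
           (\<forall>i. diffeomorphism_between (S i \<inter> EV) (Sigma V (\<lambda>_. S i \<inter> fib)) \<Phi> \<Psi>)))"

text \<open>
  The stratum \<open>None\<close> is \<open>\<Delta>\<^sub>\<epsilon>\<^sup>c\<^sup>u\<^sup>s\<^sup>p\<close>; for \<open>Some (z1, z2)\<close> the truth values tell whether \<open>F1\<close>,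
  respectively \<open>F2\<close>, vanishes.
\<close>

definition M_strata ::
  "real \<Rightarrow> (real \<Rightarrow> real^3) \<Rightarrow> real \<Rightarrow> real \<Rightarrow> real \<Rightarrow> (bool \<times> bool) option \<Rightarrow> torus2 set" where
  "M_strata T \<gamma> CK \<epsilon> r i = (case i of
     None \<Rightarrow> Delta_cusp T \<gamma> CK \<epsilon>
   | Some (z1, z2) \<Rightarrow> {q \<in> M_near_cusp T \<gamma> CK \<epsilon> r - Delta_cusp T \<gamma> CK \<epsilon>.
       \<exists>z. torus_pt2 T z = q \<and> (F1 \<gamma> \<epsilon> z = 0 \<longleftrightarrow> z1) \<and> (F2 \<gamma> \<epsilon> z = 0 \<longleftrightarrow> z2)})"

definition cusp_model :: "(real \<times> real) set" where
  "cusp_model = {(x, y). y\<^sup>2 \<le> \<bar>x ^ 3\<bar> \<and> x\<^sup>2 + y\<^sup>2 \<le> 1}"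

text \<open>
  The matching strata of the model: the cusp point, the edges \<open>y = \<bar>x\<bar>\<^sup>3\<^sup>/\<^sup>2\<close> (where \<open>F1\<close> vanishes),
  the edges \<open>y = - \<bar>x\<bar>\<^sup>3\<^sup>/\<^sup>2\<close> (where \<open>F2\<close> vanishes), and the rest. The stratum \<open>Some (True, True)\<close>
  is empty.
\<close>

definition cusp_model_strata :: "(bool \<times> bool) option \<Rightarrow> (real \<times> real) set" where
  "cusp_model_strata i = (case i of
     None \<Rightarrow> {(0, 0)}
   | Some (z1, z2) \<Rightarrow> {(x, y) \<in> cusp_model - {(0, 0)}.
       (y = sqrt \<bar>x ^ 3\<bar> \<longleftrightarrow> z1) \<and> (y = - sqrt \<bar>x ^ 3\<bar> \<longleftrightarrow> z2)})"


section \<open>Outward- and inward-pointing quadrants\<close>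

definition strictly_concave_on :: "real set \<Rightarrow> (real \<Rightarrow> real) \<Rightarrow> bool" where
  "strictly_concave_on A f \<longleftrightarrow> convex A \<and>
     (\<forall>x\<in>A. \<forall>y\<in>A. \<forall>t. x \<noteq> y \<and> 0 < t \<and> t < 1 \<longrightarrow>
        (1 - t) * f x + t * f y < f ((1 - t) * x + t * y))"

definition principal_M :: "(real \<Rightarrow> real^3) \<Rightarrow> real \<times> real \<Rightarrow> real^3" where
  "principal_M \<gamma> = (\<lambda>(s, \<theta>). - velocity \<gamma> s)"

definition principal_m :: "(real \<Rightarrow> real^3) \<Rightarrow> real \<times> real \<Rightarrow> real^3" where
  "principal_m \<gamma> = (\<lambda>(s, \<theta>). velocity (\<lambda>t. tube_normal \<gamma> (s, t)) \<theta>)"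

text \<open>
  For signs \<open>\<sigma>, \<tau>\<close>, the quadrant between \<open>\<sigma> w\<^sub>M\<close> and \<open>\<tau> w\<^sub>m\<close>: the intersection of the torus with
  the affine tangent plane, in the coordinates \<open>(x, y)\<close> along \<open>\<sigma> w\<^sub>M\<close> and \<open>\<tau> w\<^sub>m\<close>.
\<close>

definition quadrant_curve ::
  "(real \<Rightarrow> real^3) \<Rightarrow> real \<Rightarrow> real \<times> real \<Rightarrow> real \<Rightarrow> real \<Rightarrow> (real \<times> real) set" where
  "quadrant_curve \<gamma> \<epsilon> p \<sigma> \<tau> = {(x, y). x > 0 \<and> y > 0 \<and>
     tube_map \<gamma> \<epsilon> p + (x * \<sigma>) *\<^sub>R principal_M \<gamma> p + (y * \<tau>) *\<^sub>R principal_m \<gamma> p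
       \<in> range (tube_map \<gamma> \<epsilon>)}"

text \<open>Near the origin, excluding it, the set is the graph of a strictly concave positive function.\<close>

definition locally_concave_graph :: "(real \<times> real) set \<Rightarrow> bool" where
  "locally_concave_graph A \<longleftrightarrow> (\<exists>a f U. a > 0 \<and> strictly_concave_on {0<..<a} f \<and>
     (\<forall>x\<in>{0<..<a}. f x > 0) \<and> (f \<longlongrightarrow> 0) (at_right 0) \<and>
     open U \<and> (0, 0) \<in> U \<and> A \<inter> U = (\<lambda>x. (x, f x)) ` {0<..<a} \<inter> U)"

definition outward_pointing ::
  "(real \<Rightarrow> real^3) \<Rightarrow> real \<Rightarrow> real \<times> real \<Rightarrow> real \<Rightarrow> real \<Rightarrow> bool" where
  "outward_pointing \<gamma> \<epsilon> p \<sigma> \<tau> \<longleftrightarrow> locally_concave_graph (quadrant_curve \<gamma> \<epsilon> p \<sigma> \<tau>)"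

definition inward_pointing ::
  "(real \<Rightarrow> real^3) \<Rightarrow> real \<Rightarrow> real \<times> real \<Rightarrow> real \<Rightarrow> real \<Rightarrow> bool" where
  "inward_pointing \<gamma> \<epsilon> p \<sigma> \<tau> \<longleftrightarrow>
     locally_concave_graph (prod.swap ` quadrant_curve \<gamma> \<epsilon> p \<sigma> \<tau>)"

text \<open>
  The quadrants \<open>Q\<^sub>1, Q\<^sub>2, Q\<^sub>3, Q\<^sub>4\<close> correspond to the sign pairs
  \<open>(1, 1), (-1, 1), (-1, -1), (1, -1)\<close>.
\<close>

definition pointing_constant :: "(real \<Rightarrow> real^3) \<Rightarrow> real \<Rightarrow> real \<Rightarrow> bool" where
  "pointing_constant \<gamma> s c \<longleftrightarrow> c > 0 \<and>
     (\<forall>\<^sub>F \<epsilon> in at_right 0.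
        (\<forall>\<theta> \<in> {sqrt \<epsilon> * c .. pi / 2 - sqrt \<epsilon> * c}.
           outward_pointing \<gamma> \<epsilon> (s, \<theta>) 1 1 \<and> outward_pointing \<gamma> \<epsilon> (s, \<theta>) (- 1) 1 \<and>
           inward_pointing \<gamma> \<epsilon> (s, \<theta>) (- 1) (- 1) \<and> inward_pointing \<gamma> \<epsilon> (s, \<theta>) 1 (- 1)) \<and>
        (\<forall>\<theta> \<in> {- pi / 2 + sqrt \<epsilon> * c .. - sqrt \<epsilon> * c}.
           inward_pointing \<gamma> \<epsilon> (s, \<theta>) 1 1 \<and> inward_pointing \<gamma> \<epsilon> (s, \<theta>) (- 1) 1 \<and>
           outward_pointing \<gamma> \<epsilon> (s, \<theta>) (- 1) (- 1) \<and> outward_pointing \<gamma> \<epsilon> (s, \<theta>) 1 (- 1)))"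

end

theory Submission
  imports Defs
begin

text \<open>
  Geodesics of the torus give coordinates \<open>(x, a)\<close> near the diagonal: the point with base \<open>(x, x)\<close> and
  normal vector \<open>(u, -u)\<close>, \<open>u\<close> having frame coordinates \<open>a\<close>, is the pair of endpoints of the
  geodesics from \<open>x\<close> with initial velocities \<open>u\<close> and \<open>-u\<close>. Along \<open>a = \<rho> e\<close> one has
  \<open>F\<^sub>1 = 2 k \<rho>\<^sup>2 + (2/3) c \<rho>\<^sup>3 + O(\<rho>\<^sup>4)\<close>, \<open>F\<^sub>2 = - 2 k \<rho>\<^sup>2 + (2/3) c \<rho>\<^sup>3 + O(\<rho>\<^sup>4)\<close>, where \<open>k\<close> is the normal
  curvature in the direction \<open>e\<close> and \<open>c\<close> its derivative along the geodesic. So \<open>F\<^sub>1, F\<^sub>2 \<ge> 0\<close> forces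
  \<open>e\<close> to be nearly asymptotic with \<open>c > 0\<close>, and \<open>\<rho>\<close>, \<open>m = (F\<^sub>2 - F\<^sub>1) / (F\<^sub>1 + F\<^sub>2) \<in> [-1, 1]\<close> and the
  quadrant of \<open>e\<close> determine \<open>a\<close>, by the implicit function theorem for the angle of \<open>e\<close>.

  An outward-pointing quadrant forces \<open>c \<le> 0\<close> at its asymptotic direction. Letting \<open>\<epsilon> \<rightarrow> 0\<close> at \<open>\<theta> = \<epsilon>\<^sup>1\<^sup>/\<^sup>2 C\<^sub>s\<close> this gives \<open>\<bar>\<kappa>'\<bar> \<le> 3 \<kappa>\<^sup>3\<^sup>/\<^sup>2 C\<^sub>s\<close>; the factor 2 in \<open>C\<^sub>K\<close> then makes
  \<open>c > 0\<close> in exactly two quadrants, and \<open>c < 0\<close> in the other two, along all of \<open>\<Delta>\<^sub>\<epsilon>\<^sup>c\<^sup>u\<^sup>s\<^sup>p\<close>. Mapping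
  \<open>(\<rho>, m)\<close> and the quadrant to the cuspidal region gives a global trivialization; it is a
  homeomorphism by compactness.
\<close>

section \<open>Smooth maps\<close>

text \<open>Replacing \<open>a\<close> by \<open>- a\<close> exchanges the two endpoints, so
  \<open>F2\<close> at \<open>a\<close> is minus \<open>F1\<close> at \<open>- a\<close>: even terms
  of the two expansions are opposite, odd terms agree. This is why the sum sees only
  \<open>c\<close> and the difference sees \<open>k\<close> at leading order. The shape of the proof
  is dictated by the need for remainders that are smooth in \<open>(\<rho>, x, e)\<close> up to
  \<open>\<rho> = 0\<close>, uniformly over the base. Therefore the exponential map is the flow of
  an explicit equation with smooth dependence on parameters, and powers of \<rho> are divided out by
  Hadamard's lemma. Every claim for small \<rho> is then an open condition that is checked at
  \<open>\<rho> = 0\<close> on a compact set. The identification of a fibre with the model cannot be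
  a diffeomorphism at \<open>p\<close>: the two cuspidal regions leave \<open>p\<close> along
  linearly independent asymptotic directions, those of the model along opposite ones. So the
  trivialization is written in \<open>(\<rho>, m)\<close>, which degenerates exactly at
  \<open>p\<close>, and at \<open>p\<close> only continuity is shown, from the radius alone.\<close>

abbreviation (input) "smooth \<equiv> smooth_on_open"
abbreviation (input) "frechet \<equiv> frechet_derivative"
abbreviation (input) "td \<equiv> times_differentiable_on"

lemma td_mono: "td (Suc k) f U \<Longrightarrow> td k f U"
proof (induction k arbitrary: f)
 case 0
 then show ?case
  by (auto intro!: continuous_at_imp_continuous_on differentiable_imp_continuous_within)
next
 case (Suc k)
 then show ?case by auto
qed

lemma td_le: "td k f U \<Longrightarrow> j \<le> k \<Longrightarrow> td j f U"
 by (induction k) (auto simp: le_Suc_eq simp del: times_differentiable_on.simps dest: td_mono)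

lemma td_continuous: "td k f U \<Longrightarrow> continuous_on U f"
 using td_le[of k f U 0] by simp

lemma td_subset: "td k f U \<Longrightarrow> V \<subseteq> U \<Longrightarrow> td k f V"
 by (induction k arbitrary: f) (auto intro: continuous_on_subset)

lemma frechet_derivative_cong_open:
 assumes "open U" "x \<in> U" "\<And>y. y \<in> U \<Longrightarrow> f y = g y"
 shows "frechet f (at x) = frechet g (at x)"
proof -
 have "(f has_derivative D) (at x) \<longleftrightarrow> (g has_derivative D) (at x)" for D
  using assms has_derivative_transform_within_open[of f D x UNIV U g]
   has_derivative_transform_within_open[of g D x UNIV U f] by auto
 then show ?thesis unfolding frechet_derivative_def by simp
qed

lemma differentiable_cong_open:
 assumes "open U" "x \<in> U" "\<And>y. y \<in> U \<Longrightarrow> f y = g y" "f differentiable (at x)"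
 shows "g differentiable (at x)"
 using assms unfolding differentiable_def by (metis has_derivative_transform_within_open)

lemma td_cong:
 assumes "open U" "\<And>x. x \<in> U \<Longrightarrow> f x = g x" "td k f U"
 shows "td k g U"
 using assms(2,3)
proof (induction k arbitrary: f g)
 case 0
 then show ?case by (metis continuous_on_cong times_differentiable_on.simps(1))
next
 case (Suc k)
 have "g differentiable (at x)" if "x \<in> U" for x
  using differentiable_cong_open[of U x f g] Suc.prems assms(1) that by auto
 moreover have "td k (\<lambda>x. frechet g (at x) d) U" for d
 proof (rule Suc.IH)
  show "td k (\<lambda>x. frechet f (at x) d) U" using Suc.prems by auto
  show "frechet f (at x) d = frechet g (at x) d" if "x \<in> U" for x
   using frechet_derivative_cong_open[of U x f g] Suc.prems that assms(1) by auto
 qed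
 ultimately show ?case by auto
qed

text \<open>The definition speaks of \<open>frechet_derivative\<close>; here any formula that is a
  derivative on the open set \<open>U\<close> may be used in its place, so that inductions can work
  with explicit derivatives.\<close>

lemma td_Suc_I:
 assumes "open U" "\<And>x. x \<in> U \<Longrightarrow> (f has_derivative f' x) (at x)"
  "\<And>d. td k (\<lambda>x. f' x d) U"
 shows "td (Suc k) f U"
proof -
 have "frechet f (at x) = f' x" if "x \<in> U" for x
  using frechet_derivative_at[OF assms(2)[OF that]] by simp
 then have "td k (\<lambda>x. frechet f (at x) d) U" for d
  using td_cong[OF assms(1) _ assms(3)[of d]] by simp
 then show ?thesis using assms(2) differentiableI by fastforce
qed

lemma td_has_derivative:
 assumes "td (Suc k) f U" "x \<in> U"
 shows "(f has_derivative frechet f (at x)) (at x)"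
 using assms frechet_derivative_works by auto

lemma td_frechet:
 "td (Suc k) f U \<Longrightarrow> td k (\<lambda>x. frechet f (at x) d) U"
 by auto

lemma td_const [simp]: "td k (\<lambda>x. c) U"
 by (induction k arbitrary: c) auto

lemma td_bounded_linear_compose:
 assumes "open U" "bounded_linear L" "td k f U"
 shows "td k (\<lambda>x. L (f x)) U"
 using assms(3)
proof (induction k arbitrary: f)
 case 0
 then show ?case using assms(2) bounded_linear.continuous_on by auto
next
 case (Suc k)
 show ?case
 proof (rule td_Suc_I[OF assms(1)])
  show "((\<lambda>x. L (f x)) has_derivative (\<lambda>d. L (frechet f (at x) d))) (at x)" if "x \<in> U" for x
   using bounded_linear.has_derivative[OF assms(2) td_has_derivative[OF Suc.prems that]] .
  show "td k (\<lambda>x. L (frechet f (at x) d)) U" for d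
   by (rule Suc.IH[OF td_frechet[OF Suc.prems]])
 qed
qed

lemma td_id: "td k (\<lambda>x. x) U"
proof (cases k)
 case (Suc j)
 then show ?thesis by (auto simp: frechet_derivative_at[OF has_derivative_ident, symmetric])
qed auto

lemma td_add:
 assumes "open U" "td k f U" "td k g U"
 shows "td k (\<lambda>x. f x + g x) U"
 using assms(2,3)
proof (induction k arbitrary: f g)
 case 0
 then show ?case by (auto intro: continuous_intros)
next
 case (Suc k)
 show ?case
 proof (rule td_Suc_I[OF assms(1)])
  show "((\<lambda>x. f x + g x) has_derivative
    (\<lambda>d. frechet f (at x) d + frechet g (at x) d)) (at x)" if "x \<in> U" for x
   using that Suc.prems by (intro has_derivative_add td_has_derivative)
  show "td k (\<lambda>x. frechet f (at x) d + frechet g (at x) d) U" for d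
   by (rule Suc.IH[OF td_frechet[OF Suc.prems(1)] td_frechet[OF Suc.prems(2)]])
 qed
qed

lemma td_bilinear:
 assumes "open U" "bounded_bilinear B" "td k f U" "td k g U"
 shows "td k (\<lambda>x. B (f x) (g x)) U"
 using assms(3,4)
proof (induction k arbitrary: f g)
 case 0
 then show ?case using bounded_bilinear.continuous_on[OF assms(2)] by auto
next
 case (Suc k)
 show ?case
 proof (rule td_Suc_I[OF assms(1)])
  show "((\<lambda>x. B (f x) (g x)) has_derivative
    (\<lambda>d. B (f x) (frechet g (at x) d) + B (frechet f (at x) d) (g x))) (at x)"
   if "x \<in> U" for x
   using that Suc.prems by (intro bounded_bilinear.FDERIV[OF assms(2)] td_has_derivative)
  show "td k
    (\<lambda>x. B (f x) (frechet g (at x) d) + B (frechet f (at x) d) (g x)) U" for d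
   using Suc.prems
   by (intro td_add[OF assms(1)] Suc.IH td_frechet) (auto dest: td_mono simp del: times_differentiable_on.simps)
 qed
qed

lemma td_sum:
 assumes "open U" "\<And>i. i \<in> I \<Longrightarrow> td k (f i) U"
 shows "td k (\<lambda>x. \<Sum>i\<in>I. f i x) U"
 using assms(2) by (induction I rule: infinite_finite_induct) (auto intro!: td_add[OF assms(1)])

lemma linear_basis_expansion:
 fixes L :: "'a::euclidean_space \<Rightarrow> 'b::real_vector"
 assumes "linear L"
 shows "L v = (\<Sum>b\<in>Basis. (v \<bullet> b) *\<^sub>R L b)"
proof -
 have "L v = L (\<Sum>b\<in>Basis. (v \<bullet> b) *\<^sub>R b)" by (simp add: euclidean_representation)
 then show ?thesis using assms by (simp add: linear_sum linear_scale)
qed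

text \<open>The notion involves derivatives in fixed directions only, whereas the chain rule
  differentiates \<open>g\<close> in the direction \<open>frechet f (at x) d\<close>, which moves
  with \<open>x\<close>. Expanding this direction in the basis gives sums of products to which the
  induction hypothesis applies.\<close>

lemma td_compose:
 fixes f :: "'a::real_normed_vector \<Rightarrow> 'b::euclidean_space"
 assumes "open U" "open V" "f ` U \<subseteq> V" "td k f U" "td k g V"
 shows "td k (\<lambda>x. g (f x)) U"
 using assms(4,5)
proof (induction k arbitrary: g)
 case 0
 then show ?case using assms(3) by (auto intro: continuous_on_compose2)
next
 case (Suc k)
 have gd: "(g has_derivative frechet g (at (f x))) (at (f x))" if "x \<in> U" for x
  by (rule td_has_derivative[OF Suc.prems(2)]) (use that assms(3) in blast)
 show ?case
 proof (rule td_Suc_I[OF assms(1)])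
  show "((\<lambda>x. g (f x)) has_derivative (\<lambda>d. \<Sum>b\<in>Basis. (frechet f (at x) d \<bullet> b) *\<^sub>R
    frechet g (at (f x)) b)) (at x)" if "x \<in> U" for x
  proof -
   have 1: "((\<lambda>x. g (f x)) has_derivative (\<lambda>d. frechet g (at (f x)) (frechet f (at x) d))) (at x)"
    using has_derivative_compose[OF td_has_derivative[OF Suc.prems(1) that] gd[OF that]] .
   have "frechet g (at (f x)) v = (\<Sum>b\<in>Basis. (v \<bullet> b) *\<^sub>R frechet g (at (f x)) b)" for v
    by (rule linear_basis_expansion[OF has_derivative_linear[OF gd[OF that]]])
   then show ?thesis by (intro has_derivative_eq_rhs[OF 1] ext)
  qed
  show "td k (\<lambda>x. \<Sum>b\<in>Basis. (frechet f (at x) d \<bullet> b) *\<^sub>R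
    frechet g (at (f x)) b) U" for d
  proof (intro td_sum[OF assms(1)] td_bilinear[OF assms(1) bounded_bilinear_scaleR])
   fix b :: 'b
   show "td k (\<lambda>x. frechet f (at x) d \<bullet> b) U"
    by (rule td_bounded_linear_compose[OF assms(1) bounded_linear_inner_left td_frechet[OF Suc.prems(1)]])
   show "td k (\<lambda>x. frechet g (at (f x)) b) U"
    using Suc.IH[OF td_mono[OF Suc.prems(1)] td_frechet[OF Suc.prems(2)]] .
  qed
 qed
qed

lemma sm_open: "smooth f U \<Longrightarrow> open U"
 by (simp add: smooth_on_open_def)

lemma sm_td: "smooth f U \<Longrightarrow> td k f U"
 by (simp add: smooth_on_open_def)

lemma sm_continuous_on: "smooth f U \<Longrightarrow> continuous_on U f"
 by (rule td_continuous[OF sm_td])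

lemma sm_has_derivative:
 "smooth f U \<Longrightarrow> x \<in> U \<Longrightarrow> (f has_derivative frechet f (at x)) (at x)"
 by (rule td_has_derivative[OF sm_td])

lemma sm_cong: "smooth f U \<Longrightarrow> (\<And>x. x \<in> U \<Longrightarrow> f x = g x) \<Longrightarrow> smooth g U"
 unfolding smooth_on_open_def using td_cong[of U f g] by blast

lemma sm_subset: "smooth f U \<Longrightarrow> open V \<Longrightarrow> V \<subseteq> U \<Longrightarrow> smooth f V"
 unfolding smooth_on_open_def using td_subset by blast

lemma sm_frechet: "smooth f U \<Longrightarrow> smooth (\<lambda>x. frechet f (at x) d) U"
 unfolding smooth_on_open_def using td_frechet by blast

lemma sm_I_derivative:
 assumes "open U" "\<And>x. x \<in> U \<Longrightarrow> (f has_derivative f' x) (at x)" "\<And>d. smooth (\<lambda>x. f' x d) U"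
 shows "smooth f U"
 unfolding smooth_on_open_def
proof (intro conjI allI)
 fix k
 show "td k f U"
  using td_Suc_I[OF assms(1,2) sm_td[OF assms(3)]] td_mono by blast
qed fact

named_theorems sm_intros

lemma sm_const [sm_intros]: "open U \<Longrightarrow> smooth (\<lambda>x. c) U"
 by (simp add: smooth_on_open_def)

lemma sm_id [sm_intros]: "open U \<Longrightarrow> smooth (\<lambda>x. x) U"
 by (simp add: smooth_on_open_def td_id)

lemma sm_bounded_linear: "bounded_linear L \<Longrightarrow> smooth f U \<Longrightarrow> smooth (\<lambda>x. L (f x)) U"
 by (simp add: smooth_on_open_def td_bounded_linear_compose)

lemma sm_bilinear:
 "bounded_bilinear B \<Longrightarrow> smooth f U \<Longrightarrow> smooth g U \<Longrightarrow> smooth (\<lambda>x. B (f x) (g x)) U"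
 by (simp add: smooth_on_open_def td_bilinear)

lemma sm_add [sm_intros]: "smooth f U \<Longrightarrow> smooth g U \<Longrightarrow> smooth (\<lambda>x. f x + g x) U"
 by (simp add: smooth_on_open_def td_add)

lemma sm_minus [sm_intros]: "smooth f U \<Longrightarrow> smooth (\<lambda>x. - f x) U"
 by (rule sm_bounded_linear[OF bounded_linear_minus[OF bounded_linear_ident]])

lemma sm_diff [sm_intros]: "smooth f U \<Longrightarrow> smooth g U \<Longrightarrow> smooth (\<lambda>x. f x - g x) U"
 using sm_add[OF _ sm_minus, of f U g] by simp

lemma sm_fst [sm_intros]: "smooth f U \<Longrightarrow> smooth (\<lambda>x. fst (f x)) U"
 by (rule sm_bounded_linear[OF bounded_linear_fst])

lemma sm_snd [sm_intros]: "smooth f U \<Longrightarrow> smooth (\<lambda>x. snd (f x)) U"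
 by (rule sm_bounded_linear[OF bounded_linear_snd])

lemmas sm_fst' [sm_intros] = sm_fst[OF sm_id]
lemmas sm_snd' [sm_intros] = sm_snd[OF sm_id]

lemma sm_Pair [sm_intros]:
 assumes "smooth f U" "smooth g U"
 shows "smooth (\<lambda>x. (f x, g x)) U"
proof -
 have "smooth (\<lambda>x. (f x, 0) + (0, g x)) U"
  using sm_bounded_linear[OF bounded_linear_Pair[OF bounded_linear_ident bounded_linear_zero] assms(1)]
   sm_bounded_linear[OF bounded_linear_Pair[OF bounded_linear_zero bounded_linear_ident] assms(2)]
  by (rule sm_add)
 then show ?thesis by simp
qed

lemma sm_mult [sm_intros]:
 fixes f g :: "'a::euclidean_space \<Rightarrow> 'b::{euclidean_space,real_normed_algebra}"
 shows "smooth f U \<Longrightarrow> smooth g U \<Longrightarrow> smooth (\<lambda>x. f x * g x) U"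
 by (rule sm_bilinear[OF bounded_bilinear_mult])

lemma sm_scaleR [sm_intros]:
 "smooth f U \<Longrightarrow> smooth g U \<Longrightarrow> smooth (\<lambda>x. f x *\<^sub>R g x) U"
 by (rule sm_bilinear[OF bounded_bilinear_scaleR])

lemma sm_inner [sm_intros]:
 "smooth f U \<Longrightarrow> smooth g U \<Longrightarrow> smooth (\<lambda>x. f x \<bullet> g x) U"
 by (rule sm_bilinear[OF bounded_bilinear_inner])

lemma sm_cross3 [sm_intros]:
 "smooth f U \<Longrightarrow> smooth g U \<Longrightarrow> smooth (\<lambda>x. cross3 (f x) (g x)) U"
 by (rule sm_bilinear[OF bilinear_cross[unfolded bilinear_conv_bounded_bilinear]])

lemma sm_sum [sm_intros]:
 "open U \<Longrightarrow> (\<And>i. i \<in> I \<Longrightarrow> smooth (f i) U) \<Longrightarrow> smooth (\<lambda>x. \<Sum>i\<in>I. f i x) U"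
 by (simp add: smooth_on_open_def td_sum)

lemma sm_power [sm_intros]:
 fixes f :: "'a::euclidean_space \<Rightarrow> real"
 shows "smooth f U \<Longrightarrow> smooth (\<lambda>x. f x ^ n) U"
 by (induction n) (auto intro: sm_mult sm_const dest: sm_open)

lemma sm_compose:
 assumes "smooth g V" "smooth f U" "f ` U \<subseteq> V"
 shows "smooth (\<lambda>x. g (f x)) U"
 using assms by (auto simp: smooth_on_open_def intro: td_compose)

lemma sm_compose_UNIV: "smooth g UNIV \<Longrightarrow> smooth f U \<Longrightarrow> smooth (\<lambda>x. g (f x)) U"
 by (rule sm_compose) auto

lemma td_Suc_real:
 fixes f :: "real \<Rightarrow> 'b::real_normed_vector"
 assumes "open U" "\<And>x. x \<in> U \<Longrightarrow> (f has_vector_derivative f' x) (at x)" "td k f' U"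
 shows "td (Suc k) f U"
proof (rule td_Suc_I[OF assms(1)])
 show "(f has_derivative (\<lambda>d. d *\<^sub>R f' x)) (at x)" if "x \<in> U" for x
  using assms(2)[OF that] by (simp add: has_vector_derivative_def)
 show "td k (\<lambda>x. d *\<^sub>R f' x) U" for d
  using td_bounded_linear_compose[OF assms(1) bounded_linear_scaleR_right assms(3)] .
qed

lemma td_inverse: "td k (inverse :: real \<Rightarrow> real) (- {0})"
proof (induction k)
 case 0
 then show ?case by (auto intro!: continuous_intros)
next
 case (Suc k)
 show ?case
 proof (rule td_Suc_real)
  show "(inverse has_vector_derivative - (inverse x * inverse x)) (at x)" if "x \<in> - {0}" for x :: real
   using DERIV_inverse[of x UNIV] that
   by (simp add: has_real_derivative_iff_has_vector_derivative power2_eq_square)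
  show "td k (\<lambda>x::real. - (inverse x * inverse x)) (- {0})"
   by (intro td_bounded_linear_compose[OF _ bounded_linear_minus[OF bounded_linear_ident]]
     td_bilinear[OF _ bounded_bilinear_mult] Suc) auto
 qed auto
qed

lemma sm_inverse [sm_intros]:
 fixes f :: "'a::euclidean_space \<Rightarrow> real"
 assumes "smooth f U" "\<And>x. x \<in> U \<Longrightarrow> f x \<noteq> 0"
 shows "smooth (\<lambda>x. inverse (f x)) U"
proof (rule sm_compose[where g = inverse])
 show "smooth (inverse :: real \<Rightarrow> real) (- {0})"
  using td_inverse by (auto simp: smooth_on_open_def)
qed (use assms in auto)

lemma sm_divide [sm_intros]:
 fixes f :: "'a::euclidean_space \<Rightarrow> real"
 assumes "smooth f U" "smooth g U" "\<And>x. x \<in> U \<Longrightarrow> g x \<noteq> 0"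
 shows "smooth (\<lambda>x. f x / g x) U"
 using sm_mult[OF assms(1) sm_inverse[OF assms(2,3)]] by (simp add: field_simps)

lemma td_sqrt: "td k sqrt {0<..}"
proof (induction k)
 case 0
 then show ?case by (auto intro!: continuous_intros)
next
 case (Suc k)
 show ?case
 proof (rule td_Suc_real)
  show "(sqrt has_vector_derivative (1/2) *\<^sub>R inverse (sqrt x)) (at x)" if "x \<in> {0<..}" for x :: real
   using DERIV_real_sqrt[of x] that
   by (simp add: has_real_derivative_iff_has_vector_derivative field_simps)
  have "td k (\<lambda>x. inverse (sqrt x)) {0<..}"
   by (rule td_compose[OF _ _ _ Suc td_inverse]) auto
  then show "td k (\<lambda>x::real. (1/2) *\<^sub>R inverse (sqrt x)) {0<..}"
   by (intro td_bounded_linear_compose[OF _ bounded_linear_scaleR_right]) auto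
 qed auto
qed

lemma sm_sqrt [sm_intros]:
 assumes "smooth f U" "\<And>x. x \<in> U \<Longrightarrow> f x > 0"
 shows "smooth (\<lambda>x. sqrt (f x)) U"
proof (rule sm_compose[where g = sqrt])
 show "smooth sqrt {0<..}" using td_sqrt by (auto simp: smooth_on_open_def)
qed (use assms in auto)

lemma td_sin_cos: "td k (sin::real\<Rightarrow>real) UNIV \<and> td k (cos::real\<Rightarrow>real) UNIV"
proof (induction k)
 case 0
 then show ?case by (auto intro!: continuous_intros)
next
 case (Suc k)
 have "td k (\<lambda>x::real. - sin x) UNIV"
  using Suc by (intro td_bounded_linear_compose[OF _ bounded_linear_minus[OF bounded_linear_ident]]) auto
 moreover have "(sin has_vector_derivative cos x) (at x)" "(cos has_vector_derivative - sin x) (at x)" for x :: real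
  by (rule has_real_derivative_iff_has_vector_derivative[THEN iffD1, OF DERIV_sin],
    rule has_real_derivative_iff_has_vector_derivative[THEN iffD1, OF DERIV_cos])
 ultimately show ?case using Suc td_Suc_real[of UNIV sin cos k] td_Suc_real[of UNIV cos "\<lambda>x. - sin x" k] by blast
qed

lemma sm_sin [sm_intros]: "smooth f U \<Longrightarrow> smooth (\<lambda>x. sin (f x :: real)) U"
 by (rule sm_compose_UNIV) (use td_sin_cos in \<open>auto simp: smooth_on_open_def\<close>)

lemma sm_cos [sm_intros]: "smooth f U \<Longrightarrow> smooth (\<lambda>x. cos (f x :: real)) U"
 by (rule sm_compose_UNIV) (use td_sin_cos in \<open>auto simp: smooth_on_open_def\<close>)

lemma sm_arctan [sm_intros]:
 assumes "smooth f U"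
 shows "smooth (\<lambda>x. arctan (f x)) U"
proof (rule sm_compose_UNIV[OF _ assms], rule sm_I_derivative)
 show "(arctan has_derivative (\<lambda>d. inverse (1 + x\<^sup>2) * d)) (at x)" for x
  using DERIV_arctan[of x] by (simp add: has_field_derivative_def)
 show "smooth (\<lambda>x. inverse (1 + x\<^sup>2) * d) UNIV" for d :: real
  by (intro sm_intros) (auto simp: add_nonneg_eq_0_iff)
qed auto

lemma sm_cis [sm_intros]:
 assumes "smooth f U"
 shows "smooth (\<lambda>x. cis (f x)) U"
proof -
 have "smooth (\<lambda>x. cos (f x) *\<^sub>R 1 + sin (f x) *\<^sub>R \<i>) U"
  by (intro sm_intros assms sm_open[OF assms])
 then show ?thesis by (rule sm_cong) (auto simp: complex_eq_iff)
qed

lemma sm_Re [sm_intros]: "smooth f U \<Longrightarrow> smooth (\<lambda>x. Re (f x)) U"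
 by (rule sm_bounded_linear[OF bounded_linear_Re])

lemma sm_Im [sm_intros]: "smooth f U \<Longrightarrow> smooth (\<lambda>x. Im (f x)) U"
 by (rule sm_bounded_linear[OF bounded_linear_Im])

lemma sm_velocity:
 assumes "smooth c UNIV"
 shows "smooth (velocity c) UNIV" "(c has_vector_derivative velocity c t) (at t)"
proof -
 have d: "(c has_vector_derivative frechet c (at t) 1) (at t)" for t
 proof -
  have D: "(c has_derivative frechet c (at t)) (at t)"
   by (rule sm_has_derivative[OF assms]) simp
  have "frechet c (at t) = (\<lambda>d. d *\<^sub>R frechet c (at t) 1)"
  proof
   show "frechet c (at t) d = d *\<^sub>R frechet c (at t) 1" for d
    using linear_scale[OF has_derivative_linear[OF D], of d 1] by (simp only: real_scaleR_def mult_1_right)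
  qed
  with D show ?thesis unfolding has_vector_derivative_def by (rule back_subst[where P = "\<lambda>D. (c has_derivative D) (at t)"])
 qed
 then have v: "velocity c t = frechet c (at t) 1" for t
  by (simp add: velocity_def vector_derivative_at)
 show "smooth (velocity c) UNIV"
  by (rule sm_cong[OF sm_frechet[OF assms, of 1]]) (simp add: v)
 show "(c has_vector_derivative velocity c t) (at t)" using d v by simp
qed

lemma sm_frechet_joint:
 fixes f :: "'a::euclidean_space \<Rightarrow> 'b::euclidean_space"
 assumes "smooth f V" "smooth p U" "smooth h U" "p ` U \<subseteq> V"
 shows "smooth (\<lambda>z. frechet f (at (p z)) (h z)) U"
proof -
 have "smooth (\<lambda>z. \<Sum>b\<in>Basis. (h z \<bullet> b) *\<^sub>R frechet f (at (p z)) b) U"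
  by (intro sm_intros assms sm_compose[OF sm_frechet[OF assms(1)] assms(2,4)] sm_open[OF assms(2)])
 moreover have "(\<Sum>b\<in>Basis. (h z \<bullet> b) *\<^sub>R frechet f (at (p z)) b) = frechet f (at (p z)) (h z)"
  if "z \<in> U" for z
  using linear_basis_expansion[OF has_derivative_linear[OF sm_has_derivative[OF assms(1)]], of "p z" "h z"]
   that assms(4) by auto
 ultimately show ?thesis by (rule sm_cong)
qed

section \<open>The smooth inverse function theorem\<close>

text \<open>\<open>inverse_function_theorem\<close> wants the derivative as a continuous map into
  the bounded linear operators, with an inverse at \<open>x0\<close>. In finite dimension continuity
  there follows from continuity in each basis direction, and an injective linear map has a left
  inverse.\<close>

lemma inverse_function_C1:
 fixes f :: "'a::euclidean_space \<Rightarrow> 'a"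
 assumes sf: "smooth f U" and x0: "x0 \<in> U" and inj: "inj (frechet f (at x0))"
 obtains V W g where "open V" "V \<subseteq> U" "x0 \<in> V" "open W" "f x0 \<in> W" "homeomorphism V W f g"
  "\<And>y. y \<in> W \<Longrightarrow> (g has_derivative inv (frechet f (at (g y)))) (at y)"
  "\<And>y. y \<in> W \<Longrightarrow> bij (frechet f (at (g y)))"
proof -
 define f' where "f' x = Blinfun (frechet f (at x))" for x
 have f': "blinfun_apply (f' x) = frechet f (at x)" if "x \<in> U" for x
  unfolding f'_def using has_derivative_bounded_linear[OF sm_has_derivative[OF sf that]]
  by (simp add: bounded_linear_Blinfun_apply)
 have "linear (frechet f (at x0))"
  by (rule has_derivative_linear[OF sm_has_derivative[OF sf x0]])
 then obtain h where h: "linear h" "h \<circ> frechet f (at x0) = id"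
  using inj linear_injective_left_inverse by blast
 have hb: "blinfun_apply (Blinfun h) = h"
  using h(1) by (simp add: bounded_linear_Blinfun_apply linear_conv_bounded_linear)
 have "continuous_on U f'"
 proof (rule continuous_on_blinfun_componentwise)
  fix i :: 'a
  have "continuous_on U (\<lambda>x. frechet f (at x) i)"
   by (rule sm_continuous_on[OF sm_frechet[OF sf]])
  then show "continuous_on U (\<lambda>x. blinfun_apply (f' x) i)"
   by (rule continuous_on_eq) (simp add: f')
 qed
 moreover have "Blinfun h o\<^sub>L f' x0 = id_blinfun"
  using h(2) by (intro blinfun_eqI) (simp add: f'[OF x0] hb fun_eq_iff)
 moreover have "(f has_derivative blinfun_apply (f' x)) (at x)" if "x \<in> U" for x
  unfolding f'[OF that] by (rule sm_has_derivative[OF sf that])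
 ultimately obtain V W g g' where *: "open V" "V \<subseteq> U" "x0 \<in> V" "open W" "f x0 \<in> W" "homeomorphism V W f g"
  "\<And>y. y \<in> W \<Longrightarrow> (g has_derivative (g' y)) (at y)"
  "\<And>y. y \<in> W \<Longrightarrow> g' y = inv (blinfun_apply (f'(g y)))"
  "\<And>y. y \<in> W \<Longrightarrow> bij (blinfun_apply (f'(g y)))"
  using inverse_function_theorem[OF sm_open[OF sf], of f f' x0 "Blinfun h"] x0 by metis
 have gU: "g y \<in> U" if "y \<in> W" for y
  using * that by (auto simp: homeomorphism_def)
 show thesis
 proof (rule that[OF *(1-6)])
  show "(g has_derivative inv (frechet f (at (g y)))) (at y)" if "y \<in> W" for y
   using *(7,8)[OF that] f'[OF gU[OF that]] by simp
  show "bij (frechet f (at (g y)))" if "y \<in> W" for y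
   using *(9)[OF that] f'[OF gU[OF that]] by simp
 qed
qed

text \<open>
 The inverse of the derivative is differentiable because it is a component of the inverse of the
 tangent map \<open>(x, \<xi>) \<mapsto> (f x, Df(x) \<xi>)\<close>, to which the \<open>C\<^sup>1\<close> theorem applies.
\<close>

lemma inverse_derivative_differentiable:
 fixes f :: "'a::euclidean_space \<Rightarrow> 'a"
 assumes sf: "smooth f V" and hom: "homeomorphism V W f g"
  and bij: "\<And>y. y \<in> W \<Longrightarrow> bij (frechet f (at (g y)))" and y: "y \<in> W"
 shows "(\<lambda>(y, w). inv (frechet f (at (g y))) w) differentiable (at (y, w))"
proof -
 define F where "F = (\<lambda>(x, \<xi>). (f x, frechet f (at x) \<xi>))"
 have sF: "smooth F (V \<times> UNIV)"
 proof -
  have o: "open (V \<times> (UNIV :: 'a set))" using sm_open[OF sf] by (simp add: open_Times)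
  have "smooth (\<lambda>z. f (fst z)) (V \<times> (UNIV :: 'a set))"
   by (rule sm_compose[OF sf sm_fst[OF sm_id[OF o]]]) auto
  moreover have "smooth (\<lambda>z. frechet f (at (fst z)) (snd z)) (V \<times> (UNIV :: 'a set))"
   by (rule sm_frechet_joint[OF sf sm_fst[OF sm_id[OF o]] sm_snd[OF sm_id[OF o]]]) auto
  ultimately show ?thesis unfolding F_def case_prod_unfold by (rule sm_Pair)
 qed
 let ?x = "g y"
 let ?\<xi> = "inv (frechet f (at ?x)) w"
 have xV: "?x \<in> V" and fx: "f ?x = y" using hom y by (auto simp: homeomorphism_def)
 have linf: "linear (frechet f (at ?x))"
  by (rule has_derivative_linear[OF sm_has_derivative[OF sf xV]])
 have D: "(F has_derivative (\<lambda>(d, e). (frechet f (at ?x) d,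
   (\<Sum>b\<in>Basis. (?\<xi> \<bullet> b) *\<^sub>R frechet (\<lambda>x. frechet f (at x) b) (at ?x) d
     + (e \<bullet> b) *\<^sub>R frechet f (at ?x) b)))) (at (?x, ?\<xi>))"
 proof -
  have fs: "((\<lambda>z :: 'a \<times> 'a. fst z) has_derivative fst) (at (?x, ?\<xi>))"
   "((\<lambda>z :: 'a \<times> 'a. snd z) has_derivative snd) (at (?x, ?\<xi>))"
   by (auto intro: bounded_linear_imp_has_derivative bounded_linear_fst bounded_linear_snd)
  have 1: "((\<lambda>z. f (fst z)) has_derivative (\<lambda>z. frechet f (at ?x) (fst z))) (at (?x, ?\<xi>))"
   by (rule has_derivative_compose[OF fs(1)]) (simp add: sm_has_derivative[OF sf xV])
  have 2: "((\<lambda>z. frechet f (at (fst z)) b) has_derivative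
    (\<lambda>z. frechet (\<lambda>x. frechet f (at x) b) (at ?x) (fst z))) (at (?x, ?\<xi>))" for b
   by (rule has_derivative_compose[OF fs(1)]) (simp add: sm_has_derivative[OF sm_frechet[OF sf] xV])
  have "((\<lambda>z. (f (fst z), \<Sum>b\<in>Basis. (snd z \<bullet> b) *\<^sub>R frechet f (at (fst z)) b))
   has_derivative (\<lambda>(d, e). (frechet f (at ?x) d,
   (\<Sum>b\<in>Basis. (?\<xi> \<bullet> b) *\<^sub>R frechet (\<lambda>x. frechet f (at x) b) (at ?x) d
     + (e \<bullet> b) *\<^sub>R frechet f (at ?x) b)))) (at (?x, ?\<xi>))"
   by (auto intro!: derivative_eq_intros 1 2 fs simp: case_prod_unfold)
  then show ?thesis
  proof (rule has_derivative_transform_within_open[where s = "V \<times> UNIV"])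
   show "open (V \<times> (UNIV :: 'a set))" using sm_open[OF sf] by (simp add: open_Times)
   show "(f (fst z), \<Sum>b\<in>Basis. (snd z \<bullet> b) *\<^sub>R frechet f (at (fst z)) b) = F z"
    if "z \<in> V \<times> UNIV" for z
    using linear_basis_expansion[OF has_derivative_linear[OF sm_has_derivative[OF sf, of "fst z"]], of "snd z"] that
    by (auto simp: F_def case_prod_unfold)
  qed (use xV in auto)
 qed
 \<comment> \<open>The derivative of \<open>F\<close> is block triangular, with the bijection
   \<open>frechet f (at ?x)\<close> in both diagonal blocks.\<close>
 have injF: "inj (frechet F (at (?x, ?\<xi>)))"
 proof -
  have FD: "frechet F (at (?x, ?\<xi>)) = (\<lambda>(d, e). (frechet f (at ?x) d,
   (\<Sum>b\<in>Basis. (?\<xi> \<bullet> b) *\<^sub>R frechet (\<lambda>x. frechet f (at x) b) (at ?x) d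
     + (e \<bullet> b) *\<^sub>R frechet f (at ?x) b)))"
   by (rule frechet_derivative_at[OF D, symmetric])
  have lin0: "frechet (\<lambda>x. frechet f (at x) b) (at ?x) 0 = 0" for b
   by (rule linear_0[OF has_derivative_linear[OF sm_has_derivative[OF sm_frechet[OF sf] xV]]])
  have inj0: "frechet f (at ?x) d = 0 \<Longrightarrow> d = 0" for d
   using bij[OF y] linf by (metis bij_is_inj injD linear_0)
  show ?thesis
  proof (subst linear_injective_0[OF has_derivative_linear[OF sm_has_derivative[OF sF]]])
   show "(?x, ?\<xi>) \<in> V \<times> UNIV" using xV by simp
   show "\<forall>z. frechet F (at (?x, ?\<xi>)) z = 0 \<longrightarrow> z = 0"
   proof (intro allI impI)
    fix z assume z: "frechet F (at (?x, ?\<xi>)) z = 0"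
    obtain d e where de: "z = (d, e)" by (cases z)
    have d: "d = 0" using z inj0 unfolding FD de by (simp add: zero_prod_def)
    have "(\<Sum>b\<in>Basis. (e \<bullet> b) *\<^sub>R frechet f (at ?x) b) = 0"
     using z unfolding FD de d by (simp add: zero_prod_def lin0)
    then have "frechet f (at ?x) e = 0"
     by (simp add: linear_basis_expansion[OF linf, of e, symmetric])
    then show "z = 0" using inj0 d de by (simp add: zero_prod_def)
   qed
  qed
 qed
 have xm: "(?x, ?\<xi>) \<in> V \<times> UNIV" using xV by simp
 obtain V' W' G where G: "open V'" "V' \<subseteq> V \<times> UNIV" "(?x, ?\<xi>) \<in> V'" "open W'" "F (?x, ?\<xi>) \<in> W'"
  "homeomorphism V' W' F G" and dG: "\<And>y. y \<in> W' \<Longrightarrow> (G has_derivative inv (frechet F (at (G y)))) (at y)"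
  and "\<And>y. y \<in> W' \<Longrightarrow> bij (frechet F (at (G y)))"
  using inverse_function_C1[OF sF xm injF] by metis
 have Fx: "F (?x, ?\<xi>) = (y, w)"
  using bij[OF y] fx by (auto simp: F_def bij_is_surj surj_f_inv_f)
 have eq: "snd (G z) = (case z of (y, w) \<Rightarrow> inv (frechet f (at (g y))) w)" if z: "z \<in> W'" for z
 proof -
  obtain x \<xi> where x: "G z = (x, \<xi>)" by (cases "G z")
  have xV: "x \<in> V" "F (x, \<xi>) = z" using G(2,6) z x
   by (metis (no_types, lifting) homeomorphism_def image_eqI in_mono mem_Sigma_iff, metis homeomorphism_apply2[OF G(6)])
  then have "fst z = f x" "snd z = frechet f (at x) \<xi>" by (auto simp: F_def)
  moreover have "g (f x) = x" "f x \<in> W" using hom xV(1) by (auto simp: homeomorphism_def)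
  ultimately show ?thesis using x bij[of "f x"] by (simp add: case_prod_unfold bij_is_inj)
 qed
 have "(\<lambda>z. snd (G z)) differentiable (at (y, w))"
  using dG[of "(y, w)"] G(5) Fx by (metis differentiable_def has_derivative_snd)
 then show ?thesis
  using differentiable_cong_open[OF G(4), of "(y, w)" "\<lambda>z. snd (G z)"] eq G(5) Fx by auto
qed

text \<open>The derivative of \<open>g\<close> at \<open>y\<close> is \<open>L y\<close>, the
  inverse of \<open>frechet f (at (g y))\<close>. The induction on the order has to treat
  \<open>g\<close> together with all maps \<open>\<lambda>y. L y (B y)\<close>, because the
  derivative of such a map is again of the form \<open>L y (R d y)\<close>, where \<open>R\<close>
  involves \<open>g\<close>, \<open>L\<close> and \<open>B\<close> at one order less.\<close>

theorem smooth_inverse_function: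
 fixes f :: "'a::euclidean_space \<Rightarrow> 'a"
 assumes sf: "smooth f U" and x0: "x0 \<in> U" and inj: "inj (frechet f (at x0))"
 obtains V W g where "open V" "V \<subseteq> U" "x0 \<in> V" "open W" "f x0 \<in> W" "homeomorphism V W f g"
  "smooth g W"
proof -
 obtain V W g where *: "open V" "V \<subseteq> U" "x0 \<in> V" "open W" "f x0 \<in> W" "homeomorphism V W f g"
  and dg: "\<And>y. y \<in> W \<Longrightarrow> (g has_derivative inv (frechet f (at (g y)))) (at y)"
  and bij: "\<And>y. y \<in> W \<Longrightarrow> bij (frechet f (at (g y)))"
  using inverse_function_C1[OF assms] by metis
 have sfV: "smooth f V" by (rule sm_subset[OF sf *(1,2)])
 define L where "L y = inv (frechet f (at (g y)))" for y
 have gV: "g y \<in> V" if "y \<in> W" for y using *(6) that by (auto simp: homeomorphism_def)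
 have linf: "linear (frechet f (at (g y)))" if "y \<in> W" for y
  by (rule has_derivative_linear[OF sm_has_derivative[OF sfV gV[OF that]]])
 have fL: "frechet f (at (g y)) (L y w) = w" if "y \<in> W" for y w
  using bij[OF that] by (simp add: L_def bij_is_surj surj_f_inv_f)
 have Lf: "L y (frechet f (at (g y)) w) = w" if "y \<in> W" for y w
  using bij[OF that] by (simp add: L_def bij_is_inj)
 have dL: "(\<lambda>(y, w). L y w) differentiable (at (y, w))" if "y \<in> W" for y w
  unfolding L_def using inverse_derivative_differentiable[OF sfV *(6) bij that] .
 have dLB: "(\<lambda>y. L y (B y)) differentiable (at y)" if y: "y \<in> W" and B: "B differentiable (at y)" for B y
 proof -
  obtain B' where "(B has_derivative B') (at y)" using B by (auto simp: differentiable_def)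
  then have "((\<lambda>y. (y, B y)) has_derivative (\<lambda>d. (d, B' d))) (at y)"
   by (intro has_derivative_Pair has_derivative_ident)
  moreover obtain L' where "((\<lambda>(y, w). L y w) has_derivative L') (at (y, B y))"
   using dL[OF y] by (auto simp: differentiable_def)
  ultimately have "((\<lambda>y. (\<lambda>(y, w). L y w) (y, B y)) has_derivative (\<lambda>d. L' (d, B' d))) (at y)"
   by (rule has_derivative_compose)
  then show ?thesis by (auto simp: differentiable_def)
 qed
 have main: "td k g W \<and>
   (\<forall>B. td k B W \<longrightarrow> td k (\<lambda>y. L y (B y)) W)" for k
 proof (induction k)
  case 0
  have "continuous_on W g" using *(6) by (simp add: homeomorphism_def)
  moreover have "continuous_on W (\<lambda>y. L y (B y))" if "continuous_on W B" for B
  proof -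
   have "continuous_on (W \<times> UNIV) (\<lambda>(y, w). L y w)"
    by (rule continuous_at_imp_continuous_on) (auto intro!: differentiable_imp_continuous_within dL)
   from continuous_on_compose2[OF this, of W "\<lambda>y. (y, B y)"] show ?thesis
    using continuous_on_Pair[OF continuous_on_id that] by (auto simp: id_def)
  qed
  ultimately show ?case by simp
 next
  case (Suc k)
  have g: "td (Suc k) g W"
  proof (rule td_Suc_I[OF *(4)])
   show "(g has_derivative L y) (at y)" if "y \<in> W" for y using dg[OF that] by (simp add: L_def)
   show "td k (\<lambda>y. L y d) W" for d using Suc by simp
  qed
  have "td (Suc k) (\<lambda>y. L y (B y)) W" if B: "td (Suc k) B W" for B
  proof -
   define A where "A b x = frechet f (at x) b" for b x
   have A: "smooth (A b) V" for b unfolding A_def by (rule sm_frechet[OF sfV])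
   \<comment> \<open>With \<open>Y = L y (B y)\<close>, differentiating
     \<open>frechet f (at (g y)) Y = B y\<close> in the direction \<open>d\<close> and solving for
     the term with the derivative of \<open>Y\<close> leaves \<open>R d y\<close> on the
     right.\<close>
   define R where "R d y = frechet B (at y) d -
     (\<Sum>b\<in>Basis. (L y (B y) \<bullet> b) *\<^sub>R frechet (A b) (at (g y)) (L y d))" for d y
   show ?thesis
   proof (rule td_Suc_I[OF *(4)])
    show "((\<lambda>y. L y (B y)) has_derivative (\<lambda>d. L y (R d y))) (at y)" if y: "y \<in> W" for y
    proof -
     let ?Y = "\<lambda>y. L y (B y)"
     have dB: "(B has_derivative frechet B (at y)) (at y)"
      by (rule td_has_derivative[OF B y])
     obtain Y' where Y': "(?Y has_derivative Y') (at y)"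
      using dLB[OF y] dB unfolding differentiable_def by blast
     have dA: "((\<lambda>y. A b (g y)) has_derivative (\<lambda>d. frechet (A b) (at (g y)) (L y d))) (at y)" for b
      using has_derivative_compose[OF dg[OF y] sm_has_derivative[OF A gV[OF y]]] by (simp add: L_def)
     have "((\<lambda>y. \<Sum>b\<in>Basis. (?Y y \<bullet> b) *\<^sub>R A b (g y)) has_derivative
       (\<lambda>d. \<Sum>b\<in>Basis. (?Y y \<bullet> b) *\<^sub>R frechet (A b) (at (g y)) (L y d) + (Y' d \<bullet> b) *\<^sub>R A b (g y))) (at y)"
      by (auto intro!: derivative_eq_intros Y' dA)
     moreover have "(\<Sum>b\<in>Basis. (?Y z \<bullet> b) *\<^sub>R A b (g z)) = B z" if "z \<in> W" for z
      using linear_basis_expansion[OF linf[OF that], of "?Y z"] fL[OF that] by (simp add: A_def)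
     ultimately have "(B has_derivative
       (\<lambda>d. \<Sum>b\<in>Basis. (?Y y \<bullet> b) *\<^sub>R frechet (A b) (at (g y)) (L y d) + (Y' d \<bullet> b) *\<^sub>R A b (g y))) (at y)"
      using has_derivative_transform_within_open[OF _ *(4) y] by blast
     then have "frechet B (at y) =
       (\<lambda>d. \<Sum>b\<in>Basis. (?Y y \<bullet> b) *\<^sub>R frechet (A b) (at (g y)) (L y d) + (Y' d \<bullet> b) *\<^sub>R A b (g y))"
      by (rule frechet_derivative_at[symmetric])
     then have "R d y = (\<Sum>b\<in>Basis. (Y' d \<bullet> b) *\<^sub>R A b (g y))" for d
      unfolding R_def by (simp only: sum.distrib add_diff_cancel_left')
     then have "R d y = frechet f (at (g y)) (Y' d)" for d
      using linear_basis_expansion[OF linf[OF y], of "Y' d"] by (simp add: A_def)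
     then have "L y (R d y) = Y' d" for d using Lf[OF y] by simp
     then show ?thesis using Y' by simp
    qed
    have LB: "td k (\<lambda>y. L y (B y)) W"
     using Suc td_mono[OF B] by simp
    have Ld: "td k (\<lambda>y. L y d) W" for d using Suc by simp
    have "td k (\<lambda>y. frechet (A b) (at (g y)) (L y d)) W" for b d
    proof -
     have "td k (\<lambda>y. \<Sum>c\<in>Basis. (L y d \<bullet> c) *\<^sub>R frechet (A b) (at (g y)) c) W"
     proof (intro td_sum[OF *(4)] td_bilinear[OF *(4) bounded_bilinear_scaleR])
      fix c
      show "td k (\<lambda>y. L y d \<bullet> c) W"
       by (rule td_bounded_linear_compose[OF *(4) bounded_linear_inner_left Ld])
      show "td k (\<lambda>y. frechet (A b) (at (g y)) c) W"
       using td_compose[OF *(4,1) _ _ sm_td[OF sm_frechet[OF A]]] gV Suc by blast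
     qed
     moreover have "(\<Sum>c\<in>Basis. (L y d \<bullet> c) *\<^sub>R frechet (A b) (at (g y)) c)
       = frechet (A b) (at (g y)) (L y d)" if "y \<in> W" for y
      by (rule linear_basis_expansion[OF has_derivative_linear[OF sm_has_derivative[OF A gV[OF that]]], symmetric])
     ultimately show ?thesis by (rule td_cong[OF *(4), rotated])
    qed
    then have S: "td k (\<lambda>y. \<Sum>b\<in>Basis. (L y (B y) \<bullet> b) *\<^sub>R frechet (A b) (at (g y)) (L y d)) W" for d
     by (intro td_sum[OF *(4)] td_bilinear[OF *(4) bounded_bilinear_scaleR]
       td_bounded_linear_compose[OF *(4) bounded_linear_inner_left LB])
    have "td k (R d) W" for d
    proof -
     have "td k (\<lambda>y. frechet B (at y) d + - (\<Sum>b\<in>Basis. (L y (B y) \<bullet> b) *\<^sub>R frechet (A b) (at (g y)) (L y d))) W"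
      by (intro td_add[OF *(4)] td_frechet[OF B]
        td_bounded_linear_compose[OF *(4) bounded_linear_minus[OF bounded_linear_ident] S])
     then show ?thesis by (simp add: R_def[abs_def])
    qed
    then show "td k (\<lambda>y. L y (R d y)) W" for d using Suc by simp
   qed
  qed
  with g show ?case by blast
 qed
 then have "smooth g W" using *(4) by (simp add: smooth_on_open_def)
 then show thesis using that * by blast
qed

lemma smooth_map_on_of_open: "smooth f U \<Longrightarrow> S \<subseteq> U \<Longrightarrow> smooth_map_on S f"
 unfolding smooth_map_on_def by blast

lemma smooth_map_on_subset:
 assumes "smooth_map_on S f" "R \<subseteq> S"
 shows "smooth_map_on R f"
 unfolding smooth_map_on_def
proof
 fix x assume "x \<in> R"
 then have "x \<in> S" using assms(2) by blast
 then obtain U g where "x \<in> U" "smooth g U" "\<forall>y\<in>S \<inter> U. g y = f y"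
  using assms(1) unfolding smooth_map_on_def by metis
 then show "\<exists>U g. x \<in> U \<and> smooth g U \<and> (\<forall>y\<in>R \<inter> U. g y = f y)"
  using assms(2) by (intro exI[of _ U] exI[of _ g]) auto
qed

lemma smooth_map_on_cong: "smooth_map_on S f \<Longrightarrow> (\<And>x. x \<in> S \<Longrightarrow> f x = g x) \<Longrightarrow> smooth_map_on S g"
 unfolding smooth_map_on_def by simp

lemma smooth_map_on_Pair:
 assumes "smooth_map_on S f" "smooth_map_on S g"
 shows "smooth_map_on S (\<lambda>x. (f x, g x))"
 unfolding smooth_map_on_def
proof
 fix x assume x: "x \<in> S"
 obtain U f' where 1: "x \<in> U" "smooth f' U" "\<forall>y\<in>S \<inter> U. f' y = f y"
  using assms(1) x unfolding smooth_map_on_def by blast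
 obtain V g' where 2: "x \<in> V" "smooth g' V" "\<forall>y\<in>S \<inter> V. g' y = g y"
  using assms(2) x unfolding smooth_map_on_def by blast
 have o: "open (U \<inter> V)" using sm_open[OF 1(2)] sm_open[OF 2(2)] by blast
 show "\<exists>U h. x \<in> U \<and> smooth h U \<and> (\<forall>y\<in>S \<inter> U. h y = (f y, g y))"
  using 1 2 sm_Pair[OF sm_subset[OF 1(2) o] sm_subset[OF 2(2) o]]
  by (intro exI[of _ "U \<inter> V"] exI[of _ "\<lambda>x. (f' x, g' x)"]) auto
qed

lemma smooth_map_on_compose:
 assumes "smooth_map_on S f" "smooth_map_on R h" "f ` S \<subseteq> R"
 shows "smooth_map_on S (\<lambda>x. h (f x))"
 unfolding smooth_map_on_def
proof
 fix x assume x: "x \<in> S"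
 obtain U f' where 1: "x \<in> U" "smooth f' U" "\<forall>y\<in>S \<inter> U. f' y = f y"
  using assms(1) x unfolding smooth_map_on_def by blast
 obtain V h' where 2: "f x \<in> V" "smooth h' V" "\<forall>y\<in>R \<inter> V. h' y = h y"
  using assms(2,3) x unfolding smooth_map_on_def by blast
 let ?U = "U \<inter> f' -` V"
 have o: "open ?U"
  using continuous_open_preimage[OF sm_continuous_on[OF 1(2)] sm_open[OF 1(2)] sm_open[OF 2(2)]] .
 have "smooth (\<lambda>x. h' (f' x)) ?U"
  by (rule sm_compose[OF 2(2) sm_subset[OF 1(2) o]]) auto
 then show "\<exists>U k. x \<in> U \<and> smooth k U \<and> (\<forall>y\<in>S \<inter> U. k y = h (f y))"
  using 1 2 assms(3) x by (intro exI[of _ ?U] exI[of _ "\<lambda>x. h' (f' x)"]) (auto simp: image_subset_iff)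
qed

text \<open>A local smooth left inverse \<open>\<Phi>\<close> of \<open>f\<close> agrees with
  \<open>g\<close> only at points whose preimage lies in \<open>U\<close>. Since \<open>g\<close> is
  continuous, all points of \<open>T\<close> close to \<open>f s\<close> have this property, so
  \<open>\<Phi>\<close> is a smooth local extension of \<open>g\<close>.\<close>

lemma smooth_map_on_inverse:
 assumes hom: "homeomorphism S T f g"
  and loc: "\<And>s. s \<in> S \<Longrightarrow> \<exists>U V \<Phi>. open U \<and> s \<in> U \<and> f s \<in> V \<and> smooth \<Phi> V \<and>
    (\<forall>s'\<in>S \<inter> U. f s' \<in> V \<longrightarrow> \<Phi> (f s') = s')"
 shows "smooth_map_on T g"
 unfolding smooth_map_on_def
proof
 fix q assume q: "q \<in> T"
 then have gq: "g q \<in> S" "f (g q) = q" using hom by (auto simp: homeomorphism_def)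
 obtain U V \<Phi> where U: "open U" "g q \<in> U" "q \<in> V" "smooth \<Phi> V"
   "\<And>s'. s' \<in> S \<inter> U \<Longrightarrow> f s' \<in> V \<Longrightarrow> \<Phi> (f s') = s'"
  using loc[OF gq(1)] gq(2) by auto
 have "continuous_on T g" using hom by (simp add: homeomorphism_def)
 from this[unfolded continuous_on_open_invariant, rule_format, OF U(1)]
 obtain A where A: "open A" "A \<inter> T = g -` U \<inter> T" by auto
 have "smooth \<Phi> (V \<inter> A)"
  by (rule sm_subset[OF U(4)]) (use A sm_open[OF U(4)] in auto)
 moreover have "q \<in> V \<inter> A" using U A q by auto
 moreover have "\<Phi> y = g y" if "y \<in> T \<inter> (V \<inter> A)" for y
 proof -
  have "g y \<in> S" "f (g y) = y" using that hom by (auto simp: homeomorphism_def)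
  moreover have "g y \<in> U" using that A by auto
  ultimately show ?thesis using U(5)[of "g y"] that by auto
 qed
 ultimately show "\<exists>U \<Phi>. q \<in> U \<and> smooth \<Phi> U \<and> (\<forall>y\<in>T \<inter> U. \<Phi> y = g y)" by blast
qed

section \<open>Smooth dependence of solutions on parameters\<close>

text \<open>The norm is not differentiable at 0, so the estimate is made for the square. Adding
  \<open>\<delta>\<^sup>2\<close> allows \<open>2 * norm (w t) * \<delta>\<close> to be absorbed by
  \<open>(norm (w t))\<^sup>2 + \<delta>\<^sup>2\<close>, and the weighted quantity \<open>u\<close>
  decreases.\<close>

lemma gronwall_forward:
 fixes w :: "real \<Rightarrow> 'b::euclidean_space"
 assumes w: "\<And>t. 0 \<le> t \<Longrightarrow> t \<le> R \<Longrightarrow> (w has_vector_derivative w' t) (at t)"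
  and b: "\<And>t. 0 \<le> t \<Longrightarrow> t \<le> R \<Longrightarrow> norm (w' t) \<le> L * norm (w t) + \<delta>"
  and L: "0 \<le> L" "0 \<le> \<delta>" and t: "0 \<le> t" "t \<le> R"
 shows "norm (w t) \<le> (norm (w 0) + \<delta>) * exp ((L + 1) * R)"
proof -
 define u where "u t = (w t \<bullet> w t + \<delta>\<^sup>2) * exp (- (2 * L + 1) * t)" for t
 define u' where "u' t = (2 * (w t \<bullet> w' t) - (2 * L + 1) * (w t \<bullet> w t + \<delta>\<^sup>2)) * exp (- (2 * L + 1) * t)" for t
 have "u t \<le> u 0"
 proof (rule DERIV_nonpos_imp_nonincreasing[OF t(1)])
  fix s assume s: "0 \<le> s" "s \<le> t"
  have dw: "(w has_derivative (\<lambda>h. h *\<^sub>R w' s)) (at s)"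
   using w[of s] s t by (simp add: has_vector_derivative_def)
  have "(u has_real_derivative u' s) (at s)"
   unfolding u_def u'_def has_field_derivative_def
   by (auto intro!: derivative_eq_intros dw simp: fun_eq_iff algebra_simps inner_commute)
  moreover have "u' s \<le> 0"
  proof -
   have "w s \<bullet> w' s \<le> norm (w s) * norm (w' s)" by (rule norm_cauchy_schwarz)
   also have "\<dots> \<le> norm (w s) * (L * norm (w s) + \<delta>)"
    by (rule mult_left_mono) (use b[of s] s t in auto)
   finally have "w s \<bullet> w' s \<le> norm (w s) * (L * norm (w s) + \<delta>)" .
   moreover have "2 * (norm (w s) * \<delta>) \<le> (norm (w s))\<^sup>2 + \<delta>\<^sup>2"
    using sum_squares_bound[of "norm (w s)" \<delta>] by simp
   moreover have "0 \<le> L * \<delta>\<^sup>2" using L by simp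
   moreover have "w s \<bullet> w s = norm (w s) * norm (w s)" by (simp add: power2_norm_eq_inner[symmetric] power2_eq_square)
   ultimately have "2 * (w s \<bullet> w' s) \<le> (2 * L + 1) * (w s \<bullet> w s + \<delta>\<^sup>2)"
    by (simp add: algebra_simps power2_eq_square)
   then show ?thesis unfolding u'_def by (intro mult_nonpos_nonneg) auto
  qed
  ultimately show "\<exists>y. (u has_real_derivative y) (at s) \<and> y \<le> 0" by blast
 qed
 then have "u t * exp ((2 * L + 1) * t) \<le> (w 0 \<bullet> w 0 + \<delta>\<^sup>2) * exp ((2 * L + 1) * t)"
  by (intro mult_right_mono) (auto simp: u_def)
 moreover have "u t * exp ((2 * L + 1) * t) = w t \<bullet> w t + \<delta>\<^sup>2"
  unfolding u_def mult.assoc exp_add[symmetric] by (simp add: algebra_simps)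
 ultimately have "w t \<bullet> w t + \<delta>\<^sup>2 \<le> (w 0 \<bullet> w 0 + \<delta>\<^sup>2) * exp ((2 * L + 1) * t)"
  by simp
 also have "\<dots> \<le> (norm (w 0) + \<delta>)\<^sup>2 * exp (2 * ((L + 1) * R))"
 proof (rule mult_mono)
  show "w 0 \<bullet> w 0 + \<delta>\<^sup>2 \<le> (norm (w 0) + \<delta>)\<^sup>2"
   using L by (simp add: power2_sum power2_norm_eq_inner)
  have "(2 * L + 1) * t \<le> (2 * L + 2) * R" using L t by (intro mult_mono) auto
  then show "exp ((2 * L + 1) * t) \<le> exp (2 * ((L + 1) * R))" by (simp add: algebra_simps)
 qed auto
 also have "\<dots> = ((norm (w 0) + \<delta>) * exp ((L + 1) * R))\<^sup>2"
  by (simp add: power_mult_distrib exp_double)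
 finally have "w t \<bullet> w t + \<delta>\<^sup>2 \<le> ((norm (w 0) + \<delta>) * exp ((L + 1) * R))\<^sup>2" .
 then have "(norm (w t))\<^sup>2 \<le> ((norm (w 0) + \<delta>) * exp ((L + 1) * R))\<^sup>2"
  using zero_le_power2[of \<delta>] unfolding power2_norm_eq_inner by linarith
 then show ?thesis
  by (rule power2_le_imp_le) (use L in auto)
qed

lemma gronwall:
 fixes w :: "real \<Rightarrow> 'b::euclidean_space"
 assumes w: "\<And>t. \<bar>t\<bar> \<le> R \<Longrightarrow> (w has_vector_derivative w' t) (at t)"
  and b: "\<And>t. \<bar>t\<bar> \<le> R \<Longrightarrow> norm (w' t) \<le> L * norm (w t) + \<delta>"
  and L: "0 \<le> L" "0 \<le> \<delta>" and t: "\<bar>t\<bar> \<le> R"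
 shows "norm (w t) \<le> (norm (w 0) + \<delta>) * exp ((L + 1) * R)"
proof (cases "t \<ge> 0")
 case True
 show ?thesis
  by (rule gronwall_forward[of R w w']) (use w b L t True in auto)
next
 case False
 have "((\<lambda>t. w (- t)) has_vector_derivative - w' (- s)) (at s)" if "\<bar>s\<bar> \<le> R" for s
 proof -
  have "(w has_vector_derivative w' (- s)) (at (- s))" using w[of "- s"] that by simp
  moreover have "((\<lambda>t. - t) has_vector_derivative -1) (at s)"
   by (auto intro!: derivative_eq_intros)
  ultimately show ?thesis
   using vector_diff_chain_at[of "\<lambda>t. - t" "-1" s w "w' (- s)"] by (simp add: o_def)
 qed
 then have "norm (w (- (- t))) \<le> (norm (w (- 0)) + \<delta>) * exp ((L + 1) * R)"
  by (intro gronwall_forward[of R "\<lambda>t. w (- t)" "\<lambda>t. - w' (- t)"]) (use b L t False in auto)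
 then show ?thesis by simp
qed

lemma antiderivative_exists:
 fixes g :: "real \<Rightarrow> 'b::euclidean_space"
 assumes "continuous_on UNIV g"
 shows "\<exists>G. G 0 = 0 \<and> (\<forall>t. (G has_vector_derivative g t) (at t))"
proof (intro exI conjI allI)
 fix t :: real
 have "((\<lambda>u. LBINT y=ereal 0..ereal u. g y) has_vector_derivative g t) (at t within {-\<bar>t\<bar>-1..\<bar>t\<bar>+1})"
  by (rule interval_integral_FTC2) (use continuous_on_subset[OF assms] in auto)
 then show "((\<lambda>u. LBINT y=ereal 0..ereal u. g y) has_vector_derivative g t) (at t)"
  by (subst (asm) at_within_Icc_at) auto
qed simp

text \<open>Integration shrinks a bound of the form \<open>c * exp (a * \<bar>t\<bar>)\<close> by
  the factor \<open>1 / a\<close>. This is what makes the Picard iteration contract for large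
  \<open>a\<close>.\<close>

lemma exp_growth_bound:
 fixes w :: "real \<Rightarrow> 'b::euclidean_space"
 assumes w: "\<And>t. (w has_vector_derivative w' t) (at t)" and w0: "w 0 = 0"
  and b: "\<And>t. \<bar>t\<bar> \<le> R \<Longrightarrow> norm (w' t) \<le> c * exp (a * \<bar>t\<bar>)" and ac: "a > 0" "c \<ge> 0" and t: "\<bar>t\<bar> \<le> R"
 shows "norm (w t) \<le> c / a * exp (a * \<bar>t\<bar>)"
proof -
 have pos: "norm (w t) \<le> c / a * exp (a * t)" if w: "\<And>t. (w has_vector_derivative w' t) (at t)" "w 0 = 0"
   and b: "\<And>t. 0 \<le> t \<Longrightarrow> t \<le> R \<Longrightarrow> norm (w' t) \<le> c * exp (a * t)" and t: "0 < t" "t \<le> R" for w w' t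
 proof -
  have "norm (w t - w 0) \<le> c / a * exp (a * t) - c / a * exp (a * 0)"
  proof (rule differentiable_bound_general[OF t(1), of w "\<lambda>t. c / a * exp (a * t)" w' "\<lambda>t. c * exp (a * t)"])
   show "continuous_on {0..t} w"
    using w(1) by (auto intro!: continuous_at_imp_continuous_on has_vector_derivative_continuous)
   show "continuous_on {0..t} (\<lambda>t. c / a * exp (a * t))" using ac by (auto intro!: continuous_intros)
   show "((\<lambda>t. c / a * exp (a * t)) has_vector_derivative c * exp (a * x)) (at x)" for x
    unfolding has_real_derivative_iff_has_vector_derivative[symmetric]
    by (auto intro!: derivative_eq_intros simp: less_imp_neq[OF ac(1), symmetric])
  qed (use w b t in auto)
  moreover have "c / a * exp (a * 0) \<ge> 0" using ac by simp
  ultimately show ?thesis using w(2) by simp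
 qed
 consider "t > 0" | "t = 0" | "t < 0" by linarith
 then show ?thesis
 proof cases
  case 1
  have "norm (w' s) \<le> c * exp (a * s)" if "0 \<le> s" "s \<le> R" for s
   using b[of s] that by simp
  from pos[OF w w0 this 1] t 1 show ?thesis by simp
 next
  case 2
  then show ?thesis using w0 ac by simp
 next
  case 3
  have "((\<lambda>t. w (- t)) has_vector_derivative - w' (- s)) (at s)" for s
  proof -
   have "((\<lambda>t. - t) has_vector_derivative -1) (at s)"
    by (auto intro!: derivative_eq_intros)
   then show ?thesis
    using vector_diff_chain_at[of "\<lambda>t. - t" "-1" s w "w' (- s)"] w by (simp add: o_def)
  qed
  moreover have "norm (- w' (- s)) \<le> c * exp (a * s)" if "0 \<le> s" "s \<le> R" for s
   using b[of "- s"] that by simp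
  ultimately show ?thesis using pos[of "\<lambda>t. w (- t)" "\<lambda>s. - w' (- s)" "- t"] 3 w0 t by simp
 qed
qed

text \<open>Picard iteration with an exponential weight: on each interval \<open>[-R, R]\<close> the
  steps are bounded by a geometric series times \<open>exp (a * \<bar>t\<bar>)\<close>, so the
  iterates converge uniformly there without cutting the interval into short pieces. The Lipschitz
  constant may depend on \<open>R\<close>, but the iterates do not, and neither does their
  limit.\<close>

theorem ode_exists:
 fixes f :: "real \<times> 'q::euclidean_space \<Rightarrow> 'q" and y0 :: 'q
 assumes cf: "continuous_on UNIV f"
  and lip: "\<And>R. \<exists>L\<ge>0. \<forall>t y y'. \<bar>t\<bar> \<le> R \<longrightarrow> norm (f (t, y) - f (t, y')) \<le> L * norm (y - y')"
 shows "\<exists>y. y 0 = y0 \<and> (\<forall>t. (y has_vector_derivative f (t, y t)) (at t))"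
proof -
 obtain J where J: "continuous_on UNIV g \<Longrightarrow> J g 0 = 0 \<and> (\<forall>t. (J g has_vector_derivative g t) (at t))"
  for g :: "real \<Rightarrow> 'q" using antiderivative_exists by metis
 define \<Phi> where "\<Phi> p = (\<lambda>t. y0 + J (\<lambda>\<tau>. f (\<tau>, p \<tau>)) t)" for p
 define p where "p n = (\<Phi> ^^ n) (\<lambda>_. y0)" for n
 have p0: "p 0 = (\<lambda>_. y0)" by (simp add: p_def)
 have pS: "p (Suc n) = \<Phi> (p n)" for n by (simp add: p_def)
 have cfp: "continuous_on UNIV (\<lambda>\<tau>. f (\<tau>, p \<tau>))" if "continuous_on UNIV p" for p
  by (rule continuous_on_compose2[OF cf]) (auto intro!: continuous_intros that)
 have d\<Phi>: "(\<Phi> p has_vector_derivative f (t, p t)) (at t)" if "continuous_on UNIV p" for p t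
  using J[OF cfp[OF that]] unfolding \<Phi>_def by (auto intro!: derivative_eq_intros)
 have cp: "continuous_on UNIV (p n)" for n
 proof (induction n)
  case (Suc n)
  then show ?case using d\<Phi>[OF Suc] has_vector_derivative_continuous unfolding pS
   by (blast intro!: continuous_at_imp_continuous_on)
 qed (simp add: p0)
 have dp: "(p (Suc n) has_vector_derivative f (t, p n t)) (at t)" for n t
  unfolding pS by (rule d\<Phi>[OF cp])
 have pz: "p n 0 = y0" for n
  by (cases n) (use J[OF cfp[OF cp]] in \<open>auto simp: p0 pS \<Phi>_def\<close>)
 define y where "y t = y0 + (\<Sum>i. p (Suc i) t - p i t)" for t
 have main: "(\<lambda>n. p n t) \<longlonglongrightarrow> y t \<and> (y has_vector_derivative f (t, y t)) (at t)" for t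
 proof -
  define R where "R = \<bar>t\<bar> + 1"
  obtain L where L: "L \<ge> 0" "\<And>t y y'. \<bar>t\<bar> \<le> R \<Longrightarrow> norm (f (t, y) - f (t, y')) \<le> L * norm (y - y')"
   using lip by metis
  \<comment> \<open>This weight makes the contraction factor \<open>L / a\<close> at most 1/2; the
    summand 1 keeps \<open>a\<close> positive when \<open>L = 0\<close>.\<close>
  define a where "a = 2 * (L + 1)"
  have "bounded ((\<lambda>t. f (t, y0)) ` {-R..R})"
   by (intro compact_imp_bounded compact_continuous_image continuous_on_compose2[OF cf]) (auto intro!: continuous_intros)
  then obtain B where B: "B > 0" "\<And>t. \<bar>t\<bar> \<le> R \<Longrightarrow> norm (f (t, y0)) \<le> B"
   unfolding bounded_pos by (auto simp: abs_le_iff)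
  have step: "norm (p (Suc n) t - p n t) \<le> B * (1/2)^n * exp (a * \<bar>t\<bar>)" if "\<bar>t\<bar> \<le> R" for n t
   using that
  proof (induction n arbitrary: t)
   case 0
   have "norm (f (t, y0)) \<le> B * exp (a * \<bar>t\<bar>)" if "\<bar>t\<bar> \<le> R" for t
   proof -
    have "B * 1 \<le> B * exp (a * \<bar>t\<bar>)" using B(1) L(1) by (intro mult_left_mono) (auto simp: a_def)
    then show ?thesis using B(2)[OF that] by simp
   qed
   then have "norm (p (Suc 0) t - y0) \<le> B / a * exp (a * \<bar>t\<bar>)"
    by (intro exp_growth_bound[of "\<lambda>t. p (Suc 0) t - y0" "\<lambda>t. f (t, y0)" R])
     (use B L 0 dp[of 0] pz in \<open>auto simp: a_def p0 intro!: derivative_eq_intros\<close>)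
   also have "\<dots> \<le> B * exp (a * \<bar>t\<bar>)"
    using B L by (intro mult_right_mono) (auto simp: a_def field_simps)
   finally show ?case by (simp add: p0)
  next
   case (Suc n)
   have "norm (f (t, p (Suc n) t) - f (t, p n t)) \<le> (L * B * (1/2)^n) * exp (a * \<bar>t\<bar>)" if "\<bar>t\<bar> \<le> R" for t
    using L(2)[OF that, of "p (Suc n) t" "p n t"] mult_left_mono[OF Suc.IH[OF that] L(1)]
    by (simp add: mult_ac)
   then have "norm (p (Suc (Suc n)) t - p (Suc n) t) \<le> (L * B * (1/2)^n) / a * exp (a * \<bar>t\<bar>)"
    by (intro exp_growth_bound[of "\<lambda>t. p (Suc (Suc n)) t - p (Suc n) t" "\<lambda>t. f (t, p (Suc n) t) - f (t, p n t)" R])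
     (use B L Suc dp pz in \<open>auto simp: a_def intro!: derivative_eq_intros\<close>)
   also have "\<dots> \<le> (B * (1/2)^Suc n) * exp (a * \<bar>t\<bar>)"
   proof (intro mult_right_mono)
    have "L / a \<le> 1/2" using L by (simp add: a_def field_simps)
    then have "(B * (1/2)^n) * (L / a) \<le> (B * (1/2)^n) * (1/2)"
     using B by (intro mult_left_mono) auto
    then show "(L * B * (1/2)^n) / a \<le> B * (1/2)^Suc n" by (simp add: mult_ac)
   qed auto
   finally show ?case .
  qed
  have "uniform_limit {-R..R} (\<lambda>n t. \<Sum>i<n. p (Suc i) t - p i t) (\<lambda>t. \<Sum>i. p (Suc i) t - p i t) sequentially"
  proof (rule Weierstrass_m_test[where M = "\<lambda>n. B * (1/2)^n * exp (a * R)"])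
   show "norm (p (Suc n) t - p n t) \<le> B * (1/2)^n * exp (a * R)" if "t \<in> {-R..R}" for n t
   proof -
    have "norm (p (Suc n) t - p n t) \<le> B * (1/2)^n * exp (a * \<bar>t\<bar>)"
     using step that by (auto simp: abs_le_iff)
    also have "\<dots> \<le> B * (1/2)^n * exp (a * R)"
     using B L that by (intro mult_left_mono) (auto simp: a_def intro!: mult_left_mono)
    finally show ?thesis .
   qed
   show "summable (\<lambda>n. B * (1/2)^n * exp (a * R))"
    by (intro summable_mult summable_mult2 summable_geometric) auto
  qed
  then have "uniform_limit {-R..R} (\<lambda>n t. y0 + (\<Sum>i<n. p (Suc i) t - p i t)) y sequentially"
   unfolding y_def by (intro uniform_limit_intros)
  moreover have "y0 + (\<Sum>i<n. p (Suc i) t - p i t) = p n t" for n t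
   using sum_lessThan_telescope[of "\<lambda>i. p i t" n] by (simp add: p0)
  ultimately have ul: "uniform_limit {-R..R} p y sequentially" by simp
  then have lim: "(\<lambda>n. p n s) \<longlonglongrightarrow> y s" if "s \<in> {-R..R}" for s
   using that by (rule tendsto_uniform_limitI)
  \<comment> \<open>The sequence is shifted by one, since the derivative of \<open>p (Suc n)\<close>
    is expressed by \<open>p n\<close>.\<close>
  have "\<exists>g. \<forall>x\<in>{-R<..<R}. (\<lambda>n. p (Suc n) x) \<longlonglongrightarrow> g x \<and> (g has_derivative (\<lambda>h. h *\<^sub>R f (x, y x))) (at x within {-R<..<R})"
  proof (rule has_derivative_sequence[where f' = "\<lambda>n x h. h *\<^sub>R f (x, p n x)"])
   show "(p (Suc n) has_derivative (\<lambda>h. h *\<^sub>R f (x, p n x))) (at x within {-R<..<R})" for n x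
    using has_vector_derivative_at_within[OF dp] by (simp add: has_vector_derivative_def)
   show "\<forall>\<^sub>F n in sequentially. \<forall>x\<in>{-R<..<R}. \<forall>h. norm (h *\<^sub>R f (x, p n x) - h *\<^sub>R f (x, y x)) \<le> e * norm h"
    if e: "e > 0" for e :: real
   proof -
    have "e / (L + 1) > 0" using e L by simp
    then have "\<forall>\<^sub>F n in sequentially. \<forall>x\<in>{-R..R}. dist (p n x) (y x) < e / (L + 1)"
     using ul unfolding uniform_limit_iff by blast
    then show ?thesis
    proof eventually_elim
     case (elim n)
     show ?case
     proof (intro ballI allI)
      fix x h :: real assume x: "x \<in> {-R<..<R}"
      have "norm (f (x, p n x) - f (x, y x)) \<le> L * norm (p n x - y x)"
       using L(2)[of x] x by auto
      also have "\<dots> \<le> (L + 1) * (e / (L + 1))"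
       using elim x L by (intro mult_mono) (auto simp: dist_norm less_imp_le)
      also have "\<dots> = e" using L by simp
      finally have "norm (f (x, p n x) - f (x, y x)) \<le> e" .
      then have "norm h * norm (f (x, p n x) - f (x, y x)) \<le> norm h * e" by (rule mult_left_mono) simp
      then show "norm (h *\<^sub>R f (x, p n x) - h *\<^sub>R f (x, y x)) \<le> e * norm h"
       by (simp add: scaleR_diff_right[symmetric] mult_ac)
     qed
    qed
   qed
   show "0 \<in> {-R<..<R}" by (auto simp: R_def)
   show "(\<lambda>n. p (Suc n) 0) \<longlonglongrightarrow> y0" by (simp add: pz)
  qed auto
  then obtain g where g: "\<And>x. x \<in> {-R<..<R} \<Longrightarrow> (\<lambda>n. p (Suc n) x) \<longlonglongrightarrow> g x"
    "\<And>x. x \<in> {-R<..<R} \<Longrightarrow> (g has_derivative (\<lambda>h. h *\<^sub>R f (x, y x))) (at x within {-R<..<R})" by blast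
  have gy: "g x = y x" if "x \<in> {-R<..<R}" for x
   using LIMSEQ_unique[OF g(1)[OF that] LIMSEQ_Suc[OF lim]] that by auto
  have t: "t \<in> {-R<..<R}" by (auto simp: R_def)
  have "(g has_derivative (\<lambda>h. h *\<^sub>R f (t, y t))) (at t)"
   using g(2)[OF t] unfolding at_within_open[OF t open_greaterThanLessThan] .
  then have "(y has_derivative (\<lambda>h. h *\<^sub>R f (t, y t))) (at t)"
   by (rule has_derivative_transform_within_open[OF _ _ t]) (auto simp: gy)
  then show ?thesis using lim[of t] t by (auto simp: has_vector_derivative_def)
 qed
 have "y 0 = y0" by (simp add: y_def pz)
 with main show ?thesis by blast
qed

lemma ode_unique:
 fixes f :: "real \<times> 'q::euclidean_space \<Rightarrow> 'q"
 assumes lip: "\<And>R. \<exists>L\<ge>0. \<forall>t y y'. \<bar>t\<bar> \<le> R \<longrightarrow> norm (f (t, y) - f (t, y')) \<le> L * norm (y - y')"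
  and y: "\<And>t. (y has_vector_derivative f (t, y t)) (at t)"
  and z: "\<And>t. (z has_vector_derivative f (t, z t)) (at t)" and "y 0 = z 0"
 shows "y t = z t"
proof -
 obtain L where L: "L \<ge> 0" "\<And>s y y'. \<bar>s\<bar> \<le> \<bar>t\<bar> \<Longrightarrow> norm (f (s, y) - f (s, y')) \<le> L * norm (y - y')"
  using lip by metis
 have "norm (y t - z t) \<le> (norm (y 0 - z 0) + 0) * exp ((L + 1) * \<bar>t\<bar>)"
  by (rule gronwall[where w' = "\<lambda>s. f (s, y s) - f (s, z s)"])
   (use L in \<open>auto intro!: derivative_eq_intros y z\<close>)
 then show ?thesis using assms(4) by simp
qed

lemma sum_abs_Basis_le: "(\<Sum>b\<in>Basis. \<bar>v \<bullet> b\<bar> * c b) \<le> norm v * (\<Sum>b\<in>Basis. c b)"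
 if "\<And>b. b \<in> Basis \<Longrightarrow> c b \<ge> 0" for v :: "'a::euclidean_space"
 unfolding sum_distrib_left
 by (intro sum_mono mult_right_mono that Basis_le_norm)

lemma norm_linear_le_Basis:
 fixes L :: "'a::euclidean_space \<Rightarrow> 'b::real_normed_vector"
 assumes "linear L"
 shows "norm (L v) \<le> (\<Sum>b\<in>Basis. norm (L b)) * norm v"
proof -
 have "norm (L v) \<le> (\<Sum>b\<in>Basis. norm ((v \<bullet> b) *\<^sub>R L b))"
  unfolding linear_basis_expansion[OF assms, of v] by (rule norm_sum)
 also have "\<dots> \<le> norm v * (\<Sum>b\<in>Basis. norm (L b))"
  using sum_abs_Basis_le[of "\<lambda>b. norm (L b)" v] by simp
 finally show ?thesis by (simp add: mult_ac)
qed

lemma uniform_differentiability: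
 fixes f :: "'a::euclidean_space \<Rightarrow> 'b::euclidean_space"
 assumes f: "td (Suc 0) f UNIV" and K: "compact K" and e: "e > 0"
 obtains d where "d > 0"
  "\<And>z z'. z \<in> K \<Longrightarrow> norm (z' - z) < d \<Longrightarrow>
    norm (f z' - f z - frechet f (at z) (z' - z)) \<le> e * norm (z' - z)"
proof -
 let ?D = "\<lambda>z. frechet f (at z)"
 \<comment> \<open>Enlarging \<open>K\<close> by the closed unit ball keeps the segments from points
   of \<open>K\<close> to nearby points inside one compact set, on which the derivative is uniformly
   continuous.\<close>
 define K' where "K' = {x + y | x y. x \<in> K \<and> y \<in> cball 0 1}"
 have K': "compact K'" unfolding K'_def by (intro compact_sums K compact_cball)
 have KK': "K \<subseteq> K'" unfolding K'_def by (force intro: exI[of _ 0])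
 define e' where "e' = e / real DIM('a)"
 have e': "e' > 0" using e by (simp add: e'_def)
 have "\<exists>d>0. \<forall>x\<in>K'. \<forall>y\<in>K'. dist y x < d \<longrightarrow> dist (?D y b) (?D x b) < e'" for b
 proof -
  have "uniformly_continuous_on K' (\<lambda>z. ?D z b)"
   using f by (intro compact_uniformly_continuous K') (auto intro: continuous_on_subset)
  then show ?thesis using e' unfolding uniformly_continuous_on_def by blast
 qed
 then obtain d where d: "\<And>b. d b > 0" "\<And>b x y. x \<in> K' \<Longrightarrow> y \<in> K' \<Longrightarrow> dist y x < d b \<Longrightarrow> dist (?D y b) (?D x b) < e'"
  by metis
 define m where "m = Min (insert 1 (d ` Basis))"
 have m: "m > 0" "m \<le> 1"
  using d(1) by (auto simp: m_def)
 have mb: "m \<le> d b" if "b \<in> Basis" for b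
  unfolding m_def by (rule Min_le) (use that in auto)
 have lin: "linear (?D z)" for z
  by (rule has_derivative_linear[OF td_has_derivative[OF f]]) simp
 show thesis
 proof (rule that[OF m(1)])
  fix z z' assume z: "z \<in> K" "norm (z' - z) < m"
  have "norm (f z' - f z - ?D z (z' - z)) \<le> norm (z' - z) * e"
  proof (rule differentiable_bound_linearization[where S = "closed_segment z z'" and f' = ?D])
   show "z + t *\<^sub>R (z' - z) \<in> closed_segment z z'" if "t \<in> {0..1}" for t
    using that by (auto simp: in_segment algebra_simps intro!: exI[of _ t])
   show "(f has_derivative ?D x) (at x within closed_segment z z')" for x
    using td_has_derivative[OF f, of x] by (auto intro: has_derivative_at_withinI)
   fix x assume x: "x \<in> closed_segment z z'"
   then have dx: "norm (x - z) < m"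
    using segment_bound1[OF x] z(2) by (simp add: norm_minus_commute)
   have "x \<in> K'" unfolding K'_def
    by (rule CollectI, rule exI[of _ z], rule exI[of _ "x - z"]) (use z(1) dx m(2) in auto)
   have lin2: "linear (\<lambda>v. ?D x v - ?D z v)" by (intro linear_compose_sub lin)
   have "onorm (\<lambda>v. ?D x v - ?D z v) \<le> (\<Sum>b\<in>Basis. norm (?D x b - ?D z b))"
    by (rule onorm_bound[OF _ norm_linear_le_Basis[OF lin2]]) (auto intro: sum_nonneg)
   also have "\<dots> \<le> (\<Sum>b\<in>(Basis::'a set). e')"
   proof (rule sum_mono)
    fix b :: 'a assume "b \<in> Basis"
    then show "norm (?D x b - ?D z b) \<le> e'"
     using d(2)[of z x b] \<open>x \<in> K'\<close> KK' z(1) dx mb by (force simp: dist_norm)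
   qed
   also have "\<dots> = e" by (simp add: e'_def)
   finally show "onorm (?D x - ?D z) \<le> e" by (simp add: fun_diff_def)
  qed auto
  then show "norm (f z' - f z - ?D z (z' - z)) \<le> e * norm (z' - z)" by (simp add: mult_ac)
 qed
qed

text \<open>Lipschitz in the state on the whole space, with a constant that is uniform for bounded
  time and bounded parameter. The first makes all solutions global, the second is what Gronwall's
  inequality needs near a given parameter.\<close>

definition param_lipschitz :: "(real \<times> 'p::euclidean_space \<times> 'q::euclidean_space \<Rightarrow> 'q) \<Rightarrow> bool" where
 "param_lipschitz f \<longleftrightarrow> (\<forall>R. \<exists>L\<ge>0. \<forall>t x y y'. \<bar>t\<bar> \<le> R \<longrightarrow> norm x \<le> R \<longrightarrow>
   norm (f (t, x, y) - f (t, x, y')) \<le> L * norm (y - y'))"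

lemma param_lipschitzD:
 assumes "param_lipschitz f"
 obtains L where "L \<ge> 0" "\<And>t x y y'. \<bar>t\<bar> \<le> R \<Longrightarrow> norm x \<le> R \<Longrightarrow> norm (f (t, x, y) - f (t, x, y')) \<le> L * norm (y - y')"
 using assms unfolding param_lipschitz_def by metis

lemma param_lipschitz_fixed:
 assumes "param_lipschitz f"
 shows "\<exists>L\<ge>0. \<forall>t y y'. \<bar>t\<bar> \<le> R \<longrightarrow> norm (f (t, x, y) - f (t, x, y')) \<le> L * norm (y - y')"
proof -
 obtain L where "L \<ge> 0" "\<And>t z y y'. \<bar>t\<bar> \<le> max R (norm x) \<Longrightarrow> norm z \<le> max R (norm x) \<Longrightarrow>
   norm (f (t, z, y) - f (t, z, y')) \<le> L * norm (y - y')"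
  by (rule param_lipschitzD[OF assms]) blast
 then show ?thesis by (intro exI[of _ L]) auto
qed

definition param_solution ::
 "(real \<times> 'p::euclidean_space \<times> 'q::euclidean_space \<Rightarrow> 'q) \<Rightarrow> ('p \<Rightarrow> 'q) \<Rightarrow> (real \<times> 'p \<Rightarrow> 'q) \<Rightarrow> bool" where
 "param_solution f y0 Y \<longleftrightarrow> (\<forall>x. Y (0, x) = y0 x) \<and>
   (\<forall>t x. ((\<lambda>t. Y (t, x)) has_vector_derivative f (t, x, Y (t, x))) (at t))"

lemma param_solution_exists:
 assumes "continuous_on UNIV f" "param_lipschitz f"
 shows "\<exists>Y. param_solution f y0 Y"
proof -
 have "\<exists>y. y 0 = y0 x \<and> (\<forall>t. (y has_vector_derivative f (t, x, y t)) (at t))" for x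
 proof -
  have "continuous_on UNIV (\<lambda>z. f (fst z, x, snd z))"
   by (rule continuous_on_compose2[OF assms(1)]) (auto intro!: continuous_intros)
  from ode_exists[OF this, of "y0 x", unfolded fst_conv snd_conv, OF param_lipschitz_fixed[OF assms(2)]]
  show ?thesis .
 qed
 then obtain y where "\<And>x. y x 0 = y0 x \<and> (\<forall>t. (y x has_vector_derivative f (t, x, y x t)) (at t))" by metis
 then show ?thesis unfolding param_solution_def by (intro exI[of _ "\<lambda>(t, x). y x t"]) auto
qed

text \<open>Gronwall's inequality for the solutions at \<open>x\<close> and \<open>x0\<close>. The
  fields are compared along the fixed curve \<open>Y (s, x0)\<close>: changing the state costs a
  Lipschitz term, changing the parameter costs a term that is small by uniform continuity on a
  compact set.\<close>

lemma param_solution_continuous: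
 assumes cf: "continuous_on UNIV f" and lip: "param_lipschitz f" and cy: "continuous_on UNIV y0"
  and Y: "param_solution f y0 Y"
 shows "continuous_on UNIV Y"
proof -
 have dY: "((\<lambda>t. Y (t, x)) has_vector_derivative f (t, x, Y (t, x))) (at t)" for t x
  using Y by (auto simp: param_solution_def)
 have Y0: "Y (0, x) = y0 x" for x using Y by (auto simp: param_solution_def)
 have ct: "continuous_on UNIV (\<lambda>t. Y (t, x))" for x
  using dY has_vector_derivative_continuous by (blast intro!: continuous_at_imp_continuous_on)
 have "isCont Y (t0, x0)" for t0 x0
 proof -
  define R where "R = \<bar>t0\<bar> + norm x0 + 1"
  obtain L where L: "L \<ge> 0" "\<And>t x y y'. \<bar>t\<bar> \<le> R \<Longrightarrow> norm x \<le> R \<Longrightarrow> norm (f (t, x, y) - f (t, x, y')) \<le> L * norm (y - y')"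
   by (rule param_lipschitzD[OF lip]) blast
  define C where "C = exp ((L + 1) * R)"
  have C: "C > 0" by (simp add: C_def)
  show ?thesis unfolding continuous_at_eps_delta
  proof (intro allI impI)
   fix e :: real assume e: "e > 0"
   define e1 where "e1 = e / (4 * C)"
   have e1: "e1 > 0" using e C by (simp add: e1_def)
   have "uniformly_continuous_on ({-R..R} \<times> cball x0 1) (\<lambda>(t, x). f (t, x, Y (t, x0)))"
   proof (rule compact_uniformly_continuous)
    have "continuous_on UNIV (\<lambda>z::real\<times>_. Y (fst z, x0))"
     by (rule continuous_on_compose2[OF ct[of x0]]) (auto intro!: continuous_intros)
    then have "continuous_on ({-R..R} \<times> cball x0 1) (\<lambda>z. Y (fst z, x0))"
     by (rule continuous_on_subset) auto
    then show "continuous_on ({-R..R} \<times> cball x0 1) (\<lambda>(t, x). f (t, x, Y (t, x0)))"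
     unfolding case_prod_unfold
     by (intro continuous_on_compose2[OF cf]) (auto intro!: continuous_intros)
   qed (auto intro: compact_Times)
   then obtain d1 where d1: "d1 > 0" "\<And>t x t' x'. \<bar>t\<bar> \<le> R \<Longrightarrow> dist x0 x \<le> 1 \<Longrightarrow> \<bar>t'\<bar> \<le> R \<Longrightarrow> dist x0 x' \<le> 1 \<Longrightarrow>
      dist (t', x') (t, x) < d1 \<Longrightarrow> norm (f (t', x', Y (t', x0)) - f (t, x, Y (t, x0))) < e1"
    unfolding uniformly_continuous_on_def using e1
    by (auto simp: dist_norm abs_le_iff elim!: allE[of _ e1])
   obtain d2 where d2: "d2 > 0" "\<And>x. dist x x0 < d2 \<Longrightarrow> dist (y0 x) (y0 x0) < e1"
    using cy e1 unfolding continuous_on_iff by (metis UNIV_I)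
   obtain d3 where d3: "d3 > 0" "\<And>t. dist t t0 < d3 \<Longrightarrow> dist (Y (t, x0)) (Y (t0, x0)) < e / 2"
    using ct[of x0] half_gt_zero[OF e] unfolding continuous_on_iff by (metis UNIV_I)
   define d where "d = Min {d1, d2, d3, 1}"
   have d: "d > 0" "d \<le> d1" "d \<le> d2" "d \<le> d3" "d \<le> 1" using d1(1) d2(1) d3(1) by (auto simp: d_def)
   have "dist (Y z) (Y (t0, x0)) < e" if z: "dist z (t0, x0) < d" for z
   proof -
    obtain t x where zt: "z = (t, x)" by (cases z)
    have tt: "dist t t0 < d" using dist_fst_le[of z "(t0, x0)"] z zt by simp
    have xx: "dist x x0 < d" using dist_snd_le[of z "(t0, x0)"] z zt by simp
    have tR: "\<bar>t\<bar> \<le> R" using tt d(5) unfolding R_def dist_real_def by (smt (verit) norm_ge_zero)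
    have xR: "norm x \<le> R" using xx d(5) norm_triangle_sub[of x x0] unfolding R_def dist_norm by linarith
    have "norm (Y (t, x) - Y (t, x0)) \<le> (norm (Y (0, x) - Y (0, x0)) + e1) * exp ((L + 1) * R)"
    proof (rule gronwall[where w' = "\<lambda>s. f (s, x, Y (s, x)) - f (s, x0, Y (s, x0))"])
     show "((\<lambda>s. Y (s, x) - Y (s, x0)) has_vector_derivative f (s, x, Y (s, x)) - f (s, x0, Y (s, x0))) (at s)" for s
      by (auto intro!: derivative_eq_intros dY)
     show "norm (f (s, x, Y (s, x)) - f (s, x0, Y (s, x0))) \<le> L * norm (Y (s, x) - Y (s, x0)) + e1" if s: "\<bar>s\<bar> \<le> R" for s
     proof -
      have "norm (f (s, x, Y (s, x)) - f (s, x, Y (s, x0))) \<le> L * norm (Y (s, x) - Y (s, x0))"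
       by (rule L(2)[OF s xR])
      moreover have "norm (f (s, x, Y (s, x0)) - f (s, x0, Y (s, x0))) < e1"
       by (rule d1(2)[OF s _ s]) (use xx d in \<open>auto simp: dist_Pair_Pair dist_commute\<close>)
      ultimately show ?thesis
       using norm_triangle_ineq[of "f (s, x, Y (s, x)) - f (s, x, Y (s, x0))" "f (s, x, Y (s, x0)) - f (s, x0, Y (s, x0))"]
       by simp
     qed
    qed (use L e1 tR in auto)
    also have "norm (Y (0, x) - Y (0, x0)) < e1" using d2(2)[of x] xx d(3) by (simp add: Y0 dist_norm)
    then have "(norm (Y (0, x) - Y (0, x0)) + e1) * exp ((L + 1) * R) < (e1 + e1) * C"
     unfolding C_def by (intro mult_strict_right_mono) auto
    finally have "norm (Y (t, x) - Y (t, x0)) < e / 2" using C by (simp add: e1_def)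
    moreover have "dist (Y (t, x0)) (Y (t0, x0)) < e / 2" using d3(2) tt d(4) by simp
    ultimately show ?thesis unfolding zt
     using dist_triangle[of "Y (t, x)" "Y (t0, x0)" "Y (t, x0)"] by (simp add: dist_norm)
   qed
   then show "\<exists>d>0. \<forall>z. dist z (t0, x0) < d \<longrightarrow> dist (Y z) (Y (t0, x0)) < e" using d(1) by blast
  qed
 qed
 then show ?thesis by (auto intro: continuous_at_imp_continuous_on)
qed

text \<open>The field of the variational equation: the linearization of \<open>f\<close> along the
  solution \<open>Y\<close> for a variation \<open>d\<close> of the parameter. It is affine in the
  state \<open>v\<close>, hence globally Lipschitz.\<close>

definition var_field ::
 "(real \<times> 'p::euclidean_space \<times> 'q::euclidean_space \<Rightarrow> 'q) \<Rightarrow> (real \<times> 'p \<Rightarrow> 'q) \<Rightarrow> 'p \<Rightarrow>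
  real \<times> 'p \<times> 'q \<Rightarrow> 'q" where
 "var_field f Y d = (\<lambda>(t, x, v). frechet f (at (t, x, Y (t, x))) (0, d, v))"

lemma td1_linear: "td (Suc 0) f UNIV \<Longrightarrow> linear (frechet f (at z))"
 by (rule has_derivative_linear[OF td_has_derivative[OF _ UNIV_I]])

lemma bounded_derivative_on_compact:
 fixes f :: "'a::euclidean_space \<Rightarrow> 'b::euclidean_space"
 assumes f: "td (Suc 0) f UNIV" and K: "compact K"
 obtains M where "M \<ge> 0" "\<And>z v. z \<in> K \<Longrightarrow> norm (frechet f (at z) v) \<le> M * norm v"
proof -
 have "continuous_on UNIV (\<lambda>z. \<Sum>b\<in>Basis. norm (frechet f (at z) b))"
  using f by (intro continuous_intros) auto
 then have "compact ((\<lambda>z. \<Sum>b\<in>Basis. norm (frechet f (at z) b)) ` K)"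
  by (intro compact_continuous_image K) (auto intro: continuous_on_subset)
 from compact_imp_bounded[OF this, unfolded bounded_pos]
 obtain M where M: "M > 0" "\<And>z. z \<in> K \<Longrightarrow> norm (\<Sum>b\<in>Basis. norm (frechet f (at z) b)) \<le> M"
  by auto
 show thesis
 proof (rule that[of M])
  fix z v assume "z \<in> K"
  have "norm (frechet f (at z) v) \<le> (\<Sum>b\<in>Basis. norm (frechet f (at z) b)) * norm v"
   by (rule norm_linear_le_Basis[OF td1_linear[OF f]])
  also have "\<dots> \<le> M * norm v"
   using M(2)[OF \<open>z \<in> K\<close>] by (intro mult_right_mono) auto
  finally show "norm (frechet f (at z) v) \<le> M * norm v" .
 qed (use M in auto)
qed

lemma compact_graph:
 assumes "continuous_on UNIV Y" "compact A" "compact B"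
 shows "compact ((\<lambda>(t, x). (t, x, Y (t, x))) ` (A \<times> B))"
 unfolding case_prod_unfold
 by (intro compact_continuous_image compact_Times assms continuous_intros
   continuous_on_compose2[OF assms(1)]) auto

lemma var_field_lipschitz:
 fixes f :: "real \<times> 'p::euclidean_space \<times> 'q::euclidean_space \<Rightarrow> 'q"
 assumes f: "td (Suc 0) f UNIV" and cY: "continuous_on UNIV Y"
 shows "param_lipschitz (var_field f Y d)"
 unfolding param_lipschitz_def
proof
 fix R
 obtain M where M: "M \<ge> 0" "\<And>z v. z \<in> (\<lambda>(t, x). (t, x, Y (t, x))) ` ({-R..R} \<times> cball 0 R) \<Longrightarrow>
   norm (frechet f (at z) v) \<le> M * norm v"
  by (rule bounded_derivative_on_compact[OF f compact_graph[OF cY compact_Icc compact_cball]]) blast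
 show "\<exists>L\<ge>0. \<forall>t x y y'. \<bar>t\<bar> \<le> R \<longrightarrow> norm x \<le> R \<longrightarrow>
   norm (var_field f Y d (t, x, y) - var_field f Y d (t, x, y')) \<le> L * norm (y - y')"
 proof (rule exI[of _ M], intro conjI allI impI)
  fix t and x :: 'p and y y' :: 'q assume tx: "\<bar>t\<bar> \<le> R" "norm x \<le> R"
  let ?z = "(t, x, Y (t, x))"
  have "?z \<in> (\<lambda>(t, x). (t, x, Y (t, x))) ` ({-R..R} \<times> cball 0 R)"
   using tx by (auto simp: abs_le_iff)
  then have "norm (frechet f (at ?z) (0, 0, y - y')) \<le> M * norm (0::real, 0::'p, y - y')"
   by (rule M(2))
  moreover have "frechet f (at ?z) (0, 0, y - y') = var_field f Y d (t, x, y) - var_field f Y d (t, x, y')"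
   using linear_diff[OF td1_linear[OF f], of ?z "(0, d, y)" "(0, d, y')"] by (simp add: var_field_def)
  ultimately show "norm (var_field f Y d (t, x, y) - var_field f Y d (t, x, y')) \<le> M * norm (y - y')"
   by (simp add: norm_Pair)
 qed (use M in auto)
qed

lemma param_solution_lipschitz:
 fixes f :: "real \<times> 'p::euclidean_space \<times> 'q::euclidean_space \<Rightarrow> 'q"
 assumes f: "td (Suc 0) f UNIV" and lip: "param_lipschitz f"
  and y0: "td (Suc 0) y0 UNIV" and Y: "param_solution f y0 Y" and T: "T \<ge> 0"
 obtains C d where "C \<ge> 0" "d > 0"
  "\<And>s x'. \<bar>s\<bar> \<le> T \<Longrightarrow> norm (x' - x) < d \<Longrightarrow> norm (Y (s, x') - Y (s, x)) \<le> C * norm (x' - x)"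
proof -
 have dY: "((\<lambda>t. Y (t, x)) has_vector_derivative f (t, x, Y (t, x))) (at t)" for t x
  using Y by (auto simp: param_solution_def)
 have Y0: "Y (0, x) = y0 x" for x using Y by (auto simp: param_solution_def)
 have cY: "continuous_on UNIV Y"
  by (rule param_solution_continuous[OF td_continuous[OF f] lip td_continuous[OF y0] Y])
 define K where "K = (\<lambda>(t, x). (t, x, Y (t, x))) ` ({-T..T} \<times> {x})"
 have K: "compact K" unfolding K_def by (intro compact_graph cY) auto
 have inK: "(s, x, Y (s, x)) \<in> K" if "\<bar>s\<bar> \<le> T" for s
  using that unfolding K_def by (auto simp: abs_le_iff)
 obtain M where M: "M \<ge> 0" "\<And>z v. z \<in> K \<Longrightarrow> norm (frechet f (at z) v) \<le> M * norm v"
  by (rule bounded_derivative_on_compact[OF f K]) blast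
 obtain M0 where M0: "M0 \<ge> 0" "\<And>z v. z \<in> {x} \<Longrightarrow> norm (frechet y0 (at z) v) \<le> M0 * norm v"
  by (rule bounded_derivative_on_compact[OF y0, of "{x}"]) auto
 obtain d1 where d1: "d1 > 0" "\<And>z z'. z \<in> K \<Longrightarrow> norm (z' - z) < d1 \<Longrightarrow>
    norm (f z' - f z - frechet f (at z) (z' - z)) \<le> 1 * norm (z' - z)"
  by (rule uniform_differentiability[OF f K zero_less_one]) blast
 obtain d2 where d2: "d2 > 0" "\<And>z z'. z \<in> {x} \<Longrightarrow> norm (z' - z) < d2 \<Longrightarrow>
    norm (y0 z' - y0 z - frechet y0 (at z) (z' - z)) \<le> 1 * norm (z' - z)"
  by (rule uniform_differentiability[OF y0, of "{x}" 1]) auto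
 define R where "R = max T (norm x + 1)"
 obtain L where L: "L \<ge> 0" "\<And>t x y y'. \<bar>t\<bar> \<le> R \<Longrightarrow> norm x \<le> R \<Longrightarrow> norm (f (t, x, y) - f (t, x, y')) \<le> L * norm (y - y')"
  by (rule param_lipschitzD[OF lip]) blast
 show thesis
 proof (rule that[of "((1 + M0) + (1 + M)) * exp ((L + 1) * T)" "min 1 (min d1 d2)"])
  fix s x' assume s: "\<bar>s\<bar> \<le> T" and x': "norm (x' - x) < min 1 (min d1 d2)"
  let ?n = "norm (x' - x)"
  have "norm (Y (s, x') - Y (s, x)) \<le> (norm (Y (0, x') - Y (0, x)) + (1 + M) * ?n) * exp ((L + 1) * T)"
  proof (rule gronwall[where w' = "\<lambda>s. f (s, x', Y (s, x')) - f (s, x, Y (s, x))"])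
   show "((\<lambda>s. Y (s, x') - Y (s, x)) has_vector_derivative f (s, x', Y (s, x')) - f (s, x, Y (s, x))) (at s)" for s
    by (auto intro!: derivative_eq_intros dY)
   fix s assume s: "\<bar>s\<bar> \<le> T"
   have "norm x' \<le> norm x + 1" using x' norm_triangle_sub[of x' x] by linarith
   then have "norm x' \<le> R" by (simp add: R_def)
   then have 1: "norm (f (s, x', Y (s, x')) - f (s, x', Y (s, x))) \<le> L * norm (Y (s, x') - Y (s, x))"
    by (intro L(2)) (use s in \<open>auto simp: R_def\<close>)
   let ?z = "(s, x, Y (s, x))" and ?z' = "(s, x', Y (s, x))"
   have nz: "norm (?z' - ?z) = ?n" by (simp add: norm_Pair)
   have "norm (f ?z' - f ?z - frechet f (at ?z) (?z' - ?z)) \<le> 1 * norm (?z' - ?z)"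
    by (rule d1(2)[OF inK[OF s]]) (use x' nz in auto)
   moreover have "norm (frechet f (at ?z) (?z' - ?z)) \<le> M * norm (?z' - ?z)"
    by (rule M(2)[OF inK[OF s]])
   ultimately have 2: "norm (f ?z' - f ?z) \<le> (1 + M) * ?n"
    using norm_triangle_ineq2[of "f ?z' - f ?z" "frechet f (at ?z) (?z' - ?z)"]
    unfolding nz by (simp add: algebra_simps)
   show "norm (f (s, x', Y (s, x')) - f (s, x, Y (s, x))) \<le> L * norm (Y (s, x') - Y (s, x)) + (1 + M) * ?n"
    using norm_triangle_ineq[of "f (s, x', Y (s, x')) - f ?z'" "f ?z' - f ?z"] 1 2 by simp
  qed (use L M s in auto)
  also have "norm (Y (0, x') - Y (0, x)) \<le> (1 + M0) * ?n"
   using norm_triangle_ineq2[of "y0 x' - y0 x" "frechet y0 (at x) (x' - x)"]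
    d2(2)[of x x'] M0(2)[of x "x' - x"] x' unfolding Y0 by (simp add: algebra_simps)
  finally show "norm (Y (s, x') - Y (s, x)) \<le> ((1 + M0) + (1 + M)) * exp ((L + 1) * T) * ?n"
   by (simp add: algebra_simps)
 qed (use M M0 d1 d2 in auto)
qed

text \<open>The candidate \<open>V d\<close> solves the variational equation. It is linear in
  \<open>d\<close> by uniqueness of solutions, and the error
  \<open>Y (s, x') - Y (s, x) - V (x' - x) (s, x)\<close> satisfies a differential inequality whose
  inhomogeneous term is small relative to \<open>norm (x' - x)\<close>, by uniform differentiability
  along the compact solution curve.\<close>

lemma param_solution_derivative_param:
 fixes f :: "real \<times> 'p::euclidean_space \<times> 'q::euclidean_space \<Rightarrow> 'q"
 assumes f: "td (Suc 0) f UNIV" and lip: "param_lipschitz f"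
  and y0: "td (Suc 0) y0 UNIV" and Y: "param_solution f y0 Y"
  and V: "\<And>d. param_solution (var_field f Y d) (\<lambda>x. frechet y0 (at x) d) (V d)"
 shows "((\<lambda>x. Y (t, x)) has_derivative (\<lambda>d. V d (t, x))) (at x)"
proof -
 have dY: "((\<lambda>t. Y (t, x)) has_vector_derivative f (t, x, Y (t, x))) (at t)" for t x
  using Y by (auto simp: param_solution_def)
 have Y0: "Y (0, x) = y0 x" for x using Y by (auto simp: param_solution_def)
 have dV: "((\<lambda>t. V d (t, x)) has_vector_derivative var_field f Y d (t, x, V d (t, x))) (at t)" for t x d
  using V by (auto simp: param_solution_def)
 have V0: "V d (0, x) = frechet y0 (at x) d" for x d using V by (auto simp: param_solution_def)
 have cY: "continuous_on UNIV Y"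
  by (rule param_solution_continuous[OF td_continuous[OF f] lip td_continuous[OF y0] Y])
 let ?D = "\<lambda>s. frechet f (at (s, x, Y (s, x)))"
 have linD: "linear (?D s)" for s by (rule td1_linear[OF f])
 have lin0: "linear (frechet y0 (at x))" by (rule td1_linear[OF y0])
 have vf: "var_field f Y d (s, x, v) = ?D s (0, d, v)" for d s v by (simp add: var_field_def)
 have lin: "linear (\<lambda>d. V d (t, x))"
 proof (rule linearI)
  fix d d'
  show "V (d + d') (t, x) = V d (t, x) + V d' (t, x)"
  proof (rule ode_unique[where f = "\<lambda>(t, v). var_field f Y (d + d') (t, x, v)"
     and z = "\<lambda>t. V d (t, x) + V d' (t, x)"], goal_cases)
   case 1 then show ?case using param_lipschitz_fixed[OF var_field_lipschitz[OF f cY]] by simp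
  next
   case 2 then show ?case using dV by simp
  next
   case (3 t)
   have "var_field f Y (d + d') (t, x, V d (t, x) + V d' (t, x)) =
    var_field f Y d (t, x, V d (t, x)) + var_field f Y d' (t, x, V d' (t, x))"
    unfolding vf using linear_add[OF linD, of t "(0, d, V d (t, x))" "(0, d', V d' (t, x))"] by simp
   then show ?case by (auto intro!: derivative_eq_intros dV)
  next
   case 4 then show ?case unfolding V0 by (rule linear_add[OF lin0])
  qed
 next
  fix r d
  show "V (r *\<^sub>R d) (t, x) = r *\<^sub>R V d (t, x)"
  proof (rule ode_unique[where f = "\<lambda>(t, v). var_field f Y (r *\<^sub>R d) (t, x, v)"
     and z = "\<lambda>t. r *\<^sub>R V d (t, x)"], goal_cases)
   case 1 then show ?case using param_lipschitz_fixed[OF var_field_lipschitz[OF f cY]] by simp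
  next
   case 2 then show ?case using dV by simp
  next
   case (3 t)
   have "var_field f Y (r *\<^sub>R d) (t, x, r *\<^sub>R V d (t, x)) = r *\<^sub>R var_field f Y d (t, x, V d (t, x))"
    unfolding vf using linear_scale[OF linD, of t r "(0, d, V d (t, x))"] by simp
   then show ?case
    using bounded_linear.has_vector_derivative[OF bounded_linear_scaleR_right dV] by simp
  next
   case 4 then show ?case unfolding V0 by (rule linear_scale[OF lin0])
  qed
 qed
 define T where "T = \<bar>t\<bar>"
 obtain C d0 where C: "C \<ge> 0" "d0 > 0"
  "\<And>s x'. \<bar>s\<bar> \<le> T \<Longrightarrow> norm (x' - x) < d0 \<Longrightarrow> norm (Y (s, x') - Y (s, x)) \<le> C * norm (x' - x)"
  using param_solution_lipschitz[OF f lip y0 Y, of T x] by (auto simp: T_def)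
 define K where "K = (\<lambda>(t, x). (t, x, Y (t, x))) ` ({-T..T} \<times> {x})"
 have K: "compact K" unfolding K_def by (intro compact_graph cY) auto
 have inK: "(s, x, Y (s, x)) \<in> K" if "\<bar>s\<bar> \<le> T" for s
  using that unfolding K_def by (auto simp: abs_le_iff)
 obtain M where M: "M \<ge> 0" "\<And>z v. z \<in> K \<Longrightarrow> norm (frechet f (at z) v) \<le> M * norm v"
  by (rule bounded_derivative_on_compact[OF f K]) blast
 \<comment> \<open>The factor that Gronwall's inequality will produce: \<open>e1\<close> from the
   initial values, \<open>e1 * (1 + C)\<close> from the field.\<close>
 define E where "E = (2 + C) * exp ((M + 1) * T)"
 have E: "E > 0" using C(1) by (simp add: E_def add_pos_nonneg)
 show ?thesis unfolding has_derivative_at_alt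
 proof (intro conjI allI impI)
  show "bounded_linear (\<lambda>d. V d (t, x))" using lin by (simp add: linear_conv_bounded_linear)
  fix e :: real assume e: "e > 0"
  define e1 where "e1 = e / E"
  have e1: "e1 > 0" using e E by (simp add: e1_def)
  obtain d1 where d1: "d1 > 0" "\<And>z z'. z \<in> K \<Longrightarrow> norm (z' - z) < d1 \<Longrightarrow>
     norm (f z' - f z - frechet f (at z) (z' - z)) \<le> e1 * norm (z' - z)"
   by (rule uniform_differentiability[OF f K e1]) blast
  obtain d2 where d2: "d2 > 0" "\<And>z z'. z \<in> {x} \<Longrightarrow> norm (z' - z) < d2 \<Longrightarrow>
     norm (y0 z' - y0 z - frechet y0 (at z) (z' - z)) \<le> e1 * norm (z' - z)"
   by (rule uniform_differentiability[OF y0 _ e1, of "{x}"]) auto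
  define d where "d = min (d1 / (1 + C)) (min d2 d0)"
  have d: "d > 0" using d1 d2 C by (auto simp: d_def)
  have "norm (Y (t, x') - Y (t, x) - V (x' - x) (t, x)) \<le> e * norm (x' - x)" if x': "norm (x' - x) < d" for x'
  proof -
   let ?n = "norm (x' - x)"
   have "norm (Y (t, x') - Y (t, x) - V (x' - x) (t, x)) \<le>
     (norm (Y (0, x') - Y (0, x) - V (x' - x) (0, x)) + e1 * (1 + C) * ?n) * exp ((M + 1) * T)"
   proof (rule gronwall[where w' = "\<lambda>s. f (s, x', Y (s, x')) - f (s, x, Y (s, x)) - var_field f Y (x' - x) (s, x, V (x' - x) (s, x))"])
    show "((\<lambda>s. Y (s, x') - Y (s, x) - V (x' - x) (s, x)) has_vector_derivative
      f (s, x', Y (s, x')) - f (s, x, Y (s, x)) - var_field f Y (x' - x) (s, x, V (x' - x) (s, x))) (at s)" for s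
     by (auto intro!: derivative_eq_intros dY dV)
    fix s assume s: "\<bar>s\<bar> \<le> T"
    let ?z = "(s, x, Y (s, x))" and ?z' = "(s, x', Y (s, x'))"
    let ?w = "Y (s, x') - Y (s, x) - V (x' - x) (s, x)"
    have "norm (?z' - ?z) \<le> ?n + norm (Y (s, x') - Y (s, x))"
     using norm_Pair_le[of "x' - x" "Y (s, x') - Y (s, x)"] by (simp add: norm_Pair[of "0::real"])
    also have "\<dots> \<le> (1 + C) * ?n"
     using C(3)[OF s, of x'] x' by (simp add: d_def algebra_simps)
    finally have nz: "norm (?z' - ?z) \<le> (1 + C) * ?n" .
    also have "\<dots> < d1" using x' C(1) by (simp add: d_def field_simps)
    finally have "norm (f ?z' - f ?z - ?D s (?z' - ?z)) \<le> e1 * norm (?z' - ?z)"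
     by (rule d1(2)[OF inK[OF s]])
    also have "\<dots> \<le> e1 * ((1 + C) * ?n)" using nz e1 by (intro mult_left_mono) auto
    finally have 1: "norm (f ?z' - f ?z - ?D s (?z' - ?z)) \<le> e1 * (1 + C) * ?n" by (simp add: mult_ac)
    have 2: "norm (?D s (0, 0, ?w)) \<le> M * norm ?w"
     using M(2)[OF inK[OF s], of "(0, 0, ?w)"] by (simp add: norm_Pair)
    have "?D s (?z' - ?z) - ?D s (0, x' - x, V (x' - x) (s, x)) = ?D s (0, 0, ?w)"
     using linear_diff[OF linD, of s "?z' - ?z" "(0, x' - x, V (x' - x) (s, x))"] by simp
    then have E': "f ?z' - f ?z - var_field f Y (x' - x) (s, x, V (x' - x) (s, x)) =
      (f ?z' - f ?z - ?D s (?z' - ?z)) + ?D s (0, 0, ?w)"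
     unfolding vf by (simp add: algebra_simps)
    show "norm (f ?z' - f ?z - var_field f Y (x' - x) (s, x, V (x' - x) (s, x)))
      \<le> M * norm ?w + e1 * (1 + C) * ?n"
     unfolding E' using norm_triangle_ineq[of "f ?z' - f ?z - ?D s (?z' - ?z)" "?D s (0, 0, ?w)"] 1 2 by linarith
   qed (use M C e1 in \<open>auto simp: T_def\<close>)
   also have "norm (Y (0, x') - Y (0, x) - V (x' - x) (0, x)) \<le> e1 * ?n"
    using d2(2)[of x x'] x' unfolding Y0 V0 by (simp add: d_def)
   finally have "norm (Y (t, x') - Y (t, x) - V (x' - x) (t, x)) \<le> e1 * E * ?n"
    by (simp add: E_def algebra_simps)
   then show ?thesis using E by (simp add: e1_def)
  qed
  then show "\<exists>d>0. \<forall>y. norm (y - x) < d \<longrightarrow>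
    norm (Y (t, y) - Y (t, x) - V (y - x) (t, x)) \<le> e * norm (y - x)" using d by blast
 qed
qed

lemma param_solution_derivative:
 fixes f :: "real \<times> 'p::euclidean_space \<times> 'q::euclidean_space \<Rightarrow> 'q"
 assumes f: "td (Suc 0) f UNIV" and lip: "param_lipschitz f"
  and y0: "td (Suc 0) y0 UNIV" and Y: "param_solution f y0 Y"
  and V: "\<And>d. param_solution (var_field f Y d) (\<lambda>x. frechet y0 (at x) d) (V d)"
 shows "(Y has_derivative (\<lambda>(\<tau>, d). \<tau> *\<^sub>R f (t, x, Y (t, x)) + V d (t, x))) (at (t, x))"
proof -
 have cY: "continuous_on UNIV Y"
  by (rule param_solution_continuous[OF td_continuous[OF f] lip td_continuous[OF y0] Y])
 have "((\<lambda>(x, t). Y (t, x)) has_derivative (\<lambda>(d, \<tau>). V d (t, x) + blinfun_apply (blinfun_scaleR_left (f (t, x, Y (t, x)))) \<tau>))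
   (at (x, t) within UNIV \<times> UNIV)"
 proof (rule has_derivative_partialsI[where fy = "\<lambda>x t. blinfun_scaleR_left (f (t, x, Y (t, x)))"])
  show "((\<lambda>x. Y (t, x)) has_derivative (\<lambda>d. V d (t, x))) (at x within UNIV)"
   using param_solution_derivative_param[OF assms] by simp
  show "((\<lambda>t. Y (t, x)) has_derivative blinfun_apply (blinfun_scaleR_left (f (t, x, Y (t, x))))) (at t within UNIV)" for t x
   using Y by (simp add: param_solution_def has_vector_derivative_def)
  have "continuous_on UNIV (\<lambda>z. blinfun_scaleR_left (f (snd z, fst z, Y (snd z, fst z))))"
   by (intro bounded_linear.continuous_on[OF bounded_linear_blinfun_scaleR_left]
     continuous_on_compose2[OF td_continuous[OF f]] continuous_on_compose2[OF cY] continuous_intros) auto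
  then show "continuous (at (x, t) within UNIV \<times> UNIV) (\<lambda>(x, t). blinfun_scaleR_left (f (t, x, Y (t, x))))"
   by (simp add: case_prod_unfold continuous_on_eq_continuous_at)
 qed auto
 then have 1: "((\<lambda>(x, t). Y (t, x)) has_derivative (\<lambda>(d, \<tau>). V d (t, x) + \<tau> *\<^sub>R f (t, x, Y (t, x)))) (at (x, t))"
  by simp
 have "((\<lambda>z :: real \<times> 'p. (snd z, fst z)) has_derivative (\<lambda>z. (snd z, fst z))) (at (t, x))"
  by (intro derivative_intros)
 from has_derivative_compose[OF this, of "\<lambda>(x, t). Y (t, x)", unfolded fst_conv snd_conv, OF 1]
 show ?thesis by (simp add: case_prod_unfold add.commute)
qed

text \<open>The partial derivatives of \<open>Y\<close> are \<open>f\<close> along \<open>Y\<close>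
  and the solutions \<open>V d\<close> of the variational equation. By the induction hypothesis
  \<open>Y\<close> is of class \<open>k\<close>, so the variational field is of class
  \<open>k\<close>, and the induction hypothesis applies a second time, now to that field and to
  \<open>V d\<close>. This is why \<open>f\<close> is arbitrary in the induction.\<close>

theorem param_solution_times_differentiable:
 fixes f :: "real \<times> 'p::euclidean_space \<times> 'q::euclidean_space \<Rightarrow> 'q"
 assumes "td k f UNIV" "param_lipschitz f"
  "td k y0 UNIV" "param_solution f y0 Y"
 shows "td k Y UNIV"
 using assms
proof (induction k arbitrary: f y0 Y)
 case 0
 then show ?case using param_solution_continuous by auto
next
 case (Suc k)
 have f1: "td (Suc 0) f UNIV" and y1: "td (Suc 0) y0 UNIV"
  by (rule td_le[OF Suc.prems(1)], simp, rule td_le[OF Suc.prems(3)], simp)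
 have cY: "continuous_on UNIV Y"
  by (rule param_solution_continuous[OF td_continuous[OF f1] Suc.prems(2) td_continuous[OF y1] Suc.prems(4)])
 have Yk: "td k Y UNIV"
  by (rule Suc.IH[OF td_mono[OF Suc.prems(1)] Suc.prems(2) td_mono[OF Suc.prems(3)] Suc.prems(4)])
 have linf: "linear (frechet f (at z))" for z by (rule td1_linear[OF f1])
 have vfk: "td k (var_field f Y d) UNIV" for d
 proof -
  have g: "td k (\<lambda>z :: real \<times> 'p \<times> 'q. (fst z, fst (snd z), Y (fst z, fst (snd z)))) UNIV"
  proof -
   have a: "td k (\<lambda>z :: real \<times> 'p \<times> 'q. (fst z, fst (snd z))) UNIV"
    by (intro sm_td sm_intros open_UNIV)
   have b: "td k (\<lambda>z :: real \<times> 'p \<times> 'q. Y (fst z, fst (snd z))) UNIV"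
    by (rule td_compose[OF open_UNIV open_UNIV _ a Yk]) auto
   have "td k (\<lambda>z :: real \<times> 'p \<times> 'q. (fst z, fst (snd z), 0) + (0, 0, Y (fst z, fst (snd z)))) UNIV"
    by (intro td_add[OF open_UNIV] td_bounded_linear_compose[OF open_UNIV _ b]
      sm_td sm_intros open_UNIV bounded_linear_Pair bounded_linear_zero bounded_linear_ident)
   then show ?thesis by simp
  qed
  have "td k (\<lambda>z. \<Sum>b\<in>Basis. ((0, d, snd (snd z)) \<bullet> b) *\<^sub>R
    frechet f (at (fst z, fst (snd z), Y (fst z, fst (snd z)))) b) UNIV"
  proof (intro td_sum[OF open_UNIV] td_bilinear[OF open_UNIV bounded_bilinear_scaleR])
   fix b :: "real \<times> 'p \<times> 'q"
   show "td k (\<lambda>z :: real \<times> 'p \<times> 'q. (0, d, snd (snd z)) \<bullet> b) UNIV"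
    by (intro sm_td sm_intros open_UNIV)
   show "td k (\<lambda>z :: real \<times> 'p \<times> 'q. frechet f (at (fst z, fst (snd z), Y (fst z, fst (snd z)))) b) UNIV"
    using td_compose[OF open_UNIV open_UNIV subset_UNIV g td_frechet[OF Suc.prems(1), of b]] .
  qed
  moreover have "(\<Sum>b\<in>Basis. ((0, d, snd (snd z)) \<bullet> b) *\<^sub>R
    frechet f (at (fst z, fst (snd z), Y (fst z, fst (snd z)))) b) = var_field f Y d z" for z
   unfolding var_field_def case_prod_unfold by (rule linear_basis_expansion[OF linf, symmetric])
  ultimately show ?thesis by simp
 qed
 have vfl: "param_lipschitz (var_field f Y d)" for d by (rule var_field_lipschitz[OF f1 cY])
 have "\<exists>V. param_solution (var_field f Y d) (\<lambda>x. frechet y0 (at x) d) V" for d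
  by (rule param_solution_exists[OF td_continuous[OF vfk] vfl])
 then obtain V where V: "\<And>d. param_solution (var_field f Y d) (\<lambda>x. frechet y0 (at x) d) (V d)" by metis
 have Vk: "td k (V d) UNIV" for d
  by (rule Suc.IH[OF vfk vfl td_frechet[OF Suc.prems(3)] V])
 show ?case
 proof (rule td_Suc_I[OF open_UNIV])
  show "(Y has_derivative (\<lambda>p. fst p *\<^sub>R f (fst z, snd z, Y z) + V (snd p) z)) (at z)" for z
   using param_solution_derivative[OF f1 Suc.prems(2) y1 Suc.prems(4) V, of "fst z" "snd z"]
   by (simp add: case_prod_unfold)
  fix p :: "real \<times> 'p"
  have g: "td k (\<lambda>z :: real \<times> 'p. (fst z, snd z, Y z)) UNIV"
  proof -
   have "td k (\<lambda>z :: real \<times> 'p. (fst z, snd z, 0) + (0, 0, Y z)) UNIV"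
    by (intro td_add[OF open_UNIV] td_bounded_linear_compose[OF open_UNIV _ Yk]
      sm_td sm_intros open_UNIV bounded_linear_Pair bounded_linear_zero bounded_linear_ident)
   then show ?thesis by simp
  qed
  have "td k (\<lambda>z. f (fst z, snd z, Y z)) UNIV"
   using td_compose[OF open_UNIV open_UNIV subset_UNIV g td_mono[OF Suc.prems(1)]] .
  then show "td k (\<lambda>z. fst p *\<^sub>R f (fst z, snd z, Y z) + V (snd p) z) UNIV"
   by (intro td_add[OF open_UNIV] td_bounded_linear_compose[OF open_UNIV bounded_linear_scaleR_right] Vk)
 qed
qed

theorem param_solution_smooth:
 fixes f :: "real \<times> 'p::euclidean_space \<times> 'q::euclidean_space \<Rightarrow> 'q"
 assumes "smooth f UNIV" "param_lipschitz f" "smooth y0 UNIV" "param_solution f y0 Y"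
 shows "smooth Y UNIV"
 using assms param_solution_times_differentiable unfolding smooth_on_open_def by blast

text \<open>
 Hadamard's lemma: the quotient is \<open>\<integral>\<^sub>0\<^sup>1 \<partial>\<^sub>r f (t r, z) dt\<close>, which is smooth as the time-one value of
 an ordinary differential equation with parameters \<open>(r, z)\<close>.
\<close>

lemma hadamard:
 fixes f :: "real \<times> 'p::euclidean_space \<Rightarrow> 'q::euclidean_space"
 assumes f: "smooth f UNIV" and f0: "\<And>z. f (0, z) = 0"
 obtains g where "smooth g UNIV" "\<And>r z. f (r, z) = r *\<^sub>R g (r, z)"
proof -
 define F :: "real \<times> (real \<times> 'p) \<times> 'q \<Rightarrow> 'q"
  where "F = (\<lambda>w. frechet f (at (fst w * fst (fst (snd w)), snd (fst (snd w)))) (1, 0))"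
 have sF: "smooth F UNIV"
  unfolding F_def
  by (rule sm_compose_UNIV[OF sm_frechet[OF f]]) (intro sm_intros open_UNIV)
 have lF: "param_lipschitz F" unfolding param_lipschitz_def F_def by (auto intro!: exI[of _ 0])
 obtain Y where Y: "param_solution F (\<lambda>_. 0) Y"
  using param_solution_exists[OF sm_continuous_on[OF sF] lF] by blast
 have sY: "smooth Y UNIV"
  by (rule param_solution_smooth[OF sF lF _ Y]) (intro sm_intros open_UNIV)
 have eq: "f (r, z) = r *\<^sub>R Y (1, (r, z))" for r z
 proof -
  have "((\<lambda>t. f (t * r, z) - r *\<^sub>R Y (t, (r, z))) has_vector_derivative 0) (at t within UNIV)" for t
  proof -
   have "((\<lambda>t. (t * r, z)) has_vector_derivative (r, 0)) (at t)"
    by (auto intro!: derivative_eq_intros has_vector_derivative_Pair)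
   then have d: "((\<lambda>t. (t * r, z)) has_derivative (\<lambda>h. h *\<^sub>R (r, 0))) (at t)"
    by (simp add: has_vector_derivative_def)
   have D: "(f has_derivative frechet f (at (t * r, z))) (at (t * r, z))"
    by (rule sm_has_derivative[OF f]) simp
   have "((\<lambda>t. f (t * r, z)) has_derivative (\<lambda>h. frechet f (at (t * r, z)) (h *\<^sub>R (r, 0)))) (at t)"
    by (rule has_derivative_compose[OF d D])
   moreover have "frechet f (at (t * r, z)) (h *\<^sub>R (r, 0)) = h *\<^sub>R r *\<^sub>R frechet f (at (t * r, z)) (1, 0)" for h
    using linear_scale[OF has_derivative_linear[OF D], of "h * r" "(1, 0)"] by simp
   ultimately have 1: "((\<lambda>t. f (t * r, z)) has_vector_derivative r *\<^sub>R frechet f (at (t * r, z)) (1, 0)) (at t)"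
    unfolding has_vector_derivative_def by simp
   have "((\<lambda>t. Y (t, (r, z))) has_vector_derivative frechet f (at (t * r, z)) (1, 0)) (at t)"
    using Y by (auto simp: param_solution_def F_def)
   from has_vector_derivative_diff[OF 1 bounded_linear.has_vector_derivative[OF bounded_linear_scaleR_right this, of r]]
   show ?thesis by (simp only: diff_self)
  qed
  then obtain c where c: "\<And>t. t \<in> UNIV \<Longrightarrow> f (t * r, z) - r *\<^sub>R Y (t, (r, z)) = c"
   by (rule has_vector_derivative_zero_constant[OF convex_UNIV]) blast
  from c[of 0] c[of 1] show ?thesis
   using f0 Y by (simp add: param_solution_def)
 qed
 show thesis
 proof (rule that[of "\<lambda>w. Y (1, w)"])
  show "smooth (\<lambda>w. Y (1, w)) UNIV"
   by (rule sm_compose_UNIV[OF sY]) (intro sm_intros open_UNIV)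
 qed (rule eq)
qed

lemma isCont_slice:
 fixes f :: "real \<times> 'p::euclidean_space \<Rightarrow> 'q::euclidean_space"
 assumes "smooth f UNIV"
 shows "isCont (\<lambda>r. f (r, z)) a"
 using sm_continuous_on[OF sm_compose_UNIV[OF assms sm_Pair[OF sm_id[OF open_UNIV] sm_const[OF open_UNIV]]], of z]
 by (simp add: continuous_on_eq_continuous_at)

text \<open>Repeated use of \<open>hadamard\<close>: once \<open>r ^ Suc n\<close> has been divided
  out, the limit in the hypothesis says that the remaining factor vanishes at \<open>r = 0\<close>,
  so one more division is possible.\<close>

lemma hadamard_power:
 fixes f :: "real \<times> 'p::euclidean_space \<Rightarrow> real"
 assumes "smooth f UNIV" "\<And>z. ((\<lambda>r. f (r, z) / r ^ n) \<longlongrightarrow> 0) (at 0)"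
 shows "\<exists>g. smooth g UNIV \<and> (\<forall>r z. f (r, z) = r ^ Suc n * g (r, z))"
 using assms
proof (induction n arbitrary: f)
 case 0
 have "f (0, z) = 0" for z
 proof -
  have "isCont (\<lambda>r. f (r, z)) 0" by (rule isCont_slice[OF 0(1)])
  then have "((\<lambda>r. f (r, z)) \<longlongrightarrow> f (0, z)) (at 0)" by (simp add: isCont_def)
  with 0(2)[of z] show ?thesis using tendsto_unique trivial_limit_at by fastforce
 qed
 then obtain g where "smooth g UNIV" "\<And>r z. f (r, z) = r *\<^sub>R g (r, z)"
  using hadamard[OF 0(1)] by metis
 then show ?case by auto
next
 case (Suc n)
 have "((\<lambda>r. f (r, z) / r ^ n) \<longlongrightarrow> 0) (at 0)" for z
 proof -
  have "((\<lambda>r. r * (f (r, z) / r ^ Suc n)) \<longlongrightarrow> 0 * 0) (at 0)"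
   by (intro tendsto_mult Suc.prems(2) tendsto_ident_at)
  then have "((\<lambda>r. r * (f (r, z) / r ^ Suc n)) \<longlongrightarrow> 0) (at 0)" by simp
  then show ?thesis
   by (rule Lim_transform_eventually) (auto simp: eventually_at intro!: exI[of _ 1])
 qed
 then obtain g where g: "smooth g UNIV" "\<And>r z. f (r, z) = r ^ Suc n * g (r, z)"
  using Suc.IH[OF Suc.prems(1)] by metis
 have "g (0, z) = 0" for z
 proof -
  have "isCont (\<lambda>r. g (r, z)) 0" by (rule isCont_slice[OF g(1)])
  then have "((\<lambda>r. g (r, z)) \<longlongrightarrow> g (0, z)) (at 0)" by (simp add: isCont_def)
  moreover have "((\<lambda>r. g (r, z)) \<longlongrightarrow> 0) (at 0)"
   by (rule Lim_transform_eventually[OF Suc.prems(2)[of z]])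
    (auto simp: g(2) eventually_at intro!: exI[of _ 1])
  ultimately show ?thesis using tendsto_unique trivial_limit_at by blast
 qed
 then obtain h where "smooth h UNIV" "\<And>r z. g (r, z) = r *\<^sub>R h (r, z)"
  using hadamard[OF g(1)] by metis
 then show ?case using g(2) by (auto simp: mult_ac)
qed

section \<open>The frame of the torus\<close>

lemma orthonormal_expansion:
 fixes a b u :: "real^3"
 assumes "a \<bullet> a = 1" "b \<bullet> b = 1" "a \<bullet> b = 0"
 shows "u = (u \<bullet> a) *\<^sub>R a + (u \<bullet> b) *\<^sub>R b + (u \<bullet> cross3 a b) *\<^sub>R cross3 a b" "cross3 a b \<bullet> cross3 a b = 1"
proof -
 show c: "cross3 a b \<bullet> cross3 a b = 1"
  using norm_cross_dot[of a b] assms by (simp add: power_mult_distrib power2_norm_eq_inner)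
 let ?w = "u - ((u \<bullet> a) *\<^sub>R a + (u \<bullet> b) *\<^sub>R b + (u \<bullet> cross3 a b) *\<^sub>R cross3 a b)"
 have w: "?w \<bullet> a = 0" "?w \<bullet> b = 0" "cross3 a b \<bullet> ?w = 0"
  using assms c by (simp_all add: inner_diff_left inner_diff_right inner_add_left inner_add_right
    inner_commute[of b a] inner_commute dot_cross_self)
 have "cross3 (cross3 a b) w = (a \<bullet> w) *\<^sub>R b - (b \<bullet> w) *\<^sub>R a" for w :: "real^3"
  by (simp add: cross3_simps forall_3)
 then have "cross3 (cross3 a b) ?w = 0" using w by (simp add: inner_commute)
 moreover have "cross3 a b \<noteq> 0" using c by auto
 ultimately have "?w = 0" using w(3) norm_and_cross_eq_0 by blast
 then show "u = (u \<bullet> a) *\<^sub>R a + (u \<bullet> b) *\<^sub>R b + (u \<bullet> cross3 a b) *\<^sub>R cross3 a b" by simp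
qed

lemma hvd_inner:
 assumes "(f has_vector_derivative f') (at t)" "(g has_vector_derivative g') (at t)"
 shows "((\<lambda>t. f t \<bullet> g t) has_real_derivative (f t \<bullet> g' + f' \<bullet> g t)) (at t)"
 unfolding has_real_derivative_iff_has_vector_derivative
 by (rule bounded_bilinear.has_vector_derivative[OF bounded_bilinear_inner assms])

lemma hvd_inner_const:
 assumes "(f has_vector_derivative f') (at t)" "(g has_vector_derivative g') (at t)" "\<And>t. f t \<bullet> g t = c"
 shows "f t \<bullet> g' + f' \<bullet> g t = 0"
proof -
 have "((\<lambda>t. c) has_real_derivative (f t \<bullet> g' + f' \<bullet> g t)) (at t)"
  using hvd_inner[OF assms(1,2)] assms(3) by simp
 then show ?thesis using DERIV_unique DERIV_const by blast
qed

lemma hvd_chain: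
 assumes "(g has_vector_derivative g') (at (s t))" "(s has_real_derivative s') (at t)"
 shows "((\<lambda>t. g (s t)) has_vector_derivative s' *\<^sub>R g') (at t)"
 using vector_diff_chain_at[of s s' t g g'] assms
 by (simp add: has_real_derivative_iff_has_vector_derivative o_def)

lemma velocityI: "(c has_vector_derivative c') (at t) \<Longrightarrow> velocity c t = c'"
 by (simp add: velocity_def vector_derivative_at)

lemma velocity_periodic:
 fixes c :: "real \<Rightarrow> 'a::euclidean_space"
 assumes "smooth c UNIV" "\<And>s. c (s + T) = c s"
 shows "velocity c (s + T) = velocity c s"
proof -
 have "((\<lambda>s. c (s + T)) has_vector_derivative 1 *\<^sub>R velocity c (s + T)) (at s)"
  by (rule hvd_chain[OF sm_velocity(2)[OF assms(1)]]) (auto intro!: derivative_eq_intros)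
 then show ?thesis using assms(2) velocityI by fastforce
qed

locale knot =
 fixes T :: real and \<gamma> :: "real \<Rightarrow> real^3"
 assumes generic: "generic_knot T \<gamma>"
begin

abbreviation "tv \<equiv> velocity \<gamma>"
abbreviation "nv \<equiv> normal_vec \<gamma>"
abbreviation "bv \<equiv> binormal_vec \<gamma>"
abbreviation "vv \<equiv> tube_normal \<gamma>"
definition "kap s = norm (acceleration \<gamma> s)"
definition "tor s = velocity nv s \<bullet> bv s"
text \<open>The derivative of \<open>vv\<close> in its angle; \<open>tv\<close>, \<open>ww\<close>,
  \<open>vv\<close> form an orthonormal frame whose first two vectors span the tangent plane of the
  torus.\<close>

definition "ww p = cos (snd p) *\<^sub>R bv (fst p) - sin (snd p) *\<^sub>R nv (fst p)"

lemma T_pos: "T > 0" using generic by (auto simp: generic_knot_def arclength_knot_def)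

lemma sm_gamma: "smooth \<gamma> UNIV" using generic by (auto simp: generic_knot_def arclength_knot_def)

lemma kap_pos: "kap s > 0" using generic by (auto simp: generic_knot_def kap_def)

lemma gamma_periodic: "\<gamma> (s + T) = \<gamma> s"
proof -
 have "\<gamma> s = \<gamma> (s + of_int 1 * T)"
  using generic unfolding generic_knot_def arclength_knot_def by blast
 then show ?thesis by simp
qed

lemma sm_tv: "smooth tv UNIV" by (rule sm_velocity[OF sm_gamma])

lemma sm_acc: "smooth (acceleration \<gamma>) UNIV"
 unfolding acceleration_def by (rule sm_velocity[OF sm_tv])

lemma sm_kap: "smooth kap UNIV"
proof -
 have "smooth (\<lambda>s. sqrt (acceleration \<gamma> s \<bullet> acceleration \<gamma> s)) UNIV"
  by (intro sm_intros sm_acc) (use kap_pos in \<open>auto simp: kap_def\<close>)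
 then show ?thesis by (rule sm_cong) (simp add: kap_def norm_eq_sqrt_inner)
qed

lemma nv_eq: "nv s = (1 / kap s) *\<^sub>R acceleration \<gamma> s"
 by (simp add: normal_vec_def kap_def)

lemma sm_nv: "smooth nv UNIV"
proof -
 have "smooth (\<lambda>s. (1 / kap s) *\<^sub>R acceleration \<gamma> s) UNIV"
  by (intro sm_intros sm_acc sm_kap open_UNIV) (use kap_pos in \<open>simp add: less_imp_neq[THEN not_sym]\<close>)
 then show ?thesis by (rule sm_cong) (simp add: nv_eq)
qed

lemma sm_bv: "smooth bv UNIV"
proof -
 have "smooth (\<lambda>s. cross3 (tv s) (nv s)) UNIV" by (intro sm_intros sm_tv sm_nv)
 then show ?thesis by (rule sm_cong) (simp add: binormal_vec_def)
qed

lemma sm_tor: "smooth tor UNIV"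
proof -
 have "smooth (\<lambda>s. velocity nv s \<bullet> bv s) UNIV" by (intro sm_intros sm_velocity sm_nv sm_bv)
 then show ?thesis by (rule sm_cong) (simp add: tor_def)
qed

lemmas hvd_tv = sm_velocity(2)[OF sm_tv]

lemma tv_tv: "tv s \<bullet> tv s = 1"
proof -
 have "norm (tv s) = 1" using generic by (auto simp: generic_knot_def arclength_knot_def)
 then show ?thesis by (simp add: norm_eq_1)
qed

lemma acc_eq: "velocity tv s = kap s *\<^sub>R nv s"
 using kap_pos[of s] by (simp add: nv_eq acceleration_def)

lemma nv_nv: "nv s \<bullet> nv s = 1"
proof -
 have "norm (nv s) = 1" using kap_pos[of s] by (simp add: nv_eq) (simp add: kap_def)
 then show ?thesis by (simp add: norm_eq_1)
qed

lemma tv_nv: "tv s \<bullet> nv s = 0"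
proof -
 have "2 * (tv s \<bullet> velocity tv s) = 0"
  using hvd_inner_const[OF hvd_tv hvd_tv tv_tv, of s] by (simp add: inner_commute)
 then show ?thesis using kap_pos[of s] by (simp add: acc_eq)
qed

lemma bv_eq: "bv s = cross3 (tv s) (nv s)" by (simp add: binormal_vec_def)

lemma bv_bv: "bv s \<bullet> bv s = 1"
 unfolding bv_eq by (rule orthonormal_expansion(2)[OF tv_tv nv_nv tv_nv])

lemma tv_bv: "tv s \<bullet> bv s = 0" and nv_bv: "nv s \<bullet> bv s = 0"
 by (simp_all add: bv_eq dot_cross_self)

lemma frame_expansion: "u = (u \<bullet> tv s) *\<^sub>R tv s + (u \<bullet> nv s) *\<^sub>R nv s + (u \<bullet> bv s) *\<^sub>R bv s"
 unfolding bv_eq by (rule orthonormal_expansion(1)[OF tv_tv nv_nv tv_nv])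

lemmas frame_inner = tv_tv nv_nv bv_bv tv_nv tv_bv nv_bv
 tv_nv[unfolded inner_commute[of "tv _"]] tv_bv[unfolded inner_commute[of "tv _"]] nv_bv[unfolded inner_commute[of "nv _"]]

lemma frenet_tv: "(tv has_vector_derivative kap s *\<^sub>R nv s) (at s)"
 using hvd_tv[of s] by (simp add: acc_eq)

lemma frenet_nv: "(nv has_vector_derivative - kap s *\<^sub>R tv s + tor s *\<^sub>R bv s) (at s)"
proof -
 have d: "(nv has_vector_derivative velocity nv s) (at s)" by (rule sm_velocity(2)[OF sm_nv])
 have "velocity nv s \<bullet> nv s = 0"
  using hvd_inner_const[OF d d nv_nv] by (simp add: inner_commute)
 moreover have "velocity nv s \<bullet> tv s = - kap s"
  using hvd_inner_const[OF frenet_tv d tv_nv] by (simp add: inner_commute[of "tv s"] nv_nv)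
 ultimately have "velocity nv s = - kap s *\<^sub>R tv s + tor s *\<^sub>R bv s"
  using frame_expansion[of "velocity nv s" s] by (simp add: tor_def)
 then show ?thesis using d by simp
qed

lemma frenet_bv: "(bv has_vector_derivative - tor s *\<^sub>R nv s) (at s)"
proof -
 have d: "(bv has_vector_derivative velocity bv s) (at s)" by (rule sm_velocity(2)[OF sm_bv])
 have "velocity bv s \<bullet> bv s = 0"
  using hvd_inner_const[OF d d bv_bv] by (simp add: inner_commute)
 moreover have "velocity bv s \<bullet> tv s = 0"
  using hvd_inner_const[OF frenet_tv d tv_bv] by (simp add: inner_commute[of "tv s"] nv_bv)
 moreover have "velocity bv s \<bullet> nv s = - tor s"
  using hvd_inner_const[OF frenet_nv d nv_bv] by (simp add: inner_commute[of "nv s"] inner_add_left inner_diff_left tv_bv bv_bv)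
 ultimately have "velocity bv s = - tor s *\<^sub>R nv s"
  using frame_expansion[of "velocity bv s" s] by simp
 then show ?thesis using d by simp
qed

lemma tv_periodic: "tv (s + T) = tv s" by (rule velocity_periodic[OF sm_gamma gamma_periodic])
lemma acc_periodic: "acceleration \<gamma> (s + T) = acceleration \<gamma> s"
 unfolding acceleration_def by (rule velocity_periodic[OF sm_tv tv_periodic])
lemma kap_periodic: "kap (s + T) = kap s" by (simp add: kap_def acc_periodic)
lemma nv_periodic: "nv (s + T) = nv s" by (simp add: nv_eq kap_periodic acc_periodic)
lemma bv_periodic: "bv (s + T) = bv s" by (simp add: bv_eq tv_periodic nv_periodic)
lemma tor_periodic: "tor (s + T) = tor s"
 by (simp add: tor_def bv_periodic velocity_periodic[OF sm_nv nv_periodic])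

lemma vv_eq: "vv p = cos (snd p) *\<^sub>R nv (fst p) + sin (snd p) *\<^sub>R bv (fst p)"
 by (simp add: tube_normal_def case_prod_unfold)

lemma cos_cos_sin_sin: "cos x * cos x + sin x * sin x = (1::real)"
 using sin_cos_squared_add[of x] by (simp add: power2_eq_square)

lemma torus_frame_inner:
 "vv p \<bullet> vv p = 1" "ww p \<bullet> ww p = 1" "vv p \<bullet> ww p = 0" "ww p \<bullet> vv p = 0"
 "tv (fst p) \<bullet> vv p = 0" "tv (fst p) \<bullet> ww p = 0" "vv p \<bullet> tv (fst p) = 0" "ww p \<bullet> tv (fst p) = 0"
 using cos_cos_sin_sin[of "snd p"]
 by (simp_all add: vv_eq ww_def inner_add_left inner_add_right inner_diff_left inner_diff_right frame_inner
   algebra_simps)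

lemma sm_vv: "smooth vv UNIV"
proof -
 have "smooth (\<lambda>p. cos (snd p) *\<^sub>R nv (fst p) + sin (snd p) *\<^sub>R bv (fst p)) UNIV"
  by (intro sm_intros sm_compose_UNIV[OF sm_nv] sm_compose_UNIV[OF sm_bv] open_UNIV)
 then show ?thesis by (rule sm_cong) (simp add: vv_eq)
qed

lemma sm_ww: "smooth ww UNIV"
proof -
 have "smooth (\<lambda>p. cos (snd p) *\<^sub>R bv (fst p) - sin (snd p) *\<^sub>R nv (fst p)) UNIV"
  by (intro sm_intros sm_compose_UNIV[OF sm_nv] sm_compose_UNIV[OF sm_bv] open_UNIV)
 then show ?thesis by (rule sm_cong) (simp add: ww_def)
qed

text \<open>With \<open>hvd_vv_curve\<close> and \<open>hvd_ww_curve\<close> these are the structure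
  equations of the moving frame \<open>tv\<close>, \<open>ww\<close>, \<open>vv\<close> along an
  arbitrary curve \<open>c\<close> on the torus, obtained from the Frenet equations by rotating
  through the angle \<open>snd (c t)\<close>.\<close>

lemma hvd_tv_curve:
 assumes "((\<lambda>t. fst (c t)) has_real_derivative s') (at t)"
 shows "((\<lambda>t. tv (fst (c t))) has_vector_derivative
   (kap (fst (c t)) * cos (snd (c t)) * s') *\<^sub>R vv (c t) - (kap (fst (c t)) * sin (snd (c t)) * s') *\<^sub>R ww (c t)) (at t)"
proof -
 let ?\<theta> = "snd (c t)" and ?n = "nv (fst (c t))"
 have "cos ?\<theta> *\<^sub>R vv (c t) - sin ?\<theta> *\<^sub>R ww (c t) = (cos ?\<theta> * cos ?\<theta>) *\<^sub>R ?n + (sin ?\<theta> * sin ?\<theta>) *\<^sub>R ?n"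
  by (simp add: vv_eq ww_def algebra_simps)
 then have n: "?n = cos ?\<theta> *\<^sub>R vv (c t) - sin ?\<theta> *\<^sub>R ww (c t)"
  unfolding scaleR_add_left[symmetric] cos_cos_sin_sin by simp
 have "((\<lambda>t. tv (fst (c t))) has_vector_derivative s' *\<^sub>R kap (fst (c t)) *\<^sub>R ?n) (at t)"
  by (rule hvd_chain[OF frenet_tv assms])
 moreover have "s' *\<^sub>R kap (fst (c t)) *\<^sub>R ?n = (kap (fst (c t)) * cos ?\<theta> * s') *\<^sub>R vv (c t) - (kap (fst (c t)) * sin ?\<theta> * s') *\<^sub>R ww (c t)"
  by (subst n) (simp add: algebra_simps)
 ultimately show ?thesis by simp
qed

lemma hvd_vv_curve:
 assumes s: "((\<lambda>t. fst (c t)) has_real_derivative s') (at t)" and \<theta>: "((\<lambda>t. snd (c t)) has_real_derivative \<theta>') (at t)"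
 shows "((\<lambda>t. vv (c t)) has_vector_derivative
   (\<theta>' + tor (fst (c t)) * s') *\<^sub>R ww (c t) - (kap (fst (c t)) * cos (snd (c t)) * s') *\<^sub>R tv (fst (c t))) (at t)"
proof -
 have c: "((\<lambda>t. cos (snd (c t))) has_real_derivative - sin (snd (c t)) * \<theta>') (at t)"
  and s': "((\<lambda>t. sin (snd (c t))) has_real_derivative cos (snd (c t)) * \<theta>') (at t)"
  by (auto intro!: derivative_eq_intros \<theta>)
 have "((\<lambda>t. cos (snd (c t)) *\<^sub>R nv (fst (c t)) + sin (snd (c t)) *\<^sub>R bv (fst (c t))) has_vector_derivative
   (\<theta>' + tor (fst (c t)) * s') *\<^sub>R ww (c t) - (kap (fst (c t)) * cos (snd (c t)) * s') *\<^sub>R tv (fst (c t))) (at t)"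
  by (rule has_vector_derivative_eq_rhs[OF has_vector_derivative_add[OF
     has_vector_derivative_scaleR[OF c hvd_chain[OF frenet_nv s]]
     has_vector_derivative_scaleR[OF s' hvd_chain[OF frenet_bv s]]]])
   (simp add: ww_def algebra_simps)
 then show ?thesis by (simp add: vv_eq)
qed

lemma hvd_ww_curve:
 assumes s: "((\<lambda>t. fst (c t)) has_real_derivative s') (at t)" and \<theta>: "((\<lambda>t. snd (c t)) has_real_derivative \<theta>') (at t)"
 shows "((\<lambda>t. ww (c t)) has_vector_derivative
   (kap (fst (c t)) * sin (snd (c t)) * s') *\<^sub>R tv (fst (c t)) - (\<theta>' + tor (fst (c t)) * s') *\<^sub>R vv (c t)) (at t)"
proof -
 have c: "((\<lambda>t. cos (snd (c t))) has_real_derivative - sin (snd (c t)) * \<theta>') (at t)"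
  and s': "((\<lambda>t. sin (snd (c t))) has_real_derivative cos (snd (c t)) * \<theta>') (at t)"
  by (auto intro!: derivative_eq_intros \<theta>)
 have "((\<lambda>t. cos (snd (c t)) *\<^sub>R bv (fst (c t)) - sin (snd (c t)) *\<^sub>R nv (fst (c t))) has_vector_derivative
   (kap (fst (c t)) * sin (snd (c t)) * s') *\<^sub>R tv (fst (c t)) - (\<theta>' + tor (fst (c t)) * s') *\<^sub>R vv (c t)) (at t)"
  by (rule has_vector_derivative_eq_rhs[OF has_vector_derivative_diff[OF
     has_vector_derivative_scaleR[OF c hvd_chain[OF frenet_bv s]]
     has_vector_derivative_scaleR[OF s' hvd_chain[OF frenet_nv s]]]])
   (simp add: vv_eq algebra_simps)
 then show ?thesis by (simp add: ww_def)
qed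

end

locale tube = knot +
 fixes \<epsilon> :: real
 assumes eps_pos: "\<epsilon> > 0" and eps_kap: "\<And>s. \<epsilon> * kap s < 1"
begin

abbreviation "\<Gamma> \<equiv> tube_map \<gamma> \<epsilon>"
abbreviation (input) "FI \<equiv> F1 \<gamma> \<epsilon>"
abbreviation (input) "FII \<equiv> F2 \<gamma> \<epsilon>"
text \<open>The factor by which the parametrization stretches the direction \<open>tv\<close>; that
  it never vanishes makes \<open>\<Gamma>\<close> an immersion.\<close>

definition "qq p = 1 - \<epsilon> * kap (fst p) * cos (snd p)"

lemma qq_pos: "qq p > 0"
proof -
 have "\<epsilon> * kap (fst p) * cos (snd p) \<le> \<epsilon> * kap (fst p) * 1"
  using eps_pos kap_pos[of "fst p"] by (intro mult_left_mono) auto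
 then show ?thesis using eps_kap[of "fst p"] by (simp add: qq_def)
qed

lemma qq_nz: "qq p \<noteq> 0" using qq_pos[of p] by simp

lemma sm_qq: "smooth qq UNIV"
proof -
 have "smooth (\<lambda>p. 1 - \<epsilon> * kap (fst p) * cos (snd p)) UNIV"
  by (intro sm_intros sm_compose_UNIV[OF sm_kap] open_UNIV)
 then show ?thesis by (rule sm_cong) (simp add: qq_def)
qed

lemma Gamma_eq: "\<Gamma> p = \<gamma> (fst p) + \<epsilon> *\<^sub>R vv p"
 by (simp add: tube_map_def case_prod_unfold)

lemma sm_Gamma: "smooth \<Gamma> UNIV"
proof -
 have "smooth (\<lambda>p. \<gamma> (fst p) + \<epsilon> *\<^sub>R vv p) UNIV"
  by (intro sm_intros sm_compose_UNIV[OF sm_gamma] sm_vv open_UNIV)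
 then show ?thesis by (rule sm_cong) (simp add: Gamma_eq)
qed

lemma hvd_Gamma_curve:
 assumes s: "((\<lambda>t. fst (c t)) has_real_derivative s') (at t)" and \<theta>: "((\<lambda>t. snd (c t)) has_real_derivative \<theta>') (at t)"
 shows "((\<lambda>t. \<Gamma> (c t)) has_vector_derivative
   (qq (c t) * s') *\<^sub>R tv (fst (c t)) + (\<epsilon> * (\<theta>' + tor (fst (c t)) * s')) *\<^sub>R ww (c t)) (at t)"
proof -
 have "((\<lambda>t. \<gamma> (fst (c t)) + \<epsilon> *\<^sub>R vv (c t)) has_vector_derivative
   (qq (c t) * s') *\<^sub>R tv (fst (c t)) + (\<epsilon> * (\<theta>' + tor (fst (c t)) * s')) *\<^sub>R ww (c t)) (at t)"
  by (rule has_vector_derivative_eq_rhs[OF has_vector_derivative_add[OF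
     hvd_chain[OF sm_velocity(2)[OF sm_gamma] s]
     bounded_linear.has_vector_derivative[OF bounded_linear_scaleR_right hvd_vv_curve[OF s \<theta>]]]])
   (simp add: qq_def algebra_simps)
 then show ?thesis by (simp add: Gamma_eq)
qed

lemma hd_Gamma:
 "(\<Gamma> has_derivative (\<lambda>d. (qq p * fst d) *\<^sub>R tv (fst p) + (\<epsilon> * (snd d + tor (fst p) * fst d)) *\<^sub>R ww p)) (at p)"
proof -
 let ?D = "frechet \<Gamma> (at p)"
 have D: "(\<Gamma> has_derivative ?D) (at p)" by (rule sm_has_derivative[OF sm_Gamma]) simp
 have "?D d = (qq p * fst d) *\<^sub>R tv (fst p) + (\<epsilon> * (snd d + tor (fst p) * fst d)) *\<^sub>R ww p" for d
 proof -
  have l: "((\<lambda>t. p + t *\<^sub>R d) has_derivative (\<lambda>h. h *\<^sub>R d)) (at 0)"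
   by (auto intro!: derivative_eq_intros)
  have "((\<lambda>t. \<Gamma> (p + t *\<^sub>R d)) has_derivative (\<lambda>h. ?D (h *\<^sub>R d))) (at 0)"
   by (rule has_derivative_compose[OF l]) (simp add: D)
  moreover have "?D (h *\<^sub>R d) = h *\<^sub>R ?D d" for h
   by (rule linear_scale[OF has_derivative_linear[OF D]])
  ultimately have 1: "((\<lambda>t. \<Gamma> (p + t *\<^sub>R d)) has_vector_derivative ?D d) (at 0)"
   by (simp add: has_vector_derivative_def)
  have "((\<lambda>t. \<Gamma> (p + t *\<^sub>R d)) has_vector_derivative
    (qq (p + 0 *\<^sub>R d) * fst d) *\<^sub>R tv (fst (p + 0 *\<^sub>R d)) +
    (\<epsilon> * (snd d + tor (fst (p + 0 *\<^sub>R d)) * fst d)) *\<^sub>R ww (p + 0 *\<^sub>R d)) (at 0)"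
   by (rule hvd_Gamma_curve) (auto intro!: derivative_eq_intros)
  then show ?thesis using 1 vector_derivative_unique_at by fastforce
 qed
 then have "?D = (\<lambda>d. (qq p * fst d) *\<^sub>R tv (fst p) + (\<epsilon> * (snd d + tor (fst p) * fst d)) *\<^sub>R ww p)" by blast
 with D show ?thesis by (rule back_subst[where P = "\<lambda>D. (\<Gamma> has_derivative D) (at p)"])
qed

text \<open>The deck transformations of the covering of the torus by the plane. All geometry is done
  in the plane, and every object has to be checked for its behaviour under these
  translations.\<close>

definition lattice :: "(real \<times> real) set" where
 "lattice = {(of_int m * T, of_int n * (2 * pi)) | m n. True}"

end

text \<open>Translations that leave \<open>g\<close> invariant bring every point into the compact
  set \<open>K\<close>, so the derivative bound on \<open>K\<close> holds everywhere.\<close>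

lemma lipschitz_periodic:
 fixes g :: "'a::euclidean_space \<Rightarrow> 'b::euclidean_space"
 assumes g: "smooth g UNIV" and K: "compact K"
  and per: "\<And>y. \<exists>l. y + l \<in> K \<and> (\<forall>z. g (z + l) = g z)"
 shows "\<exists>L\<ge>0. \<forall>y y'. norm (g y - g y') \<le> L * norm (y - y')"
proof -
 have td: "td (Suc 0) g UNIV" by (rule sm_td[OF g])
 obtain M where M: "M \<ge> 0" "\<And>z v. z \<in> K \<Longrightarrow> norm (frechet g (at z) v) \<le> M * norm v"
  by (rule bounded_derivative_on_compact[OF td K]) blast
 have D: "(g has_derivative frechet g (at y)) (at y)" for y
  by (rule sm_has_derivative[OF g]) simp
 have b: "norm (frechet g (at y) v) \<le> M * norm v" for y v
 proof -
  obtain l where l: "y + l \<in> K" "\<And>z. g (z + l) = g z" using per by metis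
  have "((\<lambda>z. z + l) has_derivative (\<lambda>h. h)) (at y)" by (auto intro!: derivative_eq_intros)
  from has_derivative_compose[OF this D] have "(g has_derivative frechet g (at (y + l))) (at y)"
   by (simp add: l(2))
  then have "frechet g (at y) = frechet g (at (y + l))"
   using frechet_derivative_at by metis
  then show ?thesis using M(2)[OF l(1)] by simp
 qed
 have "norm (g y - g y') \<le> M * norm (y - y')" for y y'
 proof (rule differentiable_bound[OF convex_UNIV])
  show "(g has_derivative frechet g (at x)) (at x within UNIV)" for x using D by simp
  show "onorm (frechet g (at x)) \<le> M" for x by (rule onorm_bound[OF M(1) b])
 qed auto
 then show ?thesis using M(1) by blast
qed

lemma exists_int_shift:
 assumes "T > (0::real)"
 shows "\<exists>m::int. x + of_int m * T \<in> {0..T}"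
proof (intro exI[of _ "- \<lfloor>x / T\<rfloor>"])
 have "of_int \<lfloor>x / T\<rfloor> * T \<le> x"
  using of_int_floor_le[of "x / T"] unfolding pos_le_divide_eq[OF assms] .
 moreover have "x \<le> (of_int \<lfloor>x / T\<rfloor> + 1) * T"
  using floor_correct[of "x / T"] assms by (simp add: pos_divide_less_eq[symmetric] less_imp_le)
 ultimately show "x + of_int (- \<lfloor>x / T\<rfloor>) * T \<in> {0..T}"
  by (simp add: algebra_simps)
qed

lemma periodic_int:
 assumes "\<And>x. f (x + T) = f (x::real)"
 shows "f (x + of_int m * T) = f x"
proof -
 have n: "f (x + of_nat n * T) = f x" for x n
  by (induction n arbitrary: x) (auto simp: algebra_simps assms, metis add.assoc assms)
 show ?thesis
 proof (cases "m \<ge> 0")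
  case True
  then show ?thesis using n[of x "nat m"] by simp
 next
  case False
  then show ?thesis using n[of "x + of_int m * T" "nat (- m)"] by (simp add: algebra_simps)
 qed
qed

section \<open>The geodesic flow of the torus, lifted to the plane\<close>

context tube
begin

text \<open>
 In the orthonormal frame \<open>tv, ww\<close> of the torus the velocity of a geodesic rotates with angular
 speed \<open>kap s sin \<theta> s'\<close>. With the rotation angle \<open>\<alpha>\<close> as a third coordinate, the geodesic equation
 becomes a system \<open>((s, \<theta>), \<alpha>)' = geo_field (P, Q) ((s, \<theta>), \<alpha>)\<close>, where \<open>(P, Q)\<close> is the initial
 velocity in the frame. It is linear in \<open>(P, Q)\<close> and globally Lipschitz in the state.
\<close>

definition rotP :: "real \<times> real \<Rightarrow> real \<Rightarrow> real" where "rotP a \<alpha> = fst a * cos \<alpha> - snd a * sin \<alpha>"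
definition rotQ :: "real \<times> real \<Rightarrow> real \<Rightarrow> real" where "rotQ a \<alpha> = fst a * sin \<alpha> + snd a * cos \<alpha>"

definition geo_field :: "real \<times> real \<Rightarrow> (real \<times> real) \<times> real \<Rightarrow> (real \<times> real) \<times> real" where
 "geo_field a y =
  ((rotP a (snd y) / qq (fst y), rotQ a (snd y) / \<epsilon> - tor (fst (fst y)) * (rotP a (snd y) / qq (fst y))),
   kap (fst (fst y)) * sin (snd (fst y)) * (rotP a (snd y) / qq (fst y)))"

lemma geo_field_scale: "geo_field (r *\<^sub>R a) y = r *\<^sub>R geo_field a y"
 by (simp add: geo_field_def rotP_def rotQ_def algebra_simps add_divide_distrib diff_divide_distrib)

lemma geo_field_linear: "geo_field a y = fst a *\<^sub>R geo_field (1, 0) y + snd a *\<^sub>R geo_field (0, 1) y"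
 by (simp add: geo_field_def rotP_def rotQ_def algebra_simps add_divide_distrib diff_divide_distrib)

lemma sm_geo_field: "smooth (\<lambda>w :: (real \<times> real) \<times> ((real \<times> real) \<times> real). geo_field (fst w) (snd w)) UNIV"
 unfolding geo_field_def rotP_def rotQ_def
 by (intro sm_intros sm_compose_UNIV[OF sm_kap] sm_compose_UNIV[OF sm_tor] sm_compose_UNIV[OF sm_qq] open_UNIV)
  (use qq_nz eps_pos in auto)

lemma kap_lattice: "l \<in> lattice \<Longrightarrow> kap (x + fst l) = kap x"
 and tor_lattice: "l \<in> lattice \<Longrightarrow> tor (x + fst l) = tor x"
 and tv_lattice: "l \<in> lattice \<Longrightarrow> tv (x + fst l) = tv x"
 and nv_lattice: "l \<in> lattice \<Longrightarrow> nv (x + fst l) = nv x"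
 and bv_lattice: "l \<in> lattice \<Longrightarrow> bv (x + fst l) = bv x"
 and gamma_lattice: "l \<in> lattice \<Longrightarrow> \<gamma> (x + fst l) = \<gamma> x"
 by (auto simp: lattice_def periodic_int kap_periodic tor_periodic tv_periodic nv_periodic bv_periodic gamma_periodic)

lemma sin_lattice: "l \<in> lattice \<Longrightarrow> sin (x + snd l) = sin x"
 and cos_lattice: "l \<in> lattice \<Longrightarrow> cos (x + snd l) = cos x"
proof -
 have s: "sin (x + 2 * pi) = sin x" and c: "cos (x + 2 * pi) = cos x" for x :: real by simp_all
 show "l \<in> lattice \<Longrightarrow> sin (x + snd l) = sin x" "l \<in> lattice \<Longrightarrow> cos (x + snd l) = cos x"
  using periodic_int[of sin "2 * pi", OF s] periodic_int[of cos "2 * pi", OF c] by (auto simp: lattice_def)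
qed

lemma qq_lattice: "l \<in> lattice \<Longrightarrow> qq (x + l) = qq x"
 and vv_lattice: "l \<in> lattice \<Longrightarrow> vv (x + l) = vv x"
 and ww_lattice: "l \<in> lattice \<Longrightarrow> ww (x + l) = ww x"
 by (simp_all add: qq_def vv_eq ww_def kap_lattice nv_lattice bv_lattice sin_lattice cos_lattice)

lemma Gamma_lattice: "l \<in> lattice \<Longrightarrow> \<Gamma> (x + l) = \<Gamma> x"
 by (simp add: Gamma_eq gamma_lattice vv_lattice)

lemma geo_field_lattice: "l \<in> lattice \<Longrightarrow> geo_field a (y + (l, 0)) = geo_field a y"
 by (simp add: geo_field_def qq_lattice kap_lattice tor_lattice sin_lattice)

lemma lattice_minus:
 assumes "l \<in> lattice"
 shows "- l \<in> lattice"
proof -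
 obtain m n :: int where "l = (of_int m * T, of_int n * (2 * pi))" using assms by (auto simp: lattice_def)
 then show ?thesis unfolding lattice_def
  by (intro CollectI exI[of _ "- m"] exI[of _ "- n"]) (simp add: uminus_prod_def)
qed

lemma lattice_add:
 assumes "l \<in> lattice" "l' \<in> lattice"
 shows "l + l' \<in> lattice"
proof -
 obtain m n :: int where "l = (of_int m * T, of_int n * (2 * pi))" using assms by (auto simp: lattice_def)
 moreover obtain m' n' :: int where "l' = (of_int m' * T, of_int n' * (2 * pi))" using assms by (auto simp: lattice_def)
 ultimately show ?thesis unfolding lattice_def
  by (intro CollectI exI[of _ "m + m'"] exI[of _ "n + n'"]) (simp add: plus_prod_def distrib_right)
qed

lemma lattice_diff: "l \<in> lattice \<Longrightarrow> l' \<in> lattice \<Longrightarrow> l - l' \<in> lattice"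
 using lattice_add[of l "- l'"] lattice_minus by simp

lemma lattice_0: "0 \<in> lattice"
 unfolding lattice_def by (auto simp: zero_prod_def intro: exI[of _ 0])

definition box :: "(real \<times> real) set" where "box = {0..T} \<times> {0..2 * pi}"

lemma compact_box: "compact box" unfolding box_def by (intro compact_Times compact_Icc)

lemma box_shift: "\<exists>l\<in>lattice. x + l \<in> box"
proof -
 obtain m :: int where m: "fst x + of_int m * T \<in> {0..T}" using exists_int_shift[OF T_pos] by blast
 obtain n :: int where n: "snd x + of_int n * (2 * pi) \<in> {0..2 * pi}" using exists_int_shift[of "2 * pi"] by auto
 show ?thesis
  by (rule bexI[of _ "(of_int m * T, of_int n * (2 * pi))"]) (use m n in \<open>auto simp: box_def lattice_def mem_Times_iff\<close>)
qed

lemma geo_field_lipschitz: "\<exists>L\<ge>0. \<forall>y y'. norm (geo_field a y - geo_field a y') \<le> L * norm (y - y')"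
proof (rule lipschitz_periodic)
 show "smooth (geo_field a) UNIV"
  using sm_compose_UNIV[OF sm_geo_field sm_Pair[OF sm_const[OF open_UNIV] sm_id[OF open_UNIV]]] by simp
 show "compact (box \<times> {0..2 * pi})" by (intro compact_Times compact_box compact_Icc)
 fix y :: "(real \<times> real) \<times> real"
 obtain l where l: "l \<in> lattice" "fst y + l \<in> box" using box_shift by blast
 obtain n :: int where n: "snd y + of_int n * (2 * pi) \<in> {0..2 * pi}" using exists_int_shift[of "2 * pi"] by auto
 have "(0, of_int n * (2 * pi)) \<in> lattice" unfolding lattice_def by (auto intro: exI[of _ 0])
 from sin_lattice[OF this] cos_lattice[OF this]
 have "geo_field a (z + (l, of_int n * (2 * pi))) = geo_field a (z + (l, 0))" for z
  by (simp add: geo_field_def rotP_def rotQ_def)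
 then have "geo_field a (z + (l, of_int n * (2 * pi))) = geo_field a z" for z
  using geo_field_lattice[OF l(1)] by simp
 then show "\<exists>l. y + l \<in> box \<times> {0..2 * pi} \<and> (\<forall>z. geo_field a (z + l) = geo_field a z)"
  using l n by (intro exI[of _ "(l, of_int n * (2 * pi))"]) (auto simp: mem_Times_iff)
qed

definition geo_ode :: "real \<times> ((real \<times> real) \<times> (real \<times> real)) \<times> ((real \<times> real) \<times> real) \<Rightarrow> (real \<times> real) \<times> real" where
 "geo_ode = (\<lambda>(t, z, y). geo_field (snd z) y)"

text \<open>The field is linear in the initial velocity with coefficients that are periodic, hence
  Lipschitz, in the state; the constant therefore grows only with the bound on the
  parameter.\<close>

lemma geo_ode_lipschitz: "param_lipschitz geo_ode"
proof -
 obtain L1 where L1: "L1 \<ge> 0" "\<And>y y'. norm (geo_field (1, 0) y - geo_field (1, 0) y') \<le> L1 * norm (y - y')"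
  using geo_field_lipschitz by metis
 obtain L2 where L2: "L2 \<ge> 0" "\<And>y y'. norm (geo_field (0, 1) y - geo_field (0, 1) y') \<le> L2 * norm (y - y')"
  using geo_field_lipschitz by metis
 show ?thesis unfolding param_lipschitz_def
 proof
  fix R :: real
  show "\<exists>L\<ge>0. \<forall>t x y y'. \<bar>t\<bar> \<le> R \<longrightarrow> norm x \<le> R \<longrightarrow> norm (geo_ode (t, x, y) - geo_ode (t, x, y')) \<le> L * norm (y - y')"
  proof (cases "R \<ge> 0")
   case True
   have "norm (geo_ode (t, x, y) - geo_ode (t, x, y')) \<le> (R * L1 + R * L2) * norm (y - y')" if "norm x \<le> R" for t x y y'
   proof -
    have "norm (snd x) \<le> R" using that norm_snd_le[of "snd x" "fst x"] by simp
    then have a: "\<bar>fst (snd x)\<bar> \<le> R" "\<bar>snd (snd x)\<bar> \<le> R"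
     using norm_fst_le[of "fst (snd x)" "snd (snd x)"] norm_snd_le[of "snd (snd x)" "fst (snd x)"] by auto
    have "geo_ode (t, x, y) - geo_ode (t, x, y') =
      fst (snd x) *\<^sub>R (geo_field (1, 0) y - geo_field (1, 0) y') + snd (snd x) *\<^sub>R (geo_field (0, 1) y - geo_field (0, 1) y')"
     unfolding geo_ode_def prod.case by (subst (1 2) geo_field_linear) (simp add: algebra_simps)
    also have "norm \<dots> \<le> \<bar>fst (snd x)\<bar> * norm (geo_field (1, 0) y - geo_field (1, 0) y')
      + \<bar>snd (snd x)\<bar> * norm (geo_field (0, 1) y - geo_field (0, 1) y')"
     by (rule order_trans[OF norm_triangle_ineq]) simp
    also have "\<dots> \<le> R * (L1 * norm (y - y')) + R * (L2 * norm (y - y'))"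
     by (intro add_mono mult_mono a L1 L2 True) auto
    finally show ?thesis by (simp add: algebra_simps)
   qed
   then show ?thesis using True L1 L2 by (intro exI[of _ "R * L1 + R * L2"]) auto
  next
   case False
   then show ?thesis by (intro exI[of _ 0]) auto
  qed
 qed
qed

lemma sm_geo_ode: "smooth geo_ode UNIV"
proof -
 have "smooth (\<lambda>w :: real \<times> ((real \<times> real) \<times> (real \<times> real)) \<times> ((real \<times> real) \<times> real). (snd (fst (snd w)), snd (snd w))) UNIV"
  by (intro sm_intros open_UNIV)
 from sm_compose_UNIV[OF sm_geo_field this] show ?thesis by (simp add: geo_ode_def case_prod_unfold)
qed

definition geo_flow :: "real \<times> ((real \<times> real) \<times> (real \<times> real)) \<Rightarrow> (real \<times> real) \<times> real" where
 "geo_flow = (SOME Y. param_solution geo_ode (\<lambda>z. (fst z, 0)) Y)"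

lemma geo_flow_solution: "param_solution geo_ode (\<lambda>z. (fst z, 0)) geo_flow"
 unfolding geo_flow_def
 using param_solution_exists[OF sm_continuous_on[OF sm_geo_ode] geo_ode_lipschitz, of "\<lambda>z. (fst z, 0)"]
 by (rule someI_ex)

lemma sm_geo_flow: "smooth geo_flow UNIV"
 by (rule param_solution_smooth[OF sm_geo_ode geo_ode_lipschitz _ geo_flow_solution])
  (intro sm_intros open_UNIV)

lemma geo_flow_0: "geo_flow (0, z) = (fst z, 0)"
 using geo_flow_solution unfolding param_solution_def by blast

lemma geo_flow_deriv: "((\<lambda>t. geo_flow (t, z)) has_vector_derivative geo_field (snd z) (geo_flow (t, z))) (at t)"
proof -
 have "((\<lambda>t. geo_flow (t, z)) has_vector_derivative geo_ode (t, z, geo_flow (t, z))) (at t)"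
  using geo_flow_solution unfolding param_solution_def by blast
 then show ?thesis by (simp add: geo_ode_def)
qed

lemma geo_flow_unique:
 assumes "\<And>t. (y has_vector_derivative geo_field a (y t)) (at t)" "y 0 = (x, 0)"
 shows "y t = geo_flow (t, (x, a))"
proof (rule ode_unique[where f = "\<lambda>(t, y). geo_field a y"])
 show "\<exists>L\<ge>0. \<forall>t y y'. \<bar>t\<bar> \<le> R \<longrightarrow> norm ((case (t, y) of (t, y) \<Rightarrow> geo_field a y) - (case (t, y') of (t, y) \<Rightarrow> geo_field a y)) \<le> L * norm (y - y')" for R
  using geo_field_lipschitz[of a] by auto
qed (use assms geo_flow_deriv[of "(x, a)"] in \<open>auto simp: geo_flow_0\<close>)

text \<open>The exponential map of the torus at \<open>x\<close>, lifted to the plane; the tangent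
  vector is given by its coordinates in the frame \<open>tv\<close>, \<open>ww\<close>.\<close>

definition Exp :: "real \<times> real \<Rightarrow> real \<times> real \<Rightarrow> real \<times> real" where
 "Exp x a = fst (geo_flow (1, (x, a)))"

lemma geo_flow_scale: "geo_flow (t * r, (x, a)) = geo_flow (t, (x, r *\<^sub>R a))"
proof (rule geo_flow_unique[where y = "\<lambda>t. geo_flow (t * r, (x, a))"])
 show "((\<lambda>t. geo_flow (t * r, (x, a))) has_vector_derivative geo_field (r *\<^sub>R a) (geo_flow (t * r, (x, a)))) (at t)" for t
 proof -
  have "((\<lambda>t. geo_flow (t * r, (x, a))) has_vector_derivative r *\<^sub>R geo_field (snd (x, a)) (geo_flow (t * r, (x, a)))) (at t)"
   by (rule hvd_chain[OF geo_flow_deriv]) (auto intro!: derivative_eq_intros)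
  then show ?thesis by (simp add: geo_field_scale)
 qed
qed (simp add: geo_flow_0)

lemma geo_flow_Exp: "fst (geo_flow (t, (x, a))) = Exp x (t *\<^sub>R a)"
 using geo_flow_scale[of 1 t x a] by (simp add: Exp_def)

lemma geo_flow_lattice: "l \<in> lattice \<Longrightarrow> geo_flow (t, (x + l, a)) = geo_flow (t, (x, a)) + (l, 0)"
proof (rule geo_flow_unique[symmetric, where y = "\<lambda>t. geo_flow (t, (x, a)) + (l, 0)"])
 fix t assume "l \<in> lattice"
 then show "((\<lambda>t. geo_flow (t, (x, a)) + (l, 0)) has_vector_derivative geo_field a (geo_flow (t, (x, a)) + (l, 0))) (at t)"
  using has_vector_derivative_add[OF geo_flow_deriv[of "(x, a)" t] has_vector_derivative_const]
  by (simp add: geo_field_lattice)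
qed (simp add: geo_flow_0)

lemma Exp_lattice: "l \<in> lattice \<Longrightarrow> Exp (x + l) a = Exp x a + l"
 by (simp add: Exp_def geo_flow_lattice)

lemma Exp_0: "Exp x 0 = x"
 using geo_flow_Exp[of 0 x 0] by (simp add: geo_flow_0)

lemma sm_Exp: "smooth (\<lambda>z. Exp (fst z) (snd z)) UNIV"
proof -
 have "smooth (\<lambda>z. fst (geo_flow (1, z))) UNIV"
  by (intro sm_fst sm_compose_UNIV[OF sm_geo_flow] sm_Pair sm_const sm_id open_UNIV)
 then show ?thesis by (simp add: Exp_def)
qed

lemma sm_Exp': "smooth f U \<Longrightarrow> smooth g U \<Longrightarrow> smooth (\<lambda>z. Exp (f z) (g z)) U"
 using sm_compose_UNIV[OF sm_Exp sm_Pair] by fastforce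

definition geo_angle where "geo_angle x a t = snd (geo_flow (t, (x, a)))"
definition geoP where "geoP x a t = rotP a (geo_angle x a t)"
definition geoQ where "geoQ x a t = rotQ a (geo_angle x a t)"

lemma geo_flow_split: "geo_flow (t, (x, a)) = (Exp x (t *\<^sub>R a), geo_angle x a t)"
 by (simp add: geo_angle_def geo_flow_Exp[symmetric])

lemma geo_derivs:
 defines "c \<equiv> \<lambda>x a t. Exp x (t *\<^sub>R a)"
 shows fst_geo_deriv: "((\<lambda>t. fst (c x a t)) has_real_derivative geoP x a t / qq (c x a t)) (at t)"
  and snd_geo_deriv: "((\<lambda>t. snd (c x a t)) has_real_derivative
    geoQ x a t / \<epsilon> - tor (fst (c x a t)) * (geoP x a t / qq (c x a t))) (at t)"
  and geo_angle_deriv: "(geo_angle x a has_real_derivative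
    kap (fst (c x a t)) * sin (snd (c x a t)) * (geoP x a t / qq (c x a t))) (at t)"
proof -
 have d: "((\<lambda>t. (c x a t, geo_angle x a t)) has_vector_derivative geo_field a (c x a t, geo_angle x a t)) (at t)"
  using geo_flow_deriv[of "(x, a)" t] by (simp add: geo_flow_split c_def)
 have b: "bounded_linear (\<lambda>z :: (real \<times> real) \<times> real. fst (fst z))" "bounded_linear (\<lambda>z :: (real \<times> real) \<times> real. snd (fst z))"
  by (auto intro: bounded_linear_compose[OF bounded_linear_fst bounded_linear_fst] bounded_linear_compose[OF bounded_linear_snd bounded_linear_fst])
 show "((\<lambda>t. fst (c x a t)) has_real_derivative geoP x a t / qq (c x a t)) (at t)"
  using bounded_linear.has_vector_derivative[OF b(1) d]
  by (simp add: has_real_derivative_iff_has_vector_derivative geo_field_def geoP_def)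
 show "((\<lambda>t. snd (c x a t)) has_real_derivative
    geoQ x a t / \<epsilon> - tor (fst (c x a t)) * (geoP x a t / qq (c x a t))) (at t)"
  using bounded_linear.has_vector_derivative[OF b(2) d]
  by (simp add: has_real_derivative_iff_has_vector_derivative geo_field_def geoP_def geoQ_def)
 show "(geo_angle x a has_real_derivative
    kap (fst (c x a t)) * sin (snd (c x a t)) * (geoP x a t / qq (c x a t))) (at t)"
  using bounded_linear.has_vector_derivative[OF bounded_linear_snd d]
  by (simp add: has_real_derivative_iff_has_vector_derivative geo_field_def geoP_def)
qed

lemma geoP_0: "geoP x a 0 = fst a" and geoQ_0: "geoQ x a 0 = snd a"
 by (simp_all add: geoP_def geoQ_def geo_angle_def geo_flow_0 rotP_def rotQ_def)

definition geo_rate where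
 "geo_rate x a t = kap (fst (Exp x (t *\<^sub>R a))) * sin (snd (Exp x (t *\<^sub>R a))) * (geoP x a t / qq (Exp x (t *\<^sub>R a)))"

lemma geo_rate_deriv: "(geo_angle x a has_real_derivative geo_rate x a t) (at t)"
 using geo_angle_deriv by (simp add: geo_rate_def)

lemma geoP_deriv: "(geoP x a has_real_derivative - (geoQ x a t * geo_rate x a t)) (at t)"
 unfolding geoP_def[abs_def] geoQ_def rotP_def rotQ_def
 by (auto intro!: derivative_eq_intros geo_rate_deriv simp: algebra_simps)

lemma geoQ_deriv: "(geoQ x a has_real_derivative geoP x a t * geo_rate x a t) (at t)"
 unfolding geoQ_def[abs_def] geoP_def rotP_def rotQ_def
 by (auto intro!: derivative_eq_intros geo_rate_deriv simp: algebra_simps)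

text \<open>The normal curvature in the direction \<open>P tv + Q ww\<close>.\<close>

definition kform :: "real \<times> real \<Rightarrow> real \<times> real \<Rightarrow> real" where
 "kform x a = kap (fst x) * cos (snd x) / qq x * (fst a)\<^sup>2 - (snd a)\<^sup>2 / \<epsilon>"

lemma geo_Gamma_deriv:
 "((\<lambda>t. \<Gamma> (Exp x (t *\<^sub>R a))) has_vector_derivative
   geoP x a t *\<^sub>R tv (fst (Exp x (t *\<^sub>R a))) + geoQ x a t *\<^sub>R ww (Exp x (t *\<^sub>R a))) (at t)"
 by (rule has_vector_derivative_eq_rhs[OF hvd_Gamma_curve[OF fst_geo_deriv snd_geo_deriv]])
  (use eps_pos qq_nz in \<open>simp add: field_simps\<close>)

lemma geo_velocity_deriv:
 "((\<lambda>t. geoP x a t *\<^sub>R tv (fst (Exp x (t *\<^sub>R a))) + geoQ x a t *\<^sub>R ww (Exp x (t *\<^sub>R a))) has_vector_derivative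
   kform (Exp x (t *\<^sub>R a)) (geoP x a t, geoQ x a t) *\<^sub>R vv (Exp x (t *\<^sub>R a))) (at t)"
 by (rule has_vector_derivative_eq_rhs[OF has_vector_derivative_add[OF
    has_vector_derivative_scaleR[OF geoP_deriv hvd_tv_curve[OF fst_geo_deriv]]
    has_vector_derivative_scaleR[OF geoQ_deriv hvd_ww_curve[OF fst_geo_deriv snd_geo_deriv]]]])
  (simp add: geo_rate_def kform_def algebra_simps power2_eq_square)

lemma geo_acceleration:
 "acceleration (\<lambda>t. \<Gamma> (Exp x (t *\<^sub>R a))) t = kform (Exp x (t *\<^sub>R a)) (geoP x a t, geoQ x a t) *\<^sub>R vv (Exp x (t *\<^sub>R a))"
proof -
 have "velocity (\<lambda>t. \<Gamma> (Exp x (t *\<^sub>R a))) = (\<lambda>t. geoP x a t *\<^sub>R tv (fst (Exp x (t *\<^sub>R a))) + geoQ x a t *\<^sub>R ww (Exp x (t *\<^sub>R a)))"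
  using velocityI[OF geo_Gamma_deriv] by blast
 then show ?thesis unfolding acceleration_def using velocityI[OF geo_velocity_deriv] by simp
qed

text \<open>For normal acceleration the frame components of the velocity satisfy
  \<open>P' = - Q * \<beta>\<close> and \<open>Q' = P * \<beta>\<close>. Rotating them back by an
  antiderivative \<alpha> of \<beta> makes them constant, so the curve together with \<alpha> solves
  the system of \<open>geo_field\<close>, and uniqueness of its solutions identifies the
  curve.\<close>

lemma geodesic_is_Exp:
 assumes c: "smooth c UNIV"
  and acc: "\<And>t. acceleration (\<lambda>t. \<Gamma> (c t)) t \<bullet> tv (fst (c t)) = 0" "\<And>t. acceleration (\<lambda>t. \<Gamma> (c t)) t \<bullet> ww (c t) = 0"
 defines "u \<equiv> velocity (\<lambda>t. \<Gamma> (c t)) 0"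
 shows "c t = Exp (c 0) (t *\<^sub>R (u \<bullet> tv (fst (c 0)), u \<bullet> ww (c 0)))"
proof -
 define s' where "s' t = fst (velocity c t)" for t
 define th' where "th' t = snd (velocity c t)" for t
 have cd: "(c has_vector_derivative velocity c t) (at t)" for t by (rule sm_velocity(2)[OF c])
 have s: "((\<lambda>t. fst (c t)) has_real_derivative s' t) (at t)" for t
  using bounded_linear.has_vector_derivative[OF bounded_linear_fst cd]
  by (simp add: has_real_derivative_iff_has_vector_derivative s'_def)
 have th: "((\<lambda>t. snd (c t)) has_real_derivative th' t) (at t)" for t
  using bounded_linear.has_vector_derivative[OF bounded_linear_snd cd]
  by (simp add: has_real_derivative_iff_has_vector_derivative th'_def)
 define P where "P t = qq (c t) * s' t" for t
 define Q where "Q t = \<epsilon> * (th' t + tor (fst (c t)) * s' t)" for t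
 define \<beta> where "\<beta> t = kap (fst (c t)) * sin (snd (c t)) * s' t" for t
 have sG: "smooth (\<lambda>t. \<Gamma> (c t)) UNIV" by (rule sm_compose_UNIV[OF sm_Gamma c])
 have vel: "velocity (\<lambda>t. \<Gamma> (c t)) t = P t *\<^sub>R tv (fst (c t)) + Q t *\<^sub>R ww (c t)" for t
  using velocityI[OF hvd_Gamma_curve[OF s th]] by (simp add: P_def Q_def)
 have vd: "(velocity (\<lambda>t. \<Gamma> (c t)) has_vector_derivative acceleration (\<lambda>t. \<Gamma> (c t)) t) (at t)" for t
  unfolding acceleration_def by (rule sm_velocity(2)[OF sm_velocity(1)[OF sG]])
 have Pv: "P t = velocity (\<lambda>t. \<Gamma> (c t)) t \<bullet> tv (fst (c t))" and Qv: "Q t = velocity (\<lambda>t. \<Gamma> (c t)) t \<bullet> ww (c t)" for t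
  unfolding vel by (simp_all add: inner_add_left torus_frame_inner tv_tv)
 have P': "(P has_real_derivative - (Q t * \<beta> t)) (at t)" for t
 proof -
  have "((\<lambda>t. velocity (\<lambda>t. \<Gamma> (c t)) t \<bullet> tv (fst (c t))) has_real_derivative - (Q t * \<beta> t)) (at t)"
   by (rule DERIV_cong[OF hvd_inner[OF vd hvd_tv_curve[OF s]]])
    (simp add: acc vel inner_add_left inner_diff_right torus_frame_inner \<beta>_def)
  then show ?thesis by (simp add: Pv[abs_def])
 qed
 have Q': "(Q has_real_derivative P t * \<beta> t) (at t)" for t
 proof -
  have "((\<lambda>t. velocity (\<lambda>t. \<Gamma> (c t)) t \<bullet> ww (c t)) has_real_derivative P t * \<beta> t) (at t)"
   by (rule DERIV_cong[OF hvd_inner[OF vd hvd_ww_curve[OF s th]]])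
    (simp add: acc vel inner_add_left inner_diff_right torus_frame_inner tv_tv \<beta>_def)
  then show ?thesis by (simp add: Qv[abs_def])
 qed
 have sv: "smooth (velocity c) UNIV" by (rule sm_velocity(1)[OF c])
 have "smooth \<beta> UNIV"
 proof -
  have "smooth (\<lambda>t. kap (fst (c t)) * sin (snd (c t)) * fst (velocity c t)) UNIV"
   by (intro sm_intros sm_compose_UNIV[OF sm_kap] c sv)
  then show ?thesis by (rule sm_cong) (simp add: \<beta>_def s'_def)
 qed
 from antiderivative_exists[OF sm_continuous_on[OF this]]
 obtain \<alpha> where \<alpha>0: "\<alpha> 0 = 0" and \<alpha>v: "\<And>t. (\<alpha> has_vector_derivative \<beta> t) (at t)" by blast
 have \<alpha>: "(\<alpha> has_real_derivative \<beta> t) (at t)" for t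
  using \<alpha>v by (simp add: has_real_derivative_iff_has_vector_derivative)
 define A where "A t = P t * cos (\<alpha> t) + Q t * sin (\<alpha> t)" for t
 define B where "B t = Q t * cos (\<alpha> t) - P t * sin (\<alpha> t)" for t
 have "(A has_real_derivative 0) (at t)" "(B has_real_derivative 0) (at t)" for t
  unfolding A_def[abs_def] B_def[abs_def]
  by (auto intro!: derivative_eq_intros P' Q' \<alpha> simp: algebra_simps)
 then have "A t = A 0" "B t = B 0" for t
  using DERIV_isconst_all by blast+
 then have AB: "P t * cos (\<alpha> t) + Q t * sin (\<alpha> t) = P 0" "Q t * cos (\<alpha> t) - P t * sin (\<alpha> t) = Q 0" for t
  by (simp_all add: A_def B_def \<alpha>0)
 have PQ: "P t = rotP (P 0, Q 0) (\<alpha> t)" "Q t = rotQ (P 0, Q 0) (\<alpha> t)" for t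
 proof -
  have "P t * (cos (\<alpha> t) * cos (\<alpha> t) + sin (\<alpha> t) * sin (\<alpha> t)) = rotP (P 0, Q 0) (\<alpha> t)"
   "Q t * (cos (\<alpha> t) * cos (\<alpha> t) + sin (\<alpha> t) * sin (\<alpha> t)) = rotQ (P 0, Q 0) (\<alpha> t)"
   unfolding rotP_def rotQ_def fst_conv snd_conv AB[of t, symmetric] by algebra+
  then show "P t = rotP (P 0, Q 0) (\<alpha> t)" "Q t = rotQ (P 0, Q 0) (\<alpha> t)"
   by (simp_all add: cos_cos_sin_sin)
 qed
 have "(c t, \<alpha> t) = geo_flow (t, (c 0, (P 0, Q 0)))"
 proof (rule geo_flow_unique[where y = "\<lambda>t. (c t, \<alpha> t)"])
  fix t
  have v: "velocity c t = (s' t, th' t)" by (simp add: s'_def th'_def)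
  have s'P: "s' t = P t / qq (c t)" using qq_nz[of "c t"] by (simp add: P_def)
  have "th' t = Q t / \<epsilon> - tor (fst (c t)) * s' t" using eps_pos by (simp add: Q_def)
  then have "(velocity c t, \<beta> t) = ((P t / qq (c t), Q t / \<epsilon> - tor (fst (c t)) * (P t / qq (c t))),
    kap (fst (c t)) * sin (snd (c t)) * (P t / qq (c t)))"
   by (simp only: v \<beta>_def s'P)
  also have "\<dots> = geo_field (P 0, Q 0) (c t, \<alpha> t)"
   by (simp only: geo_field_def PQ[of t, symmetric] fst_conv snd_conv)
  finally have "(velocity c t, \<beta> t) = geo_field (P 0, Q 0) (c t, \<alpha> t)" .
  then show "((\<lambda>t. (c t, \<alpha> t)) has_vector_derivative geo_field (P 0, Q 0) (c t, \<alpha> t)) (at t)"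
   by (rule subst) (rule has_vector_derivative_Pair[OF cd \<alpha>v])
 qed (simp add: \<alpha>0)
 then have "c t = Exp (c 0) (t *\<^sub>R (P 0, Q 0))" by (simp add: geo_flow_split)
 then show ?thesis by (simp add: Pv Qv u_def)
qed

end

section \<open>The normal bundle of the diagonal and its exponential map in coordinates\<close>

lemma velocity_Pair:
 fixes f :: "real \<Rightarrow> 'a::euclidean_space" and g :: "real \<Rightarrow> 'b::euclidean_space"
 assumes "smooth f UNIV" "smooth g UNIV"
 shows "velocity (\<lambda>t. (f t, g t)) = (\<lambda>t. (velocity f t, velocity g t))"
 using velocityI[OF has_vector_derivative_Pair[OF sm_velocity(2)[OF assms(1)] sm_velocity(2)[OF assms(2)]]] by blast

lemma acceleration_Pair:
 fixes f :: "real \<Rightarrow> 'a::euclidean_space" and g :: "real \<Rightarrow> 'b::euclidean_space"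
 assumes "smooth f UNIV" "smooth g UNIV"
 shows "acceleration (\<lambda>t. (f t, g t)) t = (acceleration f t, acceleration g t)"
 unfolding acceleration_def velocity_Pair[OF assms]
 by (subst velocity_Pair) (auto intro: sm_velocity assms)

lemma cis_eq_iff: "cis a = cis b \<longleftrightarrow> (\<exists>n::int. b = a + of_int n * (2 * pi))"
proof -
 have "cis a = cis b \<longleftrightarrow> sin b = sin a \<and> cos b = cos a" by (auto simp: complex_eq_iff)
 then show ?thesis unfolding sin_cos_eq_iff by (simp add: mult_ac)
qed

lemma tube_map2_eq: "tube_map2 \<gamma> \<epsilon> = (\<lambda>z. (tube_map \<gamma> \<epsilon> (fst z), tube_map \<gamma> \<epsilon> (snd z)))"
 by (auto simp: tube_map2_def)

lemma torus_pt2_eq: "torus_pt2 T z = (torus_pt T (fst z), torus_pt T (snd z))"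
 by (cases z) (simp add: torus_pt2_def)

context tube
begin

definition nvec :: "real \<times> real \<Rightarrow> real \<times> real \<Rightarrow> real^3" where
 "nvec x a = fst a *\<^sub>R tv (fst x) + snd a *\<^sub>R ww x"

text \<open>\<open>Nb\<close> parametrizes the normal bundle of the diagonal by base points in the
  plane and frame coordinates: the vectors orthogonal to all \<open>(u, u)\<close> are those of the
  form \<open>(u, - u)\<close>. \<open>Pr\<close> is the exponential map in these coordinates, as
  \<open>exp_map_Nb\<close> shows.\<close>

definition Nb :: "(real \<times> real) \<times> (real \<times> real) \<Rightarrow> torus2 \<times> (real^3) \<times> (real^3)" where
 "Nb z = (torus_pt2 T (fst z, fst z), (nvec (fst z) (snd z), - nvec (fst z) (snd z)))"

definition Pr :: "(real \<times> real) \<times> (real \<times> real) \<Rightarrow> (real \<times> real) \<times> (real \<times> real)" where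
 "Pr z = (Exp (fst z) (snd z), Exp (fst z) (- snd z))"

lemma nvec_inner: "nvec x a \<bullet> nvec x b = a \<bullet> b"
 by (simp add: nvec_def inner_add_left inner_add_right torus_frame_inner tv_tv inner_prod_def)

lemma nvec_tv: "nvec x a \<bullet> tv (fst x) = fst a" and nvec_ww: "nvec x a \<bullet> ww x = snd a"
 and nvec_vv: "nvec x a \<bullet> vv x = 0"
 by (simp_all add: nvec_def inner_add_left torus_frame_inner tv_tv)

lemma nvec_minus: "nvec x (- a) = - nvec x a" by (simp add: nvec_def)

lemma nvec_lattice: "l \<in> lattice \<Longrightarrow> nvec (x + l) a = nvec x a"
 by (simp add: nvec_def tv_lattice ww_lattice)

lemma hd_Gamma_nvec: "(\<Gamma> has_derivative (\<lambda>d. nvec p (qq p * fst d, \<epsilon> * (snd d + tor (fst p) * fst d)))) (at p)"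
 using hd_Gamma[of p] by (simp add: nvec_def)

lemma tangent_coordinates_surj: "\<exists>d. a = (qq p * fst d, \<epsilon> * (snd d + tor (fst p) * fst d))"
 using qq_nz[of p] eps_pos
 by (intro exI[of _ "(fst a / qq p, snd a / \<epsilon> - tor (fst p) * (fst a / qq p))"]) (cases a, simp)

lemma tangent_space2_eq: "tangent_space2 \<gamma> \<epsilon> (p, p') = {(nvec p a, nvec p' b) | a b. True}"
proof -
 have "(tube_map2 \<gamma> \<epsilon> has_derivative (\<lambda>d. (nvec p (qq p * fst (fst d), \<epsilon> * (snd (fst d) + tor (fst p) * fst (fst d))),
   nvec p' (qq p' * fst (snd d), \<epsilon> * (snd (snd d) + tor (fst p') * fst (snd d)))))) (at (p, p'))"
  unfolding tube_map2_eq
  by (intro has_derivative_Pair has_derivative_compose[OF has_derivative_fst[OF has_derivative_ident]]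
    has_derivative_compose[OF has_derivative_snd[OF has_derivative_ident]]) (simp_all add: hd_Gamma_nvec)
 then have eq: "frechet (tube_map2 \<gamma> \<epsilon>) (at (p, p')) =
   (\<lambda>d. (nvec p (qq p * fst (fst d), \<epsilon> * (snd (fst d) + tor (fst p) * fst (fst d))),
   nvec p' (qq p' * fst (snd d), \<epsilon> * (snd (snd d) + tor (fst p') * fst (snd d)))))"
  by (rule frechet_derivative_at[symmetric])
 show ?thesis
 proof (intro set_eqI iffI)
  fix u assume "u \<in> {(nvec p a, nvec p' b) | a b. True}"
  then obtain a b where u: "u = (nvec p a, nvec p' b)" by blast
  obtain d where d: "a = (qq p * fst d, \<epsilon> * (snd d + tor (fst p) * fst d))" using tangent_coordinates_surj by blast
  obtain d' where d': "b = (qq p' * fst d', \<epsilon> * (snd d' + tor (fst p') * fst d'))" using tangent_coordinates_surj by blast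
  show "u \<in> tangent_space2 \<gamma> \<epsilon> (p, p')" unfolding tangent_space2_def eq u
   by (rule range_eqI[of _ _ "(d, d')"]) (simp add: d d')
 qed (auto simp: tangent_space2_def eq)
qed

lemma diagonal_tangent_space_eq: "diagonal_tangent_space \<gamma> \<epsilon> x = {(nvec x a, nvec x a) | a. True}"
proof -
 have "((\<lambda>x. tube_map2 \<gamma> \<epsilon> (x, x)) has_derivative (\<lambda>d. (nvec x (qq x * fst d, \<epsilon> * (snd d + tor (fst x) * fst d)),
   nvec x (qq x * fst d, \<epsilon> * (snd d + tor (fst x) * fst d))))) (at x)"
  unfolding tube_map2_eq fst_conv snd_conv by (intro has_derivative_Pair hd_Gamma_nvec)
 then have eq: "frechet (\<lambda>x. tube_map2 \<gamma> \<epsilon> (x, x)) (at x) =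
   (\<lambda>d. (nvec x (qq x * fst d, \<epsilon> * (snd d + tor (fst x) * fst d)),
   nvec x (qq x * fst d, \<epsilon> * (snd d + tor (fst x) * fst d))))"
  by (rule frechet_derivative_at[symmetric])
 show ?thesis
 proof (intro set_eqI iffI)
  fix u assume "u \<in> {(nvec x a, nvec x a) | a. True}"
  then obtain a where u: "u = (nvec x a, nvec x a)" by blast
  obtain d where d: "a = (qq x * fst d, \<epsilon> * (snd d + tor (fst x) * fst d))" using tangent_coordinates_surj by blast
  show "u \<in> diagonal_tangent_space \<gamma> \<epsilon> x" unfolding diagonal_tangent_space_def eq u
   by (rule range_eqI[of _ _ d]) (simp add: d)
 qed (auto simp: diagonal_tangent_space_def eq)
qed

lemma diagonal_normal_space_eq: "diagonal_normal_space \<gamma> \<epsilon> x = {(nvec x a, - nvec x a) | a. True}"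
proof (intro set_eqI iffI)
 fix u assume u: "u \<in> diagonal_normal_space \<gamma> \<epsilon> x"
 then obtain a b where ab: "u = (nvec x a, nvec x b)"
  unfolding diagonal_normal_space_def tangent_space2_eq by blast
 have "u \<bullet> (nvec x (a + b), nvec x (a + b)) = 0"
  using u unfolding diagonal_normal_space_def diagonal_tangent_space_eq by blast
 then have "(a + b) \<bullet> (a + b) = 0" by (simp add: ab nvec_inner inner_add_left inner_add_right)
 then have "a + b = 0" by (simp only: inner_eq_zero_iff)
 then have b: "b = - a" by (simp add: eq_neg_iff_add_eq_0 add.commute)
 show "u \<in> {(nvec x a, - nvec x a) | a. True}" unfolding ab b nvec_minus by (rule CollectI, rule exI[of _ a]) simp
next
 fix u assume "u \<in> {(nvec x a, - nvec x a) | a. True}"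
 then obtain a where a: "u = (nvec x a, nvec x (- a))" by (auto simp: nvec_minus)
 have "u \<in> {(nvec x a, nvec x b) | a b. True}" unfolding a by blast
 moreover have "u \<bullet> w = 0" if w: "w \<in> {(nvec x a, nvec x a) | a. True}" for w
 proof -
  obtain b where "w = (nvec x b, nvec x b)" using w by blast
  then show ?thesis by (simp add: a nvec_inner)
 qed
 ultimately show "u \<in> diagonal_normal_space \<gamma> \<epsilon> x"
  unfolding diagonal_normal_space_def diagonal_tangent_space_eq tangent_space2_eq by blast
qed

lemma norm_nvec_pair: "norm (nvec x a, - nvec x a) = sqrt 2 * norm a"
proof -
 have n: "norm (nvec x a) = norm a" by (simp add: norm_eq_sqrt_inner nvec_inner)
 have "norm (nvec x a, - nvec x a) = sqrt (2 * (norm a)\<^sup>2)" by (simp add: norm_Pair n)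
 then show ?thesis by (simp add: real_sqrt_mult)
qed

lemma normal_disc_bundle_eq: "normal_disc_bundle T \<gamma> \<epsilon> r = Nb ` {z. sqrt 2 * norm (snd z) \<le> r}"
proof (intro set_eqI iffI)
 fix n assume "n \<in> normal_disc_bundle T \<gamma> \<epsilon> r"
 then obtain x u where n: "n = (torus_pt2 T (x, x), u)" "u \<in> diagonal_normal_space \<gamma> \<epsilon> x" "norm u \<le> r"
  unfolding normal_disc_bundle_def by blast
 then obtain a where "u = (nvec x a, - nvec x a)" unfolding diagonal_normal_space_eq by blast
 then show "n \<in> Nb ` {z. sqrt 2 * norm (snd z) \<le> r}"
  using n by (intro image_eqI[of _ _ "(x, a)"]) (auto simp: Nb_def norm_nvec_pair)
next
 fix n assume "n \<in> Nb ` {z. sqrt 2 * norm (snd z) \<le> r}"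
 then obtain z where z: "n = Nb z" "sqrt 2 * norm (snd z) \<le> r" by blast
 show "n \<in> normal_disc_bundle T \<gamma> \<epsilon> r"
  unfolding normal_disc_bundle_def z(1) Nb_def diagonal_normal_space_eq
  by (rule CollectI, rule exI[of _ "fst z"], rule exI[of _ "(nvec (fst z) (snd z), - nvec (fst z) (snd z))"],
    intro conjI, rule refl, blast, simp only: norm_nvec_pair z(2))
qed

lemma torus_pt_eq_iff: "torus_pt T x = torus_pt T y \<longleftrightarrow> y - x \<in> lattice"
proof -
 obtain s \<theta> s' \<theta>' where xy: "x = (s, \<theta>)" "y = (s', \<theta>')" by (cases x, cases y)
 have "2 * pi * s' / T = 2 * pi * s / T + of_int n * (2 * pi) \<longleftrightarrow> s' - s = of_int n * T" for n
 proof -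
  have "2 * pi * s' / T - (2 * pi * s / T + of_int n * (2 * pi)) = 2 * pi / T * ((s' - s) - of_int n * T)"
   using T_pos by (simp add: field_simps)
  then have "2 * pi * s' / T - (2 * pi * s / T + of_int n * (2 * pi)) = 0 \<longleftrightarrow> (s' - s) - of_int n * T = 0"
   using T_pos by simp
  then show ?thesis by simp
 qed
 then have "(\<exists>n::int. 2 * pi * s' / T = 2 * pi * s / T + of_int n * (2 * pi)) \<longleftrightarrow> (\<exists>n::int. s' - s = of_int n * T)"
  by blast
 moreover have "(\<exists>n::int. \<theta>' = \<theta> + of_int n * (2 * pi)) \<longleftrightarrow> (\<exists>n::int. \<theta>' - \<theta> = of_int n * (2 * pi))"
  by (intro ex_cong1) auto
 ultimately show ?thesis
  by (auto simp: xy torus_pt_def cis_eq_iff lattice_def)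
qed

lemma torus_pt2_eq_iff: "torus_pt2 T z = torus_pt2 T w \<longleftrightarrow> fst w - fst z \<in> lattice \<and> snd w - snd z \<in> lattice"
 by (simp add: torus_pt2_eq torus_pt_eq_iff)

lemma Nb_eq_iff: "Nb z = Nb w \<longleftrightarrow> fst w - fst z \<in> lattice \<and> snd z = snd w"
proof
 assume eq: "Nb z = Nb w"
 then have l: "fst w - fst z \<in> lattice" by (simp add: Nb_def torus_pt2_eq_iff)
 have "nvec (fst w) (snd w) = nvec (fst z) (snd w)"
  using nvec_lattice[OF l, of "fst z" "snd w"] by simp
 then have n: "nvec (fst z) (snd z) = nvec (fst z) (snd w)" using eq by (simp add: Nb_def)
 have "snd z = snd w"
  using nvec_tv[of "fst z" "snd z"] nvec_tv[of "fst z" "snd w"] nvec_ww[of "fst z" "snd z"] nvec_ww[of "fst z" "snd w"]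
  unfolding n by (simp add: prod_eq_iff)
 with l show "fst w - fst z \<in> lattice \<and> snd z = snd w" by blast
next
 assume a: "fst w - fst z \<in> lattice \<and> snd z = snd w"
 then show "Nb z = Nb w"
  using nvec_lattice[of "fst w - fst z" "fst z" "snd w"] by (simp add: Nb_def torus_pt2_eq_iff)
qed

lemma Pr_lattice: "l \<in> lattice \<Longrightarrow> Pr (x + l, a) = Pr (x, a) + (l, l)"
 by (simp add: Pr_def Exp_lattice)

lemma geodesic2_Exp: "geodesic2 \<gamma> \<epsilon> (\<lambda>t. (Exp x (t *\<^sub>R a), Exp y (t *\<^sub>R b)))"
 and geodesic2_Exp_velocity: "velocity (\<lambda>t. tube_map2 \<gamma> \<epsilon> (Exp x (t *\<^sub>R a), Exp y (t *\<^sub>R b))) 0 = (nvec x a, nvec y b)"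
proof -
 have s: "smooth (\<lambda>t. Exp x (t *\<^sub>R a)) UNIV" for x a by (intro sm_Exp' sm_intros open_UNIV)
 have sG: "smooth (\<lambda>t. \<Gamma> (Exp x (t *\<^sub>R a))) UNIV" for x a by (rule sm_compose_UNIV[OF sm_Gamma s])
 have acc: "acceleration (\<lambda>t. tube_map2 \<gamma> \<epsilon> (Exp x (t *\<^sub>R a), Exp y (t *\<^sub>R b))) t =
   (acceleration (\<lambda>t. \<Gamma> (Exp x (t *\<^sub>R a))) t, acceleration (\<lambda>t. \<Gamma> (Exp y (t *\<^sub>R b))) t)" for t
  unfolding tube_map2_eq fst_conv snd_conv by (rule acceleration_Pair[OF sG sG])
 show "geodesic2 \<gamma> \<epsilon> (\<lambda>t. (Exp x (t *\<^sub>R a), Exp y (t *\<^sub>R b)))"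
  unfolding geodesic2_def
 proof (intro conjI allI ballI)
  show "smooth (\<lambda>t. (Exp x (t *\<^sub>R a), Exp y (t *\<^sub>R b))) UNIV" by (rule sm_Pair[OF s s])
  fix t w assume "w \<in> tangent_space2 \<gamma> \<epsilon> (Exp x (t *\<^sub>R a), Exp y (t *\<^sub>R b))"
  then obtain a' b' where w: "w = (nvec (Exp x (t *\<^sub>R a)) a', nvec (Exp y (t *\<^sub>R b)) b')"
   unfolding tangent_space2_eq by blast
  show "acceleration (\<lambda>t. tube_map2 \<gamma> \<epsilon> (Exp x (t *\<^sub>R a), Exp y (t *\<^sub>R b))) t \<bullet> w = 0"
   unfolding acc w geo_acceleration by (simp add: inner_commute[of "vv _"] nvec_vv)
 qed
 have v: "velocity (\<lambda>t. \<Gamma> (Exp x (t *\<^sub>R a))) 0 = nvec x a" for x a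
  using velocityI[OF geo_Gamma_deriv[of x a 0]] by (simp add: nvec_def geoP_0 geoQ_0 Exp_0)
 show "velocity (\<lambda>t. tube_map2 \<gamma> \<epsilon> (Exp x (t *\<^sub>R a), Exp y (t *\<^sub>R b))) 0 = (nvec x a, nvec y b)"
  unfolding tube_map2_eq fst_conv snd_conv velocity_Pair[OF sG sG] v by simp
qed

text \<open>\<open>exp_map\<close> is a definite description over geodesics in the product, so
  uniqueness of the endpoint is the real content. Testing the geodesic equation on tangent vectors
  with one zero component shows that both components are geodesics, hence given by
  \<open>Exp\<close>. Their starting points are known only modulo \<open>lattice\<close>, which
  moves the endpoints by the same lattice vectors.\<close>

lemma exp_map_Nb: "exp_map T \<gamma> \<epsilon> (Nb z) = torus_pt2 T (Pr z)"
proof -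
 obtain x a where z: "z = (x, a)" by (cases z)
 have "exp_map T \<gamma> \<epsilon> (Nb z) = (THE q. \<exists>c. geodesic2 \<gamma> \<epsilon> c \<and> torus_pt2 T (c 0) = torus_pt2 T (x, x) \<and>
   velocity (\<lambda>t. tube_map2 \<gamma> \<epsilon> (c t)) 0 = (nvec x a, nvec x (- a)) \<and> torus_pt2 T (c 1) = q)"
  by (simp add: exp_map_def Nb_def z nvec_minus)
 also have "\<dots> = torus_pt2 T (Pr z)"
 proof (rule the_equality)
  let ?c = "\<lambda>t. (Exp x (t *\<^sub>R a), Exp x (t *\<^sub>R (- a)))"
  show "\<exists>c. geodesic2 \<gamma> \<epsilon> c \<and> torus_pt2 T (c 0) = torus_pt2 T (x, x) \<and>
    velocity (\<lambda>t. tube_map2 \<gamma> \<epsilon> (c t)) 0 = (nvec x a, nvec x (- a)) \<and> torus_pt2 T (c 1) = torus_pt2 T (Pr z)"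
   using geodesic2_Exp[of x a x "- a"] geodesic2_Exp_velocity[of x a x "- a"]
   by (intro exI[of _ ?c]) (simp add: Exp_0 Pr_def z)
  fix q assume "\<exists>c. geodesic2 \<gamma> \<epsilon> c \<and> torus_pt2 T (c 0) = torus_pt2 T (x, x) \<and>
    velocity (\<lambda>t. tube_map2 \<gamma> \<epsilon> (c t)) 0 = (nvec x a, nvec x (- a)) \<and> torus_pt2 T (c 1) = q"
  then obtain c where c: "geodesic2 \<gamma> \<epsilon> c" "torus_pt2 T (c 0) = torus_pt2 T (x, x)"
    "velocity (\<lambda>t. tube_map2 \<gamma> \<epsilon> (c t)) 0 = (nvec x a, nvec x (- a))" "torus_pt2 T (c 1) = q" by blast
  have sc: "smooth c UNIV" using c(1) by (simp add: geodesic2_def)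
  have s1: "smooth (\<lambda>t. fst (c t)) UNIV" and s2: "smooth (\<lambda>t. snd (c t)) UNIV"
   by (intro sm_fst sm_snd sc)+
  have sG: "smooth (\<lambda>t. \<Gamma> (fst (c t))) UNIV" "smooth (\<lambda>t. \<Gamma> (snd (c t))) UNIV"
   by (rule sm_compose_UNIV[OF sm_Gamma s1], rule sm_compose_UNIV[OF sm_Gamma s2])
  have acc: "acceleration (\<lambda>t. tube_map2 \<gamma> \<epsilon> (c t)) t = (acceleration (\<lambda>t. \<Gamma> (fst (c t))) t, acceleration (\<lambda>t. \<Gamma> (snd (c t))) t)" for t
   unfolding tube_map2_eq by (rule acceleration_Pair[OF sG])
  have vel: "velocity (\<lambda>t. \<Gamma> (fst (c t))) 0 = nvec x a" "velocity (\<lambda>t. \<Gamma> (snd (c t))) 0 = nvec x (- a)"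
   using c(3) unfolding tube_map2_eq velocity_Pair[OF sG] by auto
  have perp: "acceleration (\<lambda>t. \<Gamma> (fst (c t))) t \<bullet> nvec (fst (c t)) a' + acceleration (\<lambda>t. \<Gamma> (snd (c t))) t \<bullet> nvec (snd (c t)) b' = 0" for t a' b'
  proof -
   have "(nvec (fst (c t)) a', nvec (snd (c t)) b') \<in> tangent_space2 \<gamma> \<epsilon> (fst (c t), snd (c t))"
    unfolding tangent_space2_eq by blast
   then have "(nvec (fst (c t)) a', nvec (snd (c t)) b') \<in> tangent_space2 \<gamma> \<epsilon> (c t)" by simp
   then have "acceleration (\<lambda>t. tube_map2 \<gamma> \<epsilon> (c t)) t \<bullet> (nvec (fst (c t)) a', nvec (snd (c t)) b') = 0"
    using c(1) unfolding geodesic2_def by blast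
   then show ?thesis unfolding acc by simp
  qed
  have n: "nvec p (1, 0) = tv (fst p)" "nvec p (0, 1) = ww p" "nvec p (0, 0) = 0" for p by (simp_all add: nvec_def)
  have p1: "acceleration (\<lambda>t. \<Gamma> (fst (c t))) t \<bullet> tv (fst (fst (c t))) = 0" "acceleration (\<lambda>t. \<Gamma> (fst (c t))) t \<bullet> ww (fst (c t)) = 0"
   "acceleration (\<lambda>t. \<Gamma> (snd (c t))) t \<bullet> tv (fst (snd (c t))) = 0" "acceleration (\<lambda>t. \<Gamma> (snd (c t))) t \<bullet> ww (snd (c t)) = 0" for t
   using perp[of t "(1, 0)" "(0, 0)"] perp[of t "(0, 1)" "(0, 0)"] perp[of t "(0, 0)" "(1, 0)"] perp[of t "(0, 0)" "(0, 1)"]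
   by (simp_all add: n)
  obtain l l' where l: "l \<in> lattice" "l' \<in> lattice" "fst (c 0) = x + l" "snd (c 0) = x + l'"
  proof (rule that[of "fst (c 0) - x" "snd (c 0) - x"])
   have "fst (c 0) - x \<in> lattice \<and> snd (c 0) - x \<in> lattice"
    using c(2)[symmetric] unfolding torus_pt2_eq_iff by simp
   then show "fst (c 0) - x \<in> lattice" "snd (c 0) - x \<in> lattice" by auto
  qed auto
  have comp: "nvec x a \<bullet> tv (fst (x + l)) = fst a" "nvec x a \<bullet> ww (x + l) = snd a" if "l \<in> lattice" for a l
   using that nvec_tv[of x a] nvec_ww[of x a] by (simp_all add: tv_lattice ww_lattice)
  have "fst (c 1) = Exp x a + l"
   using geodesic_is_Exp[OF s1 p1(1,2), of 1] l comp[OF l(1)] unfolding vel by (simp add: Exp_lattice)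
  moreover have "snd (c 1) = Exp x (- a) + l'"
   using geodesic_is_Exp[OF s2 p1(3,4), of 1] l comp[OF l(2), of "- a"] unfolding vel
   by (simp add: Exp_lattice uminus_prod_def)
  ultimately show "q = torus_pt2 T (Pr z)"
   using c(4) l lattice_minus[OF l(1)] lattice_minus[OF l(2)] by (auto simp: torus_pt2_eq_iff Pr_def z)
 qed
 finally show ?thesis .
qed

lemma tubular_nbhd_eq: "tubular_nbhd T \<gamma> \<epsilon> r = (\<lambda>z. torus_pt2 T (Pr z)) ` {z. sqrt 2 * norm (snd z) \<le> r}"
 unfolding tubular_nbhd_def normal_disc_bundle_eq image_image exp_map_Nb ..

end

section \<open>Taylor expansions along geodesics\<close>

lemma taylor_step:
 fixes g h :: "real \<Rightarrow> real"
 assumes d: "\<And>t. (g has_real_derivative h t) (at t)" and g0: "g 0 = 0"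
  and h: "((\<lambda>t. h t / t ^ n) \<longlongrightarrow> 0) (at 0)" and h0: "h 0 = 0"
 shows "((\<lambda>t. g t / t ^ Suc n) \<longlongrightarrow> 0) (at 0)"
proof (rule LIM_I)
 fix e :: real assume "e > 0"
 define e' where "e' = e / 2"
 have e: "e' > 0" "e' < e" using \<open>e > 0\<close> by (auto simp: e'_def)
 obtain r where r: "r > 0" "\<And>t. t \<noteq> 0 \<Longrightarrow> \<bar>t\<bar> < r \<Longrightarrow> \<bar>h t / t ^ n\<bar> < e'"
  using LIM_D[OF h e(1)] by auto
 have hb: "\<bar>h \<xi>\<bar> \<le> e' * \<bar>t\<bar> ^ n" if "\<bar>\<xi>\<bar> \<le> \<bar>t\<bar>" "\<bar>t\<bar> < r" for \<xi> t
 proof (cases "\<xi> = 0")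
  case True then show ?thesis using h0 e by simp
 next
  case False
  have "\<bar>h \<xi>\<bar> = \<bar>h \<xi> / \<xi> ^ n\<bar> * \<bar>\<xi>\<bar> ^ n" using False by (simp add: power_abs)
  also have "\<dots> \<le> e' * \<bar>t\<bar> ^ n"
   using r(2)[OF False] that e by (intro mult_mono power_mono) auto
  finally show ?thesis .
 qed
 have "\<bar>g t / t ^ Suc n\<bar> < e" if t: "t \<noteq> 0" "\<bar>t\<bar> < r" for t
 proof -
  have "\<exists>\<xi>. \<bar>\<xi>\<bar> \<le> \<bar>t\<bar> \<and> g t = t * h \<xi>"
  proof (cases "t > 0")
   case True
   then obtain \<xi> where "0 < \<xi>" "\<xi> < t" "g t - g 0 = (t - 0) * h \<xi>" using MVT2[of 0 t g h] d by blast
   then show ?thesis using g0 by (intro exI[of _ \<xi>]) auto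
  next
   case False
   then have "t < 0" using t by simp
   then obtain \<xi> where "t < \<xi>" "\<xi> < 0" "g 0 - g t = (0 - t) * h \<xi>" using MVT2[of t 0 g h] d by blast
   then show ?thesis using g0 by (intro exI[of _ \<xi>]) auto
  qed
  then obtain \<xi> where \<xi>: "\<bar>\<xi>\<bar> \<le> \<bar>t\<bar>" "g t = t * h \<xi>" by blast
  have "\<bar>g t / t ^ Suc n\<bar> = \<bar>h \<xi>\<bar> / \<bar>t\<bar> ^ n" using t by (simp add: \<xi>(2) abs_mult power_abs)
  also have "\<dots> \<le> e'" using hb[OF \<xi>(1) t(2)] t by (simp add: divide_le_eq)
  finally show ?thesis using e by simp
 qed
 then show "\<exists>s>0. \<forall>t. t \<noteq> 0 \<and> norm (t - 0) < s \<longrightarrow> norm (g t / t ^ Suc n - 0) < e"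
  using r(1) by (intro exI[of _ r]) auto
qed

lemma taylor_base:
 fixes g :: "real \<Rightarrow> real"
 assumes "(g has_real_derivative c) (at 0)"
 shows "((\<lambda>t. (g t - g 0 - c * t) / t ^ 1) \<longlongrightarrow> 0) (at 0)"
proof -
 have "((\<lambda>t. (g t - g 0) / (t - 0)) \<longlongrightarrow> c) (at 0)"
  using assms by (simp add: has_field_derivative_iff)
 then have "((\<lambda>t. (g t - g 0) / (t - 0) - c) \<longlongrightarrow> 0) (at 0)" by (simp add: LIM_zero)
 then show ?thesis
  by (rule Lim_transform_eventually) (auto simp: eventually_at field_simps intro!: exI[of _ 1])
qed

lemma taylor2:
 fixes f g :: "real \<Rightarrow> real"
 assumes "\<And>t. (f has_real_derivative g t) (at t)" "(g has_real_derivative c) (at 0)"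
 shows "((\<lambda>t. (f t - f 0 - g 0 * t - c / 2 * t\<^sup>2) / t ^ 2) \<longlongrightarrow> 0) (at 0)"
proof -
 have "((\<lambda>t. (f t - f 0 - g 0 * t - c / 2 * t\<^sup>2) / t ^ Suc 1) \<longlongrightarrow> 0) (at 0)"
  by (rule taylor_step[where h = "\<lambda>t. g t - g 0 - c * t", OF _ _ taylor_base[OF assms(2)]])
   (auto intro!: derivative_eq_intros assms(1))
 then show ?thesis by (simp add: numeral_2_eq_2)
qed

lemma taylor3:
 fixes f g k :: "real \<Rightarrow> real"
 assumes "\<And>t. (f has_real_derivative g t) (at t)" "\<And>t. (g has_real_derivative k t) (at t)"
  "(k has_real_derivative c) (at 0)"
 shows "((\<lambda>t. (f t - f 0 - g 0 * t - k 0 / 2 * t\<^sup>2 - c / 6 * t ^ 3) / t ^ 3) \<longlongrightarrow> 0) (at 0)"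
proof -
 have "((\<lambda>t. (f t - f 0 - g 0 * t - k 0 / 2 * t\<^sup>2 - c / 6 * t ^ 3) / t ^ Suc 2) \<longlongrightarrow> 0) (at 0)"
  by (rule taylor_step[where h = "\<lambda>t. g t - g 0 - k 0 * t - c / 2 * t\<^sup>2", OF _ _ taylor2[OF assms(2,3)]])
   (auto intro!: derivative_eq_intros assms(1))
 then show ?thesis by (simp add: numeral_3_eq_3)
qed

context tube
begin

text \<open>The derivative of \<open>kform\<close> along the geodesic with initial velocity \<open>nvec x a\<close>.\<close>

definition cform :: "real \<times> real \<Rightarrow> real \<times> real \<Rightarrow> real" where
 "cform x a = (fst a)\<^sup>2 / (qq x)\<^sup>2 * (fst a * (velocity kap (fst x) * cos (snd x) + kap (fst x) * tor (fst x) * sin (snd x)) / qq x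
   - 3 * kap (fst x) * sin (snd x) * snd a / \<epsilon>)"

lemma kform_deriv:
 "((\<lambda>t. kform (Exp x (t *\<^sub>R a)) (geoP x a t, geoQ x a t)) has_real_derivative
   cform (Exp x (t *\<^sub>R a)) (geoP x a t, geoQ x a t)) (at t)"
proof -
 let ?c = "\<lambda>t. Exp x (t *\<^sub>R a)"
 let ?s = "\<lambda>t. fst (?c t)" and ?th = "\<lambda>t. snd (?c t)"
 let ?P = "geoP x a t" and ?Q = "geoQ x a t" and ?q = "qq (?c t)"
 let ?s' = "?P / ?q" and ?th' = "?Q / \<epsilon> - tor (?s t) * (?P / ?q)"
 define k k' \<tau> C S q P Q where "k = kap (?s t)" "k' = velocity kap (?s t)" "\<tau> = tor (?s t)" "C = cos (?th t)" "S = sin (?th t)"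
   "q = ?q" "P = ?P" "Q = ?Q"
 note defs = this
 have q: "q \<noteq> 0" "q = 1 - \<epsilon> * k * C" by (simp_all add: defs qq_nz) (simp add: qq_def)
 have k: "((\<lambda>t. kap (?s t)) has_real_derivative k' * (P / q)) (at t)"
  using hvd_chain[OF sm_velocity(2)[OF sm_kap] fst_geo_deriv[of x a t]]
  by (simp add: has_real_derivative_iff_has_vector_derivative defs mult_ac)
 have th: "(?th has_real_derivative (Q / \<epsilon> - \<tau> * (P / q))) (at t)"
  using snd_geo_deriv[of x a t] by (simp add: defs)
 have C: "((\<lambda>t. cos (?th t)) has_real_derivative - S * (Q / \<epsilon> - \<tau> * (P / q))) (at t)"
  by (auto intro!: derivative_eq_intros th simp: defs)
 define A where "A = k' * (P / q) * C + k * (- S * (Q / \<epsilon> - \<tau> * (P / q)))"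
 have kC: "((\<lambda>t. kap (?s t) * cos (?th t)) has_real_derivative A) (at t)"
  by (rule DERIV_cong[OF DERIV_mult[OF k C]]) (simp add: A_def defs)
 have qd: "((\<lambda>t. qq (?c t)) has_real_derivative - \<epsilon> * A) (at t)"
 proof -
  have "((\<lambda>t. 1 - \<epsilon> * (kap (?s t) * cos (?th t))) has_real_derivative - \<epsilon> * A) (at t)"
   by (rule DERIV_cong[OF DERIV_diff[OF DERIV_const DERIV_cmult[OF kC]]]) simp
  then show ?thesis by (simp add: qq_def mult_ac)
 qed
 have P': "(geoP x a has_real_derivative - (Q * (k * S * (P / q)))) (at t)"
  and Q': "(geoQ x a has_real_derivative P * (k * S * (P / q))) (at t)"
  using geoP_deriv[of x a t] geoQ_deriv[of x a t] by (simp_all add: geo_rate_def defs)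
 have e: "\<epsilon> \<noteq> 0" using eps_pos by simp
 have d1: "((\<lambda>t. kap (?s t) * cos (?th t) / qq (?c t)) has_real_derivative (A * q - k * C * (- \<epsilon> * A)) / (q * q)) (at t)"
  by (rule DERIV_cong[OF DERIV_divide[OF kC qd qq_nz]]) (simp add: defs)
 \<comment> \<open>The left side is \<open>A * (q + \<epsilon> * k * C)\<close>, and the bracket is
   1 by the definition of \<open>qq\<close>. So the derivative of the normal curvature
   \<open>k * C / q\<close> in the direction \<open>tv\<close> is
   \<open>A / q\<^sup>2\<close>.\<close>
 have "A * q - k * C * (- \<epsilon> * A) = A" by (simp add: q(2) algebra_simps)
 with d1 have d1: "((\<lambda>t. kap (?s t) * cos (?th t) / qq (?c t)) has_real_derivative A / (q * q)) (at t)" by simp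
 have P2: "((\<lambda>t. (geoP x a t)\<^sup>2) has_real_derivative - (2 * P * (Q * (k * S * (P / q))))) (at t)"
  by (rule DERIV_cong[OF DERIV_power[OF P', of 2]]) (simp add: defs algebra_simps)
 have Q2: "((\<lambda>t. (geoQ x a t)\<^sup>2) has_real_derivative 2 * Q * (P * (k * S * (P / q)))) (at t)"
  by (rule DERIV_cong[OF DERIV_power[OF Q', of 2]]) (simp add: defs algebra_simps)
 have "((\<lambda>t. kap (?s t) * cos (?th t) / qq (?c t) * (geoP x a t)\<^sup>2 - (geoQ x a t)\<^sup>2 / \<epsilon>) has_real_derivative
   (A / (q * q) * P\<^sup>2 + - (2 * P * (Q * (k * S * (P / q)))) * (k * C / q)) - 2 * Q * (P * (k * S * (P / q))) / \<epsilon>) (at t)"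
  by (rule DERIV_cong[OF DERIV_diff[OF DERIV_mult[OF d1 P2] DERIV_cdivide[OF Q2]]]) (simp add: defs)
 moreover have "(A / (q * q) * P\<^sup>2 + - (2 * P * (Q * (k * S * (P / q)))) * (k * C / q)) - 2 * Q * (P * (k * S * (P / q))) / \<epsilon>
   = P\<^sup>2 / q\<^sup>2 * (P * (k' * C + k * \<tau> * S) / q - 3 * k * S * Q / \<epsilon>)"
 proof -
  have "- (2 * P * (Q * (k * S * (P / q)))) * (k * C / q) - 2 * Q * (P * (k * S * (P / q))) / \<epsilon>
    = - 2 * P\<^sup>2 * Q * k * S * (\<epsilon> * k * C + q) / (q\<^sup>2 * \<epsilon>)"
   using q(1) e by (simp add: field_simps power2_eq_square)
  also have "\<epsilon> * k * C + q = 1" by (simp add: q(2))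
  finally have 1: "- (2 * P * (Q * (k * S * (P / q)))) * (k * C / q) - 2 * Q * (P * (k * S * (P / q))) / \<epsilon>
    = - 2 * P\<^sup>2 * Q * k * S / (q\<^sup>2 * \<epsilon>)" by simp
  have "A / (q * q) * P\<^sup>2 - 2 * P\<^sup>2 * Q * k * S / (q\<^sup>2 * \<epsilon>) = P\<^sup>2 / q\<^sup>2 * (P * (k' * C + k * \<tau> * S) / q - 3 * k * S * Q / \<epsilon>)"
   using q(1) e unfolding A_def by (simp add: field_simps power2_eq_square)
  then show ?thesis using 1 by simp
 qed
 ultimately show ?thesis by (simp add: kform_def cform_def defs)
qed

end

context tube
begin

lemma sm_kform: "smooth f U \<Longrightarrow> smooth g U \<Longrightarrow> smooth (\<lambda>z. kform (f z) (g z)) U"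
 unfolding kform_def
 by (intro sm_intros sm_compose_UNIV[OF sm_kap] sm_compose_UNIV[OF sm_qq] sm_open) (use qq_nz eps_pos in auto)

lemma sm_cform: "smooth f U \<Longrightarrow> smooth g U \<Longrightarrow> smooth (\<lambda>z. cform (f z) (g z)) U"
 unfolding cform_def
 by (intro sm_intros sm_compose_UNIV[OF sm_kap] sm_compose_UNIV[OF sm_qq] sm_compose_UNIV[OF sm_tor]
   sm_compose_UNIV[OF sm_velocity(1)[OF sm_kap]] sm_open) (use qq_nz eps_pos in auto)

lemma sm_F1: "smooth (FI) UNIV" and sm_F2: "smooth (FII) UNIV"
 unfolding F1_def F2_def case_prod_unfold
 by (intro sm_intros sm_compose_UNIV[OF sm_Gamma] sm_compose_UNIV[OF sm_vv] open_UNIV)+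

lemma sm_Pr: "smooth Pr UNIV"
 unfolding Pr_def[abs_def] by (intro sm_intros sm_Exp' open_UNIV)

text \<open>Reversing the normal vector swaps the two endpoints, and with them the roles of the two
  normals. The expansion of \<open>F2\<close> is thus read off from that of \<open>F1\<close> at the
  opposite vector.\<close>

lemma F2_eq_F1: "FII (Pr (x, a)) = - FI (Pr (x, - a))"
 by (simp add: F1_def F2_def Pr_def inner_diff_left)

text \<open>With \<open>f0\<close> the geodesic in space, \<open>n0\<close> the normal along it and
  \<open>f1\<close>, \<open>n1\<close>, \<open>n2\<close> their derivatives, everything follows by
  differentiating \<open>f1 t \<bullet> n0 t = 0\<close>: first
  \<open>f1 t \<bullet> n1 t = - k t\<close>, then \<open>f1 t \<bullet> n2 t = - k' t\<close>,
  since \<open>f2\<close> is a multiple of the normal and hence orthogonal to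
  \<open>n1\<close>.\<close>

lemma geodesic_taylor:
 defines "E0 \<equiv> \<lambda>x e t. \<Gamma> (Exp x (t *\<^sub>R e))" and "N0 \<equiv> \<lambda>x e t. vv (Exp x (t *\<^sub>R e))"
 shows F1_taylor: "((\<lambda>t. ((E0 x e (- t) - E0 x e t) \<bullet> N0 x e t - 2 * kform x e * t\<^sup>2 - 2 / 3 * cform x e * t ^ 3) / t ^ 3) \<longlongrightarrow> 0) (at 0)"
  and height_taylor: "((\<lambda>t. ((E0 x e t - \<Gamma> x) \<bullet> vv x - kform x e / 2 * t\<^sup>2 - cform x e / 6 * t ^ 3) / t ^ 3) \<longlongrightarrow> 0) (at 0)"
  and tv_taylor: "((\<lambda>t. ((E0 x e t - \<Gamma> x) \<bullet> tv (fst x) - fst e * t) / t\<^sup>2) \<longlongrightarrow> 0) (at 0)"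
  and ww_taylor: "((\<lambda>t. ((E0 x e t - \<Gamma> x) \<bullet> ww x - snd e * t) / t\<^sup>2) \<longlongrightarrow> 0) (at 0)"
proof -
 define f0 where "f0 = E0 x e"
 define n0 where "n0 = N0 x e"
 define f1 where "f1 t = geoP x e t *\<^sub>R tv (fst (Exp x (t *\<^sub>R e))) + geoQ x e t *\<^sub>R ww (Exp x (t *\<^sub>R e))" for t
 define k where "k t = kform (Exp x (t *\<^sub>R e)) (geoP x e t, geoQ x e t)" for t
 define k' where "k' t = cform (Exp x (t *\<^sub>R e)) (geoP x e t, geoQ x e t)" for t
 define f2 where "f2 t = k t *\<^sub>R n0 t" for t
 define n1 where "n1 = velocity n0"
 define n2 where "n2 = velocity n1"
 define n3 where "n3 = velocity n2"
 define f3 where "f3 t = k t *\<^sub>R n1 t + k' t *\<^sub>R n0 t" for t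
 have z: "Exp x (0 *\<^sub>R e) = x" by (simp add: Exp_0)
 have at0: "f0 0 = \<Gamma> x" "n0 0 = vv x" "f1 0 = nvec x e" "k 0 = kform x e" "k' 0 = cform x e"
  by (simp_all add: f0_def n0_def E0_def N0_def f1_def k_def k'_def geoP_0 geoQ_0 nvec_def Exp_0)
 have df0: "(f0 has_vector_derivative f1 t) (at t)" for t
  unfolding f0_def E0_def f1_def by (rule geo_Gamma_deriv)
 have df1: "(f1 has_vector_derivative f2 t) (at t)" for t
  unfolding f1_def[abs_def] f2_def k_def n0_def N0_def by (rule geo_velocity_deriv)
 have dk: "(k has_real_derivative k' t) (at t)" for t
  unfolding k_def[abs_def] k'_def by (rule kform_deriv)
 have sn: "smooth n0 UNIV"
  unfolding n0_def N0_def by (intro sm_compose_UNIV[OF sm_vv] sm_Exp' sm_intros open_UNIV)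
 have dn0: "(n0 has_vector_derivative n1 t) (at t)" for t unfolding n1_def by (rule sm_velocity(2)[OF sn])
 have sn1: "smooth n1 UNIV" unfolding n1_def by (rule sm_velocity(1)[OF sn])
 have dn1: "(n1 has_vector_derivative n2 t) (at t)" for t unfolding n2_def by (rule sm_velocity(2)[OF sn1])
 have sn2: "smooth n2 UNIV" unfolding n2_def by (rule sm_velocity(1)[OF sn1])
 have dn2: "(n2 has_vector_derivative n3 t) (at t)" for t unfolding n3_def by (rule sm_velocity(2)[OF sn2])
 have df2: "(f2 has_vector_derivative f3 t) (at t)" for t
  unfolding f2_def[abs_def] f3_def by (rule has_vector_derivative_scaleR[OF dk dn0])
 have nn: "n0 t \<bullet> n0 t = 1" for t by (simp add: n0_def N0_def torus_frame_inner)
 have fn: "f1 t \<bullet> n0 t = 0" for t by (simp add: n0_def N0_def f1_def inner_add_left torus_frame_inner)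
 have nn1: "n0 t \<bullet> n1 t = 0" for t
  using hvd_inner_const[OF dn0 dn0 nn, of t] by (simp add: inner_commute)
 have fn1: "f1 t \<bullet> n1 t = - k t" for t
  using hvd_inner_const[OF df1 dn0 fn, of t] by (simp add: f2_def nn)
 have fn2: "f1 t \<bullet> n2 t = - k' t" for t
 proof -
  have "((\<lambda>t. f1 t \<bullet> n1 t) has_real_derivative f1 t \<bullet> n2 t + f2 t \<bullet> n1 t) (at t)"
   by (rule hvd_inner[OF df1 dn1])
  moreover have "((\<lambda>t. f1 t \<bullet> n1 t) has_real_derivative - k' t) (at t)"
   unfolding fn1 by (rule DERIV_minus[OF dk])
  ultimately have "f1 t \<bullet> n2 t + f2 t \<bullet> n1 t = - k' t" by (rule DERIV_unique)
  then show ?thesis by (simp add: f2_def nn1)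
 qed
 have f3n: "f3 t \<bullet> n0 t = k' t" for t by (simp add: f3_def inner_add_left nn nn1 inner_commute[of "n1 t"])
 have rev: "((\<lambda>t. g (- t)) has_vector_derivative - g') (at t)" if "(g has_vector_derivative g') (at (- t))"
  for g :: "real \<Rightarrow> real^3" and g' t
  using hvd_chain[where s = uminus and s' = "-1", OF that DERIV_minus[OF DERIV_ident]] by simp
 let ?d0 = "\<lambda>t. f0 (- t) - f0 t" and ?d1 = "\<lambda>t. - f1 (- t) - f1 t" and ?d2 = "\<lambda>t. f2 (- t) - f2 t" and ?d3 = "\<lambda>t. - f3 (- t) - f3 t"
 have d0: "(?d0 has_vector_derivative ?d1 t) (at t)" for t
  by (rule has_vector_derivative_diff[OF rev[OF df0] df0])
 have d1: "(?d1 has_vector_derivative ?d2 t) (at t)" for t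
  using has_vector_derivative_diff[OF has_vector_derivative_minus[OF rev[OF df1]] df1] by simp
 have d2: "(?d2 has_vector_derivative ?d3 t) (at t)" for t
  by (rule has_vector_derivative_diff[OF rev[OF df2] df2])
 have "((\<lambda>t. (?d0 t \<bullet> n0 t - ?d0 0 \<bullet> n0 0 - (?d0 0 \<bullet> n1 0 + ?d1 0 \<bullet> n0 0) * t
   - ((?d0 0 \<bullet> n2 0 + ?d1 0 \<bullet> n1 0) + (?d1 0 \<bullet> n1 0 + ?d2 0 \<bullet> n0 0)) / 2 * t\<^sup>2
   - (((?d0 0 \<bullet> n3 0 + ?d1 0 \<bullet> n2 0) + (?d1 0 \<bullet> n2 0 + ?d2 0 \<bullet> n1 0)) +
     ((?d1 0 \<bullet> n2 0 + ?d2 0 \<bullet> n1 0) + (?d2 0 \<bullet> n1 0 + ?d3 0 \<bullet> n0 0))) / 6 * t ^ 3) / t ^ 3) \<longlongrightarrow> 0) (at 0)"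
  by (rule taylor3[where g = "\<lambda>t. ?d0 t \<bullet> n1 t + ?d1 t \<bullet> n0 t"
     and k = "\<lambda>t. (?d0 t \<bullet> n2 t + ?d1 t \<bullet> n1 t) + (?d1 t \<bullet> n1 t + ?d2 t \<bullet> n0 t)"])
   (intro hvd_inner DERIV_add d0 d1 d2 dn0 dn1 dn2)+
 \<comment> \<open>The difference \<open>?d0\<close> is odd, so only its odd derivatives survive at
   0. The second derivative of the product becomes \<open>4 * k 0\<close>, the third
   \<open>6 * k' 0 - 2 * k' 0\<close>, which gives the coefficients 2 and 2/3.\<close>
 moreover have "?d0 0 = 0" "?d1 0 = - 2 *\<^sub>R f1 0" "?d2 0 = 0" "?d3 0 = - 2 *\<^sub>R f3 0" by (simp_all add: scaleR_2)
 ultimately have "((\<lambda>t. (?d0 t \<bullet> n0 t - 2 * k 0 * t\<^sup>2 - 2 / 3 * k' 0 * t ^ 3) / t ^ 3) \<longlongrightarrow> 0) (at 0)"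
  by (simp add: fn fn1 fn2 f3n mult.assoc)
 then show "((\<lambda>t. ((E0 x e (- t) - E0 x e t) \<bullet> N0 x e t - 2 * kform x e * t\<^sup>2 - 2 / 3 * cform x e * t ^ 3) / t ^ 3) \<longlongrightarrow> 0) (at 0)"
  by (simp add: f0_def n0_def at0(4,5)[symmetric])
 have dc: "((\<lambda>t. g t \<bullet> c) has_real_derivative g' \<bullet> c) (at t)" if "(g has_vector_derivative g') (at t)" for g g' t and c :: "real^3"
  using hvd_inner[OF that has_vector_derivative_const] by simp
 have dfc: "((\<lambda>t. f0 t - \<Gamma> x) has_vector_derivative f1 t) (at t)" for t
  using has_vector_derivative_diff[OF df0 has_vector_derivative_const] by simp
 have "((\<lambda>t. ((f0 t - \<Gamma> x) \<bullet> vv x - (f0 0 - \<Gamma> x) \<bullet> vv x - (f1 0 \<bullet> vv x) * t - (f2 0 \<bullet> vv x) / 2 * t\<^sup>2 - (f3 0 \<bullet> vv x) / 6 * t ^ 3) / t ^ 3) \<longlongrightarrow> 0) (at 0)"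
  by (rule taylor3[where g = "\<lambda>t. f1 t \<bullet> vv x" and k = "\<lambda>t. f2 t \<bullet> vv x"]) (intro dc dfc df1 df2)+
 then show "((\<lambda>t. ((E0 x e t - \<Gamma> x) \<bullet> vv x - kform x e / 2 * t\<^sup>2 - cform x e / 6 * t ^ 3) / t ^ 3) \<longlongrightarrow> 0) (at 0)"
  using fn[of 0] f3n[of 0] nn[of 0] unfolding at0 f2_def by (simp add: at0 f0_def)
 have tan: "((\<lambda>t. ((f0 t - \<Gamma> x) \<bullet> c - (f1 0 \<bullet> c) * t) / t\<^sup>2) \<longlongrightarrow> 0) (at 0)" if c: "vv x \<bullet> c = 0" for c
 proof -
  have "((\<lambda>t. ((f0 t - \<Gamma> x) \<bullet> c - (f0 0 - \<Gamma> x) \<bullet> c - (f1 0 \<bullet> c) * t - (f2 0 \<bullet> c) / 2 * t\<^sup>2) / t ^ 2) \<longlongrightarrow> 0) (at 0)"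
   by (rule taylor2[where g = "\<lambda>t. f1 t \<bullet> c"]) (intro dc dfc df1)+
  then show ?thesis using c by (simp add: at0 f2_def)
 qed
 show "((\<lambda>t. ((E0 x e t - \<Gamma> x) \<bullet> tv (fst x) - fst e * t) / t\<^sup>2) \<longlongrightarrow> 0) (at 0)"
  using tan[of "tv (fst x)"] by (simp add: torus_frame_inner at0 nvec_tv f0_def)
 show "((\<lambda>t. ((E0 x e t - \<Gamma> x) \<bullet> ww x - snd e * t) / t\<^sup>2) \<longlongrightarrow> 0) (at 0)"
  using tan[of "ww x"] by (simp add: torus_frame_inner at0 nvec_ww f0_def)
qed

text \<open>The remainder is smooth jointly in radius, base point and direction, which is what the
  later compactness arguments use. Negative radii are included, so that \<open>F2_eq_F1\<close>
  turns this into an expansion of \<open>F2\<close>.\<close>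

lemma F1_expansion:
 obtains R where "smooth R UNIV"
  "\<And>r x e. FI (Pr (x, r *\<^sub>R e)) = 2 * kform x e * r\<^sup>2 + 2 / 3 * cform x e * r ^ 3 + r ^ 4 * R (r, (x, e))"
proof -
 define f where "f w = FI (Pr (fst (snd w), fst w *\<^sub>R snd (snd w))) - 2 * kform (fst (snd w)) (snd (snd w)) * (fst w)\<^sup>2
   - 2 / 3 * cform (fst (snd w)) (snd (snd w)) * (fst w) ^ 3" for w :: "real \<times> ((real \<times> real) \<times> (real \<times> real))"
 have sf: "smooth f UNIV"
  unfolding f_def[abs_def]
  by (intro sm_intros sm_compose_UNIV[OF sm_F1] sm_compose_UNIV[OF sm_Pr] sm_kform sm_cform open_UNIV)
 have "\<exists>g. smooth g UNIV \<and> (\<forall>r z. f (r, z) = r ^ Suc 3 * g (r, z))"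
 proof (rule hadamard_power[OF sf])
  fix z
  have "f (r, z) = (\<Gamma> (Exp (fst z) ((- r) *\<^sub>R snd z)) - \<Gamma> (Exp (fst z) (r *\<^sub>R snd z))) \<bullet> vv (Exp (fst z) (r *\<^sub>R snd z))
    - 2 * kform (fst z) (snd z) * r\<^sup>2 - 2 / 3 * cform (fst z) (snd z) * r ^ 3" for r
   by (simp add: f_def F1_def Pr_def)
  then show "((\<lambda>r. f (r, z) / r ^ 3) \<longlongrightarrow> 0) (at 0)" using F1_taylor[of "fst z" "snd z"] by simp
 qed
 then obtain g where g: "smooth g UNIV" "\<And>r z. f (r, z) = r ^ Suc 3 * g (r, z)" by blast
 show thesis
 proof (rule that[OF g(1)])
  show "FI (Pr (x, r *\<^sub>R e)) = 2 * kform x e * r\<^sup>2 + 2 / 3 * cform x e * r ^ 3 + r ^ 4 * g (r, (x, e))" for r x e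
   using g(2)[of r "(x, e)"] by (simp add: f_def algebra_simps)
 qed
qed

lemma height_expansion:
 obtains R where "smooth R UNIV"
  "\<And>r x e. (\<Gamma> (Exp x (r *\<^sub>R e)) - \<Gamma> x) \<bullet> vv x = kform x e / 2 * r\<^sup>2 + cform x e / 6 * r ^ 3 + r ^ 4 * R (r, (x, e))"
proof -
 define f where "f w = (\<Gamma> (Exp (fst (snd w)) (fst w *\<^sub>R snd (snd w))) - \<Gamma> (fst (snd w))) \<bullet> vv (fst (snd w))
   - kform (fst (snd w)) (snd (snd w)) / 2 * (fst w)\<^sup>2
   - cform (fst (snd w)) (snd (snd w)) / 6 * (fst w) ^ 3" for w :: "real \<times> ((real \<times> real) \<times> (real \<times> real))"
 have sf: "smooth f UNIV"
  unfolding f_def[abs_def]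
  by (intro sm_intros sm_compose_UNIV[OF sm_Gamma] sm_compose_UNIV[OF sm_vv] sm_Exp' sm_kform sm_cform open_UNIV) auto
 have "\<exists>g. smooth g UNIV \<and> (\<forall>r z. f (r, z) = r ^ Suc 3 * g (r, z))"
 proof (rule hadamard_power[OF sf])
  show "((\<lambda>r. f (r, z) / r ^ 3) \<longlongrightarrow> 0) (at 0)" for z
   using height_taylor[of "fst z" "snd z"] by (simp add: f_def)
 qed
 then obtain g where g: "smooth g UNIV" "\<And>r z. f (r, z) = r ^ Suc 3 * g (r, z)" by blast
 show thesis
 proof (rule that[OF g(1)])
  show "(\<Gamma> (Exp x (r *\<^sub>R e)) - \<Gamma> x) \<bullet> vv x = kform x e / 2 * r\<^sup>2 + cform x e / 6 * r ^ 3 + r ^ 4 * g (r, (x, e))" for r x e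
   using g(2)[of r "(x, e)"] by (simp add: f_def algebra_simps)
 qed
qed

text \<open>There is no quadratic term because the acceleration of a geodesic is normal to the
  surface.\<close>

lemma tangential_expansion:
 obtains R S where "smooth R UNIV" "smooth S UNIV"
  "\<And>r x e. (\<Gamma> (Exp x (r *\<^sub>R e)) - \<Gamma> x) \<bullet> tv (fst x) = fst e * r + r ^ 3 * R (r, (x, e))"
  "\<And>r x e. (\<Gamma> (Exp x (r *\<^sub>R e)) - \<Gamma> x) \<bullet> ww x = snd e * r + r ^ 3 * S (r, (x, e))"
proof -
 define f where "f w = (\<Gamma> (Exp (fst (snd w)) (fst w *\<^sub>R snd (snd w))) - \<Gamma> (fst (snd w))) \<bullet> tv (fst (fst (snd w)))
   - fst (snd (snd w)) * fst w" for w :: "real \<times> ((real \<times> real) \<times> (real \<times> real))"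
 define g where "g w = (\<Gamma> (Exp (fst (snd w)) (fst w *\<^sub>R snd (snd w))) - \<Gamma> (fst (snd w))) \<bullet> ww (fst (snd w))
   - snd (snd (snd w)) * fst w" for w :: "real \<times> ((real \<times> real) \<times> (real \<times> real))"
 have sf: "smooth f UNIV" "smooth g UNIV"
  unfolding f_def[abs_def] g_def[abs_def]
  by (intro sm_intros sm_compose_UNIV[OF sm_Gamma] sm_compose_UNIV[OF sm_tv] sm_compose_UNIV[OF sm_ww] sm_Exp' open_UNIV)+
 have "\<exists>h. smooth h UNIV \<and> (\<forall>r z. f (r, z) = r ^ Suc 2 * h (r, z))"
  by (rule hadamard_power[OF sf(1)]) (simp add: f_def tv_taylor)
 then obtain R where R: "smooth R UNIV" "\<And>r z. f (r, z) = r ^ Suc 2 * R (r, z)" by blast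
 have "\<exists>h. smooth h UNIV \<and> (\<forall>r z. g (r, z) = r ^ Suc 2 * h (r, z))"
  by (rule hadamard_power[OF sf(2)]) (simp add: g_def ww_taylor)
 then obtain S where S: "smooth S UNIV" "\<And>r z. g (r, z) = r ^ Suc 2 * S (r, z)" by blast
 show thesis
 proof (rule that[OF R(1) S(1)])
  fix r x e
  show "(\<Gamma> (Exp x (r *\<^sub>R e)) - \<Gamma> x) \<bullet> tv (fst x) = fst e * r + r ^ 3 * R (r, (x, e))"
   using R(2)[of r "(x, e)"] by (simp add: f_def eval_nat_numeral)
  show "(\<Gamma> (Exp x (r *\<^sub>R e)) - \<Gamma> x) \<bullet> ww x = snd e * r + r ^ 3 * S (r, (x, e))"
   using S(2)[of r "(x, e)"] by (simp add: g_def eval_nat_numeral)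
 qed
qed

end

section \<open>Outward-pointing quadrants\<close>

text \<open>Concavity on the points \<open>z < x < y\<close> bounds \<open>f x\<close> from below by
  a convex combination of \<open>f z\<close> and \<open>f y\<close>. Dropping the positive
  \<open>f z\<close> and letting \<open>z\<close> tend to 0 leaves the chord from the
  origin.\<close>

lemma concave_ratio:
 fixes f :: "real \<Rightarrow> real"
 assumes f: "strictly_concave_on {0<..<a} f" "\<And>x. x \<in> {0<..<a} \<Longrightarrow> f x > 0"
  and x: "0 < x" "x < y" "y < a"
 shows "f y / y \<le> f x / x"
proof -
 have ev: "\<forall>\<^sub>F z in at_right 0. (x - z) / (y - z) * f y \<le> f x"
 proof -
  have "\<forall>\<^sub>F z in at_right 0. z \<in> {0<..<x}" by (rule eventually_at_right_real[OF x(1)])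
  then show ?thesis
  proof eventually_elim
   case (elim z)
   define t where "t = (x - z) / (y - z)"
   have t: "0 < t" "t < 1" using elim x by (auto simp: t_def)
   have xt: "(1 - t) * z + t * y = x"
   proof -
    have "t * (y - z) = x - z" using elim x by (simp add: t_def)
    then show ?thesis by (simp add: algebra_simps)
   qed
   have "(1 - t) * f z + t * f y < f ((1 - t) * z + t * y)"
    using f(1) elim x t unfolding strictly_concave_on_def by auto
   moreover have "(1 - t) * f z \<ge> 0" using t f(2)[of z] elim x by auto
   ultimately show ?case unfolding xt by (simp add: t_def)
  qed
 qed
 have "((\<lambda>z. (x - z) / (y - z) * f y) \<longlongrightarrow> (x - 0) / (y - 0) * f y) (at_right 0)"
  using x by (intro tendsto_intros) auto
 from tendsto_upperbound[OF this ev] have "x / y * f y \<le> f x" by simp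
 then show ?thesis using x by (simp add: field_simps)
qed

lemma DERIV_pos_eventually:
 fixes f :: "real \<Rightarrow> real"
 assumes "(f has_real_derivative c) (at 0)" "c > 0" "f 0 = 0"
 shows "\<forall>\<^sub>F t in at_right 0. f t > 0"
proof -
 obtain d where "d > 0" "\<And>h. 0 < h \<Longrightarrow> h < d \<Longrightarrow> f 0 < f (0 + h)"
  using DERIV_pos_inc_right[OF assms(1,2)] by blast
 then show ?thesis using assms(3) by (auto simp: eventually_at_right_field intro!: exI[of _ d])
qed

lemma sin_ge_half:
 fixes u :: real
 assumes "0 \<le> u" "u \<le> 1"
 shows "u / 2 \<le> sin u"
proof -
 have "sin 0 - 0 / 2 \<le> sin u - u / 2"
 proof (rule DERIV_nonneg_imp_nondecreasing[OF assms(1)])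
  fix v assume v: "0 \<le> v" "v \<le> u"
  have "cos (pi / 3) \<le> cos v" using v assms pi_gt3 by (intro cos_monotone_0_pi_le) auto
  then show "\<exists>y. ((\<lambda>u. sin u - u / 2) has_real_derivative y) (at v) \<and> 0 \<le> y"
   by (intro exI[of _ "cos v - 1 / 2"]) (auto intro!: derivative_eq_intros simp: cos_60)
 qed
 then show ?thesis by simp
qed

lemma smooth_bounded_on_compact:
 fixes R :: "'a::euclidean_space \<Rightarrow> real"
 assumes "smooth R UNIV" "compact K"
 obtains B where "B > 0" "\<And>z. z \<in> K \<Longrightarrow> \<bar>R z\<bar> \<le> B"
proof -
 have "compact (R ` K)"
  by (intro compact_continuous_image assms continuous_on_subset[OF sm_continuous_on[OF assms(1)]]) auto
 from compact_imp_bounded[OF this, unfolded bounded_pos] show thesis using that by auto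
qed

context tube
begin

lemma torus_frame_expansion: "u = (u \<bullet> tv (fst x)) *\<^sub>R tv (fst x) + (u \<bullet> ww x) *\<^sub>R ww x + (u \<bullet> vv x) *\<^sub>R vv x"
proof -
 let ?t = "tv (fst x)" and ?n = "nv (fst x)" and ?b = "bv (fst x)"
 define C S where "C = cos (snd x)" "S = sin (snd x)"
 have CS: "C * C + S * S = 1" by (simp add: C_S_def cos_cos_sin_sin)
 define p q where "p = u \<bullet> ?n" "q = u \<bullet> ?b"
 have "(u \<bullet> ww x) *\<^sub>R ww x + (u \<bullet> vv x) *\<^sub>R vv x = (p * (C * C + S * S)) *\<^sub>R ?n + (q * (C * C + S * S)) *\<^sub>R ?b"
  by (simp add: vv_eq ww_def C_S_def[symmetric] p_q_def[symmetric] inner_add_right inner_diff_right algebra_simps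
     del: CS)
 then have "(u \<bullet> ww x) *\<^sub>R ww x + (u \<bullet> vv x) *\<^sub>R vv x = p *\<^sub>R ?n + q *\<^sub>R ?b" by (simp add: CS)
 then show ?thesis using frame_expansion[of u "fst x"] by (simp add: p_q_def add.assoc)
qed

lemma principal_eq: "principal_M \<gamma> x = - tv (fst x)" "principal_m \<gamma> x = ww x"
proof -
 show "principal_M \<gamma> x = - tv (fst x)" by (simp add: principal_M_def case_prod_unfold)
 have "((\<lambda>t. vv (fst x, t)) has_vector_derivative
   (1 + tor (fst (fst x, snd x)) * 0) *\<^sub>R ww (fst x, snd x) - (kap (fst (fst x, snd x)) * cos (snd (fst x, snd x)) * 0) *\<^sub>R tv (fst (fst x, snd x))) (at (snd x))"
  by (rule hvd_vv_curve) (auto intro!: derivative_eq_intros)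
 then have "velocity (\<lambda>t. vv (fst x, t)) (snd x) = ww x" by (intro velocityI) simp
 then show "principal_m \<gamma> x = ww x" by (simp add: principal_m_def case_prod_unfold)
qed

text \<open>
 An asymptotic direction in the quadrant along which the third-order term is positive: the
 intersection curve with the tangent plane leaves the asymptotic line to the wrong side.
\<close>

lemma outward_pointing_cform:
 assumes out: "outward_pointing \<gamma> \<epsilon> x \<sigma> 1" and \<sigma>: "\<sigma> = 1 \<or> \<sigma> = -1" and cos: "cos (snd x) > 0"
  and \<phi>0: "0 < \<phi>0" "\<phi>0 < pi / 2" and k0: "kform x (- \<sigma> * cos \<phi>0, sin \<phi>0) = 0"
 shows "cform x (- \<sigma> * cos \<phi>0, sin \<phi>0) \<le> 0"
proof (rule ccontr)
 define e where "e \<phi> = (- \<sigma> * cos \<phi>, sin \<phi>)" for \<phi> :: real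
 define A where "A = kap (fst x) * cos (snd x) / qq x"
 have A: "A > 0" using kap_pos cos qq_pos by (simp add: A_def)
 have \<sigma>\<sigma>: "\<sigma> * \<sigma> = 1" "\<sigma>\<^sup>2 = 1" using \<sigma> by auto
 define k where "k \<phi> = kform x (e \<phi>)" for \<phi>
 have k: "k \<phi> = A * (cos \<phi>)\<^sup>2 - (sin \<phi>)\<^sup>2 / \<epsilon>" for \<phi>
  by (simp add: k_def e_def kform_def A_def power_mult_distrib \<sigma>\<sigma>)
 have dk: "(k has_real_derivative - (2 * sin \<phi> * cos \<phi> * (A + 1 / \<epsilon>))) (at \<phi>)" for \<phi>
  unfolding k[abs_def] using eps_pos
  by (auto intro!: derivative_eq_intros simp: field_simps power2_eq_square)
 have kz: "k \<phi>0 = 0" using k0 by (simp add: k_def e_def)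
 have kneg: "k \<phi> < 0" if "\<phi>0 < \<phi>" "\<phi> \<le> pi / 2" for \<phi>
 proof -
  have "k \<phi> < k \<phi>0"
  proof (rule DERIV_neg_imp_decreasing_open[OF that(1)])
   show "\<exists>y. (k has_real_derivative y) (at u) \<and> y < 0" if u: "\<phi>0 < u" "u < \<phi>" for u
   proof -
    have "sin u > 0" "cos u > 0" using u \<open>\<phi> \<le> pi / 2\<close> \<phi>0 by (auto intro!: sin_gt_zero cos_gt_zero_pi)
    moreover have "A + 1 / \<epsilon> > 0" using A eps_pos by (simp add: add_pos_pos)
    ultimately have "- (2 * sin u * cos u * (A + 1 / \<epsilon>)) < 0" by simp
    then show ?thesis using dk by blast
   qed
   show "continuous_on {\<phi>0..\<phi>} k" by (intro continuous_at_imp_continuous_on ballI DERIV_isCont[OF dk])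
  qed
  then show ?thesis using kz by simp
 qed
 assume "\<not> cform x (- \<sigma> * cos \<phi>0, sin \<phi>0) \<le> 0"
 then have c0: "cform x (e \<phi>0) > 0" by (simp add: e_def)
 obtain H where sH: "smooth H UNIV"
  and H: "\<And>r x e. (\<Gamma> (Exp x (r *\<^sub>R e)) - \<Gamma> x) \<bullet> vv x = kform x e / 2 * r\<^sup>2 + cform x e / 6 * r ^ 3 + r ^ 4 * H (r, (x, e))"
  by (rule height_expansion) blast
 obtain R S where sR: "smooth R UNIV" and sS: "smooth S UNIV"
  and R: "\<And>r x e. (\<Gamma> (Exp x (r *\<^sub>R e)) - \<Gamma> x) \<bullet> tv (fst x) = fst e * r + r ^ 3 * R (r, (x, e))"
  and S: "\<And>r x e. (\<Gamma> (Exp x (r *\<^sub>R e)) - \<Gamma> x) \<bullet> ww x = snd e * r + r ^ 3 * S (r, (x, e))"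
  by (rule tangential_expansion) blast
 \<comment> \<open>The height over the affine tangent plane divided by \<open>r\<^sup>2\<close>. For
   \<open>r > 0\<close> its zeros are the directions in which the torus meets that plane at geodesic
   distance \<open>r\<close>.\<close>
 define h where "h w = k (snd w) / 2 + cform x (e (snd w)) / 6 * fst w + (fst w)\<^sup>2 * H (fst w, (x, e (snd w)))" for w :: "real \<times> real"
 have se: "smooth (\<lambda>z. e (f z)) U" if "smooth f U" for f :: "real \<times> real \<Rightarrow> real" and U
  unfolding e_def by (intro sm_intros that sm_open[OF that])
 have sh: "smooth h UNIV"
  unfolding h_def[abs_def] k_def
  by (intro sm_intros sm_kform sm_cform se sm_compose_UNIV[OF sH] open_UNIV) auto
 have height: "(\<Gamma> (Exp x (r *\<^sub>R e \<phi>)) - \<Gamma> x) \<bullet> vv x = r\<^sup>2 * h (r, \<phi>)" for r \<phi>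
  unfolding H h_def k_def by (simp add: algebra_simps eval_nat_numeral)
 have ch: "continuous_on UNIV h" by (rule sm_continuous_on[OF sh])
 define K where "K = {0..1::real} \<times> {x} \<times> e ` {0..pi / 2}"
 have cK: "compact K"
  unfolding K_def e_def by (intro compact_Times compact_continuous_image continuous_intros) auto
 obtain B1 where B1: "B1 > 0" "\<And>z. z \<in> K \<Longrightarrow> \<bar>R z\<bar> \<le> B1" by (rule smooth_bounded_on_compact[OF sR cK]) blast
 obtain B2 where B2: "B2 > 0" "\<And>z. z \<in> K \<Longrightarrow> \<bar>S z\<bar> \<le> B2" by (rule smooth_bounded_on_compact[OF sS cK]) blast
 define B where "B = max B1 B2"
 have B: "B > 0" "\<And>z. z \<in> K \<Longrightarrow> \<bar>R z\<bar> \<le> B" "\<And>z. z \<in> K \<Longrightarrow> \<bar>S z\<bar> \<le> B"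
  using B1 B2 by (force simp: B_def)+
 define k1 where "k1 = 2 * sin \<phi>0 * cos \<phi>0 * (A + 1 / \<epsilon>)"
 have "sin \<phi>0 > 0" "cos \<phi>0 > 0" using \<phi>0 by (auto intro!: sin_gt_zero cos_gt_zero_pi)
 note sc = this
 have k1: "k1 > 0" using sc A eps_pos by (simp add: k1_def add_pos_pos)
 \<comment> \<open>Half of the slope at which the linear term of \<open>h\<close> would vanish along
   \<open>\<phi>0 + lam * r\<close>: the derivative
   \<open>- k1 * lam / 2 + cform x (e \<phi>0) / 6\<close> there is still positive. As
   \<open>h\<close> is negative at \<open>\<phi>0 + \<delta>\<close>, it has a zero between, at
   least \<open>lam * r\<close> beyond the asymptotic angle.\<close>
 define lam where "lam = cform x (e \<phi>0) / (6 * k1)"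
 have lam: "lam > 0" using c0 k1 by (simp add: lam_def)
 have ev1: "\<forall>\<^sub>F r in at_right 0. h (r, \<phi>0 + lam * r) > 0"
 proof (rule DERIV_pos_eventually)
  let ?c = "cform x (e \<phi>0)"
  have dC: "((\<lambda>r. cform x (e (\<phi>0 + lam * r)) / 6 * r) has_real_derivative ?c / 6) (at 0)"
  proof -
   have "isCont (\<lambda>r. cform x (e (\<phi>0 + lam * r)) / 6) 0"
   proof -
    have "smooth (\<lambda>r. cform x (e (\<phi>0 + lam * r)) / 6) UNIV"
     unfolding e_def by (intro sm_intros sm_cform open_UNIV) auto
    from sm_continuous_on[OF this] show ?thesis by (simp add: continuous_on_eq_continuous_at)
   qed
   then have "((\<lambda>r. cform x (e (\<phi>0 + lam * r)) / 6) \<longlongrightarrow> ?c / 6) (at 0)" by (simp add: isCont_def)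
   then show ?thesis unfolding has_field_derivative_iff
    by (rule Lim_transform_eventually) (auto simp: eventually_at intro!: exI[of _ 1])
  qed
  have dH: "((\<lambda>r. r\<^sup>2 * H (r, (x, e (\<phi>0 + lam * r)))) has_real_derivative 0) (at 0)"
  proof -
   have "isCont (\<lambda>r. r * H (r, (x, e (\<phi>0 + lam * r)))) 0"
   proof -
    have "smooth (\<lambda>r. r * H (r, (x, e (\<phi>0 + lam * r)))) UNIV"
     unfolding e_def by (intro sm_intros sm_compose_UNIV[OF sH] open_UNIV)
    from sm_continuous_on[OF this] show ?thesis by (simp add: continuous_on_eq_continuous_at)
   qed
   then have "((\<lambda>r. r * H (r, (x, e (\<phi>0 + lam * r)))) \<longlongrightarrow> 0) (at 0)" by (simp add: isCont_def)
   then show ?thesis unfolding has_field_derivative_iff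
    by (rule Lim_transform_eventually) (auto simp: eventually_at power2_eq_square intro!: exI[of _ 1])
  qed
  have dK: "((\<lambda>r. k (\<phi>0 + lam * r) / 2) has_real_derivative - k1 * lam / 2) (at 0)"
  proof -
   have "((\<lambda>r. k (\<phi>0 + lam * r)) has_real_derivative - (2 * sin (\<phi>0 + lam * 0) * cos (\<phi>0 + lam * 0) * (A + 1 / \<epsilon>)) * lam) (at 0)"
    by (rule DERIV_chain2[OF dk]) (auto intro!: derivative_eq_intros)
   then show ?thesis by (auto intro!: derivative_eq_intros simp: k1_def)
  qed
  show "((\<lambda>r. h (r, \<phi>0 + lam * r)) has_real_derivative - k1 * lam / 2 + ?c / 6 + 0) (at 0)"
   unfolding h_def fst_conv snd_conv by (intro DERIV_add dK dC dH)
  show "- k1 * lam / 2 + ?c / 6 + 0 > 0" using k1 c0 by (simp add: lam_def)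
  show "h (0, \<phi>0 + lam * 0) = 0" by (simp add: h_def kz)
 qed
 text \<open>Points of the intersection curve close to the asymptotic direction, but beyond it.\<close>
 define m where "m = sin \<phi>0 / cos \<phi>0"
 have m: "m > 0" using sc by (simp add: m_def)
 have pts: "\<exists>X Y. 0 < X \<and> X < d \<and> \<bar>Y\<bar> < d \<and> m * X < Y \<and> Y < (m + d) * X \<and> (X, Y) \<in> quadrant_curve \<gamma> \<epsilon> x \<sigma> 1" if d: "d > 0" for d
 proof -
  have lim: "((\<lambda>\<delta>. (sin (\<phi>0 + \<delta>)) / (cos (\<phi>0 + \<delta>))) \<longlongrightarrow> sin (\<phi>0 + 0) / cos (\<phi>0 + 0)) (at_right 0)"
   using sc by (intro tendsto_intros) auto
  have "\<forall>\<^sub>F \<delta> in at_right 0. \<delta> > 0 \<and> \<delta> < 1 \<and> \<delta> < pi / 2 - \<phi>0 \<and> sin (\<phi>0 + \<delta>) / cos (\<phi>0 + \<delta>) < m + d"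
  proof (intro eventually_conj)
   show "\<forall>\<^sub>F \<delta> in at_right 0. (0::real) < \<delta>" by (simp add: eventually_at_right_less)
   show "\<forall>\<^sub>F \<delta> in at_right 0. \<delta> < (1::real)" by (rule eventually_at_right_field[THEN iffD2]) (auto intro: exI[of _ 1])
   show "\<forall>\<^sub>F \<delta> in at_right 0. \<delta> < pi / 2 - \<phi>0" using \<phi>0
    by (intro eventually_at_right_field[THEN iffD2]) (auto intro!: exI[of _ "pi / 2 - \<phi>0"])
   show "\<forall>\<^sub>F \<delta> in at_right 0. sin (\<phi>0 + \<delta>) / cos (\<phi>0 + \<delta>) < m + d"
    using order_tendstoD(2)[OF lim] d by (simp add: m_def)
  qed
  then obtain \<delta> where \<delta>: "\<delta> > 0" "\<delta> < 1" "\<delta> < pi / 2 - \<phi>0" "sin (\<phi>0 + \<delta>) / cos (\<phi>0 + \<delta>) < m + d"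
   using eventually_happens'[OF trivial_limit_at_right_real] by blast
  have c\<delta>: "cos (\<phi>0 + \<delta>) > 0" using \<delta> \<phi>0 by (intro cos_gt_zero_pi) auto
  have ev2: "\<forall>\<^sub>F r in at_right 0. h (r, \<phi>0 + \<delta>) < 0"
  proof -
   have "isCont (\<lambda>r. h (r, \<phi>0 + \<delta>)) 0" by (rule isCont_slice[OF sh])
   then have "((\<lambda>r. h (r, \<phi>0 + \<delta>)) \<longlongrightarrow> h (0, \<phi>0 + \<delta>)) (at_right 0)"
    by (auto simp: isCont_def intro: tendsto_within_subset)
   moreover have "h (0, \<phi>0 + \<delta>) < 0" using kneg[of "\<phi>0 + \<delta>"] \<delta> by (simp add: h_def)
   ultimately show ?thesis by (rule order_tendstoD(2))
  qed
  have limt: "((\<lambda>r. (m + d) * (cos (\<phi>0 + \<delta>) - B * r\<^sup>2) - (sin (\<phi>0 + \<delta>) + B * r\<^sup>2)) \<longlongrightarrow>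
    (m + d) * (cos (\<phi>0 + \<delta>) - B * 0\<^sup>2) - (sin (\<phi>0 + \<delta>) + B * 0\<^sup>2)) (at_right 0)"
   by (intro tendsto_intros)
  have limc: "((\<lambda>r. cos (\<phi>0 + \<delta>) - B * r\<^sup>2) \<longlongrightarrow> cos (\<phi>0 + \<delta>) - B * 0\<^sup>2) (at_right 0)"
   by (intro tendsto_intros)
  \<comment> \<open>\<open>\<delta> / lam\<close> puts the two angles in the right order for the
    intermediate value theorem. \<open>lam / (2 * (1 + m) * B)\<close> keeps the cubic deviation of
    the plane coordinates below the gain in angle. \<open>d / (1 + B)\<close> keeps the point in the
    window of size \<open>d\<close>.\<close>
  define r0 where "r0 = min (min 1 (\<delta> / lam)) (min (lam / (2 * (1 + m) * B)) (d / (1 + B)))"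
  have r0: "r0 > 0" using \<delta> lam m B d by (auto simp: r0_def)
  have "\<forall>\<^sub>F r in at_right 0. 0 < r \<and> r < r0 \<and> h (r, \<phi>0 + lam * r) > 0 \<and> h (r, \<phi>0 + \<delta>) < 0 \<and>
    (m + d) * (cos (\<phi>0 + \<delta>) - B * r\<^sup>2) - (sin (\<phi>0 + \<delta>) + B * r\<^sup>2) > 0 \<and> cos (\<phi>0 + \<delta>) - B * r\<^sup>2 > 0"
  proof (intro eventually_conj ev1 ev2)
   show "\<forall>\<^sub>F r in at_right 0. (0::real) < r" by (simp add: eventually_at_right_less)
   show "\<forall>\<^sub>F r in at_right 0. r < r0" using r0
    by (intro eventually_at_right_field[THEN iffD2]) (auto intro!: exI[of _ r0])
   show "\<forall>\<^sub>F r in at_right 0. (m + d) * (cos (\<phi>0 + \<delta>) - B * r\<^sup>2) - (sin (\<phi>0 + \<delta>) + B * r\<^sup>2) > 0"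
    by (rule order_tendstoD(1)[OF limt]) (use \<delta>(4) c\<delta> in \<open>simp add: pos_divide_less_eq\<close>)
   show "\<forall>\<^sub>F r in at_right 0. cos (\<phi>0 + \<delta>) - B * r\<^sup>2 > 0"
    by (rule order_tendstoD(1)[OF limc]) (use c\<delta> in simp)
  qed
  then obtain r where r: "0 < r" "r < r0" "h (r, \<phi>0 + lam * r) > 0" "h (r, \<phi>0 + \<delta>) < 0"
    "(m + d) * (cos (\<phi>0 + \<delta>) - B * r\<^sup>2) - (sin (\<phi>0 + \<delta>) + B * r\<^sup>2) > 0" "cos (\<phi>0 + \<delta>) - B * r\<^sup>2 > 0"
   using eventually_happens'[OF trivial_limit_at_right_real] by blast
  have rs: "r < 1" "lam * r < \<delta>" "2 * (1 + m) * B * r < lam" "r * (1 + B) < d"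
   using r(2) lam m B(1) by (auto simp: r0_def pos_less_divide_eq mult_ac)
  have "\<exists>\<phi>\<ge>\<phi>0 + lam * r. \<phi> \<le> \<phi>0 + \<delta> \<and> h (r, \<phi>) = 0"
  proof (rule IVT2')
   show "continuous_on {\<phi>0 + lam * r..\<phi>0 + \<delta>} (\<lambda>\<phi>. h (r, \<phi>))"
    by (rule continuous_on_compose2[OF ch]) (auto intro!: continuous_intros)
  qed (use r rs in auto)
  then obtain \<phi> where \<phi>: "\<phi>0 + lam * r \<le> \<phi>" "\<phi> \<le> \<phi>0 + \<delta>" "h (r, \<phi>) = 0" by blast
  have \<phi>r: "0 < \<phi>" "\<phi> < pi / 2" "\<phi>0 < \<phi>" using \<phi> lam r \<phi>0 \<delta> by (auto simp: add_pos_pos) (smt (verit) mult_pos_pos)+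
  have sc\<phi>: "sin \<phi> \<le> sin (\<phi>0 + \<delta>)" "cos (\<phi>0 + \<delta>) \<le> cos \<phi>" "sin \<phi> > 0"
   using \<phi> \<phi>r \<delta> \<phi>0 by (auto intro!: sin_monotone_2pi_le cos_monotone_0_pi_le sin_gt_zero)
  have inK: "(r, (x, e \<phi>)) \<in> K" using r rs \<phi>r by (auto simp: K_def)
  define X where "X = cos \<phi> * r - \<sigma> * (r ^ 3 * R (r, (x, e \<phi>)))"
  define Y where "Y = sin \<phi> * r + r ^ 3 * S (r, (x, e \<phi>))"
  have r3: "\<bar>\<sigma> * (r ^ 3 * R (r, (x, e \<phi>)))\<bar> \<le> r * (B * r\<^sup>2)" "\<bar>r ^ 3 * S (r, (x, e \<phi>))\<bar> \<le> r * (B * r\<^sup>2)"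
   using B(2)[OF inK] B(3)[OF inK] r \<sigma> by (auto simp: abs_mult eval_nat_numeral mult_ac)
  have Xb: "r * (cos \<phi> - B * r\<^sup>2) \<le> X" "X \<le> r * (cos \<phi> + B * r\<^sup>2)"
   and Yb: "r * (sin \<phi> - B * r\<^sup>2) \<le> Y" "Y \<le> r * (sin \<phi> + B * r\<^sup>2)"
   using r3 unfolding X_def Y_def by (auto simp: algebra_simps abs_le_iff)
  have Xpos: "X > 0"
  proof -
   have "0 < r * (cos \<phi> - B * r\<^sup>2)" using r sc\<phi> by (intro mult_pos_pos) auto
   then show ?thesis using Xb by simp
  qed
  have bsmall: "r * (c + B * r\<^sup>2) < d" if "c \<le> 1" for c
  proof -
   have "r\<^sup>2 \<le> 1" using r rs by (simp add: power_le_one)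
   then have "B * r\<^sup>2 \<le> B" using B(1) by (simp add: mult_left_le)
   then have "r * (c + B * r\<^sup>2) \<le> r * (1 + B)" using that r by (intro mult_left_mono) auto
   then show ?thesis using rs by simp
  qed
  have Xd: "X < d" using Xb(2) bsmall[OF cos_le_one[of \<phi>]] by simp
  have YX: "m * X < Y"
  proof -
   have "\<phi> - \<phi>0 \<le> 1" "\<phi> - \<phi>0 \<ge> 0" using \<phi> \<delta> \<phi>r by auto
   then have "(\<phi> - \<phi>0) / 2 \<le> sin (\<phi> - \<phi>0)" by (intro sin_ge_half)
   also have "sin (\<phi> - \<phi>0) = cos \<phi>0 * (sin \<phi> - m * cos \<phi>)"
    using sc by (simp add: sin_diff m_def field_simps)
   also have "\<dots> \<le> 1 * (sin \<phi> - m * cos \<phi>)"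
   proof (rule mult_right_mono)
    have "0 \<le> sin (\<phi> - \<phi>0)" using \<phi>r \<phi>0 by (intro sin_ge_zero) auto
    then have "0 \<le> cos \<phi>0 * (sin \<phi> - m * cos \<phi>)" using sc by (simp add: sin_diff m_def field_simps)
    then show "0 \<le> sin \<phi> - m * cos \<phi>" using sc by (simp add: zero_le_mult_iff)
   qed auto
   finally have "lam * r / 2 \<le> sin \<phi> - m * cos \<phi>" using \<phi>(1) by simp
   moreover have "(1 + m) * (B * r\<^sup>2) < lam * r / 2"
    using mult_strict_right_mono[OF rs(3), of r] r by (simp add: power2_eq_square algebra_simps)
   ultimately have "m * (cos \<phi> + B * r\<^sup>2) < sin \<phi> - B * r\<^sup>2" by (simp add: algebra_simps)
   then have "r * (m * (cos \<phi> + B * r\<^sup>2)) < r * (sin \<phi> - B * r\<^sup>2)" using r by (intro mult_strict_left_mono)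
   moreover have "m * X \<le> m * (r * (cos \<phi> + B * r\<^sup>2))" using Xb(2) m by (intro mult_left_mono) auto
   ultimately show ?thesis using Yb(1) by (simp add: mult_ac)
  qed
  have Ypos: "Y > 0" using YX Xpos m by (smt (verit) mult_pos_pos)
  have Yd: "\<bar>Y\<bar> < d" using Ypos Yb(2) bsmall[OF sin_le_one[of \<phi>]] by simp
  have YX2: "Y < (m + d) * X"
  proof -
   have "sin \<phi> + B * r\<^sup>2 \<le> sin (\<phi>0 + \<delta>) + B * r\<^sup>2" using sc\<phi> by simp
   also have "\<dots> < (m + d) * (cos (\<phi>0 + \<delta>) - B * r\<^sup>2)" using r(5) by simp
   also have "\<dots> \<le> (m + d) * (cos \<phi> - B * r\<^sup>2)" using sc\<phi> m d by (intro mult_left_mono) auto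
   finally have "r * (sin \<phi> + B * r\<^sup>2) < r * ((m + d) * (cos \<phi> - B * r\<^sup>2))" using r by (intro mult_strict_left_mono)
   moreover have "(m + d) * (r * (cos \<phi> - B * r\<^sup>2)) \<le> (m + d) * X" using Xb(1) m d by (intro mult_left_mono) auto
   ultimately show ?thesis using Yb(2) by (simp add: mult_ac)
  qed
  have "(X, Y) \<in> quadrant_curve \<gamma> \<epsilon> x \<sigma> 1"
  proof -
   let ?u = "\<Gamma> (Exp x (r *\<^sub>R e \<phi>)) - \<Gamma> x"
   have "?u \<bullet> vv x = 0" unfolding height \<phi>(3) by simp
   moreover have "?u \<bullet> tv (fst x) = - (X * \<sigma>)"
    unfolding R X_def e_def using \<sigma>\<sigma> by (simp add: algebra_simps)
   moreover have "?u \<bullet> ww x = Y" unfolding S Y_def by (simp add: e_def)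
   ultimately have "?u = - (X * \<sigma>) *\<^sub>R tv (fst x) + Y *\<^sub>R ww x"
    using torus_frame_expansion[of ?u x] by simp
   then have "\<Gamma> x + (X * \<sigma>) *\<^sub>R principal_M \<gamma> x + (Y * 1) *\<^sub>R principal_m \<gamma> x = \<Gamma> (Exp x (r *\<^sub>R e \<phi>))"
    unfolding principal_eq by (simp add: algebra_simps)
   then show ?thesis using Xpos Ypos unfolding quadrant_curve_def by auto
  qed
  with Xpos Xd Yd YX YX2 show ?thesis by blast
 qed
 obtain a f U where f: "a > 0" "strictly_concave_on {0<..<a} f" "\<forall>x\<in>{0<..<a}. f x > 0"
   "open U" "(0, 0) \<in> U" "quadrant_curve \<gamma> \<epsilon> x \<sigma> 1 \<inter> U = (\<lambda>x. (x, f x)) ` {0<..<a} \<inter> U"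
  using out unfolding outward_pointing_def locally_concave_graph_def by blast
 obtain d0 where d0: "d0 > 0" "ball (0, 0) d0 \<subseteq> U" using f(4,5) open_contains_ball by blast
 have inU: "(X, Y) \<in> U" if "\<bar>X\<bar> < d0 / 2" "\<bar>Y\<bar> < d0 / 2" for X Y
 proof -
  have "norm (X, Y) < d0" using norm_Pair_le[of X Y] that by simp
  then show ?thesis using d0(2) by (auto simp: dist_norm norm_minus_commute zero_prod_def[symmetric])
 qed
 have graph: "X \<in> {0<..<a} \<and> Y = f X" if "(X, Y) \<in> quadrant_curve \<gamma> \<epsilon> x \<sigma> 1" "\<bar>X\<bar> < d0 / 2" "\<bar>Y\<bar> < d0 / 2" for X Y
 proof -
  have "(X, Y) \<in> quadrant_curve \<gamma> \<epsilon> x \<sigma> 1 \<inter> U" using that inU by blast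
  then show ?thesis unfolding f(6) by auto
 qed
 obtain X1 Y1 where 1: "0 < X1" "X1 < d0 / 2" "\<bar>Y1\<bar> < d0 / 2" "m * X1 < Y1" "(X1, Y1) \<in> quadrant_curve \<gamma> \<epsilon> x \<sigma> 1"
  using pts[of "d0 / 2"] d0 by auto
 \<comment> \<open>The second point is closer to the origin than the first and has a smaller slope,
   which is possible because these points approach the slope \<open>m\<close> from above.
   \<open>concave_ratio\<close> requires the slope to grow towards the origin.\<close>
 define d where "d = min (d0 / 2) (min X1 (Y1 / X1 - m))"
 have "d > 0" using 1 d0 by (auto simp: d_def pos_less_divide_eq)
 then obtain X2 Y2 where 2: "0 < X2" "X2 < d" "\<bar>Y2\<bar> < d" "Y2 < (m + d) * X2" "(X2, Y2) \<in> quadrant_curve \<gamma> \<epsilon> x \<sigma> 1"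
  using pts[of d] by auto
 have g1: "X1 < a" "Y1 = f X1" using graph[OF 1(5)] 1 by auto
 have g2: "Y2 = f X2" using graph[OF 2(5)] 2 by (auto simp: d_def)
 have "f X1 / X1 \<le> f X2 / X2"
  by (rule concave_ratio[OF f(2)]) (use f(3) 1 2 g1 in \<open>auto simp: d_def\<close>)
 moreover have "f X2 / X2 < m + d" using 2 g2 by (simp add: pos_divide_less_eq)
 moreover have "m + d \<le> f X1 / X1" using g1 by (simp add: d_def)
 ultimately show False by linarith
qed

end

section \<open>What the pointing constants say about the curvature\<close>

lemma periodic_bounded:
 fixes f :: "real \<Rightarrow> real"
 assumes "continuous_on UNIV f" "\<And>s. f (s + T) = f s" "T > 0"
 obtains B where "B > 0" "\<And>s. \<bar>f s\<bar> \<le> B"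
proof -
 have "compact (f ` {0..T})"
  by (intro compact_continuous_image continuous_on_subset[OF assms(1)]) auto
 from compact_imp_bounded[OF this, unfolded bounded_pos]
 obtain B where B: "B > 0" "\<And>s. s \<in> {0..T} \<Longrightarrow> \<bar>f s\<bar> \<le> B" by auto
 have "\<bar>f s\<bar> \<le> B" for s
 proof -
  obtain m :: int where "s + of_int m * T \<in> {0..T}" using exists_int_shift[OF assms(3)] by blast
  then show ?thesis using B(2)[of "s + of_int m * T"] periodic_int[of f, OF assms(2)] by simp
 qed
 then show thesis using that B by blast
qed

text \<open>Substituting \<open>\<epsilon> = t\<^sup>2\<close> turns \<open>sqrt \<epsilon>\<close>
  into \<open>t\<close>, so that limits for small \<epsilon> become limits of elementary functions
  of \<open>t\<close>.\<close>

lemma eventually_at_right_square: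
 assumes "\<forall>\<^sub>F \<epsilon> in at_right (0::real). P \<epsilon>"
 shows "\<forall>\<^sub>F t in at_right 0. P (t\<^sup>2)"
proof -
 obtain b where b: "b > 0" "\<And>y. 0 < y \<Longrightarrow> y < b \<Longrightarrow> P y"
  using assms by (auto simp: eventually_at_right_field)
 have "P (t\<^sup>2)" if "0 < t" "t < min 1 b" for t
 proof (rule b(2))
  have "t * t < 1 * b" using that by (intro mult_strict_mono) auto
  then show "t\<^sup>2 < b" by (simp add: power2_eq_square)
 qed (use that in simp)
 then show ?thesis using b(1) by (auto simp: eventually_at_right_field intro!: exI[of _ "min 1 b"])
qed

lemma eventually_at_right_sqrt:
 assumes "\<forall>\<^sub>F t in at_right (0::real). P (t\<^sup>2)"
 shows "\<forall>\<^sub>F \<epsilon> in at_right 0. P \<epsilon>"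
proof -
 obtain b where b: "b > 0" "\<And>y. 0 < y \<Longrightarrow> y < b \<Longrightarrow> P (y\<^sup>2)"
  using assms by (auto simp: eventually_at_right_field)
 have "P e" if "0 < e" "e < b\<^sup>2" for e
 proof -
  have "sqrt e < b" using that b(1) real_less_lsqrt[of b e] by simp
  then show ?thesis using b(2)[of "sqrt e"] that by simp
 qed
 then show ?thesis using b(1) by (auto simp: eventually_at_right_field intro!: exI[of _ "b\<^sup>2"])
qed

lemma sin_quotient_limit: "((\<lambda>t. sin (t * c) / t) \<longlongrightarrow> c) (at_right (0::real))"
proof -
 have "((\<lambda>t. sin (t * c)) has_real_derivative c) (at 0)" by (auto intro!: derivative_eq_intros)
 then have "((\<lambda>t. sin (t * c) / t) \<longlongrightarrow> c) (at 0)" by (simp add: has_field_derivative_iff)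
 then show ?thesis by (rule filterlim_mono) (auto simp: at_within_le_at)
qed

context knot
begin

lemma kap_upper: obtains K where "K > 0" "\<And>s. kap s \<le> K"
proof -
 obtain B where "B > 0" "\<And>s. \<bar>kap s\<bar> \<le> B"
  by (rule periodic_bounded[OF sm_continuous_on[OF sm_kap] kap_periodic T_pos]) blast
 then show thesis using that abs_le_D1 by blast
qed

lemma kap_lower: obtains K where "K > 0" "\<And>s. K \<le> kap s"
proof -
 have "continuous_on UNIV (\<lambda>s. 1 / kap s)"
  using kap_pos by (intro continuous_intros sm_continuous_on[OF sm_kap]) (auto simp: less_imp_neq[THEN not_sym])
 then obtain B where B: "B > 0" "\<And>s. \<bar>1 / kap s\<bar> \<le> B"
  by (rule periodic_bounded[OF _ _ T_pos]) (use kap_periodic in auto)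
 show thesis
 proof (rule that[of "1 / B"])
  fix s
  have "1 / kap s \<le> B" using B(2)[of s] kap_pos[of s] by (simp add: abs_of_pos)
  then show "1 / B \<le> kap s" using kap_pos[of s] B(1) by (simp add: field_simps)
 qed (use B in simp)
qed

lemma eventually_tube: "\<forall>\<^sub>F \<epsilon> in at_right 0. tube T \<gamma> \<epsilon>"
proof -
 obtain K where K: "K > 0" "\<And>s. kap s \<le> K" by (rule kap_upper) blast
 have "tube T \<gamma> \<epsilon>" if "0 < \<epsilon>" "\<epsilon> < 1 / K" for \<epsilon>
 proof
  fix s
  have "\<epsilon> * kap s \<le> \<epsilon> * K" using that K by (intro mult_left_mono) auto
  also have "\<dots> < 1" using that K by (simp add: field_simps)
  finally show "\<epsilon> * kap s < 1" .
 qed (use that in auto)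
 then show ?thesis using K(1) by (auto simp: eventually_at_right_field intro!: exI[of _ "1 / K"])
qed

text \<open>Here the asymptotic direction is explicit: its angle \<phi> has tangent \<mu> with
  \<open>\<mu>\<^sup>2 = \<epsilon> * (kap s * cos \<theta> / q)\<close>. Inserting it into
  \<open>outward_pointing_cform\<close> and cancelling positive factors gives the inequality. The
  sign of \<sigma> appears negated because the principal direction is \<open>- tv\<close>.\<close>

lemma pointing_constant_necessary:
 assumes tube: "tube T \<gamma> \<epsilon>" and c: "0 < sqrt \<epsilon> * c" "sqrt \<epsilon> * c < pi / 2"
  and \<sigma>: "\<sigma> = 1 \<or> \<sigma> = -1" and out: "outward_pointing \<gamma> \<epsilon> (s, sqrt \<epsilon> * c) \<sigma> 1"
 shows "- \<sigma> * (velocity kap s * cos (sqrt \<epsilon> * c) + kap s * tor s * sin (sqrt \<epsilon> * c)) \<le>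
  3 * kap s * (sin (sqrt \<epsilon> * c) / sqrt \<epsilon>) * sqrt (kap s * cos (sqrt \<epsilon> * c) * (1 - \<epsilon> * kap s * cos (sqrt \<epsilon> * c)))"
proof -
 interpret tube T \<gamma> \<epsilon> by fact
 define \<theta> where "\<theta> = sqrt \<epsilon> * c"
 have cs: "cos \<theta> > 0" "sin \<theta> > 0" using c by (auto simp: \<theta>_def intro!: cos_gt_zero_pi sin_gt_zero)
 let ?x = "(s, \<theta>)"
 define q where "q = qq ?x"
 have q: "q > 0" "q = 1 - \<epsilon> * kap s * cos \<theta>" by (simp_all add: q_def qq_pos) (simp add: qq_def)
 define \<mu> where "\<mu> = sqrt (\<epsilon> * (kap s * cos \<theta> / q))"
 have \<mu>: "\<mu> > 0" "\<mu>\<^sup>2 = \<epsilon> * (kap s * cos \<theta> / q)"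
  using eps_pos kap_pos[of s] cs q by (auto simp: \<mu>_def)
 define \<phi> where "\<phi> = arctan \<mu>"
 have \<phi>: "0 < \<phi>" "\<phi> < pi / 2" using \<mu> arctan_ubound[of \<mu>] by (auto simp: \<phi>_def zero_less_arctan_iff)
 have cp: "cos \<phi> > 0" using \<phi> by (intro cos_gt_zero_pi) auto
 have sp: "sin \<phi> = \<mu> * cos \<phi>" using tan_arctan[of \<mu>] cp by (simp add: \<phi>_def tan_def field_simps)
 have \<sigma>2: "(- \<sigma>)\<^sup>2 = 1" using \<sigma> by auto
 have "kform ?x (- \<sigma> * cos \<phi>, sin \<phi>) = 0"
  using \<sigma>2 eps_pos by (simp add: kform_def sp power_mult_distrib \<mu>(2) q_def)
 then have "cform ?x (- \<sigma> * cos \<phi>, sin \<phi>) \<le> 0"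
  using outward_pointing_cform[of ?x \<sigma> \<phi>] out \<sigma> cs \<phi> by (simp add: \<theta>_def)
 moreover have "cform ?x (- \<sigma> * cos \<phi>, sin \<phi>) = (cos \<phi>)\<^sup>2 / q\<^sup>2 * (cos \<phi> * (- \<sigma> * (velocity kap s * cos \<theta> + kap s * tor s * sin \<theta>) / q - 3 * kap s * sin \<theta> * \<mu> / \<epsilon>))"
  using \<sigma>2 by (simp add: cform_def sp power_mult_distrib q_def algebra_simps)
 ultimately have "((cos \<phi>)\<^sup>2 / q\<^sup>2 * cos \<phi>) * (- \<sigma> * (velocity kap s * cos \<theta> + kap s * tor s * sin \<theta>) / q - 3 * kap s * sin \<theta> * \<mu> / \<epsilon>) \<le> 0"
  by (simp only: mult.assoc)
 moreover have "(cos \<phi>)\<^sup>2 / q\<^sup>2 * cos \<phi> > 0" using cp q(1) by simp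
 ultimately have "- \<sigma> * (velocity kap s * cos \<theta> + kap s * tor s * sin \<theta>) / q - 3 * kap s * sin \<theta> * \<mu> / \<epsilon> \<le> 0"
  using mult_pos_pos not_le by metis
 then have "- \<sigma> * (velocity kap s * cos \<theta> + kap s * tor s * sin \<theta>) \<le> 3 * kap s * sin \<theta> * (\<mu> / \<epsilon> * q)"
  using q(1) by (simp add: field_simps)
 also have "\<mu> / \<epsilon> * q = sqrt (kap s * cos \<theta> * q) / sqrt \<epsilon>"
 proof -
  have "\<mu> / \<epsilon> * q = sqrt \<epsilon> * sqrt (kap s * cos \<theta>) / sqrt q / (sqrt \<epsilon> * sqrt \<epsilon>) * (sqrt q * sqrt q)"
   using eps_pos q(1) by (simp add: \<mu>_def real_sqrt_mult real_sqrt_divide)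
  also have "\<dots> = sqrt (kap s * cos \<theta>) * sqrt q / sqrt \<epsilon>"
   using eps_pos q(1) by (simp add: field_simps)
  finally show ?thesis by (simp add: real_sqrt_mult)
 qed
 finally show ?thesis by (simp add: \<theta>_def q(2) mult_ac)
qed

text \<open>The left end \<open>\<theta> = sqrt \<epsilon> * c\<close> of the first interval belongs
  to it as soon as \<open>sqrt \<epsilon> * c \<le> pi / 4\<close>. There the two outward-pointing
  quadrants give the necessary inequality for both signs, that is, for the absolute value. In the
  limit the torsion term disappears and \<open>sin (t * c) / t\<close> becomes
  \<open>c\<close>.\<close>

lemma pointing_constant_bound:
 assumes "pointing_constant \<gamma> s c"
 shows "\<bar>velocity kap s\<bar> \<le> 3 * kap s * c * sqrt (kap s)"
proof -
 have c: "c > 0" using assms by (simp add: pointing_constant_def)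
 have small: "\<forall>\<^sub>F \<epsilon> in at_right (0::real). 0 < \<epsilon> \<and> sqrt \<epsilon> * c \<le> pi / 4"
 proof -
  have "sqrt \<epsilon> * c \<le> pi / 4" if "0 < \<epsilon>" "\<epsilon> < (pi / (4 * c))\<^sup>2" for \<epsilon>
  proof -
   have "sqrt \<epsilon> < pi / (4 * c)" using that c real_less_lsqrt[of "pi / (4 * c)" \<epsilon>] by simp
   then show ?thesis using c by (simp add: field_simps)
  qed
  then show ?thesis using c by (auto simp: eventually_at_right_field intro!: exI[of _ "(pi / (4 * c))\<^sup>2"])
 qed
 have ev: "\<forall>\<^sub>F \<epsilon> in at_right 0. \<bar>velocity kap s * cos (sqrt \<epsilon> * c) + kap s * tor s * sin (sqrt \<epsilon> * c)\<bar> \<le>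
  3 * kap s * (sin (sqrt \<epsilon> * c) / sqrt \<epsilon>) * sqrt (kap s * cos (sqrt \<epsilon> * c) * (1 - \<epsilon> * kap s * cos (sqrt \<epsilon> * c)))"
  using eventually_tube small assms[unfolded pointing_constant_def, THEN conjunct2]
 proof eventually_elim
  case (elim \<epsilon>)
  have b: "0 < sqrt \<epsilon> * c" "sqrt \<epsilon> * c < pi / 2" using elim(2) c pi_gt_zero by (auto simp del: pi_gt_zero)
  have "sqrt \<epsilon> * c \<le> pi / 4" using elim(2) by blast
  then have "sqrt \<epsilon> * c \<in> {sqrt \<epsilon> * c..pi / 2 - sqrt \<epsilon> * c}" unfolding atLeastAtMost_iff by linarith
  then have o: "outward_pointing \<gamma> \<epsilon> (s, sqrt \<epsilon> * c) 1 1" "outward_pointing \<gamma> \<epsilon> (s, sqrt \<epsilon> * c) (- 1) 1"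
   using elim(3) by blast+
  from pointing_constant_necessary[OF elim(1) b _ o(1)] pointing_constant_necessary[OF elim(1) b _ o(2)]
  show ?case by (auto simp: abs_le_iff)
 qed
 have ev2: "\<forall>\<^sub>F t in at_right 0. \<bar>velocity kap s * cos (t * c) + kap s * tor s * sin (t * c)\<bar> \<le>
  3 * kap s * (sin (t * c) / t) * sqrt (kap s * cos (t * c) * (1 - t\<^sup>2 * kap s * cos (t * c)))"
  using eventually_at_right_square[OF ev] eventually_at_right_less[of 0]
  by eventually_elim simp
 have l1: "((\<lambda>t. \<bar>velocity kap s * cos (t * c) + kap s * tor s * sin (t * c)\<bar>) \<longlongrightarrow>
  \<bar>velocity kap s * cos (0 * c) + kap s * tor s * sin (0 * c)\<bar>) (at_right 0)"
  by (intro tendsto_intros)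
 have l2: "((\<lambda>t. 3 * kap s * (sin (t * c) / t) * sqrt (kap s * cos (t * c) * (1 - t\<^sup>2 * kap s * cos (t * c)))) \<longlongrightarrow>
  3 * kap s * c * sqrt (kap s * cos (0 * c) * (1 - 0\<^sup>2 * kap s * cos (0 * c)))) (at_right 0)"
  by (intro tendsto_intros sin_quotient_limit)
 from tendsto_le[OF trivial_limit_at_right_real l2 l1 ev2] show ?thesis by simp
qed

end

text \<open>Of the four asymptotic half-directions at \<open>x\<close>, those whose
  \<open>ww\<close>-component points against the sign of \<open>sin (snd x)\<close> will carry the
  two cuspidal regions, and the other two will carry nothing.\<close>

definition (in tube) nondegenerate :: "real \<times> real \<Rightarrow> bool" where
 "nondegenerate x \<longleftrightarrow> cos (snd x) > 0 \<and> sin (snd x) \<noteq> 0 \<and>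
   (\<forall>e. e \<noteq> 0 \<longrightarrow> kform x e = 0 \<longrightarrow>
    (snd e * sin (snd x) < 0 \<longrightarrow> cform x e > 0) \<and> (snd e * sin (snd x) > 0 \<longrightarrow> cform x e < 0))"

context tube
begin

text \<open>On an asymptotic direction \<open>\<bar>snd e\<bar>\<close> is \<open>\<bar>fst e\<bar>
  * sqrt (\<epsilon> * kap s * cos \<theta> / q)\<close>. The hypothesis \<open>main\<close> is then
  the statement that in \<open>cform\<close> the term with \<open>snd e\<close> outweighs the term
  with the derivative of the curvature and the torsion, so it alone decides the sign.\<close>

lemma nondegenerateI:
 assumes c: "cos \<theta> > 0" "sin \<theta> \<noteq> 0"
  and main: "\<bar>velocity kap s * cos \<theta> + kap s * tor s * sin \<theta>\<bar> * sqrt \<epsilon> < 3 * kap s * \<bar>sin \<theta>\<bar> * sqrt (kap s * cos \<theta> * qq (s, \<theta>))"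
 shows "nondegenerate (s, \<theta>)"
 unfolding nondegenerate_def
proof (intro conjI allI impI)
 define q where "q = qq (s, \<theta>)"
 have q: "q > 0" by (simp add: q_def qq_pos)
 define D where "D = velocity kap s * cos \<theta> + kap s * tor s * sin \<theta>"
 have key: "\<bar>fst e * D / q\<bar> < \<bar>3 * kap s * sin \<theta> * snd e / \<epsilon>\<bar> \<and> fst e \<noteq> 0" if e: "e \<noteq> 0" "kform (s, \<theta>) e = 0" for e
 proof -
  have Q2: "(snd e)\<^sup>2 = (fst e)\<^sup>2 * (\<epsilon> * (kap s * cos \<theta>) / q)"
   using e(2) eps_pos q by (simp add: kform_def q_def field_simps)
  have P: "fst e \<noteq> 0" using Q2 e(1) by (cases e) (auto simp: zero_prod_def)
  have "\<bar>snd e\<bar> = sqrt ((snd e)\<^sup>2)" by simp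
  also have "\<dots> = \<bar>fst e\<bar> * (sqrt \<epsilon> * sqrt (kap s * cos \<theta>) / sqrt q)"
   unfolding Q2 by (simp add: real_sqrt_mult real_sqrt_divide)
  finally have Q: "\<bar>snd e\<bar> = \<bar>fst e\<bar> * (sqrt \<epsilon> * sqrt (kap s * cos \<theta>) / sqrt q)" .
  have "\<bar>D\<bar> < 3 * kap s * \<bar>sin \<theta>\<bar> * sqrt (kap s * cos \<theta> * q) / sqrt \<epsilon>"
   using main eps_pos by (simp add: D_def q_def pos_less_divide_eq)
  then have "\<bar>fst e\<bar> / q * \<bar>D\<bar> < \<bar>fst e\<bar> / q * (3 * kap s * \<bar>sin \<theta>\<bar> * sqrt (kap s * cos \<theta> * q) / sqrt \<epsilon>)"
   using P q by (intro mult_strict_left_mono) auto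
  also have "\<dots> = 3 * kap s * \<bar>sin \<theta>\<bar> * \<bar>snd e\<bar> / \<epsilon>"
  proof -
   define r where "r = sqrt q"
   define t where "t = sqrt \<epsilon>"
   have rt: "r > 0" "q = r * r" "t > 0" "\<epsilon> = t * t" using q eps_pos by (auto simp: r_def t_def)
   have "sqrt (kap s * cos \<theta> * q) = sqrt (kap s * cos \<theta>) * r" by (simp add: real_sqrt_mult r_def)
   then show ?thesis unfolding Q r_def[symmetric] t_def[symmetric] using rt(1,3) by (simp add: rt(2,4) field_simps)
  qed
  finally have "\<bar>fst e\<bar> / q * \<bar>D\<bar> < 3 * kap s * \<bar>sin \<theta>\<bar> * \<bar>snd e\<bar> / \<epsilon>" .
  then show ?thesis using P kap_pos[of s] q eps_pos by (simp add: abs_mult)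
 qed
 have cf: "cform (s, \<theta>) e = (fst e)\<^sup>2 / q\<^sup>2 * (fst e * D / q - 3 * kap s * sin \<theta> * snd e / \<epsilon>)" for e
  by (simp add: cform_def q_def D_def)
 fix e :: "real \<times> real" assume e: "e \<noteq> 0" "kform (s, \<theta>) e = 0"
 have f: "(fst e)\<^sup>2 / q\<^sup>2 > 0" using key[OF e] q by simp
 show "cform (s, \<theta>) e > 0" if "snd e * sin (snd (s, \<theta>)) < 0"
 proof -
  have "3 * kap s * sin \<theta> * snd e / \<epsilon> < 0"
   using that kap_pos[of s] eps_pos mult_pos_neg[of "3 * kap s / \<epsilon>" "snd e * sin \<theta>"] by (simp add: mult_ac)
  then have "fst e * D / q - 3 * kap s * sin \<theta> * snd e / \<epsilon> > 0" using key[OF e] by linarith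
  then show ?thesis unfolding cf using f by (intro mult_pos_pos)
 qed
 show "cform (s, \<theta>) e < 0" if "snd e * sin (snd (s, \<theta>)) > 0"
 proof -
  have "3 * kap s * sin \<theta> * snd e / \<epsilon> > 0"
   using that kap_pos[of s] eps_pos mult_pos_pos[of "3 * kap s / \<epsilon>" "snd e * sin \<theta>"] by (simp add: mult_ac)
  then have "fst e * D / q - 3 * kap s * sin \<theta> * snd e / \<epsilon> < 0" using key[OF e] by linarith
  then show ?thesis unfolding cf using f by (intro mult_pos_neg)
 qed
qed (use c in auto)

end

context knot
begin

text \<open>The constant 3 required by \<open>nondegenerateI\<close> is split as 5/2 + 1/2. For the
  derivative of the curvature the hypothesis gives 3/2, which is 3/5 of 5/2; the gap between 3/5 and
  1 pays for replacing \<open>CK * t\<close> by \<open>sin (t * CK)\<close> and \<open>qq\<close> by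
  its lower bound. The torsion term carries an additional small factor and fits into the remaining
  1/2.\<close>

lemma eventually_nondegenerate:
 assumes CK: "CK > 0" and b: "\<And>s. \<bar>velocity kap s\<bar> \<le> 3 / 2 * kap s * CK * sqrt (kap s)"
 shows "\<forall>\<^sub>F \<epsilon> in at_right 0. tube T \<gamma> \<epsilon> \<and> sqrt \<epsilon> * CK \<le> pi / 4 \<and>
  (\<forall>s \<theta>. sin (sqrt \<epsilon> * CK) \<le> cos \<theta> \<longrightarrow> sin (sqrt \<epsilon> * CK) \<le> \<bar>sin \<theta>\<bar> \<longrightarrow> tube.nondegenerate \<gamma> \<epsilon> (s, \<theta>))"
proof (rule eventually_at_right_sqrt)
 obtain K where K: "K > 0" "\<And>s. kap s \<le> K" by (rule kap_upper) blast
 obtain k where k: "k > 0" "\<And>s. k \<le> kap s" by (rule kap_lower) blast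
 obtain B where B: "B > 0" "\<And>s. \<bar>tor s\<bar> \<le> B"
  by (rule periodic_bounded[OF sm_continuous_on[OF sm_tor] tor_periodic T_pos]) blast
 note SL = sin_quotient_limit[of CK]
 have "((\<lambda>t. sqrt (1 - t\<^sup>2 * K) * (sin (t * CK) / t)) \<longlongrightarrow> sqrt (1 - 0\<^sup>2 * K) * CK) (at_right 0)"
  by (intro tendsto_intros SL)
 then have e1: "\<forall>\<^sub>F t in at_right 0. sqrt (1 - t\<^sup>2 * K) * (sin (t * CK) / t) > 3 / 5 * CK"
  by (rule order_tendstoD) (use CK in simp)
 \<comment> \<open>Multiplied by \<open>t\<close>, positivity of this expression says that
   \<open>(2 * B * t)\<^sup>2\<close> is below a lower bound of
   \<open>kap s * cos \<theta> * q\<close>; this is the estimate of the torsion term.\<close>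
 have "((\<lambda>t. k * (sin (t * CK) / t) * (1 - t\<^sup>2 * K) - 4 * B\<^sup>2 * t) \<longlongrightarrow> k * CK * (1 - 0\<^sup>2 * K) - 4 * B\<^sup>2 * 0) (at_right 0)"
  by (intro tendsto_intros SL)
 then have e2: "\<forall>\<^sub>F t in at_right 0. k * (sin (t * CK) / t) * (1 - t\<^sup>2 * K) - 4 * B\<^sup>2 * t > 0"
  by (rule order_tendstoD) (use CK k in simp)
 have e3: "\<forall>\<^sub>F t in at_right 0. 1 - t\<^sup>2 * K > 0"
 proof -
  have "((\<lambda>t. 1 - t\<^sup>2 * K) \<longlongrightarrow> 1 - 0\<^sup>2 * K) (at_right 0)" by (intro tendsto_intros)
  then show ?thesis by (rule order_tendstoD) simp
 qed
 have e4: "\<forall>\<^sub>F t in at_right 0. t * CK < pi / 4"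
 proof -
  have "((\<lambda>t. t * CK) \<longlongrightarrow> 0 * CK) (at_right 0)" by (intro tendsto_intros)
  then show ?thesis by (rule order_tendstoD) simp
 qed
 show "\<forall>\<^sub>F t in at_right 0. tube T \<gamma> (t\<^sup>2) \<and> sqrt (t\<^sup>2) * CK \<le> pi / 4 \<and>
  (\<forall>s \<theta>. sin (sqrt (t\<^sup>2) * CK) \<le> cos \<theta> \<longrightarrow> sin (sqrt (t\<^sup>2) * CK) \<le> \<bar>sin \<theta>\<bar> \<longrightarrow> tube.nondegenerate \<gamma> (t\<^sup>2) (s, \<theta>))"
  using eventually_at_right_square[OF eventually_tube] e1 e2 e3 e4 eventually_at_right_less[of 0]
 proof eventually_elim
  case (elim t)
  interpret tube T \<gamma> "t\<^sup>2" by (rule elim(1))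
  have t: "t > 0" "sqrt (t\<^sup>2) = t" using elim(6) by auto
  define S where "S = sin (t * CK)"
  have "t * CK < pi" using elim(5) pi_gt_zero by linarith
  then have S: "S > 0" using t CK unfolding S_def by (intro sin_gt_zero) auto
  have "nondegenerate (s, \<theta>)" if th: "S \<le> cos \<theta>" "S \<le> \<bar>sin \<theta>\<bar>" for s \<theta>
  proof (rule nondegenerateI)
   show c: "cos \<theta> > 0" "sin \<theta> \<noteq> 0" using th S by auto
   define q where "q = qq (s, \<theta>)"
   have qb: "1 - t\<^sup>2 * K \<le> q"
   proof -
    have "kap s * cos \<theta> \<le> K * 1" using K c kap_pos[of s] by (intro mult_mono) (auto simp: less_imp_le)
    then have "t\<^sup>2 * (kap s * cos \<theta>) \<le> t\<^sup>2 * K" by (intro mult_left_mono) auto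
    then show ?thesis by (simp add: q_def qq_def mult_ac)
   qed
   have q: "q > 0" using qb elim(4) by linarith
   define w where "w = sqrt (kap s * cos \<theta> * q)"
   have w: "w = sqrt (kap s) * sqrt (cos \<theta>) * sqrt q" by (simp add: w_def real_sqrt_mult)
   have 1: "\<bar>velocity kap s * cos \<theta>\<bar> * t < 5 / 2 * kap s * \<bar>sin \<theta>\<bar> * w"
   proof -
    have "\<bar>velocity kap s * cos \<theta>\<bar> \<le> (3 / 2 * kap s * CK * sqrt (kap s)) * sqrt (cos \<theta>)"
    proof -
     have "sqrt (cos \<theta>) * sqrt (cos \<theta>) \<le> 1 * sqrt (cos \<theta>)"
      using c by (intro mult_right_mono) auto
     then have "cos \<theta> \<le> sqrt (cos \<theta>)" using c by simp
     then have "\<bar>velocity kap s\<bar> * cos \<theta> \<le> (3 / 2 * kap s * CK * sqrt (kap s)) * sqrt (cos \<theta>)"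
      using b[of s] c CK kap_pos[of s] by (intro mult_mono) auto
     then show ?thesis using c by (simp add: abs_mult)
    qed
    then have "\<bar>velocity kap s * cos \<theta>\<bar> * t \<le> (5 / 2 * kap s * sqrt (kap s) * sqrt (cos \<theta>)) * (3 / 5 * CK * t)"
     using mult_right_mono[of _ _ t] t by (fastforce simp: mult_ac)
    also have "\<dots> < (5 / 2 * kap s * sqrt (kap s) * sqrt (cos \<theta>)) * (sqrt (1 - t\<^sup>2 * K) * S)"
    proof (rule mult_strict_left_mono)
     show "3 / 5 * CK * t < sqrt (1 - t\<^sup>2 * K) * S" using elim(2) t by (simp add: S_def field_simps)
    qed (use kap_pos[of s] c in auto)
    also have "\<dots> \<le> (5 / 2 * kap s * sqrt (kap s) * sqrt (cos \<theta>)) * (sqrt q * \<bar>sin \<theta>\<bar>)"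
     using qb th S kap_pos[of s] c elim(4) q by (intro mult_left_mono mult_mono) auto
    finally show ?thesis by (simp add: w mult_ac)
   qed
   have 2: "\<bar>kap s * tor s * sin \<theta>\<bar> * t \<le> 1 / 2 * kap s * \<bar>sin \<theta>\<bar> * w"
   proof -
    have "2 * B * t \<le> w" unfolding w_def
    proof (rule real_le_rsqrt)
     have "(2 * B * t)\<^sup>2 = t * (4 * B\<^sup>2 * t)" by (simp add: power2_eq_square)
     also have "\<dots> \<le> t * (k * (S / t) * (1 - t\<^sup>2 * K))"
      using elim(3) t by (intro mult_left_mono) (auto simp: S_def)
     also have "\<dots> = k * S * (1 - t\<^sup>2 * K)" using t by simp
     also have "\<dots> \<le> kap s * cos \<theta> * q"
      using k th qb elim(4) S c kap_pos[of s] by (intro mult_mono) (auto simp: less_imp_le)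
     finally show "(2 * B * t)\<^sup>2 \<le> kap s * cos \<theta> * q" .
    qed
    moreover have "2 * (\<bar>tor s\<bar> * t) \<le> 2 * (B * t)" using B(2)[of s] t by simp
    ultimately have "\<bar>tor s\<bar> * t \<le> w / 2" by simp
    then have "(kap s * \<bar>sin \<theta>\<bar>) * (\<bar>tor s\<bar> * t) \<le> (kap s * \<bar>sin \<theta>\<bar>) * (w / 2)"
     using kap_pos[of s] by (intro mult_left_mono) auto
    then show ?thesis using kap_pos[of s] by (simp add: abs_mult mult_ac)
   qed
   have "\<bar>velocity kap s * cos \<theta> + kap s * tor s * sin \<theta>\<bar> * t \<le> (\<bar>velocity kap s * cos \<theta>\<bar> + \<bar>kap s * tor s * sin \<theta>\<bar>) * t"
    using t by (intro mult_right_mono abs_triangle_ineq) auto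
   also have "\<dots> < 3 * kap s * \<bar>sin \<theta>\<bar> * w" using 1 2 by (simp add: algebra_simps)
   finally show "\<bar>velocity kap s * cos \<theta> + kap s * tor s * sin \<theta>\<bar> * sqrt (t\<^sup>2) < 3 * kap s * \<bar>sin \<theta>\<bar> * sqrt (kap s * cos \<theta> * qq (s, \<theta>))"
    unfolding t(2) w_def q_def .
  qed
  then show ?case using elim(1,5) t by (simp add: S_def)
 qed
qed

end

section \<open>The tubular neighbourhood of the diagonal\<close>

lemma smooth_circle_section:
 obtains U L where "smooth L U" "\<And>\<theta>. \<bar>\<theta> - \<theta>0\<bar> < pi / 2 \<Longrightarrow> cis \<theta> \<in> U \<and> L (cis \<theta>) = (\<theta>::real)"
proof -
 define U where "U = {z. 0 < Re (z * cis (- \<theta>0))}"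
 have U: "open U" unfolding U_def by (intro open_Collect_less continuous_intros)
 define L where "L z = \<theta>0 + arctan (Im (z * cis (- \<theta>0)) / Re (z * cis (- \<theta>0)))" for z
 have "smooth L U"
  unfolding L_def[abs_def] by (intro sm_intros U) (auto simp: U_def)
 moreover have "cis \<theta> \<in> U \<and> L (cis \<theta>) = \<theta>" if "\<bar>\<theta> - \<theta>0\<bar> < pi / 2" for \<theta>
 proof -
  have e: "cis \<theta> * cis (- \<theta>0) = cis (\<theta> - \<theta>0)" by (simp add: cis_mult)
  have b: "- (pi / 2) < \<theta> - \<theta>0" "\<theta> - \<theta>0 < pi / 2" using that by linarith+
  have "cos (\<theta> - \<theta>0) > 0" using b by (intro cos_gt_zero_pi)
  moreover have "arctan (sin (\<theta> - \<theta>0) / cos (\<theta> - \<theta>0)) = \<theta> - \<theta>0"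
   using arctan_tan[OF b] by (simp add: tan_def)
  ultimately show ?thesis unfolding U_def L_def mem_Collect_eq e by simp
 qed
 ultimately show thesis by (rule that)
qed

lemma smooth_torus_section:
 fixes x0 :: "real \<times> real"
 assumes T: "T > 0"
 obtains U L V where "smooth L U" "open V" "x0 \<in> V" "\<And>x. x \<in> V \<Longrightarrow> torus_pt T x \<in> U \<and> L (torus_pt T x) = x"
proof -
 obtain U1 L1 where 1: "smooth L1 U1"
  "\<And>\<theta>. \<bar>\<theta> - 2 * pi * fst x0 / T\<bar> < pi / 2 \<Longrightarrow> cis \<theta> \<in> U1 \<and> L1 (cis \<theta>) = \<theta>"
  by (rule smooth_circle_section) blast
 obtain U2 L2 where 2: "smooth L2 U2"
  "\<And>\<theta>. \<bar>\<theta> - snd x0\<bar> < pi / 2 \<Longrightarrow> cis \<theta> \<in> U2 \<and> L2 (cis \<theta>) = \<theta>"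
  by (rule smooth_circle_section) blast
 define V where "V = {x. \<bar>2 * pi * fst x / T - 2 * pi * fst x0 / T\<bar> < pi / 2 \<and> \<bar>snd x - snd x0\<bar> < pi / 2}"
 have o: "open (U1 \<times> U2)" using sm_open[OF 1(1)] sm_open[OF 2(1)] by (rule open_Times)
 show thesis
 proof (rule that[of "\<lambda>z. (L1 (fst z) * (T / (2 * pi)), L2 (snd z))" "U1 \<times> U2" V])
  show "smooth (\<lambda>z. (L1 (fst z) * (T / (2 * pi)), L2 (snd z))) (U1 \<times> U2)"
   by (intro sm_intros sm_compose[OF 1(1)] sm_compose[OF 2(1)] o) auto
  show "open V" unfolding V_def
   by (intro open_Collect_conj open_Collect_less continuous_intros) (use T in auto)
  show "x0 \<in> V" by (simp add: V_def)
  fix x assume "x \<in> V"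
  then show "torus_pt T x \<in> U1 \<times> U2 \<and> (L1 (fst (torus_pt T x)) * (T / (2 * pi)), L2 (snd (torus_pt T x))) = x"
   using 1(2)[of "2 * pi * fst x / T"] 2(2)[of "snd x"] T
   by (auto simp: torus_pt_def case_prod_unfold V_def prod_eq_iff)
 qed
qed

lemma smooth_torus_section2:
 fixes z0 :: "(real \<times> real) \<times> (real \<times> real)"
 assumes T: "T > 0"
 obtains U L V where "smooth L U" "open V" "z0 \<in> V" "\<And>z. z \<in> V \<Longrightarrow> torus_pt2 T z \<in> U \<and> L (torus_pt2 T z) = z"
proof -
 obtain U1 L1 V1 where 1: "smooth L1 U1" "open V1" "fst z0 \<in> V1" "\<And>x. x \<in> V1 \<Longrightarrow> torus_pt T x \<in> U1 \<and> L1 (torus_pt T x) = x"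
  by (rule smooth_torus_section[OF T]) blast
 obtain U2 L2 V2 where 2: "smooth L2 U2" "open V2" "snd z0 \<in> V2" "\<And>x. x \<in> V2 \<Longrightarrow> torus_pt T x \<in> U2 \<and> L2 (torus_pt T x) = x"
  by (rule smooth_torus_section[OF T]) blast
 have o: "open (U1 \<times> U2)" using sm_open[OF 1(1)] sm_open[OF 2(1)] by (rule open_Times)
 show thesis
 proof (rule that[of "\<lambda>z. (L1 (fst z), L2 (snd z))" "U1 \<times> U2" "V1 \<times> V2"])
  show "smooth (\<lambda>z. (L1 (fst z), L2 (snd z))) (U1 \<times> U2)"
   by (intro sm_intros sm_compose[OF 1(1)] sm_compose[OF 2(1)] o) auto
  show "torus_pt2 T z \<in> U1 \<times> U2 \<and> (L1 (fst (torus_pt2 T z)), L2 (snd (torus_pt2 T z))) = z" if "z \<in> V1 \<times> V2" for z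
   using that 1(4)[of "fst z"] 2(4)[of "snd z"] by (auto simp: torus_pt2_eq prod_eq_iff)
 qed (use 1 2 in \<open>auto simp: open_Times mem_Times_iff\<close>)
qed

lemma sm_torus_pt2: "smooth (torus_pt2 T) UNIV"
 unfolding torus_pt2_eq[abs_def] torus_pt_def case_prod_unfold divide_inverse
 by (intro sm_intros open_UNIV)

context tube
begin

text \<open>The quotient map is open. The points of a period rectangle without a translate in
  \<open>A\<close> form a compact set; its image is closed and misses \<open>torus_pt T x0\<close>,
  so the complement of the image is the required neighbourhood.\<close>

lemma torus_pt_near_lift:
 assumes "open A" "x0 \<in> A"
 obtains W where "open W" "torus_pt T x0 \<in> W" "\<And>x. torus_pt T x \<in> W \<Longrightarrow> \<exists>l\<in>lattice. x + l \<in> A"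
proof -
 define K where "K = {y \<in> {fst x0..fst x0 + T} \<times> {snd x0..snd x0 + 2 * pi}. \<forall>l\<in>lattice. y + l \<notin> A}"
 have fl: "\<exists>l\<in>lattice. x + l \<in> {fst x0..fst x0 + T} \<times> {snd x0..snd x0 + 2 * pi}" for x
 proof -
  obtain l where l: "l \<in> lattice" "(x - x0) + l \<in> box" using box_shift by blast
  then show ?thesis by (intro bexI[of _ l]) (auto simp: box_def mem_Times_iff algebra_simps)
 qed
 have "K = ({fst x0..fst x0 + T} \<times> {snd x0..snd x0 + 2 * pi}) \<inter> (\<Inter>l\<in>lattice. (\<lambda>y. y + l) -` (- A))"
  by (auto simp: K_def)
 moreover have "closed ((\<lambda>y. y + l) -` (- A))" for l
  by (intro closed_vimage continuous_intros) (use assms in auto)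
 ultimately have cK: "compact K"
  by (simp add: compact_Times compact_Int_closed closed_INT)
 have ct: "continuous_on UNIV (torus_pt T)"
  unfolding torus_pt_def case_prod_unfold by (intro continuous_intros) (use T_pos in auto)
 have "closed (torus_pt T ` K)"
  by (intro compact_imp_closed compact_continuous_image cK continuous_on_subset[OF ct]) auto
 show thesis
 proof (rule that[of "- torus_pt T ` K"])
  show "open (- torus_pt T ` K)" using \<open>closed (torus_pt T ` K)\<close> by auto
  show "torus_pt T x0 \<in> - torus_pt T ` K"
  proof
   assume "torus_pt T x0 \<in> torus_pt T ` K"
   then obtain y where y: "y \<in> K" "torus_pt T y = torus_pt T x0" by force
   then have "x0 - y \<in> lattice" by (simp add: torus_pt_eq_iff)
   then have "y + (x0 - y) \<notin> A" using y(1) unfolding K_def by blast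
   then show False using assms(2) by simp
  qed
  fix x assume x: "torus_pt T x \<in> - torus_pt T ` K"
  obtain l where l: "l \<in> lattice" "x + l \<in> {fst x0..fst x0 + T} \<times> {snd x0..snd x0 + 2 * pi}" by (rule bexE[OF fl])
  have "torus_pt T (x + l) = torus_pt T x" using lattice_minus[OF l(1)] by (simp add: torus_pt_eq_iff)
  then have "x + l \<notin> K" using x imageI[of "x + l" K "torus_pt T"] by auto
  then obtain l' where "l' \<in> lattice" "x + l + l' \<in> A" using l(2) by (auto simp: K_def)
  then show "\<exists>l\<in>lattice. x + l \<in> A"
   using lattice_add[OF l(1)] by (intro bexI[of _ "l + l'"]) (auto simp: add.assoc)
 qed
qed

lemma Pr_0: "Pr (x, 0) = (x, x)" by (simp add: Pr_def Exp_0)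

definition frame_inv :: "real \<times> real \<Rightarrow> real \<times> real \<Rightarrow> real \<times> real" where
 "frame_inv x a = (fst a / qq x, snd a / \<epsilon> - tor (fst x) * (fst a / qq x))"

lemma hd_Exp_0: "((\<lambda>z. Exp (fst z) (snd z)) has_derivative (\<lambda>d. fst d + frame_inv x (snd d))) (at (x, 0))"
proof -
 let ?E = "\<lambda>z. Exp (fst z) (snd z)"
 let ?D = "frechet ?E (at (x, 0))"
 have D: "(?E has_derivative ?D) (at (x, 0))" by (rule sm_has_derivative[OF sm_Exp]) simp
 have dir: "((\<lambda>t. ?E ((x, 0) + t *\<^sub>R d)) has_vector_derivative ?D d) (at 0)" for d
 proof -
  have l: "((\<lambda>t. (x, 0) + t *\<^sub>R d) has_derivative (\<lambda>h. h *\<^sub>R d)) (at 0)"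
   by (auto intro!: derivative_eq_intros)
  have "((\<lambda>t. ?E ((x, 0) + t *\<^sub>R d)) has_derivative (\<lambda>h. ?D (h *\<^sub>R d))) (at 0)"
   by (rule has_derivative_compose[OF l]) (simp add: D)
  moreover have "?D (h *\<^sub>R d) = h *\<^sub>R ?D d" for h
   by (rule linear_scale[OF has_derivative_linear[OF D]])
  ultimately show ?thesis by (simp add: has_vector_derivative_def)
 qed
 have "?D d = fst d + frame_inv x (snd d)" for d
 proof -
  have a: "((\<lambda>t. x + t *\<^sub>R fst d) has_vector_derivative fst d) (at 0)"
   by (auto intro!: derivative_eq_intros)
  have b: "((\<lambda>t. x + t *\<^sub>R fst d) has_vector_derivative ?D (fst d, 0)) (at 0)"
   using dir[of "(fst d, 0)"] by (simp add: Exp_0)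
  have 1: "?D (fst d, 0) = fst d" by (rule vector_derivative_unique_at[OF b a])
  have e: "((\<lambda>t. Exp x (t *\<^sub>R snd d)) has_vector_derivative ?D (0, snd d)) (at 0)"
   using dir[of "(0, snd d)"] by simp
  have f: "((\<lambda>t. fst (Exp x (t *\<^sub>R snd d))) has_vector_derivative fst (?D (0, snd d))) (at 0)"
   "((\<lambda>t. snd (Exp x (t *\<^sub>R snd d))) has_vector_derivative snd (?D (0, snd d))) (at 0)"
   by (rule bounded_linear.has_vector_derivative[OF bounded_linear_fst e],
     rule bounded_linear.has_vector_derivative[OF bounded_linear_snd e])
  have g: "((\<lambda>t. fst (Exp x (t *\<^sub>R snd d))) has_vector_derivative fst (frame_inv x (snd d))) (at 0)"
   "((\<lambda>t. snd (Exp x (t *\<^sub>R snd d))) has_vector_derivative snd (frame_inv x (snd d))) (at 0)"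
   using fst_geo_deriv[of x "snd d" 0] snd_geo_deriv[of x "snd d" 0]
   unfolding has_real_derivative_iff_has_vector_derivative by (simp_all add: frame_inv_def geoP_0 geoQ_0 Exp_0)
  have 2: "?D (0, snd d) = frame_inv x (snd d)"
   using vector_derivative_unique_at[OF f(1) g(1)] vector_derivative_unique_at[OF f(2) g(2)] by (simp add: prod_eq_iff)
  have "?D d = ?D (fst d, 0) + ?D (0, snd d)"
   using linear_add[OF has_derivative_linear[OF D], of "(fst d, 0)" "(0, snd d)"] by simp
  then show ?thesis using 1 2 by simp
 qed
 then have "?D = (\<lambda>d. fst d + frame_inv x (snd d))" by blast
 with D show ?thesis by (rule back_subst[where P = "\<lambda>D. (?E has_derivative D) (at (x, 0))"])
qed

lemma frame_inv_minus: "frame_inv x (- a) = - frame_inv x a"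
 by (simp add: frame_inv_def)

text \<open>On the zero section \<open>Pr\<close> has the derivative
  \<open>(d + J e, d - J e)\<close>, where \<open>J = frame_inv x\<close> is the invertible
  derivative of \<open>Exp x\<close> at 0.\<close>

lemma inj_Pr_derivative: "inj (frechet Pr (at (x, 0)))"
proof -
 have m: "((\<lambda>z. (fst z, - snd z)) has_derivative (\<lambda>d. (fst d, - snd d))) (at (x, 0 :: real \<times> real))"
  by (auto intro!: derivative_eq_intros)
 have "((\<lambda>z. Exp (fst z) (- snd z)) has_derivative (\<lambda>d. fst d + frame_inv x (- snd d))) (at (x, 0))"
  using has_derivative_compose[OF m, of "\<lambda>z. Exp (fst z) (snd z)", unfolded fst_conv snd_conv minus_zero, OF hd_Exp_0]
  by (simp only: fst_conv snd_conv)
 from has_derivative_Pair[OF hd_Exp_0 this]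
 have D: "(Pr has_derivative (\<lambda>d. (fst d + frame_inv x (snd d), fst d - frame_inv x (snd d)))) (at (x, 0))"
  unfolding Pr_def[abs_def] frame_inv_minus by simp
 show ?thesis
  unfolding frechet_derivative_at[OF D, symmetric] linear_injective_0[OF has_derivative_linear[OF D]]
 proof (intro allI impI)
  fix d assume "(fst d + frame_inv x (snd d), fst d - frame_inv x (snd d)) = 0"
  then have a: "fst d + frame_inv x (snd d) = 0" "fst d - frame_inv x (snd d) = 0" by (auto simp: zero_prod_def)
  then have "2 *\<^sub>R fst d = 0" by (simp add: scaleR_2 add_eq_0_iff)
  then have 1: "fst d = 0" by simp
  then have "frame_inv x (snd d) = 0" using a by simp
  then have "snd d = 0"
   using qq_nz[of x] eps_pos by (auto simp: frame_inv_def zero_prod_def prod_eq_iff)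
  with 1 show "d = 0" by (simp add: prod_eq_iff)
 qed
qed

lemma Pr_local_inverse:
 obtains V W g where "open V" "(x, 0) \<in> V" "open W" "homeomorphism V W Pr g" "smooth g W"
proof -
 obtain V W g where "open V" "V \<subseteq> UNIV" "(x, 0) \<in> V" "open W" "Pr (x, 0) \<in> W" "homeomorphism V W Pr g" "smooth g W"
  by (rule smooth_inverse_function[OF sm_Pr UNIV_I inj_Pr_derivative]) blast
 then show thesis using that by blast
qed

lemma Exp_near:
 assumes e: "e > 0"
 obtains d where "d > 0" "\<And>x a. norm a \<le> d \<Longrightarrow> norm (Exp x a - x) < e"
proof -
 let ?K = "box \<times> cball (0 :: real \<times> real) 1"
 have "uniformly_continuous_on ?K (\<lambda>z. Exp (fst z) (snd z))"
  by (intro compact_uniformly_continuous continuous_on_subset[OF sm_continuous_on[OF sm_Exp]] compact_Times compact_box compact_cball) auto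
 then obtain d where d: "d > 0" "\<And>z z'. z \<in> ?K \<Longrightarrow> z' \<in> ?K \<Longrightarrow> dist z' z < d \<Longrightarrow> dist (Exp (fst z') (snd z')) (Exp (fst z) (snd z)) < e"
  unfolding uniformly_continuous_on_def using e by metis
 show thesis
 proof (rule that[of "min 1 (d / 2)"])
  fix x a :: "real \<times> real" assume a: "norm a \<le> min 1 (d / 2)"
  obtain l where l: "l \<in> lattice" "x + l \<in> box" using box_shift by blast
  have "dist (Exp (fst (x + l, a)) (snd (x + l, a))) (Exp (fst (x + l, 0 :: real \<times> real)) (snd (x + l, 0 :: real \<times> real))) < e"
   by (rule d(2)) (use l a d(1) in \<open>auto simp: dist_Pair_Pair\<close>)
  then show "norm (Exp x a - x) < e" by (simp add: Exp_0 Exp_lattice[OF l(1)] dist_norm)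
 qed (use d in auto)
qed

lemma lattice_discrete: "l \<in> lattice \<Longrightarrow> norm l < min T (2 * pi) \<Longrightarrow> l = 0"
proof -
 assume l: "l \<in> lattice" "norm l < min T (2 * pi)"
 obtain m n :: int where mn: "l = (of_int m * T, of_int n * (2 * pi))" using l by (auto simp: lattice_def)
 have "\<bar>of_int m * T\<bar> < T" "\<bar>of_int n * (2 * pi)\<bar> < 2 * pi"
  using norm_fst_le[of "fst l" "snd l"] norm_snd_le[of "snd l" "fst l"] l(2) by (auto simp: mn)
 then have "\<bar>of_int m\<bar> * T < 1 * T" "\<bar>of_int n\<bar> * (2 * pi) < 1 * (2 * pi)" using T_pos by (auto simp: abs_mult)
 then have "\<bar>of_int m :: real\<bar> < 1" "\<bar>of_int n :: real\<bar> < 1"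
  using T_pos pi_gt_zero by (simp_all only: mult_less_cancel_right_pos zero_less_mult_iff) auto
 then have "m = 0" "n = 0" by linarith+
 then show "l = 0" by (simp add: mn zero_prod_def)
qed

text \<open>Near the zero section over the compact \<open>box\<close>, \<open>Pr\<close> is
  injective on balls of a fixed radius \<delta>, a Lebesgue number. If two vectors have the same
  image in the torus, the lifts differ by lattice vectors \<open>l1\<close> and \<open>l2\<close>.
  Both are close to the difference of the base points, hence equal, and after translation by
  \<open>l1\<close> both vectors lie in one such ball.\<close>

lemma tubular_radius_exists:
 obtains \<rho> where "\<rho> > 0"
  "\<And>z w. norm (snd z) \<le> \<rho> \<Longrightarrow> norm (snd w) \<le> \<rho> \<Longrightarrow> torus_pt2 T (Pr z) = torus_pt2 T (Pr w) \<Longrightarrow> Nb z = Nb w"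
  "\<And>z. norm (snd z) \<le> \<rho> \<Longrightarrow> \<exists>V W g. open V \<and> z \<in> V \<and> open W \<and> homeomorphism V W Pr g \<and> smooth g W"
proof -
 define good where "good V \<longleftrightarrow> open V \<and> (\<exists>W g. open W \<and> homeomorphism V W Pr g \<and> smooth g W)" for V
 let ?K = "box \<times> {0 :: real \<times> real}"
 have cK: "compact ?K" by (intro compact_Times compact_box) auto
 have cov: "?K \<subseteq> \<Union>{V. good V}"
 proof
  fix z assume "z \<in> ?K"
  then obtain x where z: "z = (x, 0)" by auto
  obtain V W g where "open V" "(x, 0) \<in> V" "open W" "homeomorphism V W Pr g" "smooth g W"
   by (rule Pr_local_inverse) blast
  then show "z \<in> \<Union>{V. good V}" unfolding good_def z by blast
 qed
 obtain \<delta> where \<delta>: "\<delta> > 0" "\<And>z. z \<in> ?K \<Longrightarrow> \<exists>V. good V \<and> ball z \<delta> \<subseteq> V"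
  using Heine_Borel_lemma[OF cK cov] by (auto simp: good_def) (metis (mono_tags, lifting) good_def mem_Collect_eq)
 \<comment> \<open>The lattice vectors will differ by less than \<open>4 * e\<close>, which must
   stay below the bound of \<open>lattice_discrete\<close>; the base points will differ by less than
   \<open>2 * e\<close>, which together with \<rho> must stay below \<delta>.\<close>
 define e where "e = min (\<delta> / 8) (min T (2 * pi) / 8)"
 have e: "e > 0" using \<delta> T_pos by (auto simp: e_def)
 obtain d where d: "d > 0" "\<And>x a. norm a \<le> d \<Longrightarrow> norm (Exp x a - x) < e" by (rule Exp_near[OF e]) blast
 define \<rho> where "\<rho> = min d (\<delta> / 8)"
 have \<rho>: "\<rho> > 0" "\<rho> \<le> d" "\<rho> \<le> \<delta> / 8" using d \<delta> by (auto simp: \<rho>_def)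
 show thesis
 proof (rule that[OF \<rho>(1)])
  fix z w :: "(real \<times> real) \<times> (real \<times> real)"
  assume z: "norm (snd z) \<le> \<rho>" and w: "norm (snd w) \<le> \<rho>" and eq: "torus_pt2 T (Pr z) = torus_pt2 T (Pr w)"
  obtain x a where za: "z = (x, a)" by (cases z)
  obtain y b where wb: "w = (y, b)" by (cases w)
  obtain l where l: "l \<in> lattice" "x + l \<in> box" using box_shift by blast
  define l1 where "l1 = Exp (x + l) a - Exp y b"
  define l2 where "l2 = Exp (x + l) (- a) - Exp y (- b)"
  have ll: "l1 \<in> lattice" "l2 \<in> lattice"
  proof -
   have "Exp y b - Exp x a \<in> lattice" "Exp y (- b) - Exp x (- a) \<in> lattice"
    using eq by (auto simp: torus_pt2_eq_iff Pr_def za wb)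
   from lattice_diff[OF l(1) this(1)] lattice_diff[OF l(1) this(2)]
   show "l1 \<in> lattice" "l2 \<in> lattice"
    unfolding l1_def l2_def Exp_lattice[OF l(1)] by (simp_all add: algebra_simps)
  qed
  have n: "norm (Exp (x + l) a - (x + l)) < e" "norm (Exp (x + l) (- a) - (x + l)) < e"
    "norm (Exp y b - y) < e" "norm (Exp y (- b) - y) < e"
   using z w \<rho>(2) by (auto simp: za wb intro!: d(2))
  have tri: "norm ((p1 - c) - (p2 - d)) \<le> norm (p1 - c) + norm (p2 - d)" for p1 c p2 d :: "real \<times> real"
   by (rule norm_triangle_ineq4)
  have A1: "norm (l1 - (x + l - y)) < 2 * e" "norm (l2 - (x + l - y)) < 2 * e"
   using tri[of "Exp (x + l) a" "x + l" "Exp y b" y] tri[of "Exp (x + l) (- a)" "x + l" "Exp y (- b)" y] n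
   by (auto simp: l1_def l2_def algebra_simps)
  have "norm (l1 - l2) < min T (2 * pi)"
  proof -
   have "norm (l1 - l2) < 4 * e"
    using norm_triangle_ineq4[of "l1 - (x + l - y)" "l2 - (x + l - y)"] A1 by simp
   moreover have "8 * e \<le> min T (2 * pi)"
    using min.cobounded2[of "\<delta> / 8" "min T (2 * pi) / 8"] unfolding e_def by linarith
   ultimately show ?thesis using e by linarith
  qed
  then have "l1 = l2" using lattice_discrete[OF lattice_diff[OF ll]] by simp
  define y' where "y' = y + l1"
  have Ey: "Exp y' b = Exp (x + l) a" "Exp y' (- b) = Exp (x + l) (- a)"
  proof -
   have "Exp y' c = Exp y c + l1" for c unfolding y'_def by (rule Exp_lattice[OF ll(1)])
   then have "Exp y' b = Exp y b + l1" "Exp y' (- b) = Exp y (- b) + l2" using \<open>l1 = l2\<close> by simp_all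
   then show "Exp y' b = Exp (x + l) a" "Exp y' (- b) = Exp (x + l) (- a)" by (simp_all add: l1_def l2_def)
  qed
  have "norm (y' - (x + l)) < 2 * e" using A1(1) by (simp add: y'_def norm_minus_commute algebra_simps)
  then have yx: "norm (y' - (x + l)) < \<delta> / 4" by (auto simp: e_def)
  obtain V where V: "good V" "ball (x + l, 0) \<delta> \<subseteq> V" using \<delta>(2)[of "(x + l, 0)"] l by auto
  have in1: "(x + l, a) \<in> V"
  proof -
   have "dist (x + l, 0) (x + l, a) < \<delta>" using z \<rho> \<delta> by (simp add: za dist_Pair_Pair)
   then show ?thesis using V(2) by auto
  qed
  have in2: "(y', b) \<in> V"
  proof -
   have "norm ((y', b) - (x + l, 0)) \<le> norm (y' - (x + l)) + norm b"
    using norm_Pair_le[of "y' - (x + l)" b] by simp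
   also have "\<dots> < \<delta>" using yx w \<rho> \<delta> by (simp add: wb)
   finally have "dist (y', b) (x + l, 0) < \<delta>" by (simp only: dist_norm)
   then have "(y', b) \<in> ball (x + l, 0) \<delta>" by (simp only: mem_ball dist_commute)
   then show ?thesis using V(2) by blast
  qed
  obtain W g where "homeomorphism V W Pr g" using V(1) by (auto simp: good_def)
  moreover have "Pr (x + l, a) = Pr (y', b)" by (simp add: Pr_def Ey)
  ultimately have "(x + l, a) = (y', b)" using in1 in2 by (metis homeomorphism_apply1)
  then have "a = b" "y - x = l - l1" by (auto simp: y'_def algebra_simps)
  then show "Nb z = Nb w" unfolding Nb_eq_iff za wb using lattice_diff[OF l(1) ll(1)] by simp
 next
  fix z :: "(real \<times> real) \<times> (real \<times> real)" assume z: "norm (snd z) \<le> \<rho>"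
  obtain x a where za: "z = (x, a)" by (cases z)
  obtain l where l: "l \<in> lattice" "x + l \<in> box" using box_shift by blast
  obtain V where V: "good V" "ball (x + l, 0) \<delta> \<subseteq> V" using \<delta>(2)[of "(x + l, 0)"] l by auto
  have "dist (x + l, 0) (x + l, a) < \<delta>" using z \<rho> \<delta> by (simp add: za dist_Pair_Pair)
  then have in1: "(x + l, a) \<in> V" using V(2) by auto
  obtain W g where g: "open V" "open W" "homeomorphism V W Pr g" "smooth g W" using V(1) by (auto simp: good_def)
  let ?V = "(\<lambda>z. z - (l, 0)) ` V" and ?W = "(\<lambda>z. z - (l, l)) ` W" and ?g = "\<lambda>z. g (z + (l, l)) - (l, 0)"
  have Prs: "Pr (v - (l, 0)) = Pr v - (l, l)" for v
  proof -
   have "v - (l, 0) = (fst v + - l, snd v)" by (simp add: prod_eq_iff)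
   also have "Pr \<dots> = Pr (fst v, snd v) + (- l, - l)" by (rule Pr_lattice[OF lattice_minus[OF l(1)]])
   also have "\<dots> = Pr v - (l, l)" by (simp add: prod_eq_iff)
   finally show ?thesis .
  qed
  have oV: "open ?V" "open ?W" using g(1,2) open_translation_subtract by blast+
  have "homeomorphism ?V ?W Pr ?g"
   unfolding homeomorphism_def
  proof (intro conjI ballI)
   show "continuous_on ?V Pr" by (rule continuous_on_subset[OF sm_continuous_on[OF sm_Pr]]) simp
   show "continuous_on ?W ?g"
    by (intro continuous_intros continuous_on_compose2[OF homeomorphism_cont2[OF g(3)]]) auto
   show "Pr ` ?V = ?W" using homeomorphism_image1[OF g(3)] by (auto simp: Prs image_image)
   show "?g ` ?W = ?V" using homeomorphism_image2[OF g(3)] by (auto simp: image_image)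
   fix v assume "v \<in> ?V"
   then obtain u where u: "u \<in> V" "v = u - (l, 0)" by (elim imageE)
   show "?g (Pr v) = v" unfolding u(2) Prs diff_add_cancel homeomorphism_apply1[OF g(3) u(1)] ..
  next
   fix w assume "w \<in> ?W"
   then obtain u where u: "u \<in> W" "w = u - (l, l)" by (elim imageE)
   show "Pr (?g w) = w" unfolding u(2) Prs diff_add_cancel homeomorphism_apply2[OF g(3) u(1)] ..
  qed
  moreover have "smooth ?g ?W"
   by (intro sm_diff sm_compose[OF g(4)] sm_add sm_id sm_const oV) auto
  moreover have "z \<in> ?V" using in1 by (intro image_eqI[of _ _ "(x + l, a)"]) (auto simp: za)
  ultimately show "\<exists>V W g. open V \<and> z \<in> V \<and> open W \<and> homeomorphism V W Pr g \<and> smooth g W"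
   using oV by blast
 qed
qed

end

section \<open>Local triviality from a global trivialization\<close>

text \<open>The definition wants the fibre over \<open>b\<close> itself as typical fibre, so the
  global trivialization with model \<open>F\<close> is followed by
  \<open>\<lambda>y. K (b, y)\<close>. \<open>H\<close> and \<open>K\<close> are singular at
  \<open>z\<close>; on the stratum \<open>B\<close> the two maps reduce to
  \<open>\<lambda>q. (\<pi> q, b)\<close> and to a projection, which are smooth, and on all other
  strata \<open>H\<close> avoids \<open>z\<close>.\<close>

lemma fibration_of_trivialization:
 fixes E B :: "'a::euclidean_space set" and F :: "'c::euclidean_space set" and S :: "'i \<Rightarrow> 'a set"
 assumes hom: "homeomorphism E (B \<times> F) (\<lambda>q. (\<pi> q, H q)) K"
  and BE: "B \<subseteq> E" and B: "\<And>p. p \<in> B \<Longrightarrow> \<pi> p = p \<and> H p = z" and Hz: "\<And>q. q \<in> E \<Longrightarrow> H q = z \<Longrightarrow> q \<in> B"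
  and sm\<pi>: "smooth_map_on E \<pi>" and smH: "smooth_map_on (E - B) H" and smK: "smooth_map_on (B \<times> (F - {z})) K"
  and S: "\<And>i. S i = {q \<in> E. H q \<in> Sm i}"
  and Sm: "(\<Union>i. Sm i) = F" "\<And>i j. i \<noteq> j \<Longrightarrow> Sm i \<inter> Sm j = {}" "Sm i0 = {z}"
 shows "locally_trivial_stratified_fibration E B \<pi> S"
  and "p \<in> B \<Longrightarrow> \<exists>h g. let fib = {q \<in> E. \<pi> q = p} in
     homeomorphism fib F h g \<and> h p = z \<and> (\<forall>i. h ` (S i \<inter> fib) = Sm i) \<and>
     diffeomorphism_between (fib - {p}) (F - {z}) h g"
proof -
 have cE: "continuous_on E (\<lambda>q. (\<pi> q, H q))" and cK: "continuous_on (B \<times> F) K"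
  using hom by (auto simp: homeomorphism_def)
 have cp: "continuous_on E \<pi>" and cH: "continuous_on E H"
  using continuous_on_fst[OF cE] continuous_on_snd[OF cE] by simp_all
 have KE: "K (p, y) \<in> E" "\<pi> (K (p, y)) = p" "H (K (p, y)) = y" if "p \<in> B" "y \<in> F" for p y
 proof -
  have py: "(p, y) \<in> B \<times> F" using that by simp
  show "K (p, y) \<in> E" using homeomorphism_image2[OF hom] py by blast
  show "\<pi> (K (p, y)) = p" "H (K (p, y)) = y" using homeomorphism_apply2[OF hom py] by simp_all
 qed
 have EB: "\<pi> q \<in> B" "H q \<in> F" "K (\<pi> q, H q) = q" if "q \<in> E" for q
  using homeomorphism_image1[OF hom] homeomorphism_apply1[OF hom that] that by auto
 have zF: "z \<in> F" using Sm(1,3) by auto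
 have Kz: "K (p, z) = p" if "p \<in> B" for p using EB(3)[of p] B[OF that] BE that by auto
 have S0: "S i0 = B" unfolding S Sm(3) using B Hz BE by auto
 have zi: "z \<notin> Sm i" if "i \<noteq> i0" for i using Sm(2)[OF that] Sm(3) by auto
 have SmF: "Sm i \<subseteq> F" for i using Sm(1) by auto
 have Si: "S i \<subseteq> E - B" if "i \<noteq> i0" for i using zi[OF that] B by (auto simp: S)
 show "locally_trivial_stratified_fibration E B \<pi> S"
  unfolding locally_trivial_stratified_fibration_def
 proof (intro conjI allI impI ballI)
  show "continuous_on E \<pi>" by fact
  show "\<pi> ` E = B" using EB(1) BE B by force
  show "(\<Union>i. S i) = E" using EB(2) Sm(1) by (auto simp: S)
  show "S i \<inter> S j = {}" if "i \<noteq> j" for i j using Sm(2)[OF that] by (auto simp: S)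
  fix b assume b: "b \<in> B"
  define fib where "fib = {q \<in> E. \<pi> q = b}"
  define \<Phi> where "\<Phi> q = (\<pi> q, K (b, H q))" for q
  define \<Psi> where "\<Psi> w = K (fst w, H (snd w))" for w
  have \<Phi>: "\<Phi> q \<in> B \<times> fib" "\<Psi> (\<Phi> q) = q" "H (snd (\<Phi> q)) = H q" if "q \<in> E" for q
   using EB[OF that] KE[OF b EB(2)[OF that]] by (auto simp: \<Phi>_def \<Psi>_def fib_def)
  have \<Psi>: "\<Psi> w \<in> E" "\<Phi> (\<Psi> w) = w" "H (\<Psi> w) = H (snd w)" if "w \<in> B \<times> fib" for w
  proof -
   have w: "fst w \<in> B" "snd w \<in> E" "\<pi> (snd w) = b" using that by (auto simp: fib_def)
   note k = KE[OF w(1) EB(2)[OF w(2)]]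
   show "\<Psi> w \<in> E" "H (\<Psi> w) = H (snd w)" using k by (auto simp: \<Psi>_def)
   show "\<Phi> (\<Psi> w) = w" using k EB(3)[OF w(2)] w(3) by (auto simp: \<Psi>_def \<Phi>_def prod_eq_iff)
  qed
  have im: "\<Phi> ` (S i \<inter> E) = B \<times> (S i \<inter> fib)" "\<Psi> ` (B \<times> (S i \<inter> fib)) = S i \<inter> E" for i
  proof -
   have 1: "\<Phi> q \<in> B \<times> (S i \<inter> fib)" if "q \<in> S i \<inter> E" for q
    using \<Phi>[of q] that by (auto simp: S fib_def mem_Times_iff)
   have 2: "\<Psi> w \<in> S i \<inter> E" if "w \<in> B \<times> (S i \<inter> fib)" for w
    using \<Psi>[of w] that by (auto simp: S mem_Times_iff)
   show "\<Phi> ` (S i \<inter> E) = B \<times> (S i \<inter> fib)"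
   proof (intro equalityI subsetI)
    fix w assume w: "w \<in> B \<times> (S i \<inter> fib)"
    then have "\<Phi> (\<Psi> w) = w" by (intro \<Psi>(2)) auto
    then show "w \<in> \<Phi> ` (S i \<inter> E)" using 2[OF w] by (metis imageI)
   qed (use 1 in blast)
   show "\<Psi> ` (B \<times> (S i \<inter> fib)) = S i \<inter> E"
   proof (intro equalityI subsetI)
    fix q assume q: "q \<in> S i \<inter> E"
    then have "\<Psi> (\<Phi> q) = q" by (intro \<Phi>(2)) auto
    then show "q \<in> \<Psi> ` (B \<times> (S i \<inter> fib))" using 1[OF q] by (metis imageI)
   qed (use 2 in blast)
  qed
  have c\<Phi>: "continuous_on E \<Phi>"
   unfolding \<Phi>_def[abs_def]
   by (intro continuous_intros cp continuous_on_compose2[OF cK] cH) (use b EB in auto)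
  have c\<Psi>: "continuous_on (B \<times> fib) \<Psi>"
   unfolding \<Psi>_def[abs_def]
   by (intro continuous_on_compose2[OF cK] continuous_on_Pair continuous_on_fst continuous_on_id
     continuous_on_compose2[OF cH] continuous_on_snd) (auto simp: fib_def EB)
  have hom': "homeomorphism E (B \<times> fib) \<Phi> \<Psi>"
  proof (rule homeomorphismI[OF c\<Phi> c\<Psi>])
   show "\<Phi> ` E \<subseteq> B \<times> fib" "\<Psi> ` (B \<times> fib) \<subseteq> E" using \<Phi>(1) \<Psi>(1) by blast+
  qed (use \<Phi>(2) \<Psi>(2) in auto)
  have diff: "diffeomorphism_between (S i \<inter> E) (B \<times> (S i \<inter> fib)) \<Phi> \<Psi>" for i
   unfolding diffeomorphism_between_def
  proof (intro conjI)
   show "homeomorphism (S i \<inter> E) (B \<times> (S i \<inter> fib)) \<Phi> \<Psi>"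
   proof (rule homeomorphismI)
    show "continuous_on (S i \<inter> E) \<Phi>" "continuous_on (B \<times> (S i \<inter> fib)) \<Psi>"
     by (rule continuous_on_subset[OF c\<Phi>], blast, rule continuous_on_subset[OF c\<Psi>], blast)
    show "\<Phi> ` (S i \<inter> E) \<subseteq> B \<times> (S i \<inter> fib)" "\<Psi> ` (B \<times> (S i \<inter> fib)) \<subseteq> S i \<inter> E" using im[of i] by simp_all
   qed (use \<Phi>(2) \<Psi>(2) in auto)
   show "smooth_map_on (S i \<inter> E) \<Phi>"
   proof (cases "i = i0")
    case True
    have "smooth_map_on (S i \<inter> E) (\<lambda>q. (\<pi> q, b))"
     by (rule smooth_map_on_Pair[OF smooth_map_on_subset[OF sm\<pi>] smooth_map_on_of_open[OF sm_const[OF open_UNIV]]]) auto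
    then show ?thesis
     by (rule smooth_map_on_cong) (use B Kz[OF b] S0 True in \<open>auto simp: \<Phi>_def\<close>)
   next
    case False
    have sub: "S i \<inter> E \<subseteq> E - B" using Si[OF False] by blast
    have "smooth_map_on (S i \<inter> E) (\<lambda>q. (b, H q))"
     by (rule smooth_map_on_Pair[OF smooth_map_on_of_open[OF sm_const[OF open_UNIV]] smooth_map_on_subset[OF smH sub]]) simp
    then have k: "smooth_map_on (S i \<inter> E) (\<lambda>q. K (b, H q))"
     by (rule smooth_map_on_compose[OF _ smK]) (use b SmF[of i] zi[OF False] in \<open>auto simp: S\<close>)
    show ?thesis unfolding \<Phi>_def[abs_def]
     by (rule smooth_map_on_Pair[OF smooth_map_on_subset[OF sm\<pi>] k]) simp
   qed
   show "smooth_map_on (B \<times> (S i \<inter> fib)) \<Psi>"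
   proof (cases "i = i0")
    case True
    have "smooth_map_on (B \<times> (S i \<inter> fib)) (\<lambda>w :: 'a \<times> 'a. fst w)"
     by (rule smooth_map_on_of_open[OF sm_fst'[OF open_UNIV]]) simp
    then show ?thesis
     by (rule smooth_map_on_cong) (use B Kz S0 True in \<open>auto simp: \<Psi>_def\<close>)
   next
    case False
    have f: "smooth_map_on (B \<times> (S i \<inter> fib)) (\<lambda>w :: 'a \<times> 'a. fst w)" "smooth_map_on (B \<times> (S i \<inter> fib)) (\<lambda>w :: 'a \<times> 'a. snd w)"
     by (rule smooth_map_on_of_open[OF sm_fst'[OF open_UNIV]], simp,
       rule smooth_map_on_of_open[OF sm_snd'[OF open_UNIV]], simp)
    have "smooth_map_on (B \<times> (S i \<inter> fib)) (\<lambda>w. H (snd w))"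
     by (rule smooth_map_on_compose[OF f(2) smH]) (use Si[OF False] in auto)
    from smooth_map_on_Pair[OF f(1) this] show ?thesis unfolding \<Psi>_def[abs_def]
     by (rule smooth_map_on_compose[OF _ smK]) (use SmF[of i] zi[OF False] in \<open>auto simp: S\<close>)
   qed
  qed
  \<comment> \<open>The trivializing neighbourhood of every \<open>b\<close> is all of
    \<open>B\<close>.\<close>
  have EV: "{q \<in> E. \<pi> q \<in> B} = E" using EB(1) by auto
  show "\<exists>V \<Phi> \<Psi>. openin (top_of_set B) V \<and> b \<in> V \<and>
    (let EV = {q \<in> E. \<pi> q \<in> V}; fib = {q \<in> E. \<pi> q = b} in
      homeomorphism EV (Sigma V (\<lambda>_. fib)) \<Phi> \<Psi> \<and>
      (\<forall>q\<in>EV. fst (\<Phi> q) = \<pi> q) \<and>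
      (\<forall>i. diffeomorphism_between (S i \<inter> EV) (Sigma V (\<lambda>_. S i \<inter> fib)) \<Phi> \<Psi>))"
   unfolding Let_def
   by (rule exI[of _ B], rule exI[of _ \<Phi>], rule exI[of _ \<Psi>])
    (use b hom' diff in \<open>simp add: EV fib_def[symmetric] \<Phi>_def\<close>)
 qed
 assume p: "p \<in> B"
 define fib where "fib = {q \<in> E. \<pi> q = p}"
 define g where "g y = K (p, y)" for y
 have pE: "p \<in> E" using p BE by blast
 have cg: "continuous_on F g" unfolding g_def[abs_def]
  by (intro continuous_on_compose2[OF cK] continuous_intros) (use p in auto)
 have hg: "homeomorphism fib F H g"
  by (rule homeomorphismI[OF continuous_on_subset[OF cH] cg])
   (use p KE EB in \<open>auto simp: fib_def g_def\<close>)
 have fibp: "H q \<noteq> z" if "q \<in> fib - {p}" for q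
  using Hz[of q] B[of q] that by (auto simp: fib_def)
 have "diffeomorphism_between (fib - {p}) (F - {z}) H g"
  unfolding diffeomorphism_between_def
 proof (intro conjI)
  show "homeomorphism (fib - {p}) (F - {z}) H g"
  proof (rule homeomorphismI)
   show "H ` (fib - {p}) \<subseteq> F - {z}" using fibp homeomorphism_image1[OF hg] by blast
   show "g ` (F - {z}) \<subseteq> fib - {p}"
   proof (intro image_subsetI DiffI)
    fix y assume y: "y \<in> F - {z}"
    show "g y \<in> fib" using homeomorphism_image2[OF hg] y by blast
    show "g y \<notin> {p}" using homeomorphism_apply2[OF hg, of y] y B[OF p] by auto
   qed
  qed (use hg in \<open>auto simp: homeomorphism_def intro: continuous_on_subset\<close>)
  show "smooth_map_on (fib - {p}) H"
   by (rule smooth_map_on_subset[OF smH]) (use fibp B in \<open>auto simp: fib_def\<close>)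
  have "smooth_map_on (F - {z}) (\<lambda>y. (p, y))"
   by (rule smooth_map_on_of_open[OF sm_Pair[OF sm_const[OF open_UNIV] sm_id[OF open_UNIV]]]) simp
  then show "smooth_map_on (F - {z}) g" unfolding g_def[abs_def]
   by (rule smooth_map_on_compose[OF _ smK]) (use p in auto)
 qed
 moreover have "H ` (S i \<inter> fib) = Sm i" for i
 proof (intro equalityI subsetI)
  fix y assume y: "y \<in> Sm i"
  then have "g y \<in> S i \<inter> fib" "H (g y) = y"
   using KE[OF p, of y] SmF[of i] by (auto simp: g_def S fib_def)
  then show "y \<in> H ` (S i \<inter> fib)" by (metis imageI)
 qed (auto simp: S)
 ultimately show "\<exists>h g. let fib = {q \<in> E. \<pi> q = p} in
     homeomorphism fib F h g \<and> h p = z \<and> (\<forall>i. h ` (S i \<inter> fib) = Sm i) \<and>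
     diffeomorphism_between (fib - {p}) (F - {z}) h g"
  unfolding Let_def fib_def[symmetric] using hg B[OF p] by blast
qed

lemma nonemptyE: "A \<noteq> {} \<Longrightarrow> (\<And>x. x \<in> A \<Longrightarrow> thesis) \<Longrightarrow> thesis" by blast

text \<open>Used to pass from conditions at radius 0, where the normal curvature and its derivative
  decide, to all small radii uniformly.\<close>

lemma tube_lemma_at_zero:
 fixes U :: "(real \<times> 'p::euclidean_space) set"
 assumes "open U" "compact K" "\<And>k. k \<in> K \<Longrightarrow> (0, k) \<in> U"
 obtains d where "d > 0" "\<And>r k. \<bar>r\<bar> \<le> d \<Longrightarrow> k \<in> K \<Longrightarrow> (r, k) \<in> U"
proof -
 have cK: "compact ({0::real} \<times> K)" by (intro compact_Times assms) auto
 have sub: "{0} \<times> K \<subseteq> \<Union>{U}" using assms(3) by auto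
 have op: "open G" if "G \<in> {U}" for G using assms(1) that by simp
 obtain e where e0: "e > 0" "\<And>z. z \<in> {0} \<times> K \<Longrightarrow> \<exists>G\<in>{U}. ball z e \<subseteq> G"
  using Heine_Borel_lemma[OF cK sub op] by blast
 have e: "e > 0" "\<And>z. z \<in> {0} \<times> K \<Longrightarrow> ball z e \<subseteq> U" using e0 by simp_all
 show thesis
 proof (rule that[of "e / 2"])
  fix r :: real and k assume "\<bar>r\<bar> \<le> e / 2" "k \<in> K"
  then have "(r, k) \<in> ball (0, k) e" using e(1) by (simp add: dist_Pair_Pair dist_real_def)
  then show "(r, k) \<in> U" using e(2)[of "(0, k)"] \<open>k \<in> K\<close> by blast
 qed (use e in simp)
qed

text \<open>Just after a zero \<open>f\<close> is positive. At the next zero it would have to come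
  from positive values, contrary to the positive derivative there.\<close>

lemma unique_zero_of_increasing_zeros:
 fixes f :: "real \<Rightarrow> real"
 assumes d: "\<And>t. (f has_real_derivative f' t) (at t)"
  and pos: "\<And>t. t \<in> {c..d} \<Longrightarrow> f t = 0 \<Longrightarrow> f' t > 0"
  and ab: "a \<in> {c..d}" "b \<in> {c..d}" "f a = 0" "f b = 0"
 shows "a = b"
proof -
 have no: False if ab: "a \<in> {c..d}" "b \<in> {c..d}" "f a = 0" "f b = 0" "a < b" for a b
 proof -
  have cf: "continuous_on A f" for A
   using d by (auto intro!: continuous_at_imp_continuous_on DERIV_isCont)
  obtain \<delta> where \<delta>: "\<delta> > 0" "\<And>h. 0 < h \<Longrightarrow> h < \<delta> \<Longrightarrow> f a < f (a + h)"
   using DERIV_pos_inc_right[OF d pos[OF ab(1,3)]] by blast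
  define h where "h = min (\<delta> / 2) ((b - a) / 2)"
  have h: "0 < h" "h < \<delta>" "a + h < b"
   using \<delta>(1) ab(5) unfolding h_def by (auto simp: min_def field_simps)
  have fh: "f (a + h) > 0" using \<delta>(2)[OF h(1,2)] ab(3) by simp
  define Z where "Z = {t \<in> {a + h..b}. f t = 0}"
  have "closed Z" unfolding Z_def
   by (rule continuous_closed_preimage_constant[OF cf]) auto
  moreover have "bounded Z" by (rule bounded_subset[OF bounded_closed_interval[of "a + h" b]]) (auto simp: Z_def)
  ultimately have "compact Z" by (simp add: compact_eq_bounded_closed)
  moreover have "b \<in> Z" using h ab by (simp add: Z_def)
  ultimately obtain z where z: "z \<in> Z" "\<And>t. t \<in> Z \<Longrightarrow> z \<le> t"
   using compact_attains_inf[of Z] by blast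
  have zr: "z \<in> {c..d}" "f z = 0" "a + h < z"
   using z(1) ab h fh by (auto simp: Z_def order_le_less)
  obtain \<eta> where \<eta>: "\<eta> > 0" "\<And>h. 0 < h \<Longrightarrow> h < \<eta> \<Longrightarrow> f (z - h) < f z"
   using DERIV_pos_inc_left[OF d pos[OF zr(1,2)]] by blast
  define k where "k = min (\<eta> / 2) ((z - (a + h)) / 2)"
  have k: "0 < k" "k < \<eta>" "a + h < z - k"
   using \<eta>(1) zr(3) unfolding k_def by (auto simp: min_def field_simps)
  have "f (z - k) < 0" using \<eta>(2)[OF k(1,2)] zr(2) by simp
  then obtain t where t: "a + h \<le> t" "t \<le> z - k" "f t = 0"
   using IVT2'[of f "z - k" 0 "a + h"] fh k cf by auto
  then have "t \<in> Z" using z(1) k by (auto simp: Z_def)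
  then show False using z(2)[of t] t k by auto
 qed
 show ?thesis using no[OF ab] no[OF ab(2,1,4,3)] by (cases a b rule: linorder_cases) auto
qed

section \<open>The set M and its points on the diagonal\<close>

context tube
begin

lemma F1_lattice: "l \<in> lattice \<Longrightarrow> l' \<in> lattice \<Longrightarrow> FI (fst z + l, snd z + l') = FI z"
 and F2_lattice: "l \<in> lattice \<Longrightarrow> l' \<in> lattice \<Longrightarrow> FII (fst z + l, snd z + l') = FII z"
 by (simp_all add: F1_def F2_def case_prod_unfold Gamma_lattice vv_lattice)

lemma F_torus_pt2:
 assumes "torus_pt2 T z = torus_pt2 T w"
 shows "FI z = FI w" "FII z = FII w"
proof -
 have l: "fst w - fst z \<in> lattice" "snd w - snd z \<in> lattice" using assms by (auto simp: torus_pt2_eq_iff)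
 show "FI z = FI w" "FII z = FII w"
  using F1_lattice[OF l, of z] F2_lattice[OF l, of z] by simp_all
qed

definition offdiag :: "((real \<times> real) \<times> (real \<times> real)) set" where
 "offdiag = {z. FI z \<ge> 0 \<and> FII z \<ge> 0 \<and> cis (2 * pi * fst (fst z) / T) \<noteq> cis (2 * pi * fst (snd z) / T)}"

lemma M_set_eq: "M_set T \<gamma> \<epsilon> = closure (torus_pt2 T ` offdiag)"
proof -
 have "{torus_pt2 T ((s1, \<theta>1), (s2, \<theta>2)) | s1 \<theta>1 s2 \<theta>2.
   FI ((s1, \<theta>1), (s2, \<theta>2)) \<ge> 0 \<and> FII ((s1, \<theta>1), (s2, \<theta>2)) \<ge> 0 \<and>
   cis (2 * pi * s1 / T) \<noteq> cis (2 * pi * s2 / T)} = torus_pt2 T ` offdiag"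
  unfolding offdiag_def by (auto simp: image_iff) blast
 then show ?thesis by (simp add: M_set_def)
qed

text \<open>Closure is taken in the torus, while all estimates live in the plane. Since small
  neighbourhoods in the quotient have lifts near \<open>z\<close>, a point of the closure can be
  approximated by lifted points of the defining set.\<close>

lemma M_set_lift:
 assumes q: "torus_pt2 T z \<in> M_set T \<gamma> \<epsilon>" and A: "open A" "z \<in> A"
 obtains w where "w \<in> A" "w \<in> offdiag"
proof -
 obtain A1 A2 where A12: "open A1" "open A2" "z \<in> A1 \<times> A2" "A1 \<times> A2 \<subseteq> A"
  using A open_prod_elim by blast
 obtain W1 where W1: "open W1" "torus_pt T (fst z) \<in> W1" "\<And>x. torus_pt T x \<in> W1 \<Longrightarrow> \<exists>l\<in>lattice. x + l \<in> A1"
  by (rule torus_pt_near_lift[OF A12(1), of "fst z"]) (use A12(3) in auto)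
 obtain W2 where W2: "open W2" "torus_pt T (snd z) \<in> W2" "\<And>x. torus_pt T x \<in> W2 \<Longrightarrow> \<exists>l\<in>lattice. x + l \<in> A2"
  by (rule torus_pt_near_lift[OF A12(2), of "snd z"]) (use A12(3) in auto)
 have oW: "open (W1 \<times> W2)" and inW: "torus_pt2 T z \<in> W1 \<times> W2"
  using W1(1,2) W2(1,2) by (auto simp: open_Times torus_pt2_eq)
 have "W1 \<times> W2 \<inter> closure (torus_pt2 T ` offdiag) \<noteq> {}"
  using q inW unfolding M_set_eq by (metis IntI empty_iff)
 then have "W1 \<times> W2 \<inter> torus_pt2 T ` offdiag \<noteq> {}"
  unfolding open_Int_closure_eq_empty[OF oW] .
 then obtain q' where q': "q' \<in> W1 \<times> W2 \<inter> torus_pt2 T ` offdiag" by (rule nonemptyE)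
 from IntD2[OF q'] obtain w where "q' = torus_pt2 T w" and wo: "w \<in> offdiag" by (rule imageE)
 with q' have w: "w \<in> offdiag" "torus_pt2 T w \<in> W1 \<times> W2" by simp_all
 then obtain l l' where l: "l \<in> lattice" "fst w + l \<in> A1" "l' \<in> lattice" "snd w + l' \<in> A2"
  using W1(3)[of "fst w"] W2(3)[of "snd w"] by (auto simp: torus_pt2_eq)
 let ?w = "(fst w + l, snd w + l')"
 have eq: "torus_pt2 T ?w = torus_pt2 T w" using l lattice_minus[OF l(1)] lattice_minus[OF l(3)] by (simp add: torus_pt2_eq_iff)
 then have "cis (2 * pi * fst (fst ?w) / T) = cis (2 * pi * fst (fst w) / T)" "cis (2 * pi * fst (snd ?w) / T) = cis (2 * pi * fst (snd w) / T)"
  by (auto simp: torus_pt2_eq torus_pt_def case_prod_unfold)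
 then have "?w \<in> offdiag" using w(1) F_torus_pt2[OF eq] by (simp add: offdiag_def)
 moreover have "?w \<in> A" using l A12(4) by auto
 ultimately show thesis using that by blast
qed

lemma M_set_F_nonneg:
 assumes "torus_pt2 T z \<in> M_set T \<gamma> \<epsilon>"
 shows "FI z \<ge> 0" "FII z \<ge> 0"
proof -
 have o: "open {z. FI z < 0}" "open {z. FII z < 0}"
  by (auto intro!: open_Collect_less continuous_intros sm_continuous_on sm_F1 sm_F2)
 show "FI z \<ge> 0"
 proof (rule ccontr)
  assume "\<not> FI z \<ge> 0"
  then have "z \<in> {z. FI z < 0}" by simp
  from M_set_lift[OF assms o(1) this] show False by (auto simp: offdiag_def)
 qed
 show "FII z \<ge> 0"
 proof (rule ccontr)
  assume "\<not> FII z \<ge> 0"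
  then have "z \<in> {z. FII z < 0}" by simp
  from M_set_lift[OF assms o(2) this] show False by (auto simp: offdiag_def)
 qed
qed

text \<open>Two points on one meridian circle: that circle lies on the inner side of its tangent
  line, so \<open>F1\<close> is negative unless the points coincide. This forces the points of M
  with equal first coordinates onto the full diagonal.\<close>

lemma F1_same_circle: "FI ((s, \<theta>1), (s, \<theta>2)) = \<epsilon> * (cos (\<theta>2 - \<theta>1) - 1)"
proof -
 have "FI ((s, \<theta>1), (s, \<theta>2)) = \<epsilon> * (vv (s, \<theta>2) \<bullet> vv (s, \<theta>1) - vv (s, \<theta>1) \<bullet> vv (s, \<theta>1))"
  by (simp add: F1_def Gamma_eq inner_diff_left algebra_simps)
 also have "vv (s, \<theta>2) \<bullet> vv (s, \<theta>1) = cos (\<theta>2 - \<theta>1)"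
  by (simp add: vv_eq inner_add_left inner_add_right frame_inner cos_diff)
 finally show ?thesis by (simp add: torus_frame_inner)
qed

lemma F1_same_circle_nonneg:
 assumes "FI ((s, \<theta>1), (s, \<theta>2)) \<ge> 0"
 shows "(0, \<theta>2 - \<theta>1) \<in> lattice"
proof -
 have "cos (\<theta>2 - \<theta>1) = 1"
  using assms eps_pos cos_le_one[of "\<theta>2 - \<theta>1"] unfolding F1_same_circle by (simp add: zero_le_mult_iff)
 then obtain n :: int where "\<theta>2 - \<theta>1 = of_int n * 2 * pi" using cos_one_2pi_int by blast
 then show ?thesis unfolding lattice_def by (auto intro!: exI[of _ 0] exI[of _ n])
qed

text \<open>The definition of M removes pairs with equal first coordinate. By
  \<open>F1_same_circle_nonneg\<close> it suffices to avoid pairs of equal points.\<close>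

lemma in_M_set:
 assumes "FI z \<ge> 0" "FII z \<ge> 0" "snd z - fst z \<notin> lattice"
 shows "torus_pt2 T z \<in> M_set T \<gamma> \<epsilon>"
proof -
 have "cis (2 * pi * fst (fst z) / T) \<noteq> cis (2 * pi * fst (snd z) / T)"
 proof
  assume eq: "cis (2 * pi * fst (fst z) / T) = cis (2 * pi * fst (snd z) / T)"
  then have "torus_pt T (fst (fst z), 0) = torus_pt T (fst (snd z), 0)" by (simp add: torus_pt_def)
  then have l: "(fst (snd z) - fst (fst z), 0) \<in> lattice" by (simp add: torus_pt_eq_iff)
  have "FI (fst z + 0, snd z + - (fst (snd z) - fst (fst z), 0)) = FI z"
   by (rule F1_lattice[OF lattice_0 lattice_minus[OF l]])
  moreover have "(fst z + 0, snd z + - (fst (snd z) - fst (fst z), 0)) = ((fst (fst z), snd (fst z)), (fst (fst z), snd (snd z)))"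
   by (auto simp: prod_eq_iff)
  ultimately have "FI ((fst (fst z), snd (fst z)), (fst (fst z), snd (snd z))) \<ge> 0" using assms(1) by metis
  from lattice_add[OF l F1_same_circle_nonneg[OF this]]
  have "snd z - fst z \<in> lattice" by (simp add: minus_prod_def)
  then show False using assms(3) by blast
 qed
 then have "z \<in> offdiag" using assms by (simp add: offdiag_def)
 then show ?thesis unfolding M_set_eq by (intro subsetD[OF closure_subset] imageI)
qed

lemma Delta_set_eq: "Delta_set T \<gamma> \<epsilon> = {torus_pt2 T (x, x) | x. torus_pt2 T (x, x) \<in> M_set T \<gamma> \<epsilon>}"
proof (intro set_eqI iffI)
 fix q assume q: "q \<in> Delta_set T \<gamma> \<epsilon>"
 then obtain s \<theta>1 \<theta>2 where e: "q = torus_pt2 T ((s, \<theta>1), (s, \<theta>2))" "q \<in> M_set T \<gamma> \<epsilon>"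
  unfolding Delta_set_def by blast
 then have "FI ((s, \<theta>1), (s, \<theta>2)) \<ge> 0" by (intro M_set_F_nonneg) simp
 then have "(0, \<theta>2 - \<theta>1) \<in> lattice" by (rule F1_same_circle_nonneg)
 then have "torus_pt2 T ((s, \<theta>1), (s, \<theta>1)) = q" unfolding e(1) by (simp add: torus_pt2_eq_iff lattice_0 lattice_0[unfolded zero_prod_def])
 then show "q \<in> {torus_pt2 T (x, x) | x. torus_pt2 T (x, x) \<in> M_set T \<gamma> \<epsilon>}" using e(2) by blast
next
 fix q assume "q \<in> {torus_pt2 T (x, x) | x. torus_pt2 T (x, x) \<in> M_set T \<gamma> \<epsilon>}"
 then obtain x where "q = torus_pt2 T (x, x)" "q \<in> M_set T \<gamma> \<epsilon>" by blast
 then show "q \<in> Delta_set T \<gamma> \<epsilon>" unfolding Delta_set_def by (cases x) blast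
qed

text \<open>Where \<open>cos (snd x) < 0\<close> the normal curvature is negative in every
  direction, so the quadratic term makes \<open>F1\<close> negative for all short nonzero normal
  vectors over base points near \<open>x\<close>. Compactness of the unit circle makes this uniform,
  and no point of the defining set remains near \<open>(x, x)\<close>.\<close>

lemma diagonal_M_cos_nonneg:
 assumes M: "torus_pt2 T (x, x) \<in> M_set T \<gamma> \<epsilon>"
 shows "cos (snd x) \<ge> 0"
proof (rule ccontr)
 assume c: "\<not> cos (snd x) \<ge> 0"
 obtain R where sR: "smooth R UNIV"
  and R: "\<And>r x e. FI (Pr (x, r *\<^sub>R e)) = 2 * kform x e * r\<^sup>2 + 2 / 3 * cform x e * r ^ 3 + r ^ 4 * R (r, (x, e))"
  by (rule F1_expansion) blast
 \<comment> \<open>\<open>F1\<close> divided by the square of the radius, extended to radius 0. The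
   middle coordinate is the displacement of the base point from \<open>x\<close>.\<close>
 define \<Phi> where "\<Phi> w = 2 * kform (x + fst (snd w)) (snd (snd w)) + 2 / 3 * cform (x + fst (snd w)) (snd (snd w)) * fst w + (fst w)\<^sup>2 * R (fst w, (x + fst (snd w), snd (snd w)))"
  for w :: "real \<times> (real \<times> real) \<times> (real \<times> real)"
 have "smooth \<Phi> UNIV"
  unfolding \<Phi>_def[abs_def] by (intro sm_intros sm_kform sm_cform sm_compose_UNIV[OF sR] open_UNIV)
 from sm_continuous_on[OF this] have o: "open {w. \<Phi> w < 0}"
  by (intro open_Collect_less continuous_intros)
 have in_neg: "(0, k) \<in> {w. \<Phi> w < 0}" if k: "k \<in> {0 :: real \<times> real} \<times> sphere (0 :: real \<times> real) 1" for k
 proof -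
  obtain e where e: "k = (0, e)" "norm e = 1" using k by auto
  have A: "kap (fst x) * cos (snd x) / qq x < 0" using c kap_pos[of "fst x"] qq_pos[of x] by (simp add: divide_neg_pos mult_pos_neg)
  have "kform x e < 0"
  proof (cases "fst e = 0")
   case True
   then have "snd e \<noteq> 0" using e(2) by (cases e) auto
   then show ?thesis using True eps_pos by (simp add: kform_def)
  next
   case False
   then have "kap (fst x) * cos (snd x) / qq x * (fst e)\<^sup>2 < 0" using A by (intro mult_neg_pos) auto
   moreover have "(snd e)\<^sup>2 / \<epsilon> \<ge> 0" using eps_pos by simp
   ultimately show ?thesis by (simp add: kform_def)
  qed
  then show ?thesis by (simp add: e \<Phi>_def)
 qed
 define K0 where "K0 = {0 :: real \<times> real} \<times> sphere (0 :: real \<times> real) 1"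
 have cK0: "compact ({0 :: real} \<times> K0)" unfolding K0_def by (intro compact_Times compact_sphere) auto
 have sub: "{0} \<times> K0 \<subseteq> \<Union>{{w. \<Phi> w < 0}}" using in_neg by (auto simp: K0_def)
 have op: "open G" if "G \<in> {{w. \<Phi> w < 0}}" for G using o that by simp
 obtain d where d0: "d > 0" "\<And>z. z \<in> {0} \<times> K0 \<Longrightarrow> \<exists>G\<in>{{w. \<Phi> w < 0}}. ball z d \<subseteq> G"
  using Heine_Borel_lemma[OF cK0 sub op] by blast
 have d: "d > 0" "\<And>e. norm e = 1 \<Longrightarrow> ball (0, 0, e) d \<subseteq> {w. \<Phi> w < 0}" using d0 by (simp_all add: K0_def)
 have neg: "FI (Pr (y, a)) < 0" if "norm (y - x) < d / 2" "norm a < d / 2" "a \<noteq> 0" for y a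
 proof -
  define r where "r = norm a"
  define e where "e = (1 / r) *\<^sub>R a"
  have r: "r > 0" using that(3) by (simp add: r_def)
  have e: "norm e = 1" "a = r *\<^sub>R e" using r by (simp_all add: e_def r_def)
  have "norm ((r, y - x, e) - (0, 0, e)) < d"
   using norm_Pair_le[of r "(y - x, 0 :: real \<times> real)"] that r by (simp add: norm_Pair r_def)
  then have "(r, y - x, e) \<in> ball (0, 0, e) d" unfolding mem_ball by (subst dist_commute) (simp only: dist_norm)
  then have "\<Phi> (r, y - x, e) < 0" using d(2)[OF e(1)] by blast
  then have "r\<^sup>2 * \<Phi> (r, y - x, e) < 0" using r by (simp add: mult_pos_neg)
  moreover have "FI (Pr (y, a)) = r\<^sup>2 * \<Phi> (r, y - x, e)"
   unfolding e(2) R by (simp add: \<Phi>_def algebra_simps eval_nat_numeral)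
  ultimately show ?thesis by simp
 qed
 obtain V W g where V: "open V" "(x, 0) \<in> V" "open W" "homeomorphism V W Pr g" "smooth g W"
  by (rule Pr_local_inverse) blast
 define A where "A = W \<inter> g -` (ball x (d / 2) \<times> ball 0 (d / 2))"
 have "open A" unfolding A_def
  by (rule continuous_open_preimage[OF sm_continuous_on[OF V(5)] V(3)]) (auto intro: open_Times)
 moreover have "(x, x) \<in> A"
 proof -
  have "(x, x) \<in> W" using homeomorphism_image1[OF V(4)] V(2) Pr_0 by (metis imageI)
  moreover have "g (x, x) = (x, 0)" using homeomorphism_apply1[OF V(4) V(2)] by (simp add: Pr_0)
  ultimately show ?thesis using d(1) by (simp add: A_def)
 qed
 ultimately obtain w where w: "w \<in> A" "w \<in> offdiag" using M_set_lift[OF M] by blast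
 obtain y a where ya: "g w = (y, a)" by (cases "g w")
 have "Pr (y, a) = w" using w(1) homeomorphism_apply2[OF V(4)] by (auto simp: A_def ya[symmetric])
 moreover have "norm (y - x) < d / 2" "norm a < d / 2" using w(1) by (auto simp: A_def ya dist_norm norm_minus_commute)
 moreover have "FI w \<ge> 0" using w(2) by (simp add: offdiag_def)
 ultimately have "a = 0" using neg[of y a] by (cases "a = 0") auto
 then have "w = (y, y)" using \<open>Pr (y, a) = w\<close> by (simp add: Pr_0)
 then show False using w(2) by (simp add: offdiag_def)
qed

end

section \<open>The sign conditions in the four quadrants of normal directions\<close>

context tube
begin

definition edir :: "real \<Rightarrow> real \<Rightarrow> real \<Rightarrow> real \<times> real" where
 "edir j \<tau> \<phi> = (j * cos \<phi>, \<tau> * sin \<phi>)"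

text \<open>
 The zeros of \<open>Nf j \<tau> (\<rho>, x, m, _)\<close> are the directions in the quadrant \<open>(j, \<tau>)\<close> along which
 \<open>(F2 - F1) / (F1 + F2) = m\<close>.
\<close>

definition Nf :: "real \<Rightarrow> real \<Rightarrow> real \<times> (real \<times> real) \<times> real \<times> real \<Rightarrow> real" where
 "Nf j \<tau> w = (let z = Pr (fst (snd w), fst w *\<^sub>R edir j \<tau> (snd (snd (snd w)))) in
   FII z - FI z - fst (snd (snd w)) * (FI z + FII z))"

lemma sm_edir: "smooth f U \<Longrightarrow> smooth (\<lambda>w. edir j \<tau> (f w)) U"
 unfolding edir_def by (intro sm_intros sm_open)

lemma sm_Nf: "smooth (Nf j \<tau>) UNIV"
 unfolding Nf_def[abs_def] Let_def
 by (intro sm_intros sm_compose_UNIV[OF sm_F1] sm_compose_UNIV[OF sm_F2] sm_compose_UNIV[OF sm_Pr] sm_edir open_UNIV)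

text \<open>A blow-up of the cusp: after division by \<open>\<rho>\<^sup>2\<close> and
  \<open>\<rho> ^ 3\<close> the difference and the sum of \<open>F1\<close> and \<open>F2\<close>
  extend smoothly to \<open>\<rho> = 0\<close>, where they show the normal curvature and its
  derivative. In \<Psi> the parameter \<open>m\<close> enters with a factor \<rho>, so at
  \<open>\<rho> = 0\<close> all values of \<open>m\<close> share the asymptotic angle.\<close>

lemma quadrant_expansion:
 assumes "j\<^sup>2 = 1" "\<tau>\<^sup>2 = 1"
 obtains \<Psi> S :: "real \<times> (real \<times> real) \<times> real \<times> real \<Rightarrow> real" where "smooth \<Psi> UNIV" "smooth S UNIV"
  "\<And>\<rho> x m \<phi>. Nf j \<tau> (\<rho>, x, m, \<phi>) = \<rho>\<^sup>2 * \<Psi> (\<rho>, x, m, \<phi>)"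
  "\<And>\<rho> x m \<phi>. FI (Pr (x, \<rho> *\<^sub>R edir j \<tau> \<phi>)) + FII (Pr (x, \<rho> *\<^sub>R edir j \<tau> \<phi>)) = \<rho> ^ 3 * S (\<rho>, x, m, \<phi>)"
  "\<And>x m \<phi>. \<Psi> (0, x, m, \<phi>) = - 4 * kform x (edir j \<tau> \<phi>)"
  "\<And>x m \<phi>. S (0, x, m, \<phi>) = 4 / 3 * cform x (edir j \<tau> \<phi>)"
proof -
 obtain R where sR: "smooth R UNIV"
  and R: "\<And>r x e. FI (Pr (x, r *\<^sub>R e)) = 2 * kform x e * r\<^sup>2 + 2 / 3 * cform x e * r ^ 3 + r ^ 4 * R (r, (x, e))"
  by (rule F1_expansion) blast
 have R2: "FII (Pr (x, r *\<^sub>R e)) = - (2 * kform x e * r\<^sup>2 - 2 / 3 * cform x e * r ^ 3 + r ^ 4 * R (- r, (x, e)))" for r x e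
  using R[of x "- r" e] F2_eq_F1[of x "r *\<^sub>R e"] by (simp add: power_minus_odd)
 let ?e = "\<lambda>w :: real \<times> (real \<times> real) \<times> real \<times> real. edir j \<tau> (snd (snd (snd w)))"
 define S where "S w = 4 / 3 * cform (fst (snd w)) (?e w) + fst w * (R (fst w, fst (snd w), ?e w) - R (- fst w, fst (snd w), ?e w))" for w
 define \<Psi> where "\<Psi> w = - 4 * kform (fst (snd w)) (?e w) - (fst w)\<^sup>2 * (R (fst w, fst (snd w), ?e w) + R (- fst w, fst (snd w), ?e w))
   - fst (snd (snd w)) * fst w * S w" for w
 have sS: "smooth S UNIV"
  unfolding S_def[abs_def] by (intro sm_intros sm_cform sm_edir sm_compose_UNIV[OF sR] open_UNIV)
 have s\<Psi>: "smooth \<Psi> UNIV"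
  unfolding \<Psi>_def[abs_def] by (intro sm_intros sm_kform sm_edir sm_compose_UNIV[OF sR] sS open_UNIV)
 have sum: "FI (Pr (x, \<rho> *\<^sub>R edir j \<tau> \<phi>)) + FII (Pr (x, \<rho> *\<^sub>R edir j \<tau> \<phi>)) = \<rho> ^ 3 * S (\<rho>, x, m, \<phi>)" for \<rho> x m \<phi>
  unfolding R R2 S_def by (simp add: algebra_simps eval_nat_numeral)
 show thesis
 proof (rule that[OF s\<Psi> sS _ sum])
  fix \<rho> x m \<phi>
  let ?z = "Pr (x, \<rho> *\<^sub>R edir j \<tau> \<phi>)"
  have "Nf j \<tau> (\<rho>, x, m, \<phi>) = FII ?z - FI ?z - m * (FI ?z + FII ?z)"
   by (simp add: Nf_def Let_def)
  also have "\<dots> = FII ?z - FI ?z - m * (\<rho> ^ 3 * S (\<rho>, x, m, \<phi>))" by (simp only: sum[of x \<rho> \<phi> m])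
  also have "FII ?z - FI ?z = \<rho>\<^sup>2 * (- 4 * kform x (edir j \<tau> \<phi>) - \<rho>\<^sup>2 * (R (\<rho>, x, edir j \<tau> \<phi>) + R (- \<rho>, x, edir j \<tau> \<phi>)))"
   unfolding R R2 by (simp add: algebra_simps eval_nat_numeral)
  finally show "Nf j \<tau> (\<rho>, x, m, \<phi>) = \<rho>\<^sup>2 * \<Psi> (\<rho>, x, m, \<phi>)"
   by (simp add: \<Psi>_def algebra_simps eval_nat_numeral)
 qed (simp_all add: \<Psi>_def S_def)
qed

lemma kform_edir:
 assumes "j\<^sup>2 = 1" "\<tau>\<^sup>2 = 1"
 shows "kform x (edir j \<tau> \<phi>) = kap (fst x) * cos (snd x) / qq x * (cos \<phi>)\<^sup>2 - (sin \<phi>)\<^sup>2 / \<epsilon>"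
 using assms by (simp add: kform_def edir_def power_mult_distrib)

lemma kform_edir_deriv:
 assumes "j\<^sup>2 = 1" "\<tau>\<^sup>2 = 1"
 shows "((\<lambda>\<phi>. kform x (edir j \<tau> \<phi>)) has_real_derivative
   - (2 * sin \<phi> * cos \<phi> * (kap (fst x) * cos (snd x) / qq x + 1 / \<epsilon>))) (at \<phi>)"
 unfolding kform_edir[OF assms] using eps_pos qq_pos[of x]
 by (auto intro!: derivative_eq_intros simp: algebra_simps)

lemma edir_nonzero: "j\<^sup>2 = 1 \<Longrightarrow> \<tau>\<^sup>2 = 1 \<Longrightarrow> edir j \<tau> \<phi> \<noteq> 0"
proof
 assume a: "j\<^sup>2 = 1" "\<tau>\<^sup>2 = 1" "edir j \<tau> \<phi> = 0"
 then have "cos \<phi> = 0" "sin \<phi> = 0" by (auto simp: edir_def zero_prod_def)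
 then show False using sin_cos_squared_add[of \<phi>] by simp
qed

lemma asymptotic_angle:
 assumes "j\<^sup>2 = 1" "\<tau>\<^sup>2 = 1" "cos (snd x) > 0" "kform x (edir j \<tau> \<phi>) = 0" "\<phi> \<in> {0..pi / 2}"
 shows "0 < \<phi>" "\<phi> < pi / 2" "sin \<phi> > 0" "cos \<phi> > 0"
proof -
 have A: "kap (fst x) * cos (snd x) / qq x > 0" using assms kap_pos[of "fst x"] qq_pos[of x] by simp
 have "kform x (edir j \<tau> 0) > 0" "kform x (edir j \<tau> (pi / 2)) < 0"
  using A eps_pos unfolding kform_edir[OF assms(1,2)] by simp_all
 then have "\<phi> \<noteq> 0" "\<phi> \<noteq> pi / 2" using assms(4) by (metis less_irrefl)+
 then show p: "0 < \<phi>" "\<phi> < pi / 2" using assms(5) by auto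
 show "sin \<phi> > 0" using p by (intro sin_gt_zero) auto
 show "cos \<phi> > 0" using p by (intro cos_gt_zero_pi) auto
qed

text \<open>The two conditions become one parameter \<open>m\<close> between -1 and 1, with
  \<open>m = 1\<close> where \<open>F1\<close> vanishes and \<open>m = - 1\<close> where
  \<open>F2\<close> does. The existential form also covers a vanishing sum.\<close>

lemma nonneg_iff_Nf:
 assumes S: "FI z + FII z = s"
 shows "FI z \<ge> 0 \<and> FII z \<ge> 0 \<longleftrightarrow> s \<ge> 0 \<and> (\<exists>m\<in>{-1..1}. FII z - FI z = m * s)"
proof
 assume F: "FI z \<ge> 0 \<and> FII z \<ge> 0"
 show "s \<ge> 0 \<and> (\<exists>m\<in>{-1..1}. FII z - FI z = m * s)"
 proof (cases "s = 0")
  case True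
  then have "FI z = 0" "FII z = 0" using F S by auto
  then show ?thesis using True by (auto intro!: bexI[of _ 0])
 next
  case False
  then have s: "s > 0" using F S by auto
  have "(FII z - FI z) / s \<in> {-1..1}" using F S s by (auto simp: pos_le_divide_eq pos_divide_le_eq)
  then show ?thesis using s by (intro conjI bexI[of _ "(FII z - FI z) / s"]) auto
 qed
next
 assume a: "s \<ge> 0 \<and> (\<exists>m\<in>{-1..1}. FII z - FI z = m * s)"
 then obtain m where m: "m \<in> {-1..1}" "FII z - FI z = m * s" by blast
 have "m * s \<le> 1 * s" "(-1) * s \<le> m * s" by (rule mult_right_mono; use m(1) a in simp)+
 then show "FI z \<ge> 0 \<and> FII z \<ge> 0" using m(2) S by auto
qed

text \<open>At \<open>\<rho> = 0\<close> a zero of \<Psi> is an asymptotic direction, and in this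
  quadrant \<open>cform\<close> is negative there, so \<open>S < 0\<close>. The condition that
  \<Psi> is nonzero or \<open>S\<close> negative is open and persists for small \<rho>; it excludes
  that \<open>F1\<close> and \<open>F2\<close> are both nonnegative, since that would give a zero of
  \<Psi> for some \<open>m\<close> with nonnegative sum.\<close>

lemma empty_quadrant:
 assumes j: "j\<^sup>2 = 1" and \<tau>: "\<tau>\<^sup>2 = 1" and X: "compact X" and nd: "\<And>x. x \<in> X \<Longrightarrow> nondegenerate x \<and> \<tau> * sin (snd x) > 0"
 obtains d where "d > 0" "\<And>x \<rho> \<phi>. x \<in> X \<Longrightarrow> 0 < \<rho> \<Longrightarrow> \<rho> \<le> d \<Longrightarrow> \<phi> \<in> {0..pi / 2} \<Longrightarrow>
   \<not> (FI (Pr (x, \<rho> *\<^sub>R edir j \<tau> \<phi>)) \<ge> 0 \<and> FII (Pr (x, \<rho> *\<^sub>R edir j \<tau> \<phi>)) \<ge> 0)"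
proof -
 obtain \<Psi> S :: "real \<times> (real \<times> real) \<times> real \<times> real \<Rightarrow> real" where s: "smooth \<Psi> UNIV" "smooth S UNIV"
  and N: "\<And>\<rho> x m \<phi>. Nf j \<tau> (\<rho>, x, m, \<phi>) = \<rho>\<^sup>2 * \<Psi> (\<rho>, x, m, \<phi>)"
  and Sm: "\<And>\<rho> x m \<phi>. FI (Pr (x, \<rho> *\<^sub>R edir j \<tau> \<phi>)) + FII (Pr (x, \<rho> *\<^sub>R edir j \<tau> \<phi>)) = \<rho> ^ 3 * S (\<rho>, x, m, \<phi>)"
  and \<Psi>0: "\<And>x m \<phi>. \<Psi> (0, x, m, \<phi>) = - 4 * kform x (edir j \<tau> \<phi>)"
  and S0: "\<And>x m \<phi>. S (0, x, m, \<phi>) = 4 / 3 * cform x (edir j \<tau> \<phi>)"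
  by (rule quadrant_expansion[OF j \<tau>]) blast
 note cont = sm_continuous_on[OF s(1)] sm_continuous_on[OF s(2)]
 define G where "G = {w. \<Psi> w \<noteq> 0 \<or> S w < 0}"
 have "open G" unfolding G_def
  by (intro open_Collect_disj open_Collect_neq open_Collect_less cont continuous_intros)
 moreover have "compact (X \<times> {-1..1::real} \<times> {0..pi / 2})" by (intro compact_Times X compact_Icc)
 moreover have "(0, k) \<in> G" if "k \<in> X \<times> {-1..1} \<times> {0..pi / 2}" for k
 proof -
  obtain x m \<phi> where k: "k = (x, m, \<phi>)" "x \<in> X" "\<phi> \<in> {0..pi / 2}" using \<open>k \<in> _\<close> by auto
  have "S (0, k) < 0" if "\<Psi> (0, k) = 0"
  proof -
   have kz: "kform x (edir j \<tau> \<phi>) = 0" using that by (simp add: k \<Psi>0)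
   have n: "nondegenerate x" "\<tau> * sin (snd x) > 0" using nd[OF k(2)] by auto
   have "sin \<phi> > 0" using asymptotic_angle(3)[OF j \<tau> _ kz k(3)] n(1) by (simp add: nondegenerate_def)
   then have "snd (edir j \<tau> \<phi>) * sin (snd x) > 0"
    using n(2) mult_pos_pos[of "sin \<phi>" "\<tau> * sin (snd x)"] by (simp add: edir_def mult_ac)
   then have "cform x (edir j \<tau> \<phi>) < 0"
    using n(1) kz edir_nonzero[OF j \<tau>, of \<phi>] unfolding nondegenerate_def by blast
   then show ?thesis by (simp add: k S0)
  qed
  then show ?thesis unfolding G_def by blast
 qed
 ultimately obtain d where d: "d > 0" "\<And>r k. \<bar>r\<bar> \<le> d \<Longrightarrow> k \<in> X \<times> {-1..1} \<times> {0..pi / 2} \<Longrightarrow> (r, k) \<in> G"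
  by (rule tube_lemma_at_zero) blast+
 show thesis
 proof (rule that[OF d(1)])
  fix x \<rho> \<phi> assume x: "x \<in> X" "0 < \<rho>" "\<rho> \<le> d" "\<phi> \<in> {0..pi / 2}"
  let ?z = "Pr (x, \<rho> *\<^sub>R edir j \<tau> \<phi>)"
  show "\<not> (FI ?z \<ge> 0 \<and> FII ?z \<ge> 0)"
  proof
   assume "FI ?z \<ge> 0 \<and> FII ?z \<ge> 0"
   then have "FI ?z + FII ?z \<ge> 0 \<and> (\<exists>m\<in>{-1..1}. FII ?z - FI ?z = m * (FI ?z + FII ?z))"
    using nonneg_iff_Nf[OF refl] by blast
   then obtain m where m: "m \<in> {-1..1}" "FII ?z - FI ?z = m * (FI ?z + FII ?z)" "FI ?z + FII ?z \<ge> 0" by blast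
   then have "Nf j \<tau> (\<rho>, x, m, \<phi>) = 0" by (simp add: Nf_def Let_def)
   then have "\<Psi> (\<rho>, x, m, \<phi>) = 0" using x(2) unfolding N by simp
   then have "S (\<rho>, x, m, \<phi>) < 0" using d(2)[of \<rho> "(x, m, \<phi>)"] x m by (auto simp: G_def)
   then have "\<rho> ^ 3 * S (\<rho>, x, m, \<phi>) < 0" using x(2) by (simp add: mult_pos_neg)
   then show False using m(3) unfolding Sm[of x \<rho> \<phi> m] by simp
  qed
 qed
qed

text \<open>At \<open>\<rho> = 0\<close> every zero of \<Psi> has \<open>S > 0\<close> and a
  positive derivative in the angle, and \<Psi> is negative at angle 0 and positive at
  \<open>pi / 2\<close>. All this persists for small \<rho>. The signs at the ends give a zero, and
  zeros at which the function increases are unique.\<close>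

lemma cusp_quadrant:
 assumes j: "j\<^sup>2 = 1" and \<tau>: "\<tau>\<^sup>2 = 1" and X: "compact X" and nd: "\<And>x. x \<in> X \<Longrightarrow> nondegenerate x \<and> \<tau> * sin (snd x) < 0"
 obtains d where "d > 0"
  "\<And>x \<rho> \<phi> m. x \<in> X \<Longrightarrow> 0 < \<rho> \<Longrightarrow> \<rho> \<le> d \<Longrightarrow> \<phi> \<in> {0..pi / 2} \<Longrightarrow> m \<in> {-1..1} \<Longrightarrow> Nf j \<tau> (\<rho>, x, m, \<phi>) = 0 \<Longrightarrow>
    FI (Pr (x, \<rho> *\<^sub>R edir j \<tau> \<phi>)) + FII (Pr (x, \<rho> *\<^sub>R edir j \<tau> \<phi>)) > 0 \<and> 0 < \<phi> \<and> \<phi> < pi / 2 \<and>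
    frechet (Nf j \<tau>) (at (\<rho>, x, m, \<phi>)) (0, 0, 0, 1) > 0"
  "\<And>x \<rho> m. x \<in> X \<Longrightarrow> 0 < \<rho> \<Longrightarrow> \<rho> \<le> d \<Longrightarrow> m \<in> {-1..1} \<Longrightarrow> \<exists>!\<phi>. \<phi> \<in> {0..pi / 2} \<and> Nf j \<tau> (\<rho>, x, m, \<phi>) = 0"
proof -
 obtain \<Psi> S :: "real \<times> (real \<times> real) \<times> real \<times> real \<Rightarrow> real" where s: "smooth \<Psi> UNIV" "smooth S UNIV"
  and N: "\<And>\<rho> x m \<phi>. Nf j \<tau> (\<rho>, x, m, \<phi>) = \<rho>\<^sup>2 * \<Psi> (\<rho>, x, m, \<phi>)"
  and Sm: "\<And>\<rho> x m \<phi>. FI (Pr (x, \<rho> *\<^sub>R edir j \<tau> \<phi>)) + FII (Pr (x, \<rho> *\<^sub>R edir j \<tau> \<phi>)) = \<rho> ^ 3 * S (\<rho>, x, m, \<phi>)"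
  and \<Psi>0: "\<And>x m \<phi>. \<Psi> (0, x, m, \<phi>) = - 4 * kform x (edir j \<tau> \<phi>)"
  and S0: "\<And>x m \<phi>. S (0, x, m, \<phi>) = 4 / 3 * cform x (edir j \<tau> \<phi>)"
  by (rule quadrant_expansion[OF j \<tau>]) blast
 define D where "D w = frechet \<Psi> (at w) (0, 0, 0, 1)" for w
 have sD: "smooth D UNIV" unfolding D_def[abs_def] by (rule sm_frechet[OF s(1)])
 have line: "((\<lambda>\<phi>. f (\<rho>, x, m, \<phi>)) has_real_derivative frechet f (at (\<rho>, x, m, \<phi>)) (0, 0, 0, 1)) (at \<phi>)"
  if f: "smooth f UNIV" for f :: "real \<times> (real \<times> real) \<times> real \<times> real \<Rightarrow> real" and \<rho> x m \<phi>
 proof -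
  have Df: "(f has_derivative frechet f (at (\<rho>, x, m, \<phi>))) (at (\<rho>, x, m, \<phi>))" by (rule sm_has_derivative[OF f]) simp
  have "((\<lambda>\<phi>. (\<rho>, x, m, \<phi>)) has_derivative (\<lambda>h. h *\<^sub>R (0, 0, 0, 1))) (at \<phi>)"
   by (auto intro!: derivative_eq_intros simp: zero_prod_def)
  from has_derivative_compose[OF this Df]
  have "((\<lambda>\<phi>. f (\<rho>, x, m, \<phi>)) has_derivative (\<lambda>h. frechet f (at (\<rho>, x, m, \<phi>)) (h *\<^sub>R (0, 0, 0, 1)))) (at \<phi>)" .
  moreover have "frechet f (at (\<rho>, x, m, \<phi>)) (h *\<^sub>R (0, 0, 0, 1)) =
    frechet f (at (\<rho>, x, m, \<phi>)) (0, 0, 0, 1) * h" for h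
   unfolding linear_scale[OF has_derivative_linear[OF Df]] by (simp only: real_scaleR_def mult.commute)
  ultimately show ?thesis by (simp only: has_field_derivative_def)
 qed
 note cont = sm_continuous_on[OF s(1)] sm_continuous_on[OF s(2)] sm_continuous_on[OF sD]
 have cosx: "cos (snd x) > 0" if "x \<in> X" for x using nd[OF that] by (simp add: nondegenerate_def)
 have A: "kap (fst x) * cos (snd x) / qq x > 0" if "x \<in> X" for x
  using cosx[OF that] kap_pos[of "fst x"] qq_pos[of x] by simp
 define G where "G = {w. \<Psi> w \<noteq> 0 \<or> D w > 0 \<and> S w > 0}"
 have "open G" unfolding G_def
  by (intro open_Collect_disj open_Collect_conj open_Collect_neq open_Collect_less cont continuous_intros)
 moreover have "compact (X \<times> {-1..1::real} \<times> {0..pi / 2})" by (intro compact_Times X compact_Icc)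
 moreover have "(0, k) \<in> G" if "k \<in> X \<times> {-1..1} \<times> {0..pi / 2}" for k
 proof -
  obtain x m \<phi> where k: "k = (x, m, \<phi>)" "x \<in> X" "\<phi> \<in> {0..pi / 2}" using \<open>k \<in> _\<close> by auto
  have "D (0, k) > 0 \<and> S (0, k) > 0" if "\<Psi> (0, k) = 0"
  proof -
   have kz: "kform x (edir j \<tau> \<phi>) = 0" using that by (simp add: k \<Psi>0)
   have n: "nondegenerate x" "\<tau> * sin (snd x) < 0" using nd[OF k(2)] by auto
   note aa = asymptotic_angle[OF j \<tau> cosx[OF k(2)] kz k(3)]
   have "snd (edir j \<tau> \<phi>) * sin (snd x) < 0"
    using n(2) aa(3) mult_pos_neg[of "sin \<phi>" "\<tau> * sin (snd x)"] by (simp add: edir_def mult_ac)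
   then have "cform x (edir j \<tau> \<phi>) > 0"
    using n(1) kz edir_nonzero[OF j \<tau>, of \<phi>] unfolding nondegenerate_def by blast
   then have "S (0, k) > 0" by (simp add: k S0)
   moreover have "D (0, k) = 4 * (2 * sin \<phi> * cos \<phi> * (kap (fst x) * cos (snd x) / qq x + 1 / \<epsilon>))"
   proof (rule DERIV_unique)
    show "((\<lambda>\<phi>. \<Psi> (0, x, m, \<phi>)) has_real_derivative D (0, k)) (at \<phi>)"
     unfolding D_def k(1) by (rule line[OF s(1)])
    have "((\<lambda>\<phi>. - 4 * kform x (edir j \<tau> \<phi>)) has_real_derivative
      - 4 * - (2 * sin \<phi> * cos \<phi> * (kap (fst x) * cos (snd x) / qq x + 1 / \<epsilon>))) (at \<phi>)"
     by (rule DERIV_cmult[OF kform_edir_deriv[OF j \<tau>]])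
    then show "((\<lambda>\<phi>. \<Psi> (0, x, m, \<phi>)) has_real_derivative
      4 * (2 * sin \<phi> * cos \<phi> * (kap (fst x) * cos (snd x) / qq x + 1 / \<epsilon>))) (at \<phi>)"
     unfolding \<Psi>0 by simp
   qed
   moreover have "kap (fst x) * cos (snd x) / qq x + 1 / \<epsilon> > 0" using A[OF k(2)] eps_pos by (intro add_pos_pos) auto
   ultimately show ?thesis using aa(3,4) by simp
  qed
  then show ?thesis unfolding G_def by blast
 qed
 ultimately obtain d1 where d1: "d1 > 0" "\<And>r k. \<bar>r\<bar> \<le> d1 \<Longrightarrow> k \<in> X \<times> {-1..1} \<times> {0..pi / 2} \<Longrightarrow> (r, k) \<in> G"
  by (rule tube_lemma_at_zero) blast+
 have "open {w. \<Psi> w < 0}" by (intro open_Collect_less cont continuous_intros)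
 moreover have "compact (X \<times> {-1..1::real} \<times> {0::real})" by (intro compact_Times X compact_Icc) auto
 moreover have "(0, k) \<in> {w. \<Psi> w < 0}" if "k \<in> X \<times> {-1..1} \<times> {0}" for k
 proof -
  obtain x m where k: "k = (x, m, 0)" "x \<in> X" using \<open>k \<in> _\<close> by auto
  have "\<Psi> (0, k) = - 4 * (kap (fst x) * cos (snd x) / qq x)" unfolding k(1) \<Psi>0 kform_edir[OF j \<tau>] by simp
  then show ?thesis using A[OF k(2)] by simp
 qed
 ultimately obtain d2 where d2: "d2 > 0" "\<And>r k. \<bar>r\<bar> \<le> d2 \<Longrightarrow> k \<in> X \<times> {-1..1} \<times> {0} \<Longrightarrow> (r, k) \<in> {w. \<Psi> w < 0}"
  by (rule tube_lemma_at_zero) blast+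
 have "open {w. \<Psi> w > 0}" by (intro open_Collect_less cont continuous_intros)
 moreover have "compact (X \<times> {-1..1::real} \<times> {pi / 2})" by (intro compact_Times X compact_Icc) auto
 moreover have "(0, k) \<in> {w. \<Psi> w > 0}" if "k \<in> X \<times> {-1..1} \<times> {pi / 2}" for k
  using that eps_pos by (auto simp: \<Psi>0 kform_edir[OF j \<tau>])
 ultimately obtain d3 where d3: "d3 > 0" "\<And>r k. \<bar>r\<bar> \<le> d3 \<Longrightarrow> k \<in> X \<times> {-1..1} \<times> {pi / 2} \<Longrightarrow> (r, k) \<in> {w. \<Psi> w > 0}"
  by (rule tube_lemma_at_zero) blast+
 define d where "d = min d1 (min d2 d3)"
 have d: "d > 0" "d \<le> d1" "d \<le> d2" "d \<le> d3" using d1 d2 d3 by (auto simp: d_def)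
 have good: "D (\<rho>, x, m, \<phi>) > 0 \<and> S (\<rho>, x, m, \<phi>) > 0"
  if "x \<in> X" "0 < \<rho>" "\<rho> \<le> d" "\<phi> \<in> {0..pi / 2}" "m \<in> {-1..1}" "\<Psi> (\<rho>, x, m, \<phi>) = 0" for x \<rho> \<phi> m
  using d1(2)[of \<rho> "(x, m, \<phi>)"] that d by (auto simp: G_def)
 have ends: "\<Psi> (\<rho>, x, m, 0) < 0" "\<Psi> (\<rho>, x, m, pi / 2) > 0" if "x \<in> X" "0 < \<rho>" "\<rho> \<le> d" "m \<in> {-1..1}" for x \<rho> m
  using d2(2)[of \<rho> "(x, m, 0)"] d3(2)[of \<rho> "(x, m, pi / 2)"] that d by auto
 have zero_iff: "Nf j \<tau> (\<rho>, x, m, \<phi>) = 0 \<longleftrightarrow> \<Psi> (\<rho>, x, m, \<phi>) = 0" if "0 < \<rho>" for \<rho> x m \<phi>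
  using that unfolding N by simp
 show thesis
 proof (rule that[OF d(1)])
  fix x \<rho> \<phi> m assume x: "x \<in> X" "0 < \<rho>" "\<rho> \<le> d" "\<phi> \<in> {0..pi / 2}" "m \<in> {-1..1}" and "Nf j \<tau> (\<rho>, x, m, \<phi>) = 0"
  then have z: "\<Psi> (\<rho>, x, m, \<phi>) = 0" using zero_iff by simp
  note g = good[OF x z] and e = ends[OF x(1-3,5)]
  have "\<phi> \<noteq> 0" "\<phi> \<noteq> pi / 2" using e z by (metis less_irrefl)+
  moreover have "\<rho> ^ 3 * S (\<rho>, x, m, \<phi>) > 0" using g x(2) by simp
  moreover have "frechet (Nf j \<tau>) (at (\<rho>, x, m, \<phi>)) (0, 0, 0, 1) = \<rho>\<^sup>2 * D (\<rho>, x, m, \<phi>)"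
  proof (rule DERIV_unique)
   show "((\<lambda>\<phi>. Nf j \<tau> (\<rho>, x, m, \<phi>)) has_real_derivative frechet (Nf j \<tau>) (at (\<rho>, x, m, \<phi>)) (0, 0, 0, 1)) (at \<phi>)"
    by (rule line[OF sm_Nf])
   show "((\<lambda>\<phi>. Nf j \<tau> (\<rho>, x, m, \<phi>)) has_real_derivative \<rho>\<^sup>2 * D (\<rho>, x, m, \<phi>)) (at \<phi>)"
    unfolding N D_def by (rule DERIV_cmult[OF line[OF s(1)]])
  qed
  ultimately show "FI (Pr (x, \<rho> *\<^sub>R edir j \<tau> \<phi>)) + FII (Pr (x, \<rho> *\<^sub>R edir j \<tau> \<phi>)) > 0 \<and> 0 < \<phi> \<and> \<phi> < pi / 2 \<and>
    frechet (Nf j \<tau>) (at (\<rho>, x, m, \<phi>)) (0, 0, 0, 1) > 0"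
   unfolding Sm[of x \<rho> \<phi> m] using g x by simp
 next
  fix x \<rho> m assume x: "x \<in> X" "0 < \<rho>" "\<rho> \<le> d" "m \<in> {-1..1::real}"
  let ?f = "\<lambda>\<phi>. \<Psi> (\<rho>, x, m, \<phi>)"
  have "\<exists>\<phi>\<ge>0. \<phi> \<le> pi / 2 \<and> ?f \<phi> = 0"
  proof (rule IVT')
   show "continuous_on {0..pi / 2} ?f"
    by (intro continuous_at_imp_continuous_on ballI DERIV_isCont[OF line[OF s(1)]])
  qed (use ends[OF x] in auto)
  moreover have "\<phi> = \<phi>'" if "\<phi> \<in> {0..pi / 2}" "\<phi>' \<in> {0..pi / 2}" "?f \<phi> = 0" "?f \<phi>' = 0" for \<phi> \<phi>'
   by (rule unique_zero_of_increasing_zeros[OF line[OF s(1)] _ that])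
    (use good[OF x(1-3) _ x(4)] in \<open>simp add: D_def\<close>)
  ultimately show "\<exists>!\<phi>. \<phi> \<in> {0..pi / 2} \<and> Nf j \<tau> (\<rho>, x, m, \<phi>) = 0"
   unfolding zero_iff[OF x(2)] by (auto simp: Ex1_def)
 qed
qed

end

section \<open>Cuspidal regions\<close>

text \<open>Coordinates on the model adapted to its boundary. The squared norm is
  \<open>e\<^sup>2 + e ^ 3\<close> for every \<open>m\<close>, so curves of constant
  \<open>e\<close> are circular arcs about the cusp. For \<open>m = 1\<close> and
  \<open>m = - 1\<close> the first coordinate is \<open>j * e\<close> and the point runs along the
  upper and lower edges.\<close>

definition cusp_pt :: "real \<Rightarrow> real \<Rightarrow> real \<Rightarrow> real \<times> real" where
 "cusp_pt j m e = (j * sqrt (e\<^sup>2 + (1 - m\<^sup>2) * e ^ 3), m * e * sqrt e)"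

lemma cusp_size_strict_mono: "0 \<le> a \<Longrightarrow> a < b \<Longrightarrow> a\<^sup>2 + a ^ 3 < b\<^sup>2 + b ^ 3" for a b :: real
 by (intro add_strict_mono power_strict_mono) auto

lemma cusp_size_inj: "0 \<le> a \<Longrightarrow> 0 \<le> b \<Longrightarrow> a\<^sup>2 + a ^ 3 = b\<^sup>2 + b ^ 3 \<Longrightarrow> a = b" for a b :: real
 using cusp_size_strict_mono[of a b] cusp_size_strict_mono[of b a] by (cases a b rule: linorder_cases) auto

lemma cusp_size_surj:
 assumes "0 \<le> t"
 obtains e :: real where "0 \<le> e" "e\<^sup>2 + e ^ 3 = t"
proof -
 have "\<exists>e\<ge>0. e \<le> t + 1 \<and> e\<^sup>2 + e ^ 3 = t"
 proof (rule IVT')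
  have "t + 1 \<le> (t + 1)\<^sup>2" using assms by (simp add: power2_eq_square)
  moreover have "(t + 1) ^ 3 \<ge> 0" using assms by simp
  ultimately show "t \<le> (t + 1)\<^sup>2 + (t + 1) ^ 3" by linarith
 qed (use assms in \<open>auto intro!: continuous_intros\<close>)
 then show thesis using that by blast
qed

text \<open>The value of \<open>e\<close> at which the arc of \<open>cusp_pt\<close> lies on the
  unit circle; the radius of the tubular neighbourhood will be rescaled to it.\<close>

definition cusp_scale :: real where
 "cusp_scale = (SOME e. 0 < e \<and> e\<^sup>2 + e ^ 3 = 1)"

lemma cusp_scale: "cusp_scale > 0" "cusp_scale\<^sup>2 + cusp_scale ^ 3 = 1"
proof -
 obtain e :: real where e: "0 \<le> e" "e\<^sup>2 + e ^ 3 = 1" by (rule cusp_size_surj[of 1]) auto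
 then have "0 < e" by (cases "e = 0") auto
 with e have "0 < e \<and> e\<^sup>2 + e ^ 3 = 1" by simp
 from someI[of "\<lambda>e. 0 < e \<and> e\<^sup>2 + e ^ 3 = 1", OF this]
 show "cusp_scale > 0" "cusp_scale\<^sup>2 + cusp_scale ^ 3 = 1" by (simp_all add: cusp_scale_def)
qed

context
 fixes j m e :: real
 assumes j: "j\<^sup>2 = 1" and m: "m \<in> {-1..1}" and e: "0 \<le> e"
begin

lemma cusp_pt_sq:
 "(fst (cusp_pt j m e))\<^sup>2 = e\<^sup>2 + (1 - m\<^sup>2) * e ^ 3" "(snd (cusp_pt j m e))\<^sup>2 = m\<^sup>2 * e ^ 3" "0 \<le> (1 - m\<^sup>2) * e ^ 3"
proof -
 have "m\<^sup>2 \<le> 1" using m abs_le_square_iff[of m 1] by (simp add: abs_le_iff)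
 then show n: "0 \<le> (1 - m\<^sup>2) * e ^ 3" using e by simp
 show "(fst (cusp_pt j m e))\<^sup>2 = e\<^sup>2 + (1 - m\<^sup>2) * e ^ 3"
  using n j by (simp add: cusp_pt_def power_mult_distrib)
 show "(snd (cusp_pt j m e))\<^sup>2 = m\<^sup>2 * e ^ 3"
  using e by (simp add: cusp_pt_def power_mult_distrib eval_nat_numeral)
qed

lemma cusp_pt_size: "(fst (cusp_pt j m e))\<^sup>2 + (snd (cusp_pt j m e))\<^sup>2 = e\<^sup>2 + e ^ 3"
 unfolding cusp_pt_sq by (simp add: algebra_simps)

lemma cusp_pt_abs_fst: "e \<le> \<bar>fst (cusp_pt j m e)\<bar>" "e ^ 3 \<le> \<bar>fst (cusp_pt j m e) ^ 3\<bar>"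
proof -
 have "e\<^sup>2 \<le> (fst (cusp_pt j m e))\<^sup>2" unfolding cusp_pt_sq(1) using cusp_pt_sq(3) by simp
 then show "e \<le> \<bar>fst (cusp_pt j m e)\<bar>" using e by (simp add: abs_le_square_iff[symmetric])
 then show "e ^ 3 \<le> \<bar>fst (cusp_pt j m e) ^ 3\<bar>" using e unfolding power_abs by (rule power_mono)
qed

lemma cusp_pt_in_model: "e \<le> cusp_scale \<Longrightarrow> cusp_pt j m e \<in> cusp_model"
proof -
 assume le: "e \<le> cusp_scale"
 have "e\<^sup>2 + e ^ 3 \<le> 1"
  unfolding cusp_scale(2)[symmetric] using le e by (intro add_mono power_mono)
 moreover have "m\<^sup>2 * e ^ 3 \<le> e ^ 3" using cusp_pt_sq(3) by (simp add: algebra_simps)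
 ultimately show ?thesis
  using cusp_pt_size cusp_pt_abs_fst(2) cusp_pt_sq(2) by (auto simp: cusp_model_def case_prod_unfold)
qed

lemma cusp_pt_edges:
 assumes e0: "0 < e"
 shows "snd (cusp_pt j m e) = sqrt \<bar>fst (cusp_pt j m e) ^ 3\<bar> \<longleftrightarrow> m = 1"
  "snd (cusp_pt j m e) = - sqrt \<bar>fst (cusp_pt j m e) ^ 3\<bar> \<longleftrightarrow> m = - 1"
proof -
 let ?X = "fst (cusp_pt j m e)" and ?Y = "snd (cusp_pt j m e)"
 have Y: "?Y = m * (e * sqrt e)" "e * sqrt e > 0" using e0 by (simp_all add: cusp_pt_def)
 have s: "sqrt \<bar>?X ^ 3\<bar> = e * sqrt e" if "m\<^sup>2 = 1"
 proof -
  have "\<bar>?X\<bar> = e" using cusp_pt_sq(1) that e by (metis abs_of_nonneg add_0_right diff_self mult_zero_left power2_abs power2_eq_imp_eq abs_ge_zero)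
  then have "\<bar>?X ^ 3\<bar> = e\<^sup>2 * e" unfolding power_abs by (simp add: power3_eq_cube power2_eq_square)
  then show ?thesis using e by (simp add: real_sqrt_mult)
 qed
 have one: "m\<^sup>2 = 1" if "?Y\<^sup>2 = \<bar>?X ^ 3\<bar>"
 proof -
  have "1 * e ^ 3 \<le> m\<^sup>2 * e ^ 3" using cusp_pt_abs_fst(2) cusp_pt_sq(2) that by simp
  then have "1 \<le> m\<^sup>2" using e0 by simp
  then show ?thesis using m abs_le_square_iff[of m 1] by (simp add: abs_le_iff)
 qed
 show "?Y = sqrt \<bar>?X ^ 3\<bar> \<longleftrightarrow> m = 1"
 proof
  assume eq: "?Y = sqrt \<bar>?X ^ 3\<bar>"
  then have m1: "m\<^sup>2 = 1" by (intro one) simp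
  show "m = 1" using s[OF m1] eq Y e0 by simp
 qed (use s Y in simp)
 show "?Y = - sqrt \<bar>?X ^ 3\<bar> \<longleftrightarrow> m = - 1"
 proof
  assume eq: "?Y = - sqrt \<bar>?X ^ 3\<bar>"
  then have m1: "m\<^sup>2 = 1" by (intro one) simp
  have "m * (e * sqrt e) = (- 1) * (e * sqrt e)" using s[OF m1] eq Y by simp
  then show "m = - 1" using Y(2) by (simp only: mult_cancel_right) auto
 qed (use s Y in simp)
qed

end

lemma cusp_pt_inj:
 assumes "j\<^sup>2 = 1" "m \<in> {-1..1}" "0 < e" "j'\<^sup>2 = 1" "m' \<in> {-1..1}" "0 < e'" and eq: "cusp_pt j m e = cusp_pt j' m' e'"
 shows "j = j'" "m = m'" "e = e'"
proof -
 have sz: "e\<^sup>2 + e ^ 3 = e'\<^sup>2 + e' ^ 3"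
  using cusp_pt_size[of j m e] cusp_pt_size[of j' m' e'] assms by simp
 show e: "e = e'" by (rule cusp_size_inj[OF _ _ sz]) (use assms(3,6) in simp_all)
 have "m * (e * sqrt e) = m' * (e * sqrt e)" using eq e by (simp add: cusp_pt_def)
 moreover have "e * sqrt e > 0" using assms(3) by simp
 ultimately show m: "m = m'" by (simp only: mult_cancel_right) auto
 have "e\<^sup>2 + (1 - m\<^sup>2) * e ^ 3 > 0" using cusp_pt_sq(3)[of j m e] assms by (simp add: add_pos_nonneg)
 then show "j = j'" using eq unfolding cusp_pt_def e[symmetric] m[symmetric] by simp
qed

lemma cusp_pt_surj:
 assumes "(X, Y) \<in> cusp_model" "(X, Y) \<noteq> (0, 0)"
 obtains j m e where "j\<^sup>2 = 1" "m \<in> {-1..1}" "0 < e" "e \<le> cusp_scale" "cusp_pt j m e = (X, Y)"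
proof -
 have XY: "Y\<^sup>2 \<le> \<bar>X\<bar> ^ 3" "X\<^sup>2 + Y\<^sup>2 \<le> 1" using assms(1) by (auto simp: cusp_model_def power_abs)
 have X: "X \<noteq> 0" using XY(1) assms(2) by auto
 obtain e :: real where e: "0 \<le> e" "e\<^sup>2 + e ^ 3 = X\<^sup>2 + Y\<^sup>2" by (rule cusp_size_surj[of "X\<^sup>2 + Y\<^sup>2"]) auto
 have e0: "0 < e" using e X by (cases "e = 0") (auto simp: sum_power2_eq_zero_iff)
 have le: "e \<le> cusp_scale"
  using cusp_size_strict_mono[of cusp_scale e] cusp_scale e XY(2) by (intro leI notI) auto
 \<comment> \<open>If \<open>Y\<^sup>2\<close> exceeded \<open>e ^ 3\<close>, then so would
   \<open>\<bar>X\<bar> ^ 3\<close>. Hence \<open>X\<^sup>2 > e\<^sup>2\<close>, and the squared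
   norm would be larger than \<open>e\<^sup>2 + e ^ 3\<close>.\<close>
 have Ye: "Y\<^sup>2 \<le> e ^ 3"
 proof (rule ccontr)
  assume n: "\<not> Y\<^sup>2 \<le> e ^ 3"
  then have "e ^ 3 < \<bar>X\<bar> ^ 3" using XY(1) by linarith
  then have "e < \<bar>X\<bar>" by (rule power_less_imp_less_base) simp
  then have "e\<^sup>2 < \<bar>X\<bar>\<^sup>2" using e by (intro power_strict_mono) auto
  then show False using e(2) n by simp
 qed
 define m where "m = Y / (e * sqrt e)"
 have es: "e * sqrt e > 0" "(e * sqrt e)\<^sup>2 = e ^ 3" using e0 by (auto simp: power_mult_distrib eval_nat_numeral)
 have Ym: "Y = m * (e * sqrt e)" using es(1) e0 by (simp add: m_def)
 have m2: "Y\<^sup>2 = m\<^sup>2 * e ^ 3" unfolding es(2)[symmetric] Ym by (simp add: power_mult_distrib)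
 have "m\<^sup>2 \<le> 1" using Ye e0 unfolding m2 by simp
 then have m: "m \<in> {-1..1}" using abs_le_square_iff[of m 1] by (simp add: abs_le_iff)
 have "e\<^sup>2 + (1 - m\<^sup>2) * e ^ 3 = X\<^sup>2" using e(2) m2 by (simp add: algebra_simps)
 then have "cusp_pt (sgn X) m e = (X, Y)" using Ym by (simp add: cusp_pt_def sgn_mult_abs mult.assoc)
 moreover have "(sgn X)\<^sup>2 = 1" using X by (simp add: sgn_if)
 ultimately show thesis using that m e0 le by blast
qed

lemma sm_cusp_pt:
 assumes "smooth m U" "smooth e U" "\<And>x. x \<in> U \<Longrightarrow> e x > 0 \<and> (e x)\<^sup>2 + (1 - (m x)\<^sup>2) * e x ^ 3 > 0"
 shows "smooth (\<lambda>x. cusp_pt j (m x) (e x)) U"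
 unfolding cusp_pt_def
 by (intro sm_intros assms(1,2) sm_open[OF assms(1)]) (use assms(3) in auto)

lemma cusp_model_strata:
 "(\<Union>i. cusp_model_strata i) = cusp_model" "i \<noteq> k \<Longrightarrow> cusp_model_strata i \<inter> cusp_model_strata k = {}"
 "cusp_model_strata None = {(0, 0)}"
proof -
 show None: "cusp_model_strata None = {(0, 0)}" by (simp add: cusp_model_strata_def)
 have Some: "w \<in> cusp_model_strata (Some z) \<longleftrightarrow> w \<in> cusp_model - {(0, 0)} \<and>
   (snd w = sqrt \<bar>fst w ^ 3\<bar> \<longleftrightarrow> fst z) \<and> (snd w = - sqrt \<bar>fst w ^ 3\<bar> \<longleftrightarrow> snd z)" for w z
  by (auto simp: cusp_model_strata_def split: prod.splits)
 have 0: "(0, 0) \<in> cusp_model" by (simp add: cusp_model_def)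
 show "(\<Union>i. cusp_model_strata i) = cusp_model"
 proof (intro equalityI subsetI)
  fix w assume "w \<in> (\<Union>i. cusp_model_strata i)"
  then obtain i where "w \<in> cusp_model_strata i" by blast
  then show "w \<in> cusp_model" using 0 None Some by (cases i) auto
 next
  fix w assume w: "w \<in> cusp_model"
  show "w \<in> (\<Union>i. cusp_model_strata i)"
  proof (cases "w = (0, 0)")
   case False
   then have "w \<in> cusp_model_strata (Some (snd w = sqrt \<bar>fst w ^ 3\<bar>, snd w = - sqrt \<bar>fst w ^ 3\<bar>))"
    using w unfolding Some by simp
   then show ?thesis by blast
  qed (use None in blast)
 qed
 assume ik: "i \<noteq> k"
 show "cusp_model_strata i \<inter> cusp_model_strata k = {}"
 proof (rule ccontr)
  assume "cusp_model_strata i \<inter> cusp_model_strata k \<noteq> {}"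
  then obtain w where w: "w \<in> cusp_model_strata i" "w \<in> cusp_model_strata k" by blast
  show False
  proof (cases i; cases k)
   fix a b assume "i = Some a" "k = Some b"
   then have "fst a = fst b" "snd a = snd b" using w Some[of w a] Some[of w b] by simp_all
   then show False using ik \<open>i = Some a\<close> \<open>k = Some b\<close> by (simp add: prod_eq_iff)
  qed (use w ik None Some in auto)
 qed
qed

lemma sm_norm:
 assumes "smooth f U" "\<And>x. x \<in> U \<Longrightarrow> f x \<noteq> 0"
 shows "smooth (\<lambda>x. norm (f x)) U"
 unfolding norm_eq_sqrt_inner by (intro sm_intros assms(1)) (use assms(2) in simp)

lemma smooth_map_on_continuous_at:
 assumes "smooth_map_on (S \<inter> V) f" "open V" "x \<in> S" "x \<in> V"
 shows "continuous (at x within S) f"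
proof -
 obtain U g where U: "x \<in> U" "smooth g U" "\<forall>y\<in>S \<inter> V \<inter> U. g y = f y"
  using assms unfolding smooth_map_on_def by blast
 have o: "open (V \<inter> U)" using sm_open[OF U(2)] assms(2) by blast
 have "continuous (at x within S) g"
  using sm_continuous_on[OF U(2)] sm_open[OF U(2)] U(1) by (simp add: continuous_on_eq_continuous_at continuous_at_imp_continuous_at_within)
 then show ?thesis
  by (rule continuous_transform_within_openin[OF _ openin_open_Int[OF o]]) (use U assms in auto)
qed

lemma smooth_map_on_imp_continuous_on: "smooth_map_on S f \<Longrightarrow> continuous_on S f"
 using smooth_map_on_continuous_at[of S UNIV f] by (simp add: continuous_on_eq_continuous_within)

section \<open>Smooth charts of the tubular neighbourhood\<close>

context tube
begin

text \<open>A smooth local lift of diagonal points to the plane. For an arbitrary representative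
  \<open>x\<close> the lift is determined only up to \<open>lattice\<close>, which is harmless
  because everything it is inserted into is invariant.\<close>

lemma diagonal_section:
 assumes V: "open V" "x0 \<in> V"
 obtains U L where "smooth L U" "torus_pt2 T (x0, x0) \<in> U" "L (torus_pt2 T (x0, x0)) = x0"
  "\<And>x. torus_pt2 T (x, x) \<in> U \<Longrightarrow> \<exists>l\<in>lattice. L (torus_pt2 T (x, x)) = x + l \<and> x + l \<in> V"
proof -
 obtain U1 L1 V1 where 1: "smooth L1 U1" "open V1" "x0 \<in> V1" "\<And>x. x \<in> V1 \<Longrightarrow> torus_pt T x \<in> U1 \<and> L1 (torus_pt T x) = x"
  by (rule smooth_torus_section[OF T_pos]) blast
 have oV: "open (V1 \<inter> V)" "x0 \<in> V1 \<inter> V" using V 1(2,3) by auto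
 obtain W where W: "open W" "torus_pt T x0 \<in> W" "\<And>x. torus_pt T x \<in> W \<Longrightarrow> \<exists>l\<in>lattice. x + l \<in> V1 \<inter> V"
  by (rule torus_pt_near_lift[OF oV]) blast
 let ?U = "(U1 \<inter> W) \<times> (UNIV :: (complex \<times> complex) set)"
 have oU: "open ?U" using sm_open[OF 1(1)] W(1) by (intro open_Times) auto
 show thesis
 proof (rule that[of "\<lambda>q. L1 (fst q)" ?U])
  show "smooth (\<lambda>q. L1 (fst q)) ?U"
   by (rule sm_compose[OF 1(1) sm_fst'[OF oU]]) auto
  show "torus_pt2 T (x0, x0) \<in> ?U" "L1 (fst (torus_pt2 T (x0, x0))) = x0"
   using 1(4)[OF 1(3)] W(2) by (simp_all add: torus_pt2_eq)
  fix x assume "torus_pt2 T (x, x) \<in> ?U"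
  then have "torus_pt T x \<in> W" by (simp add: torus_pt2_eq)
  from W(3)[OF this] obtain l where l: "l \<in> lattice" "x + l \<in> V1 \<inter> V" by blast
  have "torus_pt T (x + l) = torus_pt T x" using lattice_minus[OF l(1)] by (simp add: torus_pt_eq_iff)
  then show "\<exists>l\<in>lattice. L1 (fst (torus_pt2 T (x, x))) = x + l \<and> x + l \<in> V"
   using 1(4)[of "x + l"] l by (intro bexI[of _ l]) (auto simp: torus_pt2_eq)
 qed
qed

lemma torus_pt2_Pr_lattice: "l \<in> lattice \<Longrightarrow> torus_pt2 T (Pr (x + l, a)) = torus_pt2 T (Pr (x, a))"
 by (simp add: Pr_lattice torus_pt2_eq_iff lattice_minus)

definition disc :: "real \<Rightarrow> ((real \<times> real) \<times> (real \<times> real)) set" where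
 "disc R = {z. norm (snd z) \<le> R}"

text \<open>The local inverse of \<open>Nb\<close> that belongs to a local lift \<open>L\<close> of
  the base point: the frame coordinates of a normal vector are recovered as inner products with the
  frame.\<close>

definition bundle_coord :: "(torus2 \<Rightarrow> real \<times> real) \<Rightarrow> torus2 \<times> (real^3) \<times> (real^3) \<Rightarrow> (real \<times> real) \<times> (real \<times> real)" where
 "bundle_coord L y = (L (fst y), (fst (snd y) \<bullet> tv (fst (L (fst y))), fst (snd y) \<bullet> ww (L (fst y))))"

lemma sm_bundle_coord: "smooth L U \<Longrightarrow> smooth (bundle_coord L) (U \<times> UNIV)"
proof -
 assume L: "smooth L U"
 have o: "open (U \<times> (UNIV :: ((real^3) \<times> (real^3)) set))" using sm_open[OF L] by (intro open_Times) auto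
 have s: "smooth (\<lambda>y :: torus2 \<times> (real^3) \<times> (real^3). L (fst y)) (U \<times> UNIV)"
  by (rule sm_compose[OF L sm_fst'[OF o]]) auto
 show ?thesis unfolding bundle_coord_def[abs_def]
  by (intro sm_intros s sm_compose_UNIV[OF sm_tv] sm_compose_UNIV[OF sm_ww] o)
qed

lemma bundle_coord_Nb:
 assumes "l \<in> lattice" "L (torus_pt2 T (x, x)) = x + l"
 shows "bundle_coord L (Nb (x, a)) = (x + l, a)"
proof -
 have "nvec x a = nvec (x + l) a" using nvec_lattice[OF assms(1)] by simp
 then show ?thesis by (simp only: bundle_coord_def Nb_def fst_conv snd_conv assms(2) nvec_tv nvec_ww prod.collapse)
qed

end

locale tubular = tube +
 fixes R :: real
 assumes R_pos: "R > 0"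
  and Pr_inj: "\<And>z w. norm (snd z) \<le> R \<Longrightarrow> norm (snd w) \<le> R \<Longrightarrow> torus_pt2 T (Pr z) = torus_pt2 T (Pr w) \<Longrightarrow> Nb z = Nb w"
  and Pr_inverse: "\<And>z. norm (snd z) \<le> R \<Longrightarrow> \<exists>V W g. open V \<and> z \<in> V \<and> open W \<and> homeomorphism V W Pr g \<and> smooth g W"
begin

text \<open>A normal vector \<open>(u, - u)\<close> is longer than \<open>u\<close> by the factor
  \<open>sqrt 2\<close>, so radius \<open>R\<close> in frame coordinates is radius \<open>r\<close>
  in the normal bundle.\<close>

abbreviation "r \<equiv> sqrt 2 * R"

lemma bundle_eq: "normal_disc_bundle T \<gamma> \<epsilon> r = Nb ` disc R"
 by (simp add: normal_disc_bundle_eq disc_def)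

lemma tubular_nbhd_disc: "tubular_nbhd T \<gamma> \<epsilon> r = (\<lambda>z. torus_pt2 T (Pr z)) ` disc R"
 by (simp add: tubular_nbhd_eq disc_def)

lemma sm_Nb: "smooth Nb UNIV"
 unfolding Nb_def[abs_def] nvec_def
 by (intro sm_intros sm_compose_UNIV[OF sm_torus_pt2] sm_compose_UNIV[OF sm_tv] sm_compose_UNIV[OF sm_ww] open_UNIV)

lemma compact_bundle: "compact (Nb ` disc R)"
proof -
 have "Nb ` disc R = Nb ` (box \<times> cball 0 R)"
 proof (intro equalityI image_subsetI)
  fix z assume z: "z \<in> disc R"
  obtain l where l: "l \<in> lattice" "fst z + l \<in> box" using box_shift by blast
  have "Nb z = Nb (fst z + l, snd z)" using l(1) by (simp add: Nb_eq_iff)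
  then show "Nb z \<in> Nb ` (box \<times> cball 0 R)" using l z by (intro image_eqI) (auto simp: disc_def)
 qed (auto simp: disc_def)
 moreover have "compact (box \<times> cball (0 :: real \<times> real) R)" by (intro compact_Times compact_box compact_cball)
 ultimately show ?thesis
  using compact_continuous_image[OF continuous_on_subset[OF sm_continuous_on[OF sm_Nb] subset_UNIV]] by metis
qed

lemma smooth_exp_map: "smooth_map_on (Nb ` disc R) (exp_map T \<gamma> \<epsilon>)"
 unfolding smooth_map_on_def
proof
 fix y assume "y \<in> Nb ` disc R"
 then obtain z where z: "y = Nb z" by blast
 obtain U L where L: "smooth L U" "torus_pt2 T (fst z, fst z) \<in> U" "L (torus_pt2 T (fst z, fst z)) = fst z"
  "\<And>x. torus_pt2 T (x, x) \<in> U \<Longrightarrow> \<exists>l\<in>lattice. L (torus_pt2 T (x, x)) = x + l \<and> x + l \<in> UNIV"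
  by (rule diagonal_section[of UNIV "fst z"]) auto
 have s: "smooth (\<lambda>y. torus_pt2 T (Pr (bundle_coord L y))) (U \<times> UNIV)"
  by (intro sm_compose_UNIV[OF sm_torus_pt2] sm_compose_UNIV[OF sm_Pr] sm_bundle_coord L)
 have eq: "torus_pt2 T (Pr (bundle_coord L y')) = exp_map T \<gamma> \<epsilon> y'" if y': "y' \<in> Nb ` disc R \<inter> U \<times> UNIV" for y'
 proof -
  obtain x a where xa: "y' = Nb (x, a)" using y' by auto
  then have "torus_pt2 T (x, x) \<in> U" using y' by (auto simp: Nb_def)
  from L(4)[OF this] obtain l where l: "l \<in> lattice" "L (torus_pt2 T (x, x)) = x + l" by blast
  show ?thesis unfolding xa bundle_coord_Nb[where L=L, OF l] exp_map_Nb by (rule torus_pt2_Pr_lattice[OF l(1)])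
 qed
 show "\<exists>U g. y \<in> U \<and> smooth g U \<and> (\<forall>y'\<in>Nb ` disc R \<inter> U. g y' = exp_map T \<gamma> \<epsilon> y')"
  by (rule exI[of _ "U \<times> UNIV"], rule exI[of _ "\<lambda>y. torus_pt2 T (Pr (bundle_coord L y))"])
   (use s eq L(2) z in \<open>auto simp: Nb_def\<close>)
qed

lemma exp_map_inj: "inj_on (exp_map T \<gamma> \<epsilon>) (Nb ` disc R)"
proof (rule inj_onI)
 fix y y' assume "y \<in> Nb ` disc R" "y' \<in> Nb ` disc R" and eq: "exp_map T \<gamma> \<epsilon> y = exp_map T \<gamma> \<epsilon> y'"
 then obtain z z' where z: "y = Nb z" "norm (snd z) \<le> R" "y' = Nb z'" "norm (snd z') \<le> R" by (auto simp: disc_def)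
 then show "y = y'" using Pr_inj[OF z(2,4)] eq by (simp add: exp_map_Nb)
qed

abbreviation "log_map \<equiv> inv_into (Nb ` disc R) (exp_map T \<gamma> \<epsilon>)"

abbreviation "nbhd \<equiv> (\<lambda>z. torus_pt2 T (Pr z)) ` disc R"

lemma homeomorphism_exp_map: "homeomorphism (Nb ` disc R) nbhd (exp_map T \<gamma> \<epsilon>) log_map"
proof -
 have im: "exp_map T \<gamma> \<epsilon> ` Nb ` disc R = nbhd" by (simp add: image_image exp_map_Nb)
 obtain g where g: "homeomorphism (Nb ` disc R) nbhd (exp_map T \<gamma> \<epsilon>) g"
  using homeomorphism_compact[OF compact_bundle smooth_map_on_imp_continuous_on[OF smooth_exp_map] im exp_map_inj] by blast
 have "log_map q = g q" if "q \<in> nbhd" for q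
  by (rule inv_into_f_eq[OF exp_map_inj _ homeomorphism_apply2[OF g that]]) (use homeomorphism_image2[OF g] that in blast)
 then show ?thesis using homeomorphism_cong[OF g refl refl, of "exp_map T \<gamma> \<epsilon>" log_map] by simp
qed

lemma log_map_eq: "z \<in> disc R \<Longrightarrow> log_map (torus_pt2 T (Pr z)) = Nb z"
 using inv_into_f_f[OF exp_map_inj, of "Nb z"] by (simp add: exp_map_Nb)

lemma proj_eq: "z \<in> disc R \<Longrightarrow> tubular_proj T \<gamma> \<epsilon> r (torus_pt2 T (Pr z)) = torus_pt2 T (fst z, fst z)"
 unfolding tubular_proj_def bundle_eq by (subst log_map_eq) (simp_all add: Nb_def)

text \<open>The maps \<open>L2\<close> and \<open>g\<close> are local inverses of
  \<open>torus_pt2\<close> and \<open>Pr\<close>, but their composition could pick a preimage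
  outside the disc bundle. Continuity of \<open>log_map\<close> gives a neighbourhood
  \<open>B\<close> on which the disc preimage stays near \<open>z0\<close>; there the composition
  returns a lattice translate of it.\<close>

lemma chart:
 assumes z0: "z0 \<in> disc R"
 obtains U Z where "smooth Z U" "torus_pt2 T (Pr z0) \<in> U" "Z (torus_pt2 T (Pr z0)) = z0"
  "\<And>q. q \<in> U \<Longrightarrow> q \<in> nbhd \<Longrightarrow> Z q \<in> disc R \<and> torus_pt2 T (Pr (Z q)) = q"
proof -
 have n0: "norm (snd z0) \<le> R" using z0 by (simp add: disc_def)
 obtain V W g where g: "open V" "z0 \<in> V" "open W" "homeomorphism V W Pr g" "smooth g W"
  using Pr_inverse[OF n0] by (elim exE conjE) blast
 obtain U2 L2 V2 where 2: "smooth L2 U2" "open V2" "Pr z0 \<in> V2" "\<And>z. z \<in> V2 \<Longrightarrow> torus_pt2 T z \<in> U2 \<and> L2 (torus_pt2 T z) = z"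
  by (rule smooth_torus_section2[OF T_pos]) blast
 obtain U1 L1 where 1: "smooth L1 U1" "torus_pt2 T (fst z0, fst z0) \<in> U1" "L1 (torus_pt2 T (fst z0, fst z0)) = fst z0"
  "\<And>x. torus_pt2 T (x, x) \<in> U1 \<Longrightarrow> \<exists>l\<in>lattice. L1 (torus_pt2 T (x, x)) = x + l \<and> x + l \<in> UNIV"
  by (rule diagonal_section[of UNIV "fst z0"]) auto
 define A where "A = (U1 \<times> UNIV) \<inter> bundle_coord L1 -` (V \<inter> Pr -` V2)"
 have oA: "open A"
 proof -
  have "open (Pr -` V2)" by (rule open_vimage[OF 2(2) sm_continuous_on[OF sm_Pr]])
  then have "open (V \<inter> Pr -` V2)" using g(1) by blast
  then show ?thesis unfolding A_def
   by (rule continuous_open_preimage[OF sm_continuous_on[OF sm_bundle_coord[OF 1(1)]] sm_open[OF sm_bundle_coord[OF 1(1)]]])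
 qed
 have N0: "Nb z0 \<in> A"
  using bundle_coord_Nb[OF lattice_0, of L1 "fst z0" "snd z0"] 1(2,3) g(2) 2(3) by (simp add: A_def Nb_def)
 note cl = homeomorphism_cont2[OF homeomorphism_exp_map]
 from cl[unfolded continuous_on_open_invariant, rule_format, OF oA]
 obtain B where B: "open B" "B \<inter> nbhd = log_map -` A \<inter> nbhd" by (elim exE conjE)
 define U where "U = (U2 \<inter> L2 -` W) \<inter> B"
 have o2: "open (U2 \<inter> L2 -` W)" by (rule continuous_open_preimage[OF sm_continuous_on[OF 2(1)] sm_open[OF 2(1)] g(3)])
 have sZ: "smooth (\<lambda>q. g (L2 q)) U"
  by (rule sm_compose[OF g(5) sm_subset[OF 2(1)]]) (use o2 B(1) in \<open>auto simp: U_def\<close>)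
 have W0: "Pr z0 \<in> W" "g (Pr z0) = z0" using g(2) homeomorphism_image1[OF g(4)] homeomorphism_apply1[OF g(4)] by auto
 have q0: "torus_pt2 T (Pr z0) \<in> U" "g (L2 (torus_pt2 T (Pr z0))) = z0"
 proof -
  have "torus_pt2 T (Pr z0) \<in> log_map -` A \<inter> nbhd" using N0 z0 log_map_eq[OF z0] by auto
  then have "torus_pt2 T (Pr z0) \<in> B" using B(2) by blast
  then show "torus_pt2 T (Pr z0) \<in> U" "g (L2 (torus_pt2 T (Pr z0))) = z0"
   using 2(4)[OF 2(3)] W0 by (auto simp: U_def)
 qed
 have Z: "g (L2 q) \<in> disc R \<and> torus_pt2 T (Pr (g (L2 q))) = q" if q: "q \<in> U" "q \<in> nbhd" for q
 proof -
  obtain x a where xa: "q = torus_pt2 T (Pr (x, a))" "(x, a) \<in> disc R" using q(2) by auto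
  have "log_map q \<in> A" using q B(2) by (auto simp: U_def)
  then have A': "Nb (x, a) \<in> A" unfolding xa(1) log_map_eq[OF xa(2)] .
  then have "torus_pt2 T (x, x) \<in> U1" by (simp add: A_def Nb_def)
  from 1(4)[OF this] obtain l where l: "l \<in> lattice" "L1 (torus_pt2 T (x, x)) = x + l" by blast
  have "(x + l, a) \<in> V \<inter> Pr -` V2" using A' bundle_coord_Nb[where L=L1, OF l] by (simp add: A_def)
  then have v: "(x + l, a) \<in> V" "Pr (x + l, a) \<in> V2" by auto
  have eq: "torus_pt2 T (Pr (x + l, a)) = q" unfolding xa(1) by (rule torus_pt2_Pr_lattice[OF l(1)])
  have "L2 q = Pr (x + l, a)" using 2(4)[OF v(2)] eq by simp
  then have "g (L2 q) = (x + l, a)" using homeomorphism_apply1[OF g(4) v(1)] by simp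
  then show ?thesis using eq xa(2) by (simp add: disc_def)
 qed
 show thesis by (rule that[OF sZ q0 Z])
qed

lemma is_tubular_radius: "is_tubular_radius T \<gamma> \<epsilon> r"
proof -
 have "smooth_map_on nbhd log_map"
  unfolding smooth_map_on_def
 proof
  fix q assume "q \<in> nbhd"
  then obtain z0 where z0: "z0 \<in> disc R" "q = torus_pt2 T (Pr z0)" by blast
  obtain U Z where Z: "smooth Z U" "torus_pt2 T (Pr z0) \<in> U" "Z (torus_pt2 T (Pr z0)) = z0"
   "\<And>q. q \<in> U \<Longrightarrow> q \<in> nbhd \<Longrightarrow> Z q \<in> disc R \<and> torus_pt2 T (Pr (Z q)) = q"
   by (rule chart[OF z0(1)]) blast
  have "Nb (Z q') = log_map q'" if "q' \<in> nbhd \<inter> U" for q'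
   using Z(4)[of q'] that log_map_eq[of "Z q'"] by simp
  moreover have "smooth (\<lambda>q. Nb (Z q)) U" by (rule sm_compose_UNIV[OF sm_Nb Z(1)])
  ultimately show "\<exists>U g. q \<in> U \<and> smooth g U \<and> (\<forall>q'\<in>nbhd \<inter> U. g q' = log_map q')"
   using Z(2) z0(2) by (intro exI[of _ U] exI[of _ "\<lambda>q. Nb (Z q)"]) simp
 qed
 then have "diffeomorphism_between (normal_disc_bundle T \<gamma> \<epsilon> r) (tubular_nbhd T \<gamma> \<epsilon> r) (exp_map T \<gamma> \<epsilon>) log_map"
  unfolding diffeomorphism_between_def bundle_eq tubular_nbhd_disc
  using homeomorphism_exp_map smooth_exp_map by blast
 then show ?thesis unfolding is_tubular_radius_def using R_pos by (intro conjI exI[of _ log_map]) auto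
qed

end

section \<open>The cuspidal part of the diagonal\<close>

locale cusp = tube +
 fixes CK :: real
 assumes CK_pos: "CK > 0" and CK_small: "sqrt \<epsilon> * CK \<le> pi / 4"
  and nondegenerate_away: "\<And>s \<theta>. sin (sqrt \<epsilon> * CK) \<le> cos \<theta> \<Longrightarrow> sin (sqrt \<epsilon> * CK) \<le> \<bar>sin \<theta>\<bar> \<Longrightarrow> nondegenerate (s, \<theta>)"
begin

abbreviation "B \<equiv> Delta_cusp T \<gamma> CK \<epsilon>"

definition BL :: "(real \<times> real) set" where
 "BL = {x. torus_pt2 T (x, x) \<in> B}"

lemma BL_iff: "x \<in> BL \<longleftrightarrow> torus_pt2 T (x, x) \<in> M_set T \<gamma> \<epsilon> \<and>
  (\<forall>k :: int. snd x \<notin> {of_int k * pi / 2 - sqrt \<epsilon> * CK <..< of_int k * pi / 2 + sqrt \<epsilon> * CK})" (is "_ \<longleftrightarrow> ?M \<and> ?A")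
proof
 assume x: "x \<in> BL"
 then have D: "torus_pt2 T (x, x) \<in> Delta_set T \<gamma> \<epsilon>" and N: "torus_pt2 T (x, x) \<notin> {torus_pt2 T ((s1, \<theta>1), (s2, \<theta>2)) | s1 \<theta>1 s2 \<theta>2.
    \<exists>k::int. \<theta>1 \<in> {of_int k * pi / 2 - sqrt \<epsilon> * CK <..< of_int k * pi / 2 + sqrt \<epsilon> * CK}}"
  unfolding BL_def Delta_cusp_def by blast+
 have ?M using D unfolding Delta_set_def by blast
 moreover have ?A
 proof (rule allI, rule notI)
  fix k :: int assume k: "snd x \<in> {of_int k * pi / 2 - sqrt \<epsilon> * CK <..< of_int k * pi / 2 + sqrt \<epsilon> * CK}"
  have "torus_pt2 T (x, x) = torus_pt2 T ((fst x, snd x), (fst x, snd x))" by simp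
  then show False using N k by blast
 qed
 ultimately show "?M \<and> ?A" ..
next
 assume a: "?M \<and> ?A"
 have "torus_pt2 T (x, x) \<in> Delta_set T \<gamma> \<epsilon>" using a unfolding Delta_set_eq by blast
 moreover have "torus_pt2 T (x, x) \<notin> {torus_pt2 T ((s1, \<theta>1), (s2, \<theta>2)) | s1 \<theta>1 s2 \<theta>2.
    \<exists>k::int. \<theta>1 \<in> {of_int k * pi / 2 - sqrt \<epsilon> * CK <..< of_int k * pi / 2 + sqrt \<epsilon> * CK}}"
 proof
  assume "torus_pt2 T (x, x) \<in> {torus_pt2 T ((s1, \<theta>1), (s2, \<theta>2)) | s1 \<theta>1 s2 \<theta>2.
    \<exists>k::int. \<theta>1 \<in> {of_int k * pi / 2 - sqrt \<epsilon> * CK <..< of_int k * pi / 2 + sqrt \<epsilon> * CK}}"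
  then obtain s1 \<theta>1 s2 \<theta>2 and k :: int where e: "torus_pt2 T (x, x) = torus_pt2 T ((s1, \<theta>1), (s2, \<theta>2))"
   and k: "\<theta>1 \<in> {of_int k * pi / 2 - sqrt \<epsilon> * CK <..< of_int k * pi / 2 + sqrt \<epsilon> * CK}" by blast
  from e have "(s1, \<theta>1) - x \<in> lattice" by (simp add: torus_pt2_eq_iff)
  then obtain n :: int where "\<theta>1 - snd x = of_int n * (2 * pi)" unfolding lattice_def by (auto simp: prod_eq_iff)
  then have "\<theta>1 = snd x + of_int n * (2 * pi)" by simp
  \<comment> \<open>A full turn is four steps of \<open>pi / 2\<close>, so changing the
    representative by \<open>n\<close> turns shifts the index \<open>k\<close> by
    \<open>4 * n\<close>.\<close>
  then have "snd x \<in> {of_int (k - 4 * n) * pi / 2 - sqrt \<epsilon> * CK <..< of_int (k - 4 * n) * pi / 2 + sqrt \<epsilon> * CK}"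
   using k by (simp add: algebra_simps diff_divide_distrib)
  then show False using a by blast
 qed
 ultimately show "x \<in> BL" unfolding BL_def Delta_cusp_def by blast
qed

lemma B_eq: "B = (\<lambda>x. torus_pt2 T (x, x)) ` BL"
proof (intro equalityI subsetI)
 fix q assume q: "q \<in> B"
 then have "q \<in> Delta_set T \<gamma> \<epsilon>" unfolding Delta_cusp_def by blast
 then obtain x where "q = torus_pt2 T (x, x)" unfolding Delta_set_eq by blast
 then show "q \<in> (\<lambda>x. torus_pt2 T (x, x)) ` BL" using q unfolding BL_def by blast
qed (auto simp: BL_def)

lemma torus_pt2_diag_lattice: "l \<in> lattice \<Longrightarrow> torus_pt2 T (x + l, x + l) = torus_pt2 T (x, x)"
 by (simp add: torus_pt2_eq_iff lattice_minus)

lemma BL_lattice: "x \<in> BL \<Longrightarrow> l \<in> lattice \<Longrightarrow> x + l \<in> BL"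
 by (simp add: BL_def torus_pt2_diag_lattice)

lemma closed_BL: "closed BL"
proof -
 have c: "continuous_on UNIV (\<lambda>x. torus_pt2 T (x, x))"
  by (intro continuous_on_compose2[OF sm_continuous_on[OF sm_torus_pt2]] continuous_intros) auto
 have "closed {x. torus_pt2 T (x, x) \<in> M_set T \<gamma> \<epsilon>}"
  using closed_vimage[OF _ c, of "M_set T \<gamma> \<epsilon>"] by (simp add: M_set_def vimage_def)
 moreover have "closed {x :: real \<times> real. snd x \<notin> {of_int k * pi / 2 - sqrt \<epsilon> * CK <..< of_int k * pi / 2 + sqrt \<epsilon> * CK}}" for k :: int
 proof -
  have "open (snd -` {of_int k * pi / 2 - sqrt \<epsilon> * CK <..< of_int k * pi / 2 + sqrt \<epsilon> * CK} :: (real \<times> real) set)"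
   by (intro open_vimage open_greaterThanLessThan continuous_intros)
  then show ?thesis by (simp add: closed_def vimage_def Compl_eq)
 qed
 ultimately have "closed ({x. torus_pt2 T (x, x) \<in> M_set T \<gamma> \<epsilon>} \<inter> (\<Inter>k :: int. {x. snd x \<notin> {of_int k * pi / 2 - sqrt \<epsilon> * CK <..< of_int k * pi / 2 + sqrt \<epsilon> * CK}}))"
  by (intro closed_Int closed_INT) auto
 moreover have "\<dots> = BL" by (rule set_eqI) (simp add: BL_iff)
 ultimately show ?thesis by simp
qed

text \<open>Distance at least \<open>sqrt \<epsilon> * CK\<close> from all multiples of
  \<open>pi / 2\<close> bounds \<open>\<bar>sin (snd x)\<bar>\<close> and
  \<open>\<bar>cos (snd x)\<bar>\<close> from below by \<open>sin (sqrt \<epsilon> * CK)\<close>.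
  The sign of the cosine comes from membership in M.\<close>

lemma BL_nondegenerate:
 assumes "x \<in> BL"
 shows "nondegenerate x"
proof -
 define \<delta> where "\<delta> = sqrt \<epsilon> * CK"
 have \<delta>: "0 < \<delta>" "\<delta> \<le> pi / 4" using eps_pos CK_pos CK_small by (auto simp: \<delta>_def)
 define k where "k = \<lfloor>snd x / (pi / 2)\<rfloor>"
 define \<beta> where "\<beta> = snd x - of_int k * pi / 2"
 have fl: "of_int k * (pi / 2) \<le> snd x" "snd x < (of_int k + 1) * (pi / 2)"
  using floor_divide_lower[of "pi / 2" "snd x"] floor_divide_upper[of "pi / 2" "snd x"] by (auto simp: k_def)
 have out: "snd x \<notin> {of_int i * pi / 2 - \<delta> <..< of_int i * pi / 2 + \<delta>}" for i :: int
  using assms unfolding BL_iff \<delta>_def by blast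
 have \<beta>: "\<delta> \<le> \<beta>" "\<beta> \<le> pi / 2 - \<delta>"
  using fl out[of k] out[of "k + 1"] \<delta>(1) by (auto simp: \<beta>_def algebra_simps add_divide_distrib)
 have "sin \<delta> \<le> sin \<beta>" using \<beta> \<delta> by (subst sin_mono_le_eq) auto
 then have s1: "sin \<delta> \<le> \<bar>sin \<beta>\<bar>" by linarith
 have "cos (pi / 2 - \<delta>) \<le> cos \<beta>" using \<beta> \<delta> by (subst cos_mono_le_eq) auto
 then have s2: "sin \<delta> \<le> \<bar>cos \<beta>\<bar>" using sin_cos_eq[of \<delta>] by simp
 have "sin \<delta> > 0" using \<delta> by (intro sin_gt_zero) auto
 obtain n :: int where n: "k = 2 * n \<or> k = 2 * n + 1" by (metis evenE oddE)
 have half: "\<bar>sin (\<eta> + of_int n * pi)\<bar> = \<bar>sin \<eta>\<bar> \<and> \<bar>cos (\<eta> + of_int n * pi)\<bar> = \<bar>cos \<eta>\<bar>" for \<eta> :: real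
 proof -
  have "sin (of_int n * pi) = 0" "\<bar>cos (of_int n * pi)\<bar> = 1" using sin_npi_int[of n] cos_npi_int[of n] by (auto simp: mult.commute)
  then show ?thesis by (simp add: sin_add cos_add abs_mult)
 qed
 have x: "snd x = (if k = 2 * n then \<beta> else \<beta> + pi / 2) + of_int n * pi"
  using n by (auto simp: \<beta>_def algebra_simps add_divide_distrib)
 have "sin \<delta> \<le> \<bar>sin (snd x)\<bar> \<and> sin \<delta> \<le> \<bar>cos (snd x)\<bar>"
 proof (cases "k = 2 * n")
  case True
  then show ?thesis using half[of \<beta>] s1 s2 x by simp
 next
  case False
  have "sin (\<beta> + pi / 2) = cos \<beta>" "cos (\<beta> + pi / 2) = - sin \<beta>" by (simp_all add: sin_add cos_add)
  then show ?thesis using False half[of "\<beta> + pi / 2"] s1 s2 x by simp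
 qed
 moreover have "cos (snd x) \<ge> 0" using diagonal_M_cos_nonneg assms unfolding BL_iff by blast
 ultimately have "nondegenerate (fst x, snd x)" by (intro nondegenerate_away) (auto simp: \<delta>_def)
 then show ?thesis by simp
qed

lemma compact_BL_box: "compact (BL \<inter> box)"
 using closed_Int_compact[OF closed_BL compact_box] .

lemma B_eq_box: "B = (\<lambda>x. torus_pt2 T (x, x)) ` (BL \<inter> box)"
proof (intro equalityI subsetI)
 fix q assume "q \<in> B"
 then obtain x where x: "q = torus_pt2 T (x, x)" "x \<in> BL" unfolding B_eq by blast
 obtain l where l: "l \<in> lattice" "x + l \<in> box" using box_shift by blast
 show "q \<in> (\<lambda>x. torus_pt2 T (x, x)) ` (BL \<inter> box)"
  using l x BL_lattice[OF x(2) l(1)] by (intro image_eqI[of _ _ "x + l"]) (auto simp: torus_pt2_diag_lattice)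
qed (auto simp: B_eq)

lemma compact_B: "compact B"
 unfolding B_eq_box
 by (intro compact_continuous_image compact_BL_box continuous_on_compose2[OF sm_continuous_on[OF sm_torus_pt2]] continuous_intros) auto

end

section \<open>The bundle map to the cuspidal model\<close>

context tube
begin

text \<open>The conclusions of \<open>empty_quadrant\<close> for the quadrant \<open>(j, s)\<close>
  and of \<open>cusp_quadrant\<close> for its neighbour \<open>(j, - s)\<close>, at a single base
  point and radius.\<close>

definition good_quadrant :: "real \<Rightarrow> real \<Rightarrow> real \<times> real \<Rightarrow> real \<Rightarrow> bool" where
 "good_quadrant j s x \<rho> \<longleftrightarrow>
   (\<forall>\<phi>\<in>{0..pi / 2}. \<not> (FI (Pr (x, \<rho> *\<^sub>R edir j s \<phi>)) \<ge> 0 \<and> FII (Pr (x, \<rho> *\<^sub>R edir j s \<phi>)) \<ge> 0)) \<and>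
   (\<forall>\<phi>\<in>{0..pi / 2}. \<forall>m\<in>{-1..1}. Nf j (- s) (\<rho>, x, m, \<phi>) = 0 \<longrightarrow>
    FI (Pr (x, \<rho> *\<^sub>R edir j (- s) \<phi>)) + FII (Pr (x, \<rho> *\<^sub>R edir j (- s) \<phi>)) > 0 \<and> 0 < \<phi> \<and> \<phi> < pi / 2 \<and>
    frechet (Nf j (- s)) (at (\<rho>, x, m, \<phi>)) (0, 0, 0, 1) > 0) \<and>
   (\<forall>m\<in>{-1..1}. \<exists>!\<phi>. \<phi> \<in> {0..pi / 2} \<and> Nf j (- s) (\<rho>, x, m, \<phi>) = 0)"

definition angle :: "real \<times> real \<Rightarrow> real" where
 "angle a = arccos (\<bar>fst a\<bar> / norm a)"

lemma polar:
 assumes "a \<noteq> 0" "fst a = j * \<bar>fst a\<bar>" "snd a = \<tau> * \<bar>snd a\<bar>"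
 shows "norm a *\<^sub>R edir j \<tau> (angle a) = a" "angle a \<in> {0..pi / 2}"
proof -
 have n: "norm a > 0" "(norm a)\<^sup>2 = (fst a)\<^sup>2 + (snd a)\<^sup>2" using assms(1) by simp (simp add: norm_prod_def)
 define y where "y = \<bar>fst a\<bar> / norm a"
 have "\<bar>fst a\<bar> \<le> norm a" using norm_fst_le[of "fst a" "snd a"] by simp
 then have y: "0 \<le> y" "y \<le> 1" using n by (auto simp: y_def)
 have "1 - y\<^sup>2 = ((norm a)\<^sup>2 - (fst a)\<^sup>2) / (norm a)\<^sup>2" using n(1) by (simp add: y_def power_divide diff_divide_distrib)
 also have "\<dots> = (\<bar>snd a\<bar> / norm a)\<^sup>2" unfolding n(2) power_divide by simp
 finally have "1 - y\<^sup>2 = (\<bar>snd a\<bar> / norm a)\<^sup>2" .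
 then have "sin (angle a) = \<bar>snd a\<bar> / norm a" using y n by (simp add: angle_def y_def[symmetric] sin_arccos)
 moreover have "cos (angle a) = \<bar>fst a\<bar> / norm a" using y by (simp add: angle_def y_def[symmetric])
 ultimately show "norm a *\<^sub>R edir j \<tau> (angle a) = a"
  using assms(2,3) n(1) by (simp add: edir_def prod_eq_iff)
 show "angle a \<in> {0..pi / 2}"
  using y arccos_lbound[of y] arccos_le_pi2[of y] by (simp add: angle_def y_def[symmetric])
qed

lemma norm_edir: "j\<^sup>2 = 1 \<Longrightarrow> \<tau>\<^sup>2 = 1 \<Longrightarrow> norm (edir j \<tau> \<phi>) = 1"
 by (simp add: edir_def norm_Pair power_mult_distrib)

definition Fsum :: "(real \<times> real) \<times> (real \<times> real) \<Rightarrow> real" where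
 "Fsum z = FI (Pr z) + FII (Pr z)"

definition Fratio :: "(real \<times> real) \<times> (real \<times> real) \<Rightarrow> real" where
 "Fratio z = (FII (Pr z) - FI (Pr z)) / Fsum z"

lemma sm_Fsum: "smooth Fsum UNIV"
 unfolding Fsum_def[abs_def] by (intro sm_intros sm_compose_UNIV[OF sm_F1] sm_compose_UNIV[OF sm_F2] sm_compose_UNIV[OF sm_Pr] open_UNIV)

lemma sm_Fratio: "open U \<Longrightarrow> (\<And>z. z \<in> U \<Longrightarrow> Fsum z \<noteq> 0) \<Longrightarrow> smooth Fratio U"
 unfolding Fratio_def[abs_def]
 by (intro sm_intros sm_subset[OF sm_Fsum] sm_compose_UNIV[OF sm_F1] sm_compose_UNIV[OF sm_F2] sm_compose_UNIV[OF sm_Pr]) auto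

lemma F_Pr_cong:
 assumes "torus_pt2 T (Pr z) = torus_pt2 T (Pr w)"
 shows "Fsum z = Fsum w" "Fratio z = Fratio w"
 using F_torus_pt2[OF assms] by (simp_all add: Fsum_def Fratio_def)

lemma F_Fratio:
 assumes "Fsum z \<noteq> 0"
 shows "FI (Pr z) = 0 \<longleftrightarrow> Fratio z = 1" "FII (Pr z) = 0 \<longleftrightarrow> Fratio z = - 1"
 using assms by (auto simp: Fratio_def Fsum_def field_simps)

end

context tubular
begin

definition size_of :: "(real \<times> real) \<times> (real \<times> real) \<Rightarrow> real" where
 "size_of z = cusp_scale / R * norm (snd z)"

definition Ht :: "(real \<times> real) \<times> (real \<times> real) \<Rightarrow> real \<times> real" where
 "Ht z = cusp_pt (sgn (fst (snd z))) (Fratio z) (size_of z)"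

text \<open>The choice among the preimages in the disc bundle is immaterial: they differ by a
  lattice translation of the base point, under which \<open>Ht\<close> is invariant.\<close>

definition H :: "torus2 \<Rightarrow> real \<times> real" where
 "H q = Ht (SOME z. z \<in> disc R \<and> torus_pt2 T (Pr z) = q)"

lemma snd_eq:
 assumes "z \<in> disc R" "w \<in> disc R" "torus_pt2 T (Pr z) = torus_pt2 T (Pr w)"
 shows "snd z = snd w" "fst w - fst z \<in> lattice"
 using Pr_inj[of z w] assms by (auto simp: disc_def Nb_eq_iff)

lemma H_eq:
 assumes z: "z \<in> disc R"
 shows "H (torus_pt2 T (Pr z)) = Ht z"
proof -
 define w where "w = (SOME w. w \<in> disc R \<and> torus_pt2 T (Pr w) = torus_pt2 T (Pr z))"
 have "w \<in> disc R \<and> torus_pt2 T (Pr w) = torus_pt2 T (Pr z)"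
  unfolding w_def by (rule someI[of _ z]) (use z in simp)
 then have w: "w \<in> disc R" "torus_pt2 T (Pr w) = torus_pt2 T (Pr z)" by auto
 show ?thesis unfolding H_def w_def[symmetric] Ht_def size_of_def snd_eq(1)[OF w(1) z w(2)] F_Pr_cong[OF w(2)] ..
qed

lemma size_of:
 assumes "z \<in> disc R"
 shows "0 \<le> size_of z" "size_of z \<le> cusp_scale" "size_of z = 0 \<longleftrightarrow> snd z = 0"
proof -
 have "norm (snd z) \<le> R" using assms by (simp add: disc_def)
 then have "cusp_scale / R * norm (snd z) \<le> cusp_scale / R * R" using cusp_scale(1) R_pos by (intro mult_left_mono) auto
 then show "size_of z \<le> cusp_scale" using R_pos by (simp add: size_of_def)
 show "0 \<le> size_of z" "size_of z = 0 \<longleftrightarrow> snd z = 0" using cusp_scale(1) R_pos by (auto simp: size_of_def)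
qed

lemma Ht_0: "snd z = 0 \<Longrightarrow> Ht z = (0, 0)"
 by (simp add: Ht_def cusp_pt_def size_of_def)

end

locale cusp_nbhd = cusp + tubular +
 assumes good: "\<And>x \<rho> j. x \<in> BL \<Longrightarrow> x \<in> box \<Longrightarrow> 0 < \<rho> \<Longrightarrow> \<rho> \<le> R \<Longrightarrow> j\<^sup>2 = 1 \<Longrightarrow> good_quadrant j (sgn (sin (snd x))) x \<rho>"
begin

abbreviation "E \<equiv> M_near_cusp T \<gamma> CK \<epsilon> r"
abbreviation "\<pi> \<equiv> tubular_proj T \<gamma> \<epsilon> r"

text \<open>Coordinates for the part of M over the cuspidal diagonal. Restricting the base point to
  \<open>box\<close> keeps the set compact and still reaches every point of
  \<open>E\<close>.\<close>

definition Adm :: "((real \<times> real) \<times> (real \<times> real)) set" where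
 "Adm = {z \<in> (BL \<inter> box) \<times> cball 0 R. torus_pt2 T (Pr z) \<in> M_set T \<gamma> \<epsilon>}"

lemma Adm:
 assumes "z \<in> Adm"
 shows "fst z \<in> BL" "fst z \<in> box" "z \<in> disc R" "torus_pt2 T (Pr z) \<in> M_set T \<gamma> \<epsilon>"
 using assms by (auto simp: Adm_def disc_def)

lemma E_eq: "E = (\<lambda>z. torus_pt2 T (Pr z)) ` Adm"
proof (intro equalityI subsetI)
 fix q assume "q \<in> E"
 then have q: "q \<in> M_set T \<gamma> \<epsilon>" "q \<in> nbhd" "\<pi> q \<in> B" unfolding M_near_cusp_def tubular_nbhd_disc by auto
 then obtain z where z: "z \<in> disc R" "q = torus_pt2 T (Pr z)" by blast
 have x: "fst z \<in> BL" using q(3) unfolding z(2) proj_eq[OF z(1)] BL_def by simp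
 obtain l where l: "l \<in> lattice" "fst z + l \<in> box" using box_shift by blast
 have e: "torus_pt2 T (Pr (fst z + l, snd z)) = q" using torus_pt2_Pr_lattice[OF l(1), of "fst z" "snd z"] z(2) by simp
 have "(fst z + l, snd z) \<in> Adm" using e q(1) z(1) l BL_lattice[OF x l(1)] by (simp add: Adm_def disc_def)
 then show "q \<in> (\<lambda>z. torus_pt2 T (Pr z)) ` Adm" using e by (metis image_eqI)
next
 fix q assume "q \<in> (\<lambda>z. torus_pt2 T (Pr z)) ` Adm"
 then obtain z where z: "z \<in> Adm" "q = torus_pt2 T (Pr z)" by blast
 have "\<pi> q \<in> B" using Adm(1)[OF z(1)] unfolding z(2) proj_eq[OF Adm(3)[OF z(1)]] BL_def by simp
 then show "q \<in> E" using Adm[OF z(1)] z(2) unfolding M_near_cusp_def tubular_nbhd_disc by blast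
qed

lemma Adm_0: "x \<in> BL \<Longrightarrow> x \<in> box \<Longrightarrow> (x, 0) \<in> Adm"
proof -
 assume x: "x \<in> BL" "x \<in> box"
 have "torus_pt2 T (x, x) \<in> M_set T \<gamma> \<epsilon>" using x(1) unfolding BL_iff by blast
 then show ?thesis using x R_pos by (simp add: Adm_def Pr_0)
qed

text \<open>For nonzero \<open>a\<close> the two endpoints differ in the torus. Otherwise exchanging
  them would not change the point, and \<open>a\<close> and \<open>- a\<close> would be two
  preimages of it within the tubular radius.\<close>

lemma AdmI:
 assumes x: "x \<in> BL" "x \<in> box" and a: "norm a \<le> R" and F: "FI (Pr (x, a)) \<ge> 0" "FII (Pr (x, a)) \<ge> 0"
 shows "(x, a) \<in> Adm"
proof (cases "a = 0")
 case True
 then show ?thesis using Adm_0[OF x] by simp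
next
 case False
 have "snd (Pr (x, a)) - fst (Pr (x, a)) \<notin> lattice"
 proof
  assume l: "snd (Pr (x, a)) - fst (Pr (x, a)) \<in> lattice"
  have "Pr (x, - a) = (snd (Pr (x, a)), fst (Pr (x, a)))" by (simp add: Pr_def)
  then have "torus_pt2 T (Pr (x, a)) = torus_pt2 T (Pr (x, - a))"
   using l lattice_minus[OF l] by (simp add: torus_pt2_eq_iff)
  then have "snd (x, a) = snd (x, - a)" by (intro snd_eq) (use a in \<open>auto simp: disc_def\<close>)
  then show False using False by (simp add: eq_neg_iff_add_eq_0 prod_eq_iff)
 qed
 then show ?thesis using in_M_set[OF F] x a by (simp add: Adm_def)
qed

text \<open>Every nonzero admissible vector lies in one of the two cuspidal quadrants:
  \<open>good_quadrant\<close> excludes a second component with the sign of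
  \<open>sin (snd x)\<close>. Its polar angle is then the zero of \<open>Nf\<close> for
  \<open>m = Fratio z\<close>, and since this angle is strictly between 0 and \<open>pi / 2\<close>,
  both components are nonzero.\<close>

lemma Adm_polar:
 assumes z: "z \<in> Adm" and a0: "snd z \<noteq> 0"
 defines "j \<equiv> sgn (fst (snd z))" and "\<tau> \<equiv> - sgn (sin (snd (fst z)))"
 shows "Fsum z > 0" "Fratio z \<in> {-1..1}" "j\<^sup>2 = 1" "\<tau>\<^sup>2 = 1" "norm (snd z) *\<^sub>R edir j \<tau> (angle (snd z)) = snd z"
  "Nf j \<tau> (norm (snd z), fst z, Fratio z, angle (snd z)) = 0" "j * fst (snd z) > 0" "\<tau> * snd (snd z) > 0"
  "frechet (Nf j \<tau>) (at (norm (snd z), fst z, Fratio z, angle (snd z))) (0, 0, 0, 1) > 0"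
  "angle (snd z) \<in> {0..pi / 2}"
proof -
 obtain x a where xa: "z = (x, a)" by (cases z)
 have x: "x \<in> BL" "x \<in> box" "0 < norm a" "norm a \<le> R" and Mz: "torus_pt2 T (Pr (x, a)) \<in> M_set T \<gamma> \<epsilon>"
  using z a0 by (auto simp: xa Adm_def)
 note F = M_set_F_nonneg[OF Mz]
 define s where "s = sgn (sin (snd x))"
 have "sin (snd x) \<noteq> 0" using BL_nondegenerate[OF x(1)] by (simp add: nondegenerate_def)
 then have s: "s = 1 \<or> s = -1" by (simp add: s_def sgn_if)
 have \<tau>: "\<tau> = - s" by (simp add: \<tau>_def s_def xa)
 show \<tau>2: "\<tau>\<^sup>2 = 1" using s \<tau> by auto
 \<comment> \<open>\<open>sgn\<close> would be 0 for a vanishing first component; the sign 1 is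
   taken provisionally until the angle shows that this case does not occur.\<close>
 define j' :: real where "j' = (if fst a \<ge> 0 then 1 else - 1)"
 have j': "j' = 1 \<or> j' = -1" "j'\<^sup>2 = 1" "fst a = j' * \<bar>fst a\<bar>" by (auto simp: j'_def)
 have g: "good_quadrant j' s x (norm a)" unfolding s_def by (rule good[OF x j'(2)])
 have a: "a \<noteq> 0" using a0 xa by simp
 have sa: "snd a = - s * \<bar>snd a\<bar>"
 proof (rule ccontr)
  assume "snd a \<noteq> - s * \<bar>snd a\<bar>"
  then have "snd a = s * \<bar>snd a\<bar>" using s by (auto simp: abs_if split: if_splits)
  from polar[OF a j'(3) this] have "norm a *\<^sub>R edir j' s (angle a) = a" "angle a \<in> {0..pi / 2}" .
  then show False using g F unfolding good_quadrant_def by metis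
 qed
 note p = polar[OF a j'(3) sa]
 obtain m where m: "m \<in> {-1..1}" "FII (Pr (x, a)) - FI (Pr (x, a)) = m * Fsum (x, a)"
  using nonneg_iff_Nf[of "Pr (x, a)" "Fsum (x, a)"] F by (auto simp: Fsum_def)
 have N: "Nf j' (- s) (norm a, x, m, angle a) = 0" using m(2) by (simp add: Nf_def Let_def p(1) Fsum_def)
 have G: "Fsum (x, a) > 0 \<and> 0 < angle a \<and> angle a < pi / 2 \<and> frechet (Nf j' (- s)) (at (norm a, x, m, angle a)) (0, 0, 0, 1) > 0"
  using g p m(1) N unfolding good_quadrant_def Fsum_def by metis
 have mr: "Fratio (x, a) = m" using m(2) G by (simp add: Fratio_def)
 have "cos (angle a) > 0" "sin (angle a) > 0" using G by (auto intro!: cos_gt_zero_pi sin_gt_zero)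
 then have cs: "norm a * cos (angle a) > 0" "norm a * sin (angle a) > 0" using x(3) by simp_all
 have fa: "fst a = norm a * (j' * cos (angle a))" "snd a = norm a * (- s * sin (angle a))"
  using arg_cong[OF p(1), of fst] arg_cong[OF p(1), of snd] by (simp_all add: edir_def)
 have "j' * fst a = norm a * cos (angle a)" "- s * snd a = norm a * sin (angle a)"
  unfolding fa using j'(1) s by auto
 then have pos: "j' * fst a > 0" "- s * snd a > 0" using cs by simp_all
 have jj: "j = j'" using pos(1) j'(1) by (auto simp: j_def xa sgn_if)
 show "Fsum z > 0" "Fratio z \<in> {-1..1}" "j\<^sup>2 = 1" "norm (snd z) *\<^sub>R edir j \<tau> (angle (snd z)) = snd z"
  "Nf j \<tau> (norm (snd z), fst z, Fratio z, angle (snd z)) = 0" "j * fst (snd z) > 0" "\<tau> * snd (snd z) > 0"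
  "frechet (Nf j \<tau>) (at (norm (snd z), fst z, Fratio z, angle (snd z))) (0, 0, 0, 1) > 0"
  "angle (snd z) \<in> {0..pi / 2}"
  using G mr m(1) N p pos j'(2) unfolding jj \<tau> xa by simp_all
qed

lemma Ht_nonzero:
 assumes z: "z \<in> Adm" and a0: "snd z \<noteq> 0"
 shows "Ht z \<in> cusp_model - {(0, 0)}" "(fst (Ht z))\<^sup>2 + (snd (Ht z))\<^sup>2 = (size_of z)\<^sup>2 + size_of z ^ 3"
proof -
 note p = Adm_polar[OF z a0] and s = size_of[OF Adm(3)[OF z]]
 show sz: "(fst (Ht z))\<^sup>2 + (snd (Ht z))\<^sup>2 = (size_of z)\<^sup>2 + size_of z ^ 3"
  unfolding Ht_def by (rule cusp_pt_size[OF p(3,2) s(1)])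
 have "Ht z \<noteq> (0, 0)"
 proof
  assume "Ht z = (0, 0)"
  then have "(size_of z)\<^sup>2 + size_of z ^ 3 = 0\<^sup>2 + 0 ^ 3" using sz by simp
  then have "size_of z = 0" by (rule cusp_size_inj[OF s(1) order_refl])
  then show False using s(3) a0 by simp
 qed
 moreover have "Ht z \<in> cusp_model" unfolding Ht_def by (rule cusp_pt_in_model[OF p(3,2) s(1,2)])
 ultimately show "Ht z \<in> cusp_model - {(0, 0)}" by simp
qed

lemma E_cases:
 assumes "q \<in> E"
 obtains z where "z \<in> Adm" "q = torus_pt2 T (Pr z)" "H q = Ht z" "\<pi> q = torus_pt2 T (fst z, fst z)" "q \<in> B \<longleftrightarrow> snd z = 0"
proof -
 obtain z where z: "z \<in> Adm" "q = torus_pt2 T (Pr z)" using assms unfolding E_eq by blast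
 note d = Adm(3)[OF z(1)]
 have "q \<in> B \<longleftrightarrow> snd z = 0"
 proof
  assume "q \<in> B"
  then obtain x where x: "q = torus_pt2 T (Pr (x, 0))" unfolding B_eq by (auto simp: Pr_0)
  have "snd z = snd (x, 0 :: real \<times> real)" by (rule snd_eq(1)[OF d]) (use x z(2) R_pos in \<open>auto simp: disc_def\<close>)
  then show "snd z = 0" by simp
 next
  assume "snd z = 0"
  then have "z = (fst z, 0)" by (simp add: prod_eq_iff)
  then have "q = torus_pt2 T (fst z, fst z)" using z(2) Pr_0 by metis
  then show "q \<in> B" using Adm(1)[OF z(1)] by (simp add: BL_def)
 qed
 then show thesis using that[OF z] H_eq[OF d] proj_eq[OF d] z(2) by simp
qed

lemma B_E: "p \<in> B \<Longrightarrow> p \<in> E \<and> \<pi> p = p \<and> H p = (0, 0)"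
proof -
 assume p: "p \<in> B"
 then obtain x where x: "p = torus_pt2 T (x, x)" "x \<in> BL" "x \<in> box" unfolding B_eq_box by blast
 have pE: "p \<in> E" unfolding E_eq using Adm_0[OF x(2,3)] x(1) Pr_0 by (metis image_eqI)
 obtain z where z: "z \<in> Adm" "p = torus_pt2 T (Pr z)" "H p = Ht z" "\<pi> p = torus_pt2 T (fst z, fst z)" "p \<in> B \<longleftrightarrow> snd z = 0"
  by (rule E_cases[OF pE])
 then have "snd z = 0" using p by simp
 then have "z = (fst z, 0)" by (simp add: prod_eq_iff)
 then have "p = torus_pt2 T (fst z, fst z)" using z(2) Pr_0 by metis
 then show ?thesis using pE z Ht_0[OF \<open>snd z = 0\<close>] by simp
qed

lemma H_model: "q \<in> E \<Longrightarrow> H q \<in> cusp_model" and H_zero: "q \<in> E \<Longrightarrow> H q = (0, 0) \<Longrightarrow> q \<in> B"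
proof -
 assume q: "q \<in> E"
 obtain z where z: "z \<in> Adm" "q = torus_pt2 T (Pr z)" "H q = Ht z" "\<pi> q = torus_pt2 T (fst z, fst z)" "q \<in> B \<longleftrightarrow> snd z = 0"
  by (rule E_cases[OF q])
 show "H q \<in> cusp_model"
 proof (cases "snd z = 0")
  case True
  then show ?thesis using z(3) by (simp add: Ht_0 cusp_model_def)
 qed (use Ht_nonzero[OF z(1)] z(3) in simp)
 show "q \<in> B" if "H q = (0, 0)" using Ht_nonzero(1)[OF z(1)] that z(3,5) by auto
qed

lemma H_size:
 assumes "z \<in> disc R" "torus_pt2 T (Pr z) \<in> E"
 shows "(fst (Ht z))\<^sup>2 + (snd (Ht z))\<^sup>2 = (size_of z)\<^sup>2 + size_of z ^ 3"
proof -
 obtain w where w: "w \<in> Adm" "torus_pt2 T (Pr z) = torus_pt2 T (Pr w)" "H (torus_pt2 T (Pr z)) = Ht w"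
  by (rule E_cases[OF assms(2)]) blast
 have e: "snd z = snd w" by (rule snd_eq(1)[OF assms(1) Adm(3)[OF w(1)] w(2)])
 have "Ht z = Ht w" using H_eq[OF assms(1)] w(3) by simp
 moreover have "size_of z = size_of w" by (simp add: size_of_def e)
 moreover have "(fst (Ht w))\<^sup>2 + (snd (Ht w))\<^sup>2 = (size_of w)\<^sup>2 + size_of w ^ 3"
  using Ht_nonzero(2)[OF w(1)] Ht_0[of w] by (cases "snd w = 0") (auto simp: size_of_def)
 ultimately show ?thesis by simp
qed

text \<open>\<open>H\<close> determines the side \<open>j\<close>, the ratio \<open>m\<close> and
  the size, hence the radius. The angle is then the unique zero in \<open>good_quadrant\<close>. At
  the cusp itself the base point determines everything.\<close>

lemma bundle_map_inj: "inj_on (\<lambda>q. (\<pi> q, H q)) E"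
proof (rule inj_onI)
 fix q q' assume q: "q \<in> E" "q' \<in> E" and "(\<pi> q, H q) = (\<pi> q', H q')"
 then have eq: "\<pi> q = \<pi> q'" "H q = H q'" by auto
 show "q = q'"
 proof (cases "H q = (0, 0)")
  case True
  then have "q \<in> B" "q' \<in> B" using H_zero q eq by auto
  then show ?thesis using B_E eq(1) by metis
 next
  case False
  obtain z where z: "z \<in> Adm" "q = torus_pt2 T (Pr z)" "H q = Ht z" "\<pi> q = torus_pt2 T (fst z, fst z)" "q \<in> B \<longleftrightarrow> snd z = 0"
   by (rule E_cases[OF q(1)])
  obtain z' where z': "z' \<in> Adm" "q' = torus_pt2 T (Pr z')" "H q' = Ht z'" "\<pi> q' = torus_pt2 T (fst z', fst z')" "q' \<in> B \<longleftrightarrow> snd z' = 0"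
   by (rule E_cases[OF q(2)])
  \<comment> \<open>The second point expressed over the lift of the base point used for the first,
    so that both angles are zeros of the same function.\<close>
  define w where "w = (fst z, snd z')"
  have "fst z' - fst z \<in> lattice" using eq(1) z(4) z'(4) by (simp add: torus_pt2_eq_iff)
  from lattice_minus[OF this] have l: "fst z - fst z' \<in> lattice" by simp
  have wq: "torus_pt2 T (Pr w) = q'" using torus_pt2_Pr_lattice[OF l, of "fst z'" "snd z'"] z'(2) by (simp add: w_def)
  have w: "w \<in> Adm" using z(1) z'(1) wq by (auto simp: Adm_def w_def z'(2))
  have Hw: "Ht w = Ht z" using H_eq[OF Adm(3)[OF w]] wq eq(2) z(3) by simp
  have n: "snd z \<noteq> 0" "snd w \<noteq> 0" using False eq(2) z(3) z'(3) Ht_0[of z] Ht_0[of z'] by (auto simp: w_def)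
  note pz = Adm_polar[OF z(1) n(1)] and pw = Adm_polar[OF w n(2)]
  have s: "0 < size_of z" "0 < size_of w"
   using size_of[OF Adm(3)[OF z(1)]] size_of[OF Adm(3)[OF w]] n by (auto simp: order_less_le)
  note inj = cusp_pt_inj[OF pw(3,2) s(2) pz(3,2) s(1) Hw[unfolded Ht_def]]
  have nn: "norm (snd w) = norm (snd z)" using inj(3) cusp_scale(1) R_pos by (simp add: size_of_def)
  have fw: "fst w = fst z" by (simp add: w_def)
  have x: "fst z \<in> BL" "fst z \<in> box" "0 < norm (snd z)" "norm (snd z) \<le> R"
   using Adm[OF z(1)] n by (auto simp: disc_def)
  define P where "P \<phi> \<longleftrightarrow> \<phi> \<in> {0..pi / 2} \<and> Nf (sgn (fst (snd z))) (- sgn (sin (snd (fst z)))) (norm (snd z), fst z, Fratio z, \<phi>) = 0" for \<phi>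
  have ex1: "\<exists>!\<phi>. P \<phi>"
   using good[OF x pz(3)] pz(2) unfolding good_quadrant_def P_def by blast
  have "P (angle (snd z))" unfolding P_def by (intro conjI pz(6,10))
  moreover have "P (angle (snd w))" unfolding P_def by (intro conjI pw(10) pw(6)[unfolded inj(1,2) nn fw])
  ultimately have "angle (snd w) = angle (snd z)" using ex1 by blast
  then have "snd w = snd z" using pz(5) pw(5)[unfolded inj(1) nn fw] by simp
  then have "w = z" using fw by (simp add: prod_eq_iff)
  then show ?thesis using wq z(2) by simp
 qed
qed

lemma bundle_map_surj: "(\<lambda>q. (\<pi> q, H q)) ` E = B \<times> cusp_model"
proof (intro equalityI subsetI)
 fix w assume "w \<in> (\<lambda>q. (\<pi> q, H q)) ` E"
 then obtain q where q: "q \<in> E" "w = (\<pi> q, H q)" by blast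
 have "\<pi> q \<in> B" using q(1) unfolding M_near_cusp_def by simp
 then show "w \<in> B \<times> cusp_model" using q H_model by simp
next
 fix w assume w: "w \<in> B \<times> cusp_model"
 then obtain p y where py: "w = (p, y)" "p \<in> B" "y \<in> cusp_model" by blast
 obtain x where x: "p = torus_pt2 T (x, x)" "x \<in> BL" "x \<in> box" using py(2) unfolding B_eq_box by blast
 show "w \<in> (\<lambda>q. (\<pi> q, H q)) ` E"
 proof (cases "y = (0, 0)")
  case True
  then have "w = (\<pi> p, H p)" using B_E[OF py(2)] py(1) by simp
  then show ?thesis by (rule image_eqI) (use B_E[OF py(2)] in simp)
 next
  case False
  obtain j m e where c: "j\<^sup>2 = 1" "m \<in> {-1..1}" "0 < e" "e \<le> cusp_scale" "cusp_pt j m e = y"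
   using cusp_pt_surj[of "fst y" "snd y"] py(3) False by (metis prod.collapse)
  define \<rho> where "\<rho> = e * R / cusp_scale"
  have \<rho>: "0 < \<rho>" "\<rho> \<le> R" "cusp_scale / R * \<rho> = e"
   using c(3,4) cusp_scale(1) R_pos by (auto simp: \<rho>_def field_simps)
  define s where "s = sgn (sin (snd x))"
  have "sin (snd x) \<noteq> 0" using BL_nondegenerate[OF x(2)] by (simp add: nondegenerate_def)
  then have s: "(- s)\<^sup>2 = 1" by (auto simp: s_def sgn_if)
  have g: "good_quadrant j s x \<rho>" unfolding s_def by (rule good[OF x(2,3) \<rho>(1,2) c(1)])
  then obtain \<phi> where \<phi>: "\<phi> \<in> {0..pi / 2}" "Nf j (- s) (\<rho>, x, m, \<phi>) = 0"
   using c(2) unfolding good_quadrant_def by blast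
  define a where "a = \<rho> *\<^sub>R edir j (- s) \<phi>"
  have G: "Fsum (x, a) > 0" "0 < \<phi>" "\<phi> < pi / 2"
   using g \<phi> c(2) unfolding good_quadrant_def Fsum_def a_def by blast+
  have m: "FII (Pr (x, a)) - FI (Pr (x, a)) = m * Fsum (x, a)"
   using \<phi>(2) by (simp add: Nf_def Let_def Fsum_def a_def)
  have F: "FI (Pr (x, a)) \<ge> 0 \<and> FII (Pr (x, a)) \<ge> 0"
   using nonneg_iff_Nf[of "Pr (x, a)" "Fsum (x, a)"] m c(2) G(1) by (auto simp: Fsum_def)
  have na: "norm a = \<rho>" using \<rho>(1) norm_edir[OF c(1) s] by (simp add: a_def)
  have A: "(x, a) \<in> Adm" using F \<rho>(2) na by (intro AdmI x) auto
  have "cos \<phi> > 0" using G by (intro cos_gt_zero_pi) auto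
  then have j: "sgn (fst a) = j" using c(1) \<rho>(1) by (auto simp: a_def edir_def power2_eq_1_iff sgn_mult)
  have "Fratio (x, a) = m" using m G(1) by (simp add: Fratio_def)
  then have "Ht (x, a) = y" using c(5) \<rho>(3) by (simp add: Ht_def size_of_def j na)
  then have "H (torus_pt2 T (Pr (x, a))) = y" using H_eq[OF Adm(3)[OF A]] by simp
  moreover have "\<pi> (torus_pt2 T (Pr (x, a))) = p" using proj_eq[OF Adm(3)[OF A]] x(1) by simp
  moreover have "torus_pt2 T (Pr (x, a)) \<in> E" using A unfolding E_eq by blast
  ultimately show ?thesis unfolding py(1) by (intro image_eqI[of _ _ "torus_pt2 T (Pr (x, a))"]) simp_all
 qed
qed

lemma compact_E: "compact E"
proof -
 have cp: "continuous_on UNIV (\<lambda>z. torus_pt2 T (Pr z))"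
  by (rule sm_continuous_on[OF sm_compose_UNIV[OF sm_torus_pt2 sm_Pr]])
 have "closed ((\<lambda>z. torus_pt2 T (Pr z)) -` M_set T \<gamma> \<epsilon>)"
  by (rule closed_vimage[OF _ cp]) (simp add: M_set_def)
 then have "compact (((BL \<inter> box) \<times> cball 0 R) \<inter> ((\<lambda>z. torus_pt2 T (Pr z)) -` M_set T \<gamma> \<epsilon>))"
  by (intro compact_Int_closed compact_Times compact_BL_box compact_cball)
 moreover have "\<dots> = Adm" by (auto simp: Adm_def)
 ultimately have "compact Adm" by simp
 then show ?thesis unfolding E_eq
  by (intro compact_continuous_image continuous_on_subset[OF cp]) auto
qed

end

section \<open>Smoothness of the bundle map and of its inverse\<close>

context cusp_nbhd
begin

lemma E_nbhd: "q \<in> E \<Longrightarrow> q \<in> nbhd"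
 unfolding M_near_cusp_def tubular_nbhd_disc by blast

lemma smooth_proj: "smooth_map_on E \<pi>"
 unfolding smooth_map_on_def
proof
 fix q assume "q \<in> E"
 then obtain z0 where z0: "z0 \<in> disc R" "q = torus_pt2 T (Pr z0)" using E_nbhd by blast
 obtain U Z where Z: "smooth Z U" "torus_pt2 T (Pr z0) \<in> U" "Z (torus_pt2 T (Pr z0)) = z0"
  "\<And>q. q \<in> U \<Longrightarrow> q \<in> nbhd \<Longrightarrow> Z q \<in> disc R \<and> torus_pt2 T (Pr (Z q)) = q"
  by (rule chart[OF z0(1)]) blast
 have "smooth (\<lambda>q. torus_pt2 T (fst (Z q), fst (Z q))) U"
  by (intro sm_compose_UNIV[OF sm_torus_pt2] sm_intros Z(1))
 moreover have "torus_pt2 T (fst (Z q'), fst (Z q')) = \<pi> q'" if "q' \<in> E \<inter> U" for q'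
  using Z(4)[of q'] that E_nbhd[of q'] proj_eq[of "Z q'"] by simp
 ultimately show "\<exists>U g. q \<in> U \<and> smooth g U \<and> (\<forall>q'\<in>E \<inter> U. g q' = \<pi> q')"
  using Z(2) z0(2) by (intro exI[of _ U] exI[of _ "\<lambda>q. torus_pt2 T (fst (Z q), fst (Z q))"]) simp
qed

lemma sm_size_of: "open U \<Longrightarrow> (\<And>z. z \<in> U \<Longrightarrow> snd z \<noteq> 0) \<Longrightarrow> smooth size_of U"
 unfolding size_of_def[abs_def] by (intro sm_intros sm_norm) auto

lemma smooth_H: "smooth_map_on (E - B) H"
 unfolding smooth_map_on_def
proof
 fix q assume q: "q \<in> E - B"
 obtain z0 where z0: "z0 \<in> Adm" "q = torus_pt2 T (Pr z0)" "H q = Ht z0" "\<pi> q = torus_pt2 T (fst z0, fst z0)" "q \<in> B \<longleftrightarrow> snd z0 = 0"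
  by (rule E_cases[of q]) (use q in auto)
 have a0: "snd z0 \<noteq> 0" using z0(5) q by simp
 note p = Adm_polar[OF z0(1) a0]
 obtain U Z where Z: "smooth Z U" "torus_pt2 T (Pr z0) \<in> U" "Z (torus_pt2 T (Pr z0)) = z0"
  "\<And>q. q \<in> U \<Longrightarrow> q \<in> nbhd \<Longrightarrow> Z q \<in> disc R \<and> torus_pt2 T (Pr (Z q)) = q"
  by (rule chart[OF Adm(3)[OF z0(1)]]) blast
 define j where "j = sgn (fst (snd z0))"
 \<comment> \<open>On this set the sign in \<open>Ht\<close> is the constant \<open>j\<close>, and
   \<open>Fratio\<close> is smooth.\<close>
 define O1 where "O1 = {z. j * fst (snd z) > 0 \<and> Fsum z \<noteq> 0}"
 have oO1: "open O1" unfolding O1_def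
  by (intro open_Collect_conj open_Collect_less open_Collect_neq sm_continuous_on[OF sm_Fsum] continuous_intros)
 have ne: "snd z \<noteq> 0" if "z \<in> O1" for z using that by (auto simp: O1_def)
 have s: "smooth Fratio O1" "smooth size_of O1"
  by (rule sm_Fratio[OF oO1], simp add: O1_def, rule sm_size_of[OF oO1 ne])
 \<comment> \<open>The chart is open in the ambient space and contains points outside M, where
   \<open>Fratio\<close> may leave the interval from -1 to 1. Positivity under the square root of
   \<open>cusp_pt\<close> is therefore secured by shrinking the domain to where \<open>f\<close> is
   positive.\<close>
 define f where "f z = (size_of z)\<^sup>2 + (1 - (Fratio z)\<^sup>2) * size_of z ^ 3" for z
 have "smooth f O1" unfolding f_def[abs_def] by (intro sm_intros s oO1)
 from continuous_open_preimage[OF sm_continuous_on[OF this] oO1, of "{0<..}"]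
 have oO2: "open (O1 \<inter> f -` {0<..})" by simp
 define O2 where "O2 = O1 \<inter> f -` {0<..}"
 have pos: "size_of z > 0" if "z \<in> O1" for z
  using ne[OF that] cusp_scale(1) R_pos by (simp add: size_of_def)
 have G: "smooth (\<lambda>z. cusp_pt j (Fratio z) (size_of z)) O2"
 proof (rule sm_cusp_pt)
  show "smooth Fratio O2" "smooth size_of O2"
   unfolding O2_def by (rule sm_subset[OF s(1) oO2], blast, rule sm_subset[OF s(2) oO2], blast)
 qed (use pos in \<open>auto simp: O2_def f_def\<close>)
 have z0O: "z0 \<in> O2"
 proof -
  have "z0 \<in> O1" using p(1,7) by (simp add: O1_def j_def)
  moreover have "f z0 > 0"
   unfolding f_def using pos[OF calculation] cusp_pt_sq(3)[OF p(3,2), of "size_of z0"] by (simp add: add_pos_nonneg)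
  ultimately show ?thesis by (simp add: O2_def)
 qed
 define V where "V = U \<inter> Z -` O2"
 have oV: "open V" unfolding V_def
  by (rule continuous_open_preimage[OF sm_continuous_on[OF Z(1)] sm_open[OF Z(1)] sm_open[OF G]])
 have sm: "smooth (\<lambda>q. cusp_pt j (Fratio (Z q)) (size_of (Z q))) V"
  by (rule sm_compose[OF G sm_subset[OF Z(1) oV]]) (auto simp: V_def)
 have eq: "cusp_pt j (Fratio (Z q')) (size_of (Z q')) = H q'" if q': "q' \<in> (E - B) \<inter> V" for q'
 proof -
  have z: "Z q' \<in> disc R" "torus_pt2 T (Pr (Z q')) = q'" using Z(4)[of q'] q' E_nbhd[of q'] by (auto simp: V_def)
  have "j * fst (snd (Z q')) > 0" using q' by (simp add: V_def O2_def O1_def)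
  then have "sgn (fst (snd (Z q'))) = j" using p(3) by (auto simp: j_def[symmetric] power2_eq_1_iff)
  then show ?thesis using H_eq[OF z(1)] z(2) by (simp add: Ht_def)
 qed
 show "\<exists>U g. q \<in> U \<and> smooth g U \<and> (\<forall>q'\<in>(E - B) \<inter> U. g q' = H q')"
  by (rule exI[of _ V], rule exI[of _ "\<lambda>q. cusp_pt j (Fratio (Z q)) (size_of (Z q))"])
   (use sm eq Z(2,3) z0O z0(2) in \<open>simp add: V_def\<close>)
qed

text \<open>Away from the cusp \<open>H\<close> is smooth. Near a cusp point \<open>Fratio\<close>
  takes all values from -1 to 1, but the norm of \<open>H\<close> is
  \<open>sqrt (e\<^sup>2 + e ^ 3)\<close> with \<open>e\<close> the rescaled radius, and this tends
  to 0.\<close>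

lemma continuous_H: "continuous_on E H"
 unfolding continuous_on_eq_continuous_within
proof
 fix q assume q: "q \<in> E"
 show "continuous (at q within E) H"
 proof (cases "q \<in> B")
  case False
  have "smooth_map_on (E \<inter> - B) H" using smooth_H by (simp add: Diff_eq)
  from smooth_map_on_continuous_at[OF this _ q] show ?thesis
   using False compact_imp_closed[OF compact_B] by (simp add: open_Compl)
 next
  case True
  obtain z0 where z0: "z0 \<in> Adm" "q = torus_pt2 T (Pr z0)" "H q = Ht z0" "\<pi> q = torus_pt2 T (fst z0, fst z0)" "q \<in> B \<longleftrightarrow> snd z0 = 0"
   by (rule E_cases[OF q])
  obtain U Z where Z: "smooth Z U" "torus_pt2 T (Pr z0) \<in> U" "Z (torus_pt2 T (Pr z0)) = z0"
   "\<And>q. q \<in> U \<Longrightarrow> q \<in> nbhd \<Longrightarrow> Z q \<in> disc R \<and> torus_pt2 T (Pr (Z q)) = q"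
   by (rule chart[OF Adm(3)[OF z0(1)]]) blast
  have qU: "q \<in> U" using Z(2) z0(2) by simp
  have cZ: "continuous (at q within E) Z"
   using sm_continuous_on[OF Z(1)] sm_open[OF Z(1)] qU
   by (simp add: continuous_on_eq_continuous_at continuous_at_imp_continuous_at_within)
  define h where "h q = sqrt ((size_of (Z q))\<^sup>2 + size_of (Z q) ^ 3)" for q
  have "continuous (at q within E) h" unfolding h_def[abs_def] size_of_def
   by (intro continuous_intros cZ)
  then have "continuous (at q within E) (\<lambda>q. norm (H q))"
  proof (rule continuous_transform_within_openin[OF _ openin_open_Int[OF sm_open[OF Z(1)]]])
   show "q \<in> E \<inter> U" using q qU by simp
   fix q' assume q': "q' \<in> E \<inter> U"
   then have z: "Z q' \<in> disc R" "torus_pt2 T (Pr (Z q')) = q'" using Z(4)[of q'] E_nbhd[of q'] by auto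
   have "(fst (H q'))\<^sup>2 + (snd (H q'))\<^sup>2 = (size_of (Z q'))\<^sup>2 + size_of (Z q') ^ 3"
    using H_size[OF z(1)] H_eq[OF z(1)] z(2) q' by simp
   then show "h q' = norm (H q')" by (simp add: h_def norm_prod_def)
  qed
  then have "((\<lambda>q. norm (H q)) \<longlongrightarrow> norm (H q)) (at q within E)" by (simp add: continuous_within)
  moreover have H0: "H q = 0" using B_E[OF True] by (simp add: zero_prod_def)
  ultimately have "((\<lambda>q. norm (H q)) \<longlongrightarrow> 0) (at q within E)" by simp
  then show ?thesis using H0 by (simp add: continuous_within tendsto_norm_zero_cancel)
 qed
qed

lemma homeomorphism_bundle_map:
 obtains K where "homeomorphism E (B \<times> cusp_model) (\<lambda>q. (\<pi> q, H q)) K"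
proof -
 have "continuous_on E (\<lambda>q. (\<pi> q, H q))"
  by (intro continuous_on_Pair smooth_map_on_imp_continuous_on[OF smooth_proj] continuous_H)
 from homeomorphism_compact[OF compact_E this bundle_map_surj bundle_map_inj] that show thesis by blast
qed

text \<open>From the unknowns radius, lifted base point, ratio and angle to quantities that
  \<open>(\<pi> q, H q)\<close> determines: the squared norm of \<open>H q\<close>, the base point,
  the second coordinate of \<open>H q\<close>, and the equation \<open>Nf = 0\<close>. Inverting
  this map locally inverts the bundle map.\<close>

definition polar_param :: "real \<Rightarrow> real \<Rightarrow> real \<times> (real \<times> real) \<times> real \<times> real \<Rightarrow> real \<times> (real \<times> real) \<times> real \<times> real" where
 "polar_param j \<tau> w = (let e = cusp_scale / R * fst w in
   (e\<^sup>2 + e ^ 3, fst (snd w), fst (snd (snd w)) * (e * sqrt e), Nf j \<tau> w))"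

lemma sm_polar_param: "smooth (polar_param j \<tau>) {w. fst w > 0}"
proof -
 have o: "open {w :: real \<times> (real \<times> real) \<times> real \<times> real. fst w > 0}" by (intro open_Collect_less continuous_intros)
 show ?thesis unfolding polar_param_def[abs_def] Let_def
  by (intro sm_intros o sm_subset[OF sm_Nf]) (use cusp_scale(1) R_pos in auto)
qed

text \<open>The derivative is triangular in the order radius, base point, ratio, angle. The diagonal
  entries are a positive multiple of the radius variation, the identity, \<open>e * sqrt e\<close>,
  and the derivative of \<open>Nf\<close> in the angle.\<close>

lemma polar_param_inj:
 assumes \<rho>: "\<rho> > 0" and N: "frechet (Nf j \<tau>) (at (\<rho>, x, m, \<phi>)) (0, 0, 0, 1) > 0"
 shows "inj (frechet (polar_param j \<tau>) (at (\<rho>, x, m, \<phi>)))"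
proof -
 let ?w = "(\<rho>, x, m, \<phi>)"
 define k where "k = cusp_scale / R"
 have k: "k > 0" using cusp_scale(1) R_pos by (simp add: k_def)
 define C where "C \<rho> = (k * \<rho>) * sqrt (k * \<rho>)" for \<rho>
 have "smooth C {0<..}" unfolding C_def[abs_def] by (intro sm_intros) (use k in auto)
 then have dC: "(C has_derivative frechet C (at \<rho>)) (at \<rho>)" using \<rho> by (intro sm_has_derivative) auto
 define DC where "DC = frechet C (at \<rho>)"
 define DN where "DN = frechet (Nf j \<tau>) (at ?w)"
 have dN: "(Nf j \<tau> has_derivative DN) (at ?w)" unfolding DN_def by (rule sm_has_derivative[OF sm_Nf]) simp
 have dA: "((\<lambda>w :: real \<times> (real \<times> real) \<times> real \<times> real. (k * fst w)\<^sup>2 + (k * fst w) ^ 3) has_derivative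
   (\<lambda>h. (2 * k\<^sup>2 * \<rho> + 3 * k ^ 3 * \<rho>\<^sup>2) * fst h)) (at ?w)"
  by (auto intro!: derivative_eq_intros simp: algebra_simps eval_nat_numeral)
 have dC': "((\<lambda>w :: real \<times> (real \<times> real) \<times> real \<times> real. C (fst w)) has_derivative (\<lambda>h. DC (fst h))) (at ?w)"
  unfolding DC_def
  by (rule has_derivative_compose[OF has_derivative_fst[OF has_derivative_ident]]) (use dC in simp)
 have dm: "((\<lambda>w :: real \<times> (real \<times> real) \<times> real \<times> real. fst (snd (snd w))) has_derivative (\<lambda>h. fst (snd (snd h)))) (at ?w)"
  by (intro derivative_intros)
 have dx: "((\<lambda>w :: real \<times> (real \<times> real) \<times> real \<times> real. fst (snd w)) has_derivative (\<lambda>h. fst (snd h))) (at ?w)"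
  by (intro derivative_intros)
 define D where "D h = ((2 * k\<^sup>2 * \<rho> + 3 * k ^ 3 * \<rho>\<^sup>2) * fst h, fst (snd h), m * DC (fst h) + fst (snd (snd h)) * C \<rho>, DN h)"
  for h :: "real \<times> (real \<times> real) \<times> real \<times> real"
 have "(polar_param j \<tau> has_derivative D) (at ?w)"
  unfolding polar_param_def[abs_def] Let_def k_def[symmetric] C_def[symmetric] D_def[abs_def]
  using has_derivative_mult[OF dm dC'] by (intro has_derivative_Pair dA dx dN) simp
 then have D: "frechet (polar_param j \<tau>) (at ?w) = D" and lin: "linear D"
  by (rule frechet_derivative_at[symmetric], rule has_derivative_linear)
 have "h = 0" if h: "D h = 0" for h
 proof -
  obtain r y n p where hp: "h = (r, y, n, p)" by (cases h)
  have "2 * k\<^sup>2 * \<rho> + 3 * k ^ 3 * \<rho>\<^sup>2 > 0" using k \<rho> by (intro add_pos_pos) auto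
  then have r: "r = 0" using h by (simp add: D_def hp zero_prod_def)
  have y: "y = 0" using h by (simp add: D_def hp zero_prod_def)
  have "DC 0 = 0" using has_derivative_linear[OF dC] linear_0 by (auto simp: DC_def)
  moreover have "C \<rho> > 0" using k \<rho> by (simp add: C_def)
  ultimately have n: "n = 0" using h r by (simp add: D_def hp zero_prod_def)
  have "DN (p *\<^sub>R (0, 0, 0, 1)) = p * DN (0, 0, 0, 1)"
   by (rule linear_scale[OF has_derivative_linear[OF dN], of p "(0, 0, 0, 1)", unfolded real_scaleR_def])
  moreover have "p *\<^sub>R (0, 0, 0, 1) = h" using r y n by (simp add: hp zero_prod_def)
  ultimately have "p = 0" using h N by (simp add: D_def DN_def zero_prod_def)
  then show ?thesis using r y n by (simp add: hp zero_prod_def)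
 qed
 then show ?thesis unfolding D linear_injective_0[OF lin] by blast
qed

text \<open>Near a point off the cusp, \<open>K\<close> is the composition of \<open>c\<close>, the
  local inverse \<open>g\<close> of \<open>polar_param\<close> and the exponential map in polar
  coordinates, all of them smooth on open sets. \<open>smooth_map_on_inverse\<close> passes from
  this local left inverse to \<open>K\<close>.\<close>

lemma smooth_inverse_bundle_map:
 assumes hom: "homeomorphism E (B \<times> cusp_model) (\<lambda>q. (\<pi> q, H q)) K"
 shows "smooth_map_on (B \<times> (cusp_model - {(0, 0)})) K"
proof (rule smooth_map_on_inverse)
 have im: "(\<lambda>q. (\<pi> q, H q)) ` (E - B) = B \<times> (cusp_model - {(0, 0)})"
 proof (intro equalityI subsetI)
  fix w assume "w \<in> (\<lambda>q. (\<pi> q, H q)) ` (E - B)"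
  then obtain q where q: "q \<in> E" "q \<notin> B" "w = (\<pi> q, H q)" by blast
  have "w \<in> B \<times> cusp_model" using q(1,3) homeomorphism_image1[OF hom] by blast
  then show "w \<in> B \<times> (cusp_model - {(0, 0)})" using H_zero[OF q(1)] q(2,3) by auto
 next
  fix w assume w: "w \<in> B \<times> (cusp_model - {(0, 0)})"
  then have "w \<in> (\<lambda>q. (\<pi> q, H q)) ` E" using homeomorphism_image1[OF hom] by auto
  then obtain q where q: "q \<in> E" "w = (\<pi> q, H q)" by blast
  then have "q \<notin> B" using w B_E[of q] by auto
  then show "w \<in> (\<lambda>q. (\<pi> q, H q)) ` (E - B)" using q by blast
 qed
 show "homeomorphism (E - B) (B \<times> (cusp_model - {(0, 0)})) (\<lambda>q. (\<pi> q, H q)) K"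
  by (rule homeomorphism_of_subsets[OF hom]) (use im in auto)
 fix q assume q: "q \<in> E - B"
 obtain z0 where z0: "z0 \<in> Adm" "q = torus_pt2 T (Pr z0)" "H q = Ht z0" "\<pi> q = torus_pt2 T (fst z0, fst z0)" "q \<in> B \<longleftrightarrow> snd z0 = 0"
  by (rule E_cases[of q]) (use q in auto)
 have a0: "snd z0 \<noteq> 0" using z0(5) q by simp
 define j where "j = sgn (fst (snd z0))"
 define \<tau> where "\<tau> = - sgn (sin (snd (fst z0)))"
 note p = Adm_polar[OF z0(1) a0, folded j_def \<tau>_def]
 obtain U Z where Z: "smooth Z U" "torus_pt2 T (Pr z0) \<in> U" "Z (torus_pt2 T (Pr z0)) = z0"
  "\<And>q. q \<in> U \<Longrightarrow> q \<in> nbhd \<Longrightarrow> Z q \<in> disc R \<and> torus_pt2 T (Pr (Z q)) = q"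
  by (rule chart[OF Adm(3)[OF z0(1)]]) blast
 obtain UL L where L: "smooth L UL" "torus_pt2 T (fst z0, fst z0) \<in> UL" "L (torus_pt2 T (fst z0, fst z0)) = fst z0"
  "\<And>x. torus_pt2 T (x, x) \<in> UL \<Longrightarrow> \<exists>l\<in>lattice. L (torus_pt2 T (x, x)) = x + l \<and> x + l \<in> UNIV"
  by (rule diagonal_section[of UNIV "fst z0"]) auto
 define k where "k z = (norm (snd z), L (torus_pt2 T (fst z, fst z)), Fratio z, angle (snd z))" for z
 have kz0: "k z0 = (norm (snd z0), fst z0, Fratio z0, angle (snd z0))" by (simp add: k_def L(3))
 have n0: "norm (snd z0) > 0" using a0 by simp
 have "k z0 \<in> {w. fst w > 0}" unfolding kz0 using n0 by simp
 moreover have "inj (frechet (polar_param j \<tau>) (at (k z0)))"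
  unfolding kz0 by (rule polar_param_inj[OF n0 p(9)])
 ultimately obtain V W g where g: "open V" "V \<subseteq> {w. fst w > 0}" "k z0 \<in> V" "open W" "polar_param j \<tau> (k z0) \<in> W"
  "homeomorphism V W (polar_param j \<tau>) g" "smooth g W"
  by (rule smooth_inverse_function[OF sm_polar_param])
 define O1 where "O1 = {z. j * fst (snd z) > 0 \<and> \<tau> * snd (snd z) > 0 \<and> Fsum z \<noteq> 0 \<and> torus_pt2 T (fst z, fst z) \<in> UL}"
 have cd: "continuous_on UNIV (\<lambda>z :: (real \<times> real) \<times> (real \<times> real). torus_pt2 T (fst z, fst z))"
  by (intro continuous_on_compose2[OF sm_continuous_on[OF sm_torus_pt2]] continuous_intros) auto
 have "open {z :: (real \<times> real) \<times> (real \<times> real). torus_pt2 T (fst z, fst z) \<in> UL}"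
  using open_vimage[OF sm_open[OF L(1)] cd] by (simp add: vimage_def)
 then have oO1: "open O1" unfolding O1_def
  by (intro open_Collect_conj open_Collect_less open_Collect_neq sm_continuous_on[OF sm_Fsum] continuous_intros)
 have ne: "snd z \<noteq> 0" if "z \<in> O1" for z using that by (auto simp: O1_def)
 have "continuous_on O1 k" unfolding k_def[abs_def]
 proof (intro continuous_on_Pair)
  show "continuous_on O1 (\<lambda>z. norm (snd z))" by (intro continuous_intros)
  show "continuous_on O1 (\<lambda>z. L (torus_pt2 T (fst z, fst z)))"
   by (rule continuous_on_compose2[OF sm_continuous_on[OF L(1)] continuous_on_subset[OF cd]]) (auto simp: O1_def)
  show "continuous_on O1 Fratio" by (rule sm_continuous_on[OF sm_Fratio[OF oO1]]) (simp add: O1_def)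
  have "\<bar>fst a\<bar> / norm a \<in> {-1..1}" if "a \<noteq> 0" for a :: "real \<times> real"
   using that norm_fst_le[of "fst a" "snd a"] by (auto simp: divide_le_eq order_trans[OF _ divide_nonneg_nonneg])
  then show "continuous_on O1 (\<lambda>z. angle (snd z))" unfolding angle_def
   by (intro continuous_on_compose2[OF continuous_on_arccos'] continuous_intros) (use ne in auto)
 qed
 then have oO2: "open (O1 \<inter> k -` V)" by (rule continuous_open_preimage[OF _ oO1 g(1)])
 define Q where "Q = U \<inter> Z -` (O1 \<inter> k -` V)"
 have oQ: "open Q" unfolding Q_def by (rule continuous_open_preimage[OF sm_continuous_on[OF Z(1)] sm_open[OF Z(1)] oO2])
 have "z0 \<in> O1" using p(1,7,8) L(2) by (simp add: O1_def)
 then have qQ: "q \<in> Q" using Z(2,3) g(3) z0(2) by (simp add: Q_def)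
 \<comment> \<open>The prescribed values of \<open>polar_param\<close>; the last entry is 0 because
   points of M solve \<open>Nf = 0\<close> for their own ratio.\<close>
 define c where "c w = ((fst (snd w))\<^sup>2 + (snd (snd w))\<^sup>2, L (fst w), snd (snd w), 0 :: real)" for w :: "torus2 \<times> real \<times> real"
 have oUL: "open (UL \<times> (UNIV :: (real \<times> real) set))" using sm_open[OF L(1)] by (intro open_Times) auto
 have sc: "smooth c (UL \<times> UNIV)"
  unfolding c_def[abs_def]
  by (intro sm_intros oUL sm_compose[OF L(1)]) auto
 define Dm where "Dm = (UL \<times> UNIV) \<inter> c -` W"
 have oD: "open Dm" unfolding Dm_def by (rule continuous_open_preimage[OF sm_continuous_on[OF sc] oUL g(4)])
 define \<Phi> where "\<Phi> w = torus_pt2 T (Pr (fst (snd (g (c w))), fst (g (c w)) *\<^sub>R edir j \<tau> (snd (snd (snd (g (c w)))))))" for w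
 have sgc: "smooth (\<lambda>w. g (c w)) Dm"
  by (rule sm_compose[OF g(7) sm_subset[OF sc oD]]) (auto simp: Dm_def)
 have s\<Phi>: "smooth \<Phi> Dm"
  unfolding \<Phi>_def[abs_def]
  by (intro sm_compose_UNIV[OF sm_torus_pt2] sm_compose_UNIV[OF sm_Pr] sm_intros sm_edir sgc)
 have key: "(\<pi> q', H q') \<in> UL \<times> UNIV \<and> polar_param j \<tau> (k (Z q')) = c (\<pi> q', H q') \<and> k (Z q') \<in> V \<and>
   torus_pt2 T (Pr (fst (snd (k (Z q'))), fst (k (Z q')) *\<^sub>R edir j \<tau> (snd (snd (snd (k (Z q'))))))) = q'"
  if q': "q' \<in> (E - B) \<inter> Q" for q'
 proof -
  define z where "z = Z q'"
  have z: "z \<in> disc R" "torus_pt2 T (Pr z) = q'" "z \<in> O1" "k z \<in> V" "q' \<in> E"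
   using q' Z(4)[of q'] E_nbhd[of q'] by (auto simp: Q_def z_def)
  have pq: "\<pi> q' = torus_pt2 T (fst z, fst z)" using proj_eq[OF z(1)] z(2) by simp
  have jp: "j * fst (snd z) > 0" "\<tau> * snd (snd z) > 0" and F0: "Fsum z \<noteq> 0" and tL: "torus_pt2 T (fst z, fst z) \<in> UL"
   using z(3) by (auto simp: O1_def)
  from L(4)[OF tL] obtain l where l: "l \<in> lattice" "L (torus_pt2 T (fst z, fst z)) = fst z + l" by blast
  have j1: "j = 1 \<or> j = -1" "\<tau> = 1 \<or> \<tau> = -1" using p(3,4) by (auto simp: power2_eq_1_iff)
  have sj: "sgn (fst (snd z)) = j" using jp(1) j1(1) by auto
  have ab: "fst (snd z) = j * \<bar>fst (snd z)\<bar>" "snd (snd z) = \<tau> * \<bar>snd (snd z)\<bar>" using jp j1 by auto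
  note pol = polar[OF ne[OF z(3)] ab]
  have HH: "H q' = cusp_pt j (Fratio z) (size_of z)" using H_eq[OF z(1)] z(2) sj by (simp add: Ht_def)
  have sz: "(fst (H q'))\<^sup>2 + (snd (H q'))\<^sup>2 = (size_of z)\<^sup>2 + size_of z ^ 3"
   using H_size[of z] z H_eq[OF z(1)] by simp
  have t: "torus_pt2 T (Pr (fst z + l, snd z)) = q'" using torus_pt2_Pr_lattice[OF l(1), of "fst z" "snd z"] z(2) by simp
  have FF: "FI (Pr (fst z + l, snd z)) = FI (Pr z)" "FII (Pr (fst z + l, snd z)) = FII (Pr z)"
   using F_torus_pt2[of "Pr (fst z + l, snd z)" "Pr z"] t z(2) by simp_all
  have kz: "k z = (norm (snd z), fst z + l, Fratio z, angle (snd z))" by (simp add: k_def l(2))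
  have "Nf j \<tau> (k z) = FII (Pr z) - FI (Pr z) - Fratio z * Fsum z"
   by (simp add: kz Nf_def Let_def pol(1) FF Fsum_def)
  then have "Nf j \<tau> (k z) = 0" using F0 by (simp add: Fratio_def)
  moreover have "snd (H q') = Fratio z * (size_of z * sqrt (size_of z))" by (simp add: HH cusp_pt_def)
  ultimately have "polar_param j \<tau> (k z) = c (\<pi> q', H q')"
   using sz by (simp add: polar_param_def Let_def c_def pq l(2) size_of_def[symmetric]) (simp add: kz size_of_def)
  moreover have "torus_pt2 T (Pr (fst (snd (k z)), fst (k z) *\<^sub>R edir j \<tau> (snd (snd (snd (k z)))))) = q'"
   using t by (simp add: kz pol(1))
  ultimately show ?thesis using z(4) tL pq by (simp add: z_def)
 qed
 have "(\<pi> q, H q) \<in> Dm"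
  using key[of q] q qQ g(5) Z(3) z0(2) by (auto simp: Dm_def)
 moreover have "\<Phi> (\<pi> q', H q') = q'" if q': "q' \<in> (E - B) \<inter> Q" for q'
 proof -
  have "g (c (\<pi> q', H q')) = k (Z q')"
   using key[OF q'] homeomorphism_apply1[OF g(6), of "k (Z q')"] by simp
  then show ?thesis using key[OF q'] by (simp add: \<Phi>_def)
 qed
 ultimately show "\<exists>U V \<Phi>. open U \<and> q \<in> U \<and> (\<pi> q, H q) \<in> V \<and> smooth \<Phi> V \<and>
    (\<forall>q'\<in>(E - B) \<inter> U. (\<pi> q', H q') \<in> V \<longrightarrow> \<Phi> (\<pi> q', H q') = q')"
  using oQ qQ s\<Phi> by (intro exI[of _ Q] exI[of _ Dm] exI[of _ \<Phi>]) simp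
qed

text \<open>\<open>F1\<close> vanishes where the ratio is 1, which is the upper edge of the model,
  and \<open>F2\<close> where it is -1, the lower edge. The existential over lifts in
  \<open>M_strata\<close> is harmless since both functions are invariant under the lattice.\<close>

lemma M_strata_eq: "M_strata T \<gamma> CK \<epsilon> r i = {q \<in> E. H q \<in> cusp_model_strata i}"
proof (cases i)
 case None
 show ?thesis unfolding None cusp_model_strata(3) using B_E H_zero by (auto simp: M_strata_def)
next
 case (Some c)
 obtain c1 c2 where c: "i = Some (c1, c2)" using Some by (cases c) auto
 show ?thesis
 proof (rule set_eqI)
  fix q
  have "q \<in> M_strata T \<gamma> CK \<epsilon> r i \<longleftrightarrow> q \<in> E \<and> q \<notin> B \<and> (\<exists>z. torus_pt2 T z = q \<and> (FI z = 0 \<longleftrightarrow> c1) \<and> (FII z = 0 \<longleftrightarrow> c2))"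
   by (auto simp: M_strata_def c)
  also have "\<dots> \<longleftrightarrow> q \<in> E \<and> H q \<in> cusp_model_strata i"
  proof (rule conj_cong[OF refl])
   assume q: "q \<in> E"
   obtain z where z: "z \<in> Adm" "q = torus_pt2 T (Pr z)" "H q = Ht z" "\<pi> q = torus_pt2 T (fst z, fst z)" "q \<in> B \<longleftrightarrow> snd z = 0"
    by (rule E_cases[OF q])
   have S: "H q \<in> cusp_model_strata i \<longleftrightarrow> Ht z \<in> cusp_model - {(0, 0)} \<and>
     (snd (Ht z) = sqrt \<bar>fst (Ht z) ^ 3\<bar> \<longleftrightarrow> c1) \<and> (snd (Ht z) = - sqrt \<bar>fst (Ht z) ^ 3\<bar> \<longleftrightarrow> c2)"
    by (auto simp: cusp_model_strata_def c z(3) split: prod.splits)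
   show "(q \<notin> B \<and> (\<exists>z. torus_pt2 T z = q \<and> (FI z = 0 \<longleftrightarrow> c1) \<and> (FII z = 0 \<longleftrightarrow> c2))) \<longleftrightarrow> H q \<in> cusp_model_strata i"
   proof (cases "snd z = 0")
    case True
    then show ?thesis using z(5) S Ht_0[OF True] by simp
   next
    case False
    note p = Adm_polar[OF z(1) False] and s = size_of[OF Adm(3)[OF z(1)]]
    have s0: "0 < size_of z" using s(1,3) False by (simp add: order_less_le)
    have F: "(\<exists>w. torus_pt2 T w = q \<and> (FI w = 0 \<longleftrightarrow> c1) \<and> (FII w = 0 \<longleftrightarrow> c2)) \<longleftrightarrow>
      (FI (Pr z) = 0 \<longleftrightarrow> c1) \<and> (FII (Pr z) = 0 \<longleftrightarrow> c2)" (is "?L \<longleftrightarrow> ?R")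
    proof
     assume ?L
     then obtain w where w: "torus_pt2 T w = q" "FI w = 0 \<longleftrightarrow> c1" "FII w = 0 \<longleftrightarrow> c2" by blast
     have "torus_pt2 T (Pr z) = torus_pt2 T w" using w(1) z(2) by simp
     from F_torus_pt2[OF this] show ?R using w(2,3) by simp
    next
     assume ?R
     then show ?L using z(2) by (intro exI[of _ "Pr z"]) simp
    qed
    have F0: "Fsum z \<noteq> 0" using p(1) by simp
    show ?thesis unfolding S F F_Fratio[OF F0] Ht_def cusp_pt_edges[OF p(3,2) s(1) s0]
     using z(5) False Ht_nonzero(1)[OF z(1) False] by (simp add: Ht_def)
   qed
  qed
  finally show "q \<in> M_strata T \<gamma> CK \<epsilon> r i \<longleftrightarrow> q \<in> {q \<in> E. H q \<in> cusp_model_strata i}" by simp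
 qed
qed

theorem cusp_fibration:
 "locally_trivial_stratified_fibration E B \<pi> (M_strata T \<gamma> CK \<epsilon> r)"
 "p \<in> B \<Longrightarrow> \<exists>h g. let fib = {q \<in> E. \<pi> q = p} in
   homeomorphism fib cusp_model h g \<and> h p = (0, 0) \<and>
   (\<forall>i. h ` (M_strata T \<gamma> CK \<epsilon> r i \<inter> fib) = cusp_model_strata i) \<and>
   diffeomorphism_between (fib - {p}) (cusp_model - {(0, 0)}) h g"
proof -
 obtain K where K: "homeomorphism E (B \<times> cusp_model) (\<lambda>q. (\<pi> q, H q)) K" by (rule homeomorphism_bundle_map)
 have BE: "B \<subseteq> E" using B_E by blast
 have B': "\<And>p. p \<in> B \<Longrightarrow> \<pi> p = p \<and> H p = (0, 0)" using B_E by blast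
 note fib = fibration_of_trivialization[OF K BE B' H_zero smooth_proj smooth_H smooth_inverse_bundle_map[OF K] M_strata_eq
   cusp_model_strata(1,2,3)]
 show "locally_trivial_stratified_fibration E B \<pi> (M_strata T \<gamma> CK \<epsilon> r)" by (rule fib(1))
 show "p \<in> B \<Longrightarrow> \<exists>h g. let fib = {q \<in> E. \<pi> q = p} in
   homeomorphism fib cusp_model h g \<and> h p = (0, 0) \<and>
   (\<forall>i. h ` (M_strata T \<gamma> CK \<epsilon> r i \<inter> fib) = cusp_model_strata i) \<and>
   diffeomorphism_between (fib - {p}) (cusp_model - {(0, 0)}) h g" by (rule fib(2))
qed

end

section \<open>Choice of the radius, and conclusion\<close>

context cusp
begin

text \<open>The quadrant lemmas are applied for each side \<open>j\<close> and each sign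
  \<open>s\<close> of \<open>sin (snd x)\<close>; the smallest of the four radii serves all of
  them.\<close>

lemma good_radius:
 obtains d where "d > 0" "\<And>x \<rho> j. x \<in> BL \<Longrightarrow> x \<in> box \<Longrightarrow> 0 < \<rho> \<Longrightarrow> \<rho> \<le> d \<Longrightarrow> j\<^sup>2 = 1 \<Longrightarrow> good_quadrant j (sgn (sin (snd x))) x \<rho>"
proof -
 have ex: "\<exists>d>0. \<forall>x\<in>BL \<inter> box \<inter> {x. s * sin (snd x) \<ge> 0}. \<forall>\<rho>. 0 < \<rho> \<longrightarrow> \<rho> \<le> d \<longrightarrow> good_quadrant j s x \<rho>"
  if js: "j\<^sup>2 = 1" "s\<^sup>2 = 1" for j s
 proof -
  \<comment> \<open>The weak inequality keeps \<open>X\<close> compact; nondegeneracy turns it into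
    a strict one.\<close>
  define X where "X = BL \<inter> box \<inter> {x. s * sin (snd x) \<ge> 0}"
  have cX: "compact X" unfolding X_def
   by (intro compact_Int_closed compact_BL_box closed_Collect_le continuous_intros)
  have s0: "s \<noteq> 0" using js(2) by auto
  have ndX: "nondegenerate x \<and> s * sin (snd x) > 0" "nondegenerate x \<and> - s * sin (snd x) < 0" if "x \<in> X" for x
  proof -
   have n: "nondegenerate x" using that by (intro BL_nondegenerate) (simp add: X_def)
   then have "s * sin (snd x) \<noteq> 0" using s0 by (simp add: nondegenerate_def)
   then have "s * sin (snd x) > 0" using that by (simp add: order_less_le X_def)
   then show "nondegenerate x \<and> s * sin (snd x) > 0" "nondegenerate x \<and> - s * sin (snd x) < 0" using n by simp_all
  qed
  have js': "(- s)\<^sup>2 = 1" using js(2) by simp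
  obtain d1 where d1: "d1 > 0" "\<And>x \<rho> \<phi>. x \<in> X \<Longrightarrow> 0 < \<rho> \<Longrightarrow> \<rho> \<le> d1 \<Longrightarrow> \<phi> \<in> {0..pi / 2} \<Longrightarrow>
    \<not> (FI (Pr (x, \<rho> *\<^sub>R edir j s \<phi>)) \<ge> 0 \<and> FII (Pr (x, \<rho> *\<^sub>R edir j s \<phi>)) \<ge> 0)"
   by (rule empty_quadrant[OF js cX ndX(1)]) blast+
  obtain d2 where d2: "d2 > 0"
   "\<And>x \<rho> \<phi> m. x \<in> X \<Longrightarrow> 0 < \<rho> \<Longrightarrow> \<rho> \<le> d2 \<Longrightarrow> \<phi> \<in> {0..pi / 2} \<Longrightarrow> m \<in> {-1..1} \<Longrightarrow> Nf j (- s) (\<rho>, x, m, \<phi>) = 0 \<Longrightarrow>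
     FI (Pr (x, \<rho> *\<^sub>R edir j (- s) \<phi>)) + FII (Pr (x, \<rho> *\<^sub>R edir j (- s) \<phi>)) > 0 \<and> 0 < \<phi> \<and> \<phi> < pi / 2 \<and>
     frechet (Nf j (- s)) (at (\<rho>, x, m, \<phi>)) (0, 0, 0, 1) > 0"
   "\<And>x \<rho> m. x \<in> X \<Longrightarrow> 0 < \<rho> \<Longrightarrow> \<rho> \<le> d2 \<Longrightarrow> m \<in> {-1..1} \<Longrightarrow> \<exists>!\<phi>. \<phi> \<in> {0..pi / 2} \<and> Nf j (- s) (\<rho>, x, m, \<phi>) = 0"
   by (rule cusp_quadrant[OF js(1) js' cX ndX(2)]) blast+
  have "good_quadrant j s x \<rho>" if "x \<in> X" "0 < \<rho>" "\<rho> \<le> min d1 d2" for x \<rho>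
   unfolding good_quadrant_def
  proof (intro conjI ballI)
   fix \<phi> :: real assume "\<phi> \<in> {0..pi / 2}"
   then show "\<not> (FI (Pr (x, \<rho> *\<^sub>R edir j s \<phi>)) \<ge> 0 \<and> FII (Pr (x, \<rho> *\<^sub>R edir j s \<phi>)) \<ge> 0)"
    using that by (intro d1(2)) auto
  next
   fix \<phi> m :: real assume a: "\<phi> \<in> {0..pi / 2}" "m \<in> {-1..1}"
   show "Nf j (- s) (\<rho>, x, m, \<phi>) = 0 \<longrightarrow> FI (Pr (x, \<rho> *\<^sub>R edir j (- s) \<phi>)) + FII (Pr (x, \<rho> *\<^sub>R edir j (- s) \<phi>)) > 0 \<and> 0 < \<phi> \<and> \<phi> < pi / 2 \<and>
     frechet (Nf j (- s)) (at (\<rho>, x, m, \<phi>)) (0, 0, 0, 1) > 0"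
    by (rule impI, rule d2(2)[OF that(1,2) _ a]) (use that(3) in simp_all)
  next
   fix m :: real assume m: "m \<in> {-1..1}"
   show "\<exists>!\<phi>. \<phi> \<in> {0..pi / 2} \<and> Nf j (- s) (\<rho>, x, m, \<phi>) = 0"
    by (rule d2(3)[OF that(1,2) _ m]) (use that(3) in simp)
  qed
  then show ?thesis using d1(1) d2(1) unfolding X_def[symmetric] by (intro exI[of _ "min d1 d2"]) auto
 qed
 obtain d1 where d1: "d1 > 0" "\<forall>x\<in>BL \<inter> box \<inter> {x. 1 * sin (snd x) \<ge> 0}. \<forall>\<rho>. 0 < \<rho> \<longrightarrow> \<rho> \<le> d1 \<longrightarrow> good_quadrant 1 1 x \<rho>"
  using ex[of 1 1] by auto
 obtain d2 where d2: "d2 > 0" "\<forall>x\<in>BL \<inter> box \<inter> {x. 1 * sin (snd x) \<ge> 0}. \<forall>\<rho>. 0 < \<rho> \<longrightarrow> \<rho> \<le> d2 \<longrightarrow> good_quadrant (-1) 1 x \<rho>"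
  using ex[of "-1" 1] by auto
 obtain d3 where d3: "d3 > 0" "\<forall>x\<in>BL \<inter> box \<inter> {x. -1 * sin (snd x) \<ge> 0}. \<forall>\<rho>. 0 < \<rho> \<longrightarrow> \<rho> \<le> d3 \<longrightarrow> good_quadrant 1 (-1) x \<rho>"
  using ex[of 1 "-1"] by auto
 obtain d4 where d4: "d4 > 0" "\<forall>x\<in>BL \<inter> box \<inter> {x. -1 * sin (snd x) \<ge> 0}. \<forall>\<rho>. 0 < \<rho> \<longrightarrow> \<rho> \<le> d4 \<longrightarrow> good_quadrant (-1) (-1) x \<rho>"
  using ex[of "-1" "-1"] by auto
 show thesis
 proof (rule that[of "min (min d1 d2) (min d3 d4)"])
  fix x \<rho> and j :: real assume x: "x \<in> BL" "x \<in> box" "0 < \<rho>" "\<rho> \<le> min (min d1 d2) (min d3 d4)" and j: "j\<^sup>2 = 1"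
  have "sin (snd x) \<noteq> 0" using BL_nondegenerate[OF x(1)] by (simp add: nondegenerate_def)
  then consider "sin (snd x) > 0" | "sin (snd x) < 0" by linarith
  then show "good_quadrant j (sgn (sin (snd x))) x \<rho>"
  proof cases
   case 1
   then show ?thesis using d1(2) d2(2) x j by (auto simp: power2_eq_1_iff)
  next
   case 2
   then show ?thesis using d3(2) d4(2) x j by (auto simp: power2_eq_1_iff)
  qed
 qed (use d1(1) d2(1) d3(1) d4(1) in simp)
qed

lemma cusp_neighbourhood:
 obtains r0 where "r0 > 0" "\<And>r. 0 < r \<Longrightarrow> r \<le> r0 \<Longrightarrow> cusp_nbhd T \<gamma> \<epsilon> CK (r / sqrt 2)"
proof -
 obtain \<rho> where \<rho>: "\<rho> > 0"
  "\<And>z w. norm (snd z) \<le> \<rho> \<Longrightarrow> norm (snd w) \<le> \<rho> \<Longrightarrow> torus_pt2 T (Pr z) = torus_pt2 T (Pr w) \<Longrightarrow> Nb z = Nb w"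
  "\<And>z. norm (snd z) \<le> \<rho> \<Longrightarrow> \<exists>V W g. open V \<and> z \<in> V \<and> open W \<and> homeomorphism V W Pr g \<and> smooth g W"
  by (rule tubular_radius_exists) blast
 obtain d where d: "d > 0" "\<And>x \<rho> j. x \<in> BL \<Longrightarrow> x \<in> box \<Longrightarrow> 0 < \<rho> \<Longrightarrow> \<rho> \<le> d \<Longrightarrow> j\<^sup>2 = 1 \<Longrightarrow> good_quadrant j (sgn (sin (snd x))) x \<rho>"
  by (rule good_radius) blast
 show thesis
 proof (rule that[of "sqrt 2 * min \<rho> d"])
  show "0 < sqrt 2 * min \<rho> d" using \<rho>(1) d(1) by simp
  fix r :: real assume r: "0 < r" "r \<le> sqrt 2 * min \<rho> d"
  have R: "0 < r / sqrt 2" "r / sqrt 2 \<le> \<rho>" "r / sqrt 2 \<le> d"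
   using r by (auto simp: divide_le_eq mult.commute intro: order_trans[OF r(2)])
  show "cusp_nbhd T \<gamma> \<epsilon> CK (r / sqrt 2)"
  proof (unfold_locales)
   show "0 < r / sqrt 2" by fact
   show "Nb z = Nb w" if "norm (snd z) \<le> r / sqrt 2" "norm (snd w) \<le> r / sqrt 2" "torus_pt2 T (Pr z) = torus_pt2 T (Pr w)" for z w
    by (rule \<rho>(2)[OF _ _ that(3)]) (use that R in linarith)+
   show "\<exists>V W g. open V \<and> z \<in> V \<and> open W \<and> homeomorphism V W Pr g \<and> smooth g W" if "norm (snd z) \<le> r / sqrt 2" for z
    by (rule \<rho>(3)) (use that R in linarith)
   show "good_quadrant j (sgn (sin (snd x))) x \<eta>" if "x \<in> BL" "x \<in> box" "0 < \<eta>" "\<eta> \<le> r / sqrt 2" "j\<^sup>2 = 1" for x \<eta> j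
    by (rule d(2)[OF that(1,2,3) _ that(5)]) (use that R in linarith)
  qed
 qed
qed

end

theorem corollary88:
  fixes T :: real and \<gamma> :: "real \<Rightarrow> real^3" and C :: "real \<Rightarrow> real" and CK :: real
  assumes "generic_knot T \<gamma>"
    and "\<And>s. pointing_constant \<gamma> s (C s)"
    and "\<And>s. C (s + T) = C s"
    and "bdd_above (range C)"
    and "CK = 2 * (SUP s. C s)"
  shows "\<forall>\<^sub>F \<epsilon> in at_right 0. \<exists>r0>0. \<forall>r. 0 < r \<and> r \<le> r0 \<longrightarrow>
    is_tubular_radius T \<gamma> \<epsilon> r \<and>
    locally_trivial_stratified_fibration (M_near_cusp T \<gamma> CK \<epsilon> r) (Delta_cusp T \<gamma> CK \<epsilon>)
      (tubular_proj T \<gamma> \<epsilon> r) (M_strata T \<gamma> CK \<epsilon> r) \<and>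
    (\<forall>p \<in> Delta_cusp T \<gamma> CK \<epsilon>. \<exists>h g.
       let fib = {q \<in> M_near_cusp T \<gamma> CK \<epsilon> r. tubular_proj T \<gamma> \<epsilon> r q = p} in
         homeomorphism fib cusp_model h g \<and> h p = (0, 0) \<and>
         (\<forall>i. h ` (M_strata T \<gamma> CK \<epsilon> r i \<inter> fib) = cusp_model_strata i) \<and>
         diffeomorphism_between (fib - {p}) (cusp_model - {(0, 0)}) h g)"
proof -
  interpret knot T \<gamma> by unfold_locales (rule assms(1))
  have C: "C s \<le> CK / 2" for s using cSUP_upper[OF UNIV_I assms(4), of s] assms(5) by simp
  have CK: "CK > 0" using assms(2)[of 0] C[of 0] by (simp add: pointing_constant_def)
  have bound: "\<bar>velocity kap s\<bar> \<le> 3 / 2 * kap s * CK * sqrt (kap s)" for s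
  proof -
    have "3 * kap s * sqrt (kap s) * C s \<le> 3 * kap s * sqrt (kap s) * (CK / 2)"
      using C kap_pos[of s] by (intro mult_left_mono) auto
    then show ?thesis using pointing_constant_bound[OF assms(2)[of s]] by (simp add: mult_ac)
  qed
  show ?thesis
  proof (rule eventually_mono[OF eventually_nondegenerate[OF CK bound]])
    fix \<epsilon> :: real
    assume \<epsilon>: "tube T \<gamma> \<epsilon> \<and> sqrt \<epsilon> * CK \<le> pi / 4 \<and>
      (\<forall>s \<theta>. sin (sqrt \<epsilon> * CK) \<le> cos \<theta> \<longrightarrow> sin (sqrt \<epsilon> * CK) \<le> \<bar>sin \<theta>\<bar> \<longrightarrow> tube.nondegenerate \<gamma> \<epsilon> (s, \<theta>))"
    then interpret tube T \<gamma> \<epsilon> by blast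
    interpret cusp T \<gamma> \<epsilon> CK by unfold_locales (use \<epsilon> CK in auto)
    obtain r0 where r0: "r0 > 0" "\<And>r. 0 < r \<Longrightarrow> r \<le> r0 \<Longrightarrow> cusp_nbhd T \<gamma> \<epsilon> CK (r / sqrt 2)" by (rule cusp_neighbourhood) blast
    show "\<exists>r0>0. \<forall>r. 0 < r \<and> r \<le> r0 \<longrightarrow>
      is_tubular_radius T \<gamma> \<epsilon> r \<and>
      locally_trivial_stratified_fibration (M_near_cusp T \<gamma> CK \<epsilon> r) (Delta_cusp T \<gamma> CK \<epsilon>)
        (tubular_proj T \<gamma> \<epsilon> r) (M_strata T \<gamma> CK \<epsilon> r) \<and>
      (\<forall>p \<in> Delta_cusp T \<gamma> CK \<epsilon>. \<exists>h g.
         let fib = {q \<in> M_near_cusp T \<gamma> CK \<epsilon> r. tubular_proj T \<gamma> \<epsilon> r q = p} in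
           homeomorphism fib cusp_model h g \<and> h p = (0, 0) \<and>
           (\<forall>i. h ` (M_strata T \<gamma> CK \<epsilon> r i \<inter> fib) = cusp_model_strata i) \<and>
           diffeomorphism_between (fib - {p}) (cusp_model - {(0, 0)}) h g)"
    proof (intro exI[of _ r0] conjI allI impI ballI)
      show "r0 > 0" by fact
      fix r :: real assume r: "0 < r \<and> r \<le> r0"
      then interpret N: cusp_nbhd T \<gamma> \<epsilon> CK "r / sqrt 2" using r0(2) by blast
      have rr: "sqrt 2 * (r / sqrt 2) = r" by simp
      show "is_tubular_radius T \<gamma> \<epsilon> r" using N.is_tubular_radius unfolding rr .
      show "locally_trivial_stratified_fibration (M_near_cusp T \<gamma> CK \<epsilon> r) (Delta_cusp T \<gamma> CK \<epsilon>)
        (tubular_proj T \<gamma> \<epsilon> r) (M_strata T \<gamma> CK \<epsilon> r)" using N.cusp_fibration(1) unfolding rr .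
      fix p assume "p \<in> Delta_cusp T \<gamma> CK \<epsilon>"
      from N.cusp_fibration(2)[OF this]
      show "\<exists>h g. let fib = {q \<in> M_near_cusp T \<gamma> CK \<epsilon> r. tubular_proj T \<gamma> \<epsilon> r q = p} in
           homeomorphism fib cusp_model h g \<and> h p = (0, 0) \<and>
           (\<forall>i. h ` (M_strata T \<gamma> CK \<epsilon> r i \<inter> fib) = cusp_model_strata i) \<and>
           diffeomorphism_between (fib - {p}) (cusp_model - {(0, 0)}) h g" unfolding rr .
    qed
  qed
qed

end
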